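(* Up to automorphisms of $\mathbb{P}^2_{\mathbb{C}}$ the Fermat foliation $\mathcal{F}_0^5$ and the Hilbert modular foliation $\mathcal{F}_H^5$ are the only reduced convex foliations of degree $5$ on $\mathbb{P}^2_{\mathbb{C}}$: both are reduced convex, and every reduced convex foliation of degree $5$ on $\mathbb{P}^2_{\mathbb{C}}$ is conjugated by an element of $\mathrm{Aut}(\mathbb{P}^2_{\mathbb{C}})$ to one of them.
   Context: Foliations on $\mathbb{P}^2_{\mathbb{C}}$ are holomorphic, with isolated singularities. The degree of a foliation is the number of tangencies (with multiplicity) with a generic line. The Fermat foliation $\mathcal{F}_0^5$ is defined in an affine chart by $(x^5-x)\,\mathrm{d}y-(y^5-y)\,\mathrm{d}x$. The Hilbert modular foliation $\mathcal{F}_H^5$ is defined in an affine chart by $$(y^2-1)(y^2-(\sqrt5-2)^2)(y+\sqrt5x)\,\mathrm{d}x-(x^2-1)(x^2-(\sqrt5-2)^2)(x+\sqrt5y)\,\mathrm{d}y.$$ A foliation on $\mathbb{P}^2_{\mathbb{C}}$ is convex if its leaves other than straight lines have no inflection points. A foliation of degree $d\ge1$ has at most $3d$ distinct invariant lines, and if this bound is reached it is convex; a foliation of degree $d$ having exactly $3d$ distinct invariant lines is called reduced convex. *)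

theory Defs
  imports "HOL-Analysis.Analysis" "HOL-Complex_Analysis.Complex_Analysis"
begin

text \<open>
  The projective plane is the set of lines through the origin of \<open>complex^3\<close>, in homogeneous
  coordinates \<open>(x : y : z) = (v$1 : v$2 : v$3)\<close>. A foliation is given by a homogeneous
  polynomial 1-form \<open>A dx + B dy + C dz\<close>, encoded as the coefficient map
  \<open>\<omega> v = (A v, B v, C v)\<close>. Forms that differ by a nonzero constant factor define the same
  foliation, and all notions below are invariant under such a rescaling.
\<close>

definition dot3 :: "complex^3 \<Rightarrow> complex^3 \<Rightarrow> complex" where
  "dot3 u v = (\<Sum>i\<in>UNIV. u $ i * v $ i)"

definition proj_point :: "(complex^3) set \<Rightarrow> bool" where
  "proj_point P \<longleftrightarrow> (\<exists>p. p \<noteq> 0 \<and> P = vec.span {p})"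

definition line_of :: "complex^3 \<Rightarrow> (complex^3) set" where
  "line_of l = {v. dot3 l v = 0}"

definition proj_line :: "(complex^3) set \<Rightarrow> bool" where
  "proj_line L \<longleftrightarrow> (\<exists>l. l \<noteq> 0 \<and> L = line_of l)"

text \<open>Over an infinite field polynomials may be identified with polynomial functions.\<close>

definition hom_poly :: "nat \<Rightarrow> (complex^3 \<Rightarrow> complex) \<Rightarrow> bool" where
  "hom_poly e f \<longleftrightarrow>
     (\<exists>c :: nat \<Rightarrow> nat \<Rightarrow> nat \<Rightarrow> complex. \<forall>v.
        f v = (\<Sum>(i, j, k) \<in> {(i, j, k). i + j + k = e}. c i j k * v$1 ^ i * v$2 ^ j * v$3 ^ k))"

definition singular_vectors :: "(complex^3 \<Rightarrow> complex^3) \<Rightarrow> (complex^3) set" where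
  "singular_vectors \<omega> = {v. v \<noteq> 0 \<and> \<omega> v = 0}"

text \<open>Vectors near \<open>v\<close> represent the points of the projective plane near the class of \<open>v\<close>.\<close>

definition isolated_singularities :: "(complex^3 \<Rightarrow> complex^3) \<Rightarrow> bool" where
  "isolated_singularities \<omega> \<longleftrightarrow>
     (\<forall>v \<in> singular_vectors \<omega>. \<exists>\<epsilon>>0. \<forall>w \<in> singular_vectors \<omega>. dist w v < \<epsilon> \<longrightarrow> w \<in> vec.span {v})"

text \<open>
  The second condition (vanishing on the radial vector field) says that the distribution
  \<open>ker \<omega>\<close> descends to the projective plane. The common degree \<open>e\<close> of the coefficients is left
  unspecified: the degree of the foliation is defined geometrically further down.
\<close>

definition foliation :: "(complex^3 \<Rightarrow> complex^3) \<Rightarrow> bool" where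
  "foliation \<omega> \<longleftrightarrow>
     (\<exists>e. \<forall>i. hom_poly e (\<lambda>v. \<omega> v $ i)) \<and> (\<forall>v. dot3 (\<omega> v) v = 0) \<and> isolated_singularities \<omega>"

definition invariant_line :: "(complex^3 \<Rightarrow> complex^3) \<Rightarrow> (complex^3) set \<Rightarrow> bool" where
  "invariant_line \<omega> L \<longleftrightarrow> proj_line L \<and> (\<forall>p\<in>L. \<forall>q\<in>L. dot3 (\<omega> p) q = 0)"

definition tangency_points :: "(complex^3 \<Rightarrow> complex^3) \<Rightarrow> (complex^3) set \<Rightarrow> (complex^3) set set" where
  "tangency_points \<omega> L =
     {P. proj_point P \<and> P \<subseteq> L \<and> (\<forall>p\<in>P. \<forall>q\<in>L. dot3 (\<omega> p) q = 0)}"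

text \<open>
  If \<open>P\<close> is spanned by \<open>p\<close> and \<open>L\<close> by \<open>p, q\<close>, then \<open>t \<mapsto> p + t q\<close> is a local parameter of \<open>L\<close>
  at \<open>P\<close>, in which the restriction of the form to \<open>L\<close> reads \<open>\<omega>(p + t q)(q) dt\<close>. For \<open>L\<close> not
  invariant, its order of vanishing at \<open>t = 0\<close> does not depend on the choice of \<open>p\<close> and \<open>q\<close>.
\<close>

definition tangency_mult ::
    "(complex^3 \<Rightarrow> complex^3) \<Rightarrow> (complex^3) set \<Rightarrow> (complex^3) set \<Rightarrow> nat" where
  "tangency_mult \<omega> L P =
     (let (p, q) = (SOME (p, q). P = vec.span {p} \<and> L = vec.span {p, q})
      in nat (zorder (\<lambda>t. dot3 (\<omega> (p + t *s q)) q) 0))"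

definition tangency_number :: "(complex^3 \<Rightarrow> complex^3) \<Rightarrow> (complex^3) set \<Rightarrow> nat" where
  "tangency_number \<omega> L = (\<Sum>P \<in> tangency_points \<omega> L. tangency_mult \<omega> L P)"

text \<open>
  ``Generic line'' means every line in a nonempty principal Zariski open subset \<open>g \<noteq> 0\<close> of the
  dual plane. The junk value of \<open>tangency_number\<close> on invariant lines is excluded explicitly.
\<close>

definition has_degree :: "(complex^3 \<Rightarrow> complex^3) \<Rightarrow> nat \<Rightarrow> bool" where
  "has_degree \<omega> d \<longleftrightarrow>
     (\<exists>m g. hom_poly m g \<and> (\<exists>l. g l \<noteq> 0) \<and>
        (\<forall>l. l \<noteq> 0 \<and> g l \<noteq> 0 \<longrightarrow>
           \<not> invariant_line \<omega> (line_of l) \<and> tangency_number \<omega> (line_of l) = d))"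

definition foliation_of_degree :: "nat \<Rightarrow> (complex^3 \<Rightarrow> complex^3) \<Rightarrow> bool" where
  "foliation_of_degree d \<omega> \<longleftrightarrow> foliation \<omega> \<and> has_degree \<omega> d"

text \<open>For \<open>d \<ge> 1\<close> the cardinality condition forces the set of invariant lines to be finite.\<close>

definition reduced_convex :: "nat \<Rightarrow> (complex^3 \<Rightarrow> complex^3) \<Rightarrow> bool" where
  "reduced_convex d \<omega> \<longleftrightarrow>
     d \<ge> 1 \<and> foliation_of_degree d \<omega> \<and> card {L. invariant_line \<omega> L} = 3 * d"

definition same_foliation :: "(complex^3 \<Rightarrow> complex^3) \<Rightarrow> (complex^3 \<Rightarrow> complex^3) \<Rightarrow> bool" where
  "same_foliation \<omega> \<eta> \<longleftrightarrow> (\<exists>c. c \<noteq> 0 \<and> (\<forall>v. \<omega> v = c *s \<eta> v))"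

definition pullback :: "complex^3^3 \<Rightarrow> (complex^3 \<Rightarrow> complex^3) \<Rightarrow> complex^3 \<Rightarrow> complex^3" where
  "pullback M \<omega> v = transpose M *v \<omega> (M *v v)"

lemma dot3_pullback: "dot3 (pullback M \<omega> v) w = dot3 (\<omega> (M *v v)) (M *v w)"
  by (simp add: dot3_def pullback_def matrix_vector_mult_def transpose_def sum_3 algebra_simps)

text \<open>Automorphisms of the projective plane are induced by invertible \<open>3 \<times> 3\<close> matrices.\<close>

definition conjugate_foliations :: "(complex^3 \<Rightarrow> complex^3) \<Rightarrow> (complex^3 \<Rightarrow> complex^3) \<Rightarrow> bool" where
  "conjugate_foliations \<omega> \<eta> \<longleftrightarrow>
     (\<exists>M :: complex^3^3. invertible M \<and> same_foliation (pullback M \<omega>) \<eta>)"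

text \<open>
  If \<open>a\<close> and \<open>b\<close> are the homogenisations in degree \<open>d\<close> of the coefficients of an affine form
  \<open>a dx + b dy\<close>, this is \<open>z^(d+2)\<close> times the pullback of that form under
  \<open>(x, y, z) \<mapsto> (x/z, y/z)\<close>, obtained from \<open>d(x/z) = (z dx - x dz)/z^2\<close>.
\<close>

definition homogenized_form ::
    "(complex^3 \<Rightarrow> complex) \<Rightarrow> (complex^3 \<Rightarrow> complex) \<Rightarrow> complex^3 \<Rightarrow> complex^3" where
  "homogenized_form a b v = vector [v$3 * a v, v$3 * b v, - (v$1 * a v + v$2 * b v)]"

definition fermat5 :: "complex^3 \<Rightarrow> complex^3" where
  "fermat5 = homogenized_form
     (\<lambda>v. - (v$2 ^ 5 - v$2 * v$3 ^ 4))
     (\<lambda>v. v$1 ^ 5 - v$1 * v$3 ^ 4)"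

definition hilbert5 :: "complex^3 \<Rightarrow> complex^3" where
  "hilbert5 = (let s = complex_of_real (sqrt 5) in homogenized_form
     (\<lambda>v. (v$2 ^ 2 - v$3 ^ 2) * (v$2 ^ 2 - (s - 2) ^ 2 * v$3 ^ 2) * (v$2 + s * v$1))
     (\<lambda>v. - ((v$1 ^ 2 - v$3 ^ 2) * (v$1 ^ 2 - (s - 2) ^ 2 * v$3 ^ 2) * (v$1 + s * v$2))))"

text \<open>In the chart \<open>z = 1\<close> (where \<open>dz = 0\<close>) these are the usual affine forms.\<close>

lemma fermat5_chart:
  "dot3 (fermat5 (vector [x, y, 1])) (vector [dx, dy, 0]) = (x^5 - x) * dy - (y^5 - y) * dx"
  by (simp add: fermat5_def homogenized_form_def dot3_def sum_3 algebra_simps)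

lemma hilbert5_chart:
  fixes x y dx dy :: complex
  defines "s \<equiv> complex_of_real (sqrt 5)"
  shows "dot3 (hilbert5 (vector [x, y, 1])) (vector [dx, dy, 0]) =
     (y^2 - 1) * (y^2 - (s - 2)^2) * (y + s * x) * dx - (x^2 - 1) * (x^2 - (s - 2)^2) * (x + s * y) * dy"
  unfolding s_def by (simp add: hilbert5_def Let_def homogenized_form_def dot3_def sum_3)

end

theory Submission
  imports Defs "HOL-Computational_Algebra.Fundamental_Theorem_Algebra"
begin

text \<open>
  Let \<open>L\<close> be an invariant line of a reduced convex foliation of degree 5. Each point \<open>p\<close> of \<open>L\<close> on
  \<open>r \<ge> 2\<close> invariant lines is singular. In a chart \<open>y\<close> of \<open>L\<close>, let \<open>R\<close> be the polynomial of degree 6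
  that vanishes at the singular points and let \<open>W\<close> be the Wronskian of the two polynomials describing
  the foliation to first order along \<open>L\<close>. Then \<open>R W\<close> has degree at most 14, and it is divisible by
  \<open>(y - p)^(r - 1)\<close> for each \<open>p\<close>. As \<open>L\<close> meets the 14 other lines, these orders add up to 14. So \<open>L\<close>
  carries exactly six singular points, all of them are intersection points, and \<open>R W\<close> is known up to
  a constant. The resulting differential equation, the Camacho-Sad formula (the indices of \<open>L\<close> have
  sum 1, and they are 1 at the points with \<open>r \<ge> 3\<close>) and the reciprocity of the two indices at a node
  leave three kinds of lines: those with two 6-fold points, those with one 6-fold point and a node
  that lies on a line of the first kind, and those whose six points have the multiplicities
  5, 5, 3, 3, 2, 2.

  If a line of the first kind exists, there are three 6-fold points and the foliation is the Fermat
  foliation. Otherwise there are six 5-fold points, any two of them joined by an invariant line,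
  and the 3-fold points, in which two joins of the remaining four points meet each of these lines,
  determine the six points up to projective equivalence. In suitable coordinates they depend on a
  parameter \<open>t\<close> with \<open>t^2 + 4 t - 1 = 0\<close>, and the lines joining them determine the form.
\<close>

text \<open>Both bounds in the count are sharp: \<open>R\<close> has degree at most 6, and
  \<open>W\<close> has degree at most 8 rather than 9 because the leading terms cancel. As there is
  no slack, the order of \<open>R W\<close> at every point is known exactly.

  A single line does not decide which multiplicities occur. A line with only one node (a point on
  exactly two invariant lines) has index -4 there, because its other five indices are 1. For a line
  with at least two nodes, eight patterns of multiplicities are arithmetically possible, and in each
  of them the index at a node is a root of an explicit integer polynomial. The exclusion comes from
  the second invariant line through the node, whose index is the reciprocal: the roots collected in
  \<open>cs_bad\<close> have no reciprocal among all the values that can occur. What survives are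
  -1/4 and -4, reciprocal to each other, and the two roots of x^2 + 3 x + 1, whose product is
  1.\<close>

no_notation fps_nth (infixl "$" 75)

section \<open>Linear algebra in three variables\<close>

lemma dot3_3: "dot3 u v = u$1 * v$1 + u$2 * v$2 + u$3 * v$3"
  by (simp add: dot3_def sum_3)

lemma dot3_add [simp]: "dot3 (u + v) w = dot3 u w + dot3 v w" "dot3 w (u + v) = dot3 w u + dot3 w v"
  by (simp_all add: dot3_3 algebra_simps)

lemma dot3_diff [simp]: "dot3 (u - v) w = dot3 u w - dot3 v w" "dot3 w (u - v) = dot3 w u - dot3 w v"
  by (simp_all add: dot3_3 algebra_simps)

lemma dot3_scale [simp]: "dot3 (c *s u) w = c * dot3 u w" "dot3 u (c *s w) = c * dot3 u w"
  by (simp_all add: dot3_3 algebra_simps)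

lemma dot3_zero [simp]: "dot3 0 w = 0" "dot3 w 0 = 0"
  by (simp_all add: dot3_3)

text \<open>The cross product: the line through two points and, dually, the common point of two
  lines. It vanishes exactly on dependent vectors, so \<open>cr u v \<noteq> 0\<close> expresses
  that two projective points or lines are distinct.\<close>

definition cr :: "complex^3 \<Rightarrow> complex^3 \<Rightarrow> complex^3" where
  "cr u v = vector [u$2 * v$3 - u$3 * v$2, u$3 * v$1 - u$1 * v$3, u$1 * v$2 - u$2 * v$1]"

lemma cr_nth [simp]:
  "cr u v $ 1 = u$2 * v$3 - u$3 * v$2"
  "cr u v $ 2 = u$3 * v$1 - u$1 * v$3"
  "cr u v $ 3 = u$1 * v$2 - u$2 * v$1"
  by (simp_all add: cr_def)

lemma vec3_eq_iff: "u = v \<longleftrightarrow> u$1 = v$1 \<and> u$2 = v$2 \<and> u$3 = (v :: 'a^3)$3"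
  by (simp add: vec_eq_iff forall_3)

lemma dot3_cr [simp]: "dot3 (cr u v) u = 0" "dot3 (cr u v) v = 0"
  by (simp_all add: dot3_3 algebra_simps)

text \<open>Cramer's rule, multiplied through by the determinant.\<close>

lemma cramer:
  "dot3 (cr a b) w *s v = dot3 (cr v b) w *s a + dot3 (cr a v) w *s b + dot3 (cr a b) v *s w"
  by (simp add: vec3_eq_iff dot3_3 algebra_simps)

lemma exists_dot3_1:
  assumes "l \<noteq> 0" shows "\<exists>w. dot3 l w = 1"
proof -
  from assms consider "l$1 \<noteq> 0" | "l$2 \<noteq> 0" | "l$3 \<noteq> 0" by (auto simp: vec3_eq_iff)
  then show ?thesis
  proof cases
    case 1 then show ?thesis by (intro exI[of _ "vector [1 / l$1, 0, 0]"]) (simp add: dot3_3)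
  next
    case 2 then show ?thesis by (intro exI[of _ "vector [0, 1 / l$2, 0]"]) (simp add: dot3_3)
  next
    case 3 then show ?thesis by (intro exI[of _ "vector [0, 0, 1 / l$3]"]) (simp add: dot3_3)
  qed
qed

lemma line_of_cr_E:
  assumes "cr a b \<noteq> 0" "dot3 (cr a b) v = 0"
  obtains x y where "v = x *s a + y *s b"
proof -
  obtain w where w: "dot3 (cr a b) w = 1" using exists_dot3_1 assms(1) by blast
  show thesis using cramer[of a b w v] w assms(2) that by simp
qed

lemma basis_E:
  assumes "dot3 (cr a b) w \<noteq> 0"
  obtains x y z where "v = x *s a + y *s b + z *s w"
proof -
  let ?d = "dot3 (cr a b) w"
  have "v = (1 / ?d) *s (?d *s v)" using assms by simp
  also have "\<dots> = (dot3 (cr v b) w / ?d) *s a + (dot3 (cr a v) w / ?d) *s b + (dot3 (cr a b) v / ?d) *s w"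
    by (subst cramer) (simp add: vec3_eq_iff algebra_simps)
  finally show thesis by (rule that)
qed

lemma cr_scale [simp]: "cr (c *s u) v = c *s cr u v" "cr u (c *s v) = c *s cr u v"
  by (simp_all add: vec3_eq_iff algebra_simps)

lemma cr_self [simp]: "cr u u = 0" by (simp add: vec3_eq_iff)

lemma cr_zero [simp]: "cr 0 u = 0" "cr u 0 = 0" by (simp_all add: vec3_eq_iff)

lemma cr_anti: "cr u v = - cr v u" by (simp add: vec3_eq_iff)

lemma cr_add [simp]: "cr (u + v) w = cr u w + cr v w" "cr w (u + v) = cr w u + cr w v"
  by (simp_all add: vec3_eq_iff algebra_simps)

lemma cr_eq_0D:
  assumes "cr p q = 0" "p \<noteq> 0"
  obtains c where "q = c *s p"
proof -
  have e: "p$2 * q$3 = p$3 * q$2" "p$3 * q$1 = p$1 * q$3" "p$1 * q$2 = p$2 * q$1"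
    using assms(1) by (auto simp: vec3_eq_iff)
  from assms(2) consider "p$1 \<noteq> 0" | "p$2 \<noteq> 0" | "p$3 \<noteq> 0" by (auto simp: vec3_eq_iff)
  then show thesis
  proof cases
    case 1 then show thesis using e by (intro that[of "q$1 / p$1"]) (auto simp: vec3_eq_iff field_simps)
  next
    case 2 then show thesis using e by (intro that[of "q$2 / p$2"]) (auto simp: vec3_eq_iff field_simps)
  next
    case 3 then show thesis using e by (intro that[of "q$3 / p$3"]) (auto simp: vec3_eq_iff field_simps)
  qed
qed

lemma line_of_scale [simp]: "c \<noteq> 0 \<Longrightarrow> line_of (c *s l) = line_of l"
  by (auto simp: line_of_def)

lemma line_of_eq_iff:
  assumes "l \<noteq> 0" "m \<noteq> 0" shows "line_of l = line_of m \<longleftrightarrow> cr l m = 0"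
proof
  assume "cr l m = 0"
  then obtain c where "m = c *s l" using assms cr_eq_0D by blast
  then show "line_of l = line_of m" using assms by (cases "c = 0") auto
next
  assume eq: "line_of l = line_of m"
  show "cr l m = 0"
  proof (rule ccontr)
    assume "cr l m \<noteq> 0"
    then obtain w where w: "dot3 (cr l m) w = 1" using exists_dot3_1 by blast
    have "cr l w \<in> line_of l" by (simp add: line_of_def dot3_3 algebra_simps)
    then have "cr l w \<in> line_of m" using eq by simp
    then have "dot3 m (cr l w) = 0" by (simp add: line_of_def)
    moreover have "dot3 m (cr l w) = - dot3 (cr l m) w" by (simp add: dot3_3 algebra_simps)
    ultimately show False using w by simp
  qed
qed

lemma span_single: "vec.span {p :: complex^3} = {c *s p |c. True}"
  by (auto simp: vec.span_singleton)

lemma span_pair: "vec.span {p, q :: complex^3} = {x *s p + y *s q |x y. True}"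
proof -
  have "v \<in> vec.span {p, q} \<longleftrightarrow> (\<exists>x y. v = x *s p + y *s q)" for v
  proof -
    have "v \<in> vec.span {p, q} \<longleftrightarrow> (\<exists>x y. v - x *s p = y *s q)"
      by (subst vec.span_breakdown_eq) (auto simp: vec.span_singleton)
    also have "\<dots> \<longleftrightarrow> (\<exists>x y. v = x *s p + y *s q)" by (metis add_diff_cancel_left' diff_add_cancel add.commute)
    finally show ?thesis .
  qed
  then show ?thesis by auto
qed

lemma span_pair_eq_line_of:
  assumes "cr p q \<noteq> 0" shows "vec.span {p, q} = line_of (cr p q)"
proof (intro equalityI subsetI)
  fix v assume "v \<in> line_of (cr p q)"
  then have "dot3 (cr p q) v = 0" by (simp add: line_of_def)
  from line_of_cr_E[OF assms this] obtain x y where "v = x *s p + y *s q" .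
  then show "v \<in> vec.span {p, q}" by (auto simp: span_pair)
qed (auto simp: span_pair line_of_def)

lemma line_of_subspace [simp]:
  "u \<in> line_of l \<Longrightarrow> v \<in> line_of l \<Longrightarrow> u + v \<in> line_of l"
  "u \<in> line_of l \<Longrightarrow> c *s u \<in> line_of l" "0 \<in> line_of l"
  by (auto simp: line_of_def)

lemma span_single_subset_line: "vec.span {p} \<subseteq> line_of l \<longleftrightarrow> p \<in> line_of l"
proof
  assume "vec.span {p} \<subseteq> line_of l" then show "p \<in> line_of l" by (simp add: subset_iff vec.span_base)
qed (auto simp: span_single)

lemma span_single_eq_iff:
  assumes "p \<noteq> 0" "q \<noteq> 0" shows "vec.span {p :: complex^3} = vec.span {q} \<longleftrightarrow> cr p q = 0"
proof
  assume "vec.span {p} = vec.span {q}"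
  then have "q \<in> vec.span {p}" by (simp add: vec.span_base)
  then show "cr p q = 0" by (auto simp: span_single)
next
  assume "cr p q = 0"
  then obtain c where c: "q = c *s p" using assms cr_eq_0D by blast
  with assms have "c \<noteq> 0" by auto
  then have "p = (1 / c) *s q" using c by (simp add: vec3_eq_iff)
  then have "p \<in> vec.span {q}" by (auto simp: vec.span_singleton)
  moreover have "q \<in> vec.span {p}" using c by (auto simp: vec.span_singleton)
  ultimately show "vec.span {p} = vec.span {q}" by (simp add: vec.span_eq)
qed

lemma line_Int_line:
  assumes "cr l m \<noteq> 0" shows "line_of l \<inter> line_of m = vec.span {cr l m}"
proof (intro equalityI subsetI)
  fix v assume "v \<in> line_of l \<inter> line_of m"
  then have d: "dot3 l v = 0" "dot3 m v = 0" by (auto simp: line_of_def)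
  have "cr (cr l m) v = dot3 l v *s m - dot3 m v *s l"
    by (simp add: vec3_eq_iff dot3_3 algebra_simps)
  with d have "cr (cr l m) v = 0" by simp
  then obtain c where "v = c *s cr l m" using assms cr_eq_0D by blast
  then show "v \<in> vec.span {cr l m}" by (auto simp: span_single)
next
  fix v assume "v \<in> vec.span {cr l m}"
  then show "v \<in> line_of l \<inter> line_of m"
    by (auto simp: span_single line_of_def dot3_3 algebra_simps)
qed

lemma line_of_through:
  assumes "cr p q \<noteq> 0" "p \<in> line_of l" "q \<in> line_of l" "l \<noteq> 0"
  shows "line_of l = line_of (cr p q)"
proof -
  have "cr (cr p q) l = dot3 p l *s q - dot3 q l *s p"
    by (simp add: vec3_eq_iff dot3_3 algebra_simps)
  moreover have "dot3 p l = 0" "dot3 q l = 0" using assms by (auto simp: line_of_def dot3_3 mult.commute)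
  ultimately show ?thesis using assms line_of_eq_iff[of l "cr p q"] by (simp add: cr_anti[of l])
qed

lemma line_point_E:
  assumes "l \<noteq> 0" "p \<in> line_of l" "p \<noteq> 0"
  obtains u where "u \<in> line_of l" "cr p u \<noteq> 0"
proof -
  obtain w where w: "dot3 l w = 1" using exists_dot3_1 assms by blast
  obtain k where k: "dot3 p k = 1" using exists_dot3_1 assms by blast
  show thesis
  proof (rule that[of "cr l k"])
    show "cr l k \<in> line_of l" by (simp add: line_of_def dot3_3 algebra_simps)
    have "cr p (cr l k) = dot3 p k *s l - dot3 p l *s k"
      by (simp add: vec3_eq_iff dot3_3 algebra_simps)
    moreover have "dot3 p l = 0" using assms by (simp add: line_of_def dot3_3 mult.commute)
    ultimately show "cr p (cr l k) \<noteq> 0" using k assms by simp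
  qed
qed

lemma line_basis_E:
  assumes "l \<noteq> 0"
  obtains a b where "cr a b \<noteq> 0" "line_of l = line_of (cr a b)"
proof -
  have "\<exists>p. p \<noteq> 0 \<and> p \<in> line_of l"
  proof (cases "cr l (vector [1,0,0]) = 0")
    case True
    then have "l$2 = 0" "l$3 = 0" by (auto simp: vec3_eq_iff)
    then show ?thesis by (intro exI[of _ "vector [0,1,0]"]) (simp add: vec3_eq_iff line_of_def dot3_3)
  next
    case False
    then show ?thesis
      by (intro exI[of _ "cr l (vector [1,0,0])"]) (simp add: line_of_def dot3_3 algebra_simps)
  qed
  then obtain p where p: "p \<noteq> 0" "p \<in> line_of l" by blast
  obtain u where "u \<in> line_of l" "cr p u \<noteq> 0" using line_point_E assms p by blast
  then show thesis using that line_of_through p assms by metis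
qed

section \<open>Homogeneous polynomial functions\<close>

text \<open>An inductive counterpart of \<open>hom_poly\<close>, equivalent to it by
  \<open>hom_poly_iff_hp\<close>. Restriction to lines, gradients and division by a linear form are
  then proved by induction on the construction of the function instead of by work with families of
  coefficients.\<close>

inductive hp :: "nat \<Rightarrow> (complex^3 \<Rightarrow> complex) \<Rightarrow> bool" where
  hp_const: "hp 0 (\<lambda>_. c)"
| hp_coord: "hp e f \<Longrightarrow> hp (Suc e) (\<lambda>v. v $ i * f v)"
| hp_add: "hp e f \<Longrightarrow> hp e g \<Longrightarrow> hp e (\<lambda>v. f v + g v)"

lemma hp_zero: "hp e (\<lambda>_. 0)"
proof (induction e)
  case (Suc e)
  from hp_coord[OF this, of 1] show ?case by simp
qed (rule hp_const)

lemma hp_cmult: "hp e f \<Longrightarrow> hp e (\<lambda>v. c * f v)"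
proof (induction rule: hp.induct)
  case (hp_const d) show ?case by (rule hp.hp_const)
next
  case (hp_coord e f i)
  from hp.hp_coord[OF hp_coord.IH, of i] show ?case by (simp add: mult.left_commute)
next
  case (hp_add e f g)
  from hp.hp_add[OF hp_add.IH] show ?case by (simp add: distrib_left)
qed

lemma hp_minus: "hp e f \<Longrightarrow> hp e (\<lambda>v. - f v)"
  using hp_cmult[of e f "-1"] by simp

lemma hp_diff: "hp e f \<Longrightarrow> hp e g \<Longrightarrow> hp e (\<lambda>v. f v - g v)"
  using hp_add[OF _ hp_minus, of e f g] by simp

lemma hp_mult: "hp e f \<Longrightarrow> hp d g \<Longrightarrow> hp (e + d) (\<lambda>v. f v * g v)"
proof (induction rule: hp.induct)
  case (hp_const c) then show ?case by (simp add: hp_cmult)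
next
  case (hp_coord e f i)
  from hp.hp_coord[OF hp_coord.IH[OF hp_coord.prems], of i] show ?case by (simp add: mult.assoc)
next
  case (hp_add e f g')
  from hp.hp_add[OF hp_add.IH(1)[OF hp_add.prems] hp_add.IH(2)[OF hp_add.prems]]
  show ?case by (simp add: distrib_right)
qed

lemma hp_nth: "hp (Suc 0) (\<lambda>v. v $ i)"
  using hp_coord[OF hp_const[of 1], of i] by simp

lemma hp_sum: "finite A \<Longrightarrow> (\<And>a. a \<in> A \<Longrightarrow> hp e (f a)) \<Longrightarrow> hp e (\<lambda>v. \<Sum>a\<in>A. f a v)"
  by (induction A rule: finite_induct) (auto intro: hp_zero hp_add)

lemma hp_dot3: "(\<And>i. hp e (\<lambda>v. w v $ i)) \<Longrightarrow> hp e (\<lambda>v. dot3 (w v) p)"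
  by (simp add: dot3_3 mult.commute[of _ "p $ _"] hp_add hp_cmult)

lemma hp_linear: "hp (Suc 0) (\<lambda>v. dot3 l v)"
  by (simp add: dot3_3 hp_add hp_cmult hp_nth)

lemma hp_power: "hp e f \<Longrightarrow> hp (n * e) (\<lambda>v. f v ^ n)"
proof (induction n)
  case 0 then show ?case using hp_const[of 1] by simp
next
  case (Suc n) then show ?case using hp_mult[of e f "n * e"] by simp
qed

lemma hp_prod: "finite A \<Longrightarrow> hp (card A) (\<lambda>v. \<Prod>l\<in>A. dot3 l v)"
proof (induction A rule: finite_induct)
  case empty then show ?case using hp_const[of 1] by simp
next
  case (insert l A) then show ?case using hp_mult[OF hp_linear[of l], of "card A"] by simp
qed

lemma hp_subst: "hp e f \<Longrightarrow> (\<And>i. hp (Suc 0) (\<lambda>v. h v $ i)) \<Longrightarrow> hp e (\<lambda>v. f (h v))"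
proof (induction rule: hp.induct)
  case (hp_const c) show ?case by (rule hp.hp_const)
next
  case (hp_coord e f i)
  from hp_mult[OF hp_coord.prems[of i] hp_coord.IH[OF hp_coord.prems]] show ?case by simp
next
  case (hp_add e f g) then show ?case by (simp add: hp.hp_add)
qed

lemma finite_triples: "finite {(i, j, k). i + j + k = (e::nat)}"
  by (rule finite_subset[of _ "{..e} \<times> {..e} \<times> {..e}"]) auto

lemma hom_poly_imp_hp:
  assumes "hom_poly e f" shows "hp e f"
proof -
  obtain c where c: "f = (\<lambda>v. \<Sum>(i, j, k) \<in> {(i, j, k). i + j + k = e}. c i j k * v$1 ^ i * v$2 ^ j * v$3 ^ k)"
    using assms by (auto simp: hom_poly_def fun_eq_iff)
  have m: "hp (i + j + k) (\<lambda>v. d * v$1 ^ i * v$2 ^ j * v$3 ^ k)" for i j k d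
    using hp_mult[OF hp_mult[OF hp_cmult[OF hp_power[OF hp_nth[of 1], of i], of d]
        hp_power[OF hp_nth[of 2], of j]] hp_power[OF hp_nth[of 3], of k]] by simp
  show ?thesis unfolding c by (rule hp_sum[OF finite_triples]) (auto intro!: m)
qed

lemma hom_poly_add:
  assumes "hom_poly e f" "hom_poly e g" shows "hom_poly e (\<lambda>v. f v + g v)"
proof -
  obtain c where c: "\<And>v. f v = (\<Sum>(i, j, k) \<in> {(i, j, k). i + j + k = e}. c i j k * v$1 ^ i * v$2 ^ j * v$3 ^ k)"
    using assms by (auto simp: hom_poly_def)
  obtain d where d: "\<And>v. g v = (\<Sum>(i, j, k) \<in> {(i, j, k). i + j + k = e}. d i j k * v$1 ^ i * v$2 ^ j * v$3 ^ k)"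
    using assms by (auto simp: hom_poly_def)
  show ?thesis unfolding hom_poly_def
    by (rule exI[of _ "\<lambda>i j k. c i j k + d i j k"])
       (simp add: c d sum.distrib[symmetric] case_prod_beta algebra_simps)
qed

lemma hom_poly_monom:
  assumes "i + j + k = e"
  shows "hom_poly e (\<lambda>v. d * v$1 ^ i * v$2 ^ j * v$3 ^ k)"
  unfolding hom_poly_def
proof (intro exI allI)
  fix v :: "complex^3"
  let ?A = "{(i, j, k). i + j + k = e}"
  have "(\<Sum>(i', j', k')\<in>?A. (if (i', j', k') = (i, j, k) then d else 0) * v$1 ^ i' * v$2 ^ j' * v$3 ^ k')
      = (\<Sum>t\<in>?A. if t = (i, j, k) then d * v$1 ^ i * v$2 ^ j * v$3 ^ k else 0)"
    by (intro sum.cong refl) (simp add: case_prod_beta prod_eq_iff split: if_split)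
  also have "\<dots> = d * v$1 ^ i * v$2 ^ j * v$3 ^ k"
    using assms by (subst sum.delta) (auto intro: finite_triples)
  finally show "d * v$1 ^ i * v$2 ^ j * v$3 ^ k
      = (\<Sum>(i', j', k')\<in>?A. (if (i', j', k') = (i, j, k) then d else 0) * v$1 ^ i' * v$2 ^ j' * v$3 ^ k')"
    by simp
qed

lemma hom_poly_sum:
  "finite A \<Longrightarrow> A \<noteq> {} \<Longrightarrow> (\<And>a. a \<in> A \<Longrightarrow> hom_poly e (f a)) \<Longrightarrow> hom_poly e (\<lambda>v. \<Sum>a\<in>A. f a v)"
  by (induction A rule: finite_ne_induct) (auto intro: hom_poly_add)

lemma hom_poly_coord:
  assumes "hom_poly e f" shows "hom_poly (Suc e) (\<lambda>v. v $ i * f v)"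
proof -
  obtain c where c: "f = (\<lambda>v. \<Sum>(i, j, k) \<in> {(i, j, k). i + j + k = e}. c i j k * v$1 ^ i * v$2 ^ j * v$3 ^ k)"
    using assms by (auto simp: hom_poly_def fun_eq_iff)
  have "(e, 0, 0) \<in> {(i, j, k). i + j + k = e}" by simp
  then have ne: "{(i, j, k). i + j + k = e} \<noteq> {}" by blast
  have m: "hom_poly (Suc e) (\<lambda>v. v $ l * (d * v$1 ^ i * v$2 ^ j * v$3 ^ k))" if "i + j + k = e" for i j k d and l :: 3
  proof -
    consider "l = 1" | "l = 2" | "l = 3" using exhaust_3[of l] by auto
    then show ?thesis
    proof cases
      case 1 then show ?thesis using hom_poly_monom[of "Suc i" j k "Suc e" d] that by (simp add: mult_ac)
    next
      case 2 then show ?thesis using hom_poly_monom[of i "Suc j" k "Suc e" d] that by (simp add: mult_ac)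
    next
      case 3 then show ?thesis using hom_poly_monom[of i j "Suc k" "Suc e" d] that by (simp add: mult_ac)
    qed
  qed
  show ?thesis unfolding c sum_distrib_left
  proof (rule hom_poly_sum[OF finite_triples ne])
    fix a assume "a \<in> {(i, j, k). i + j + k = e}"
    then obtain i' j' k' where "a = (i', j', k')" "i' + j' + k' = e" by blast
    then show "hom_poly (Suc e) (\<lambda>v. v $ i * (case a of (i, j, k) \<Rightarrow> c i j k * v$1 ^ i * v$2 ^ j * v$3 ^ k))"
      using m[of i' j' k' i "c i' j' k'"] by simp
  qed
qed

lemma hom_poly_iff_hp: "hom_poly e f \<longleftrightarrow> hp e f"
proof
  show "hp e f \<Longrightarrow> hom_poly e f"
  proof (induction rule: hp.induct)
    case (hp_const c) then show ?case using hom_poly_monom[of 0 0 0 0 c] by simp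
  qed (auto intro: hom_poly_coord hom_poly_add)
qed (rule hom_poly_imp_hp)

lemma hp_scale: "hp e f \<Longrightarrow> f (c *s v) = c ^ e * f v"
  by (induction rule: hp.induct) (simp_all add: algebra_simps)

lemma hp_restrict:
  "hp e f \<Longrightarrow> \<exists>p. degree p \<le> e \<and> (\<forall>t. f (u + t *s w) = poly p t)"
proof (induction rule: hp.induct)
  case (hp_const c) show ?case by (rule exI[of _ "[:c:]"]) simp
next
  case (hp_coord e f i)
  then obtain p where p: "degree p \<le> e" "\<And>t. f (u + t *s w) = poly p t" by blast
  have "degree ([:u $ i, w $ i:] * p) \<le> Suc e"
    by (rule order_trans[OF degree_mult_le]) (use p in \<open>auto simp: degree_pCons_eq_if\<close>)
  then show ?case using p by (intro exI[of _ "[:u $ i, w $ i:] * p"]) (simp add: algebra_simps)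
next
  case (hp_add e f g)
  then obtain p q where "degree p \<le> e" "\<And>t. f (u + t *s w) = poly p t"
     "degree q \<le> e" "\<And>t. g (u + t *s w) = poly q t" by blast
  then show ?case by (intro exI[of _ "p + q"]) (auto intro: degree_add_le)
qed

lemma hp_gradient:
  "hp e f \<Longrightarrow> \<exists>G. \<forall>v w. ((\<lambda>t. f (v + t *s w)) has_field_derivative dot3 (G v) w) (at 0)"
proof (induction rule: hp.induct)
  case (hp_const c) show ?case by (rule exI[of _ "\<lambda>_. 0"]) simp
next
  case (hp_coord e f i)
  then obtain G where G: "\<And>v w. ((\<lambda>t. f (v + t *s w)) has_field_derivative dot3 (G v) w) (at 0)" by blast
  have *: "dot3 (axis i 1) w = w $ i" for w :: "complex^3"
    by (simp add: dot3_def axis_def if_distrib[of "\<lambda>x. x * _"] cong: if_cong)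
  have "((\<lambda>t. (v + t *s w) $ i * f (v + t *s w)) has_field_derivative
          dot3 (f v *s axis i 1 + v $ i *s G v) w) (at 0)" for v w
    by (auto intro!: derivative_eq_intros G simp: *)
  then show ?case by (intro exI[of _ "\<lambda>v. f v *s axis i 1 + v $ i *s G v"] allI)
next
  case (hp_add e f g)
  then obtain G H where "\<And>v w. ((\<lambda>t. f (v + t *s w)) has_field_derivative dot3 (G v) w) (at 0)"
    "\<And>v w. ((\<lambda>t. g (v + t *s w)) has_field_derivative dot3 (H v) w) (at 0)" by blast
  then have "((\<lambda>t. f (v + t *s w) + g (v + t *s w)) has_field_derivative dot3 (G v + H v) w) (at 0)" for v w
    by (auto intro!: derivative_eq_intros)
  then show ?case by (intro exI[of _ "\<lambda>v. G v + H v"] allI)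
qed

text \<open>The map \<open>v - dot3 l v *s n\<close> projects along \<open>n\<close> onto the plane
  where \<open>dot3 l v\<close> vanishes; divisibility of the difference is inherited through
  products by the product rule for differences. The clause for \<open>e = 0\<close> rules out a
  nonzero constant quotient, which the truncated degree \<open>e - 1\<close> would admit.\<close>

lemma hp_divide_remainder:
  assumes "hp e f" "dot3 l n = 1"
  shows "\<exists>g. (e = 0 \<longrightarrow> g = (\<lambda>_. 0)) \<and> hp (e - 1) g \<and> (\<forall>v. f v - f (v - dot3 l v *s n) = dot3 l v * g v)"
  using assms(1)
proof (induction rule: hp.induct)
  case (hp_const c) show ?case by (intro exI[of _ "\<lambda>_. 0"]) (simp add: hp_zero)
next
  case (hp_coord e f i)
  then obtain g where g: "e = 0 \<longrightarrow> g = (\<lambda>_. 0)" "hp (e - 1) g"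
    "\<And>v. f v - f (v - dot3 l v *s n) = dot3 l v * g v" by blast
  have 1: "hp e (\<lambda>v. v $ i * g v)"
  proof (cases e)
    case 0 then show ?thesis using g by (simp add: hp_zero)
  next
    case (Suc k) then show ?thesis using hp.hp_coord[OF g(2), of i] by simp
  qed
  have 2: "hp e (\<lambda>v. n $ i * f (v - dot3 l v *s n))"
    by (rule hp_cmult, rule hp_subst[OF hp_coord.hyps])
       (simp add: mult.commute[of _ "n $ _"], intro hp_diff hp_nth hp_cmult hp_linear)
  have "v $ i * f v - (v - dot3 l v *s n) $ i * f (v - dot3 l v *s n)
      = dot3 l v * (v $ i * g v + n $ i * f (v - dot3 l v *s n))" for v
  proof -
    have "v $ i * f v - (v - dot3 l v *s n) $ i * f (v - dot3 l v *s n)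
        = v $ i * (f v - f (v - dot3 l v *s n)) + dot3 l v * (n $ i * f (v - dot3 l v *s n))"
      by (simp add: algebra_simps)
    then show ?thesis using g(3)[of v] by (simp add: distrib_left mult.left_commute)
  qed
  then show ?case using hp.hp_add[OF 1 2] by (intro exI[of _ "\<lambda>v. v $ i * g v + n $ i * f (v - dot3 l v *s n)"]) simp
next
  case (hp_add e f f')
  then obtain g g' where g: "e = 0 \<longrightarrow> g = (\<lambda>_. 0)" "hp (e - 1) g"
    "e = 0 \<longrightarrow> g' = (\<lambda>_. 0)" "hp (e - 1) g'"
    and *: "\<And>v. f v - f (v - dot3 l v *s n) = dot3 l v * g v"
    "\<And>v. f' v - f' (v - dot3 l v *s n) = dot3 l v * g' v" by blast
  have "f v + f' v - (f (v - dot3 l v *s n) + f' (v - dot3 l v *s n)) = dot3 l v * (g v + g' v)" for v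
    unfolding distrib_left *[symmetric] by (simp only: add_diff_add)
  then show ?case using g
    by (intro exI[of _ "\<lambda>v. g v + g' v"] conjI impI allI) (auto intro: hp.hp_add)
qed

lemma hp_factor:
  assumes "hp e f" "l \<noteq> 0" "\<And>v. v \<in> line_of l \<Longrightarrow> f v = 0"
  obtains g where "e = 0 \<Longrightarrow> g = (\<lambda>_. 0)" "hp (e - 1) g" "\<And>v. f v = dot3 l v * g v"
proof -
  obtain n where n: "dot3 l n = 1" using exists_dot3_1 assms by blast
  have "f (v - dot3 l v *s n) = 0" for v
    using n by (intro assms(3)) (simp add: line_of_def)
  then have z: "f v - f (v - dot3 l v *s n) = f v" for v by simp
  from hp_divide_remainder[OF assms(1) n]
  obtain g where g: "e = 0 \<longrightarrow> g = (\<lambda>_. 0)" "hp (e - 1) g"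
    "\<And>v. f v - f (v - dot3 l v *s n) = dot3 l v * g v" by blast
  from g(3) have "f v = dot3 l v * g v" for v by (simp only: z)
  with g show thesis by (intro that[of g]) simp_all
qed

text \<open>Restriction to the affine line from \<open>u\<close> to \<open>w\<close>, which stays
  inside \<open>V\<close>, reduces the claim to polynomials in one variable. It is applied with
  \<open>V\<close> the whole space and with \<open>V\<close> a projective line.\<close>

lemma hp_no_zero_divisors:
  assumes f: "hp e f" and g: "hp d g" and u: "u \<in> V" "f u \<noteq> 0" and w: "w \<in> V" "g w \<noteq> 0"
    and V: "\<And>a b t. a \<in> V \<Longrightarrow> b \<in> V \<Longrightarrow> a + t *s (b - a) \<in> V"
  shows "\<exists>v\<in>V. f v * g v \<noteq> 0"
proof (rule ccontr)
  assume "\<not> ?thesis"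
  then have z: "f (u + t *s (w - u)) * g (u + t *s (w - u)) = 0" for t using V u w by blast
  obtain p where p: "\<And>t. f (u + t *s (w - u)) = poly p t" using hp_restrict[OF f] by blast
  obtain q where q: "\<And>t. g (u + t *s (w - u)) = poly q t" using hp_restrict[OF g] by blast
  have "poly (p * q) t = 0" for t using z p q by simp
  then have "p * q = 0" using poly_all_0_iff_0 by blast
  moreover have "p \<noteq> 0" using p[of 0] u by auto
  moreover have "q \<noteq> 0" using q[of 1] w by auto
  ultimately show False by simp
qed

lemma hp_cancel:
  assumes f: "hp e f" and g: "hp d g" and nz: "f u \<noteq> 0" and z: "\<And>v. f v * g v = 0"
  shows "g v = 0"
  using hp_no_zero_divisors[OF f g, of u UNIV v] nz z by blast

lemma line_of_affine: "a \<in> line_of l \<Longrightarrow> b \<in> line_of l \<Longrightarrow> a + t *s (b - a) \<in> line_of l"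
  by (simp add: line_of_def)

lemma hp_cancel_line:
  assumes f: "hp e f" and g: "hp d g" and nz: "u \<in> line_of l" "f u \<noteq> 0"
    and z: "\<And>v. v \<in> line_of l \<Longrightarrow> f v * g v = 0" and v: "v \<in> line_of l"
  shows "g v = 0"
  using hp_no_zero_divisors[OF f g nz v _ line_of_affine] z by blast

lemma hp_prod_nonzero_on:
  assumes "finite A" "\<And>m. m \<in> A \<Longrightarrow> \<exists>v \<in> line_of l. dot3 m v \<noteq> 0"
  shows "\<exists>v \<in> line_of l. (\<Prod>m\<in>A. dot3 m v) \<noteq> 0"
  using assms
proof (induction A rule: finite_induct)
  case empty show ?case by (rule bexI[of _ 0]) simp_all
next
  case (insert a A)
  then obtain v where v: "v \<in> line_of l" "(\<Prod>m\<in>A. dot3 m v) \<noteq> 0" by blast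
  obtain u where u: "u \<in> line_of l" "dot3 a u \<noteq> 0" using insert by blast
  from hp_no_zero_divisors[OF hp_linear hp_prod[OF insert.hyps(1)] u v line_of_affine] insert.hyps
  show ?case by simp
qed

lemma exists_not_on_line:
  assumes "cr l m \<noteq> 0" shows "\<exists>v \<in> line_of l. dot3 m v \<noteq> 0"
proof -
  obtain w where w: "dot3 (cr l m) w = 1" using assms exists_dot3_1 by blast
  have "cr l w \<in> line_of l" by (simp add: line_of_def dot3_3 algebra_simps)
  moreover have "dot3 m (cr l w) = - dot3 (cr l m) w" by (simp add: dot3_3 algebra_simps)
  ultimately show ?thesis using w by (intro bexI[of _ "cr l w"]) auto
qed

text \<open>The linear forms are divided off one at a time: on a line \<open>l\<close> of the family
  the product of the other forms is not identically zero, so the remaining quotient vanishes on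
  \<open>l\<close>. If there are more lines than the degree allows, \<open>f\<close> is zero, which
  is recorded by a zero quotient.\<close>

lemma hp_factor_lines:
  assumes "finite A" "hp e f" "\<And>l. l \<in> A \<Longrightarrow> l \<noteq> 0" "\<And>l m. l \<in> A \<Longrightarrow> m \<in> A \<Longrightarrow> l \<noteq> m \<Longrightarrow> cr l m \<noteq> 0"
    and "\<And>l v. l \<in> A \<Longrightarrow> v \<in> line_of l \<Longrightarrow> f v = 0"
  shows "\<exists>g. hp (e - card A) g \<and> (\<forall>v. f v = (\<Prod>l\<in>A. dot3 l v) * g v) \<and> (e < card A \<longrightarrow> g = (\<lambda>_. 0))"
  using assms
proof (induction A rule: finite_induct)
  case empty then show ?case by (intro exI[of _ f]) simp
next
  case (insert l A)
  have "\<exists>g. hp (e - card A) g \<and> (\<forall>v. f v = (\<Prod>l\<in>A. dot3 l v) * g v) \<and> (e < card A \<longrightarrow> g = (\<lambda>_. 0))"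
    by (rule insert.IH[OF insert.prems(1) insert.prems(2) insert.prems(3) insert.prems(4)]) simp_all
  then obtain g where g: "hp (e - card A) g" "\<And>v. f v = (\<Prod>l\<in>A. dot3 l v) * g v"
    "e < card A \<Longrightarrow> g = (\<lambda>_. 0)" by blast
  have "\<exists>v \<in> line_of l. (\<Prod>m\<in>A. dot3 m v) \<noteq> 0"
  proof (rule hp_prod_nonzero_on[OF insert.hyps(1)])
    fix m assume "m \<in> A"
    with insert.hyps insert.prems(3)[of l m] have "cr l m \<noteq> 0" by auto
    then show "\<exists>v \<in> line_of l. dot3 m v \<noteq> 0" by (rule exists_not_on_line)
  qed
  then obtain u where u: "u \<in> line_of l" "(\<Prod>m\<in>A. dot3 m u) \<noteq> 0" by blast
  have gz: "g v = 0" if "v \<in> line_of l" for v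
    by (rule hp_cancel_line[OF hp_prod[OF insert.hyps(1)] g(1) u _ that])
       (use g(2) insert.prems(4) in auto)
  obtain k where k: "e - card A = 0 \<Longrightarrow> k = (\<lambda>_. 0)" "hp (e - card A - 1) k" "\<And>v. g v = dot3 l v * k v"
    using hp_factor[OF g(1) _ gz] insert.prems(2) by (metis insertI1)
  show ?case
    using insert.hyps k g by (intro exI[of _ k]) (auto simp: mult_ac)
qed

section \<open>Polynomials describing the foliation along an invariant line\<close>

lemma prod_linear_powers_dvd:
  fixes f :: "complex poly"
  assumes "finite S" "\<And>p. p \<in> S \<Longrightarrow> [:-p, 1:] ^ m p dvd f"
  shows "(\<Prod>p\<in>S. [:-p, 1:] ^ m p) dvd f"
  using assms
proof (induction S rule: finite_induct)
  case (insert a S)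
  show ?case
  proof (cases "f = 0")
    case False
    obtain g where g: "f = (\<Prod>p\<in>S. [:-p, 1:] ^ m p) * g" using insert by (auto elim: dvdE)
    have nz: "poly (\<Prod>p\<in>S. [:-p, 1:] ^ m p) a \<noteq> 0" using insert.hyps by (auto simp: poly_prod)
    have "order a f = order a (\<Prod>p\<in>S. [:-p, 1:] ^ m p) + order a g"
      unfolding g by (rule order_mult) (use False g in simp)
    then have "order a f = order a g" using nz by (simp add: order_0I)
    moreover have "m a \<le> order a f" using insert.prems[of a] False by (simp add: order_divides)
    ultimately have "[:-a, 1:] ^ m a dvd g" by (simp add: order_divides)
    then show ?thesis using insert.hyps by (simp add: g mult.commute[of "[:-a, 1:] ^ m a"])
  qed simp
qed simp

lemma degree_prod_linear_powers:
  "finite S \<Longrightarrow> degree (\<Prod>p\<in>S. [:-p, 1 :: complex:] ^ m p) = (\<Sum>p\<in>S. m p)"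
  by (subst degree_prod_sum_eq) (auto simp: degree_power_eq)

lemma linear_power_dvd_pderiv:
  assumes "[:-p, 1:] ^ Suc k dvd (f :: complex poly)" shows "[:-p, 1:] ^ k dvd pderiv f"
proof -
  define l where "l = [:-p, 1:]"
  obtain g where f: "f = l ^ Suc k * g" using assms unfolding l_def by (rule dvdE)
  have "pderiv f = l ^ Suc k * pderiv g + g * (smult (of_nat (Suc k)) (l ^ k) * pderiv l)"
    by (simp only: f pderiv_mult pderiv_power_Suc)
  moreover have "l ^ k dvd l ^ Suc k * pderiv g" by (simp add: le_imp_power_dvd dvd_mult2)
  moreover have "l ^ k dvd g * (smult (of_nat (Suc k)) (l ^ k) * pderiv l)"
    by (intro dvd_mult dvd_mult2 dvd_smult dvd_refl)
  ultimately show ?thesis unfolding l_def[symmetric] by (simp only: dvd_add)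
qed

lemma linear_power_dvd_poly_0:
  assumes "[:-p, 1:] ^ k dvd (f :: complex poly)"
  shows "k \<ge> 1 \<Longrightarrow> poly f p = 0" "k \<ge> 2 \<Longrightarrow> poly (pderiv f) p = 0"
    "k \<ge> 3 \<Longrightarrow> poly (pderiv (pderiv f)) p = 0"
    "k \<ge> 4 \<Longrightarrow> poly (pderiv (pderiv (pderiv f))) p = 0"
    "k \<ge> 5 \<Longrightarrow> poly (pderiv (pderiv (pderiv (pderiv f)))) p = 0"
proof -
  have *: "poly h p = 0" if "[:-p, 1:] ^ j dvd h" "j \<ge> 1" for j h
    using dvd_trans[OF le_imp_power_dvd[of 1 j] that(1)] that(2) by (simp add: poly_eq_0_iff_dvd)
  have s: "[:-p, 1:] ^ (j - 1) dvd pderiv h" if "[:-p, 1:] ^ j dvd h" "j \<ge> 1" for j h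
    using linear_power_dvd_pderiv[of p "j - 1" h] that by (cases j) auto
  show "k \<ge> 1 \<Longrightarrow> poly f p = 0" using * assms by blast
  show "k \<ge> 2 \<Longrightarrow> poly (pderiv f) p = 0"
    by (rule *[OF s[OF assms]]) auto
  show "k \<ge> 3 \<Longrightarrow> poly (pderiv (pderiv f)) p = 0"
    by (rule *[OF s[OF s[OF assms]]]) auto
  show "k \<ge> 4 \<Longrightarrow> poly (pderiv (pderiv (pderiv f))) p = 0"
    by (rule *[OF s[OF s[OF s[OF assms]]]]) auto
  show "k \<ge> 5 \<Longrightarrow> poly (pderiv (pderiv (pderiv (pderiv f)))) p = 0"
    by (rule *[OF s[OF s[OF s[OF s[OF assms]]]]]) auto
qed

text \<open>Take \<open>h = g - c f\<close> vanishing at a point \<open>a\<close> where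
  \<open>f\<close> does not vanish. The relation \<open>f h' = f' h\<close> says that
  \<open>h'\<close> vanishes at \<open>a\<close> at least to the order of \<open>h\<close>, but
  differentiation lowers that order by one, so \<open>h = 0\<close>.\<close>

lemma wronskian_0_proportional:
  fixes f g :: "complex poly"
  assumes W: "f * pderiv g = pderiv f * g" and f: "f \<noteq> 0"
  obtains c where "g = smult c f"
proof -
  obtain a where a: "poly f a \<noteq> 0" using f poly_all_0_iff_0 by blast
  define c where "c = poly g a / poly f a"
  define h where "h = g - smult c f"
  have Wh: "f * pderiv h = pderiv f * h"
    using W by (simp add: h_def pderiv_diff pderiv_smult algebra_simps)
  have h0: "poly h a = 0" using a by (simp add: h_def c_def)
  have "h = 0"
  proof (rule ccontr)
    assume h: "h \<noteq> 0"
    have o: "order a h = Suc (order a (pderiv h))" by (rule order_pderiv[OF h h0])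
    have "pderiv h \<noteq> 0"
    proof
      assume "pderiv h = 0"
      then obtain d where "h = [:d:]" using pderiv_iszero by blast
      with h0 h show False by simp
    qed
    then have nz: "f * pderiv h \<noteq> 0" using f by simp
    have "order a (pderiv h) = order a (f * pderiv h)"
      using order_mult[OF nz, of a] order_0I[OF a] by simp
    also have "\<dots> = order a (pderiv f) + order a h" using Wh nz by (simp add: order_mult)
    finally show False using o by simp
  qed
  then show thesis by (intro that[of c]) (simp add: h_def)
qed

text \<open>The two products of leading terms both have coefficient \<open>5 a b\<close> in degree 9
  and cancel. This saved degree makes the count in \<open>line_polynomials\<close> sharp.\<close>

lemma degree_wronskian_le:
  fixes f g :: "complex poly"
  assumes "degree f \<le> 5" "degree g \<le> 5"
  shows "degree (f * pderiv g - pderiv f * g) \<le> 8"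
proof -
  have split: "\<exists>h. p = monom (coeff p 5) 5 + h \<and> degree h \<le> 4" if "degree p \<le> 5" for p :: "complex poly"
  proof (intro exI conjI)
    show "p = monom (coeff p 5) 5 + (p - monom (coeff p 5) 5)" by simp
    show "degree (p - monom (coeff p 5) 5) \<le> 4"
    proof (rule degree_le, safe)
      fix i :: nat assume "4 < i"
      then have "i = 5 \<or> i > 5" by auto
      then show "coeff (p - monom (coeff p 5) 5) i = 0" using that by (auto simp: coeff_eq_0)
    qed
  qed
  obtain a f0 b g0 where f: "f = monom a 5 + f0" "degree f0 \<le> 4" and g: "g = monom b 5 + g0" "degree g0 \<le> 4"
    using split assms by meson
  have d: "degree (p * q) \<le> 8" if "degree p \<le> i" "degree q \<le> j" "i + j \<le> 8" for p q :: "complex poly" and i j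
    using degree_mult_le[of p q] that by linarith
  have pd: "degree (pderiv p) \<le> 3" if "degree p \<le> 4" for p :: "complex poly"
    using that by (simp add: degree_pderiv)
  have m: "degree (monom c 4 :: complex poly) \<le> 4" "degree (monom c 5 :: complex poly) \<le> 5" for c
    by (simp_all add: degree_monom_le)
  have "f * pderiv g - pderiv f * g = monom a 5 * pderiv g0 + f0 * monom (5 * b) 4 + f0 * pderiv g0
      - monom (5 * a) 4 * g0 - pderiv f0 * monom b 5 - pderiv f0 * g0"
    by (simp add: f g pderiv_add pderiv_monom algebra_simps mult_monom)
  also have "degree \<dots> \<le> 8"
    using d[OF m(2) pd[OF g(2)]] d[OF f(2) m(1)] d[OF f(2) pd[OF g(2)]] d[OF m(1) g(2)]
      d[OF pd[OF f(2)] m(2)] d[OF pd[OF f(2)] g(2)]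
    by (intro degree_diff_le degree_add_le) simp_all
  finally show ?thesis .
qed

text \<open>Lagrange interpolation of \<open>a\<close> at the six roots of \<open>R\<close>,
  compared in degree 5. In other words, this is the residue theorem for \<open>- a / R\<close> on
  the projective line: the hypothesis on the leading coefficients fixes the residue at infinity, and
  1 is the self-intersection number of a line in the plane.\<close>

lemma residue_sum_eq_1:
  fixes a R :: "complex poly"
  assumes "degree a \<le> 5" "degree R = 6" "coeff R 6 = - coeff a 5" "finite S" "card S = 6"
    "R = smult (lead_coeff R) (\<Prod>p\<in>S. [:-p, 1:])"
  shows "(\<Sum>p\<in>S. - poly a p / poly (pderiv R) p) = 1"
proof -
  define P where "P p = (\<Prod>q\<in>S - {p}. [:-q, 1::complex:])" for p
  let ?c = "lead_coeff R"
  have c: "?c \<noteq> 0" using assms(2) by (metis degree_0 leading_coeff_0_iff zero_neq_numeral)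
  have degP: "degree (P p) = 5" and lcP: "coeff (P p) 5 = 1" if "p \<in> S" for p
  proof -
    show d: "degree (P p) = 5" unfolding P_def using assms(4,5) that by (subst degree_prod_sum_eq) auto
    have "lead_coeff (P p) = 1" unfolding P_def by (simp add: lead_coeff_prod)
    with d show "coeff (P p) 5 = 1" by simp
  qed
  have Pp: "poly (P p) p \<noteq> 0" for p using assms(4) by (auto simp: P_def poly_prod)
  have P0: "poly (P p) q = 0" if "q \<in> S" "q \<noteq> p" for p q
    using assms(4) that by (auto simp: P_def poly_prod)
  have dR: "poly (pderiv R) p = ?c * poly (P p) p" if "p \<in> S" for p
  proof -
    have "R = smult ?c ([:-p, 1:] * P p)"
      using assms(6) prod.remove[OF assms(4) that, of "\<lambda>p. [:-p, 1:]"] by (simp add: P_def)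
    moreover have "pderiv ([:-p, 1:] * P p) = P p + [:-p, 1:] * pderiv (P p)"
      unfolding pderiv_mult by (simp add: pderiv_pCons add.commute)
    ultimately have "pderiv R = smult ?c (P p + [:-p, 1:] * pderiv (P p))"
      by (metis pderiv_smult)
    then show ?thesis by simp
  qed
  define b where "b = (\<Sum>p\<in>S. smult (poly a p / poly (P p) p) (P p))"
  have "a = b"
  proof (rule poly_eqI_degree)
    fix q assume q: "q \<in> S"
    have "poly b q = (\<Sum>p\<in>S. if p = q then poly a q else 0)"
      unfolding b_def poly_sum using Pp P0 q by (intro sum.cong) auto
    then show "poly a q = poly b q" using q assms(4) by simp
  next
    show "degree a < card S" using assms by simp
    have "degree b \<le> 5" unfolding b_def
      by (rule degree_sum_le[OF assms(4)]) (metis degP degree_smult_le)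
    then show "degree b < card S" using assms by simp
  qed
  then have "coeff a 5 = coeff b 5" by (rule arg_cong)
  then have "coeff a 5 = (\<Sum>p\<in>S. poly a p / poly (P p) p)"
    by (simp add: b_def coeff_sum lcP)
  also have "\<dots> = ?c * (\<Sum>p\<in>S. poly a p / poly (pderiv R) p)"
    using c by (simp add: sum_distrib_left dR)
  finally have "?c * (\<Sum>p\<in>S. poly a p / poly (pderiv R) p) = - ?c" using assms(2,3) by simp
  then have "?c * (1 + (\<Sum>p\<in>S. poly a p / poly (pderiv R) p)) = 0" by (simp add: distrib_left)
  then have "1 + (\<Sum>p\<in>S. poly a p / poly (pderiv R) p) = 0" using c by simp
  then show ?thesis by (simp add: sum_negf add_eq_0_iff)
qed

text \<open>In the application \<open>m p\<close> counts the invariant lines through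
  \<open>p\<close> other than the given one. The sharp degree count makes the order of
  \<open>R W\<close> at \<open>p\<close> equal to \<open>m p\<close>; each nonvanishing claim holds
  because its failure would contribute one more factor \<open>y - p\<close>.\<close>

lemma line_polynomials:
  fixes a b :: "complex poly" and m :: "complex \<Rightarrow> nat"
  defines "R \<equiv> b - [:0, 1:] * a"
  assumes deg: "degree a \<le> 5" "degree b \<le> 5" and R0: "R \<noteq> 0" and fin: "finite S"
    and m: "\<And>p. p \<in> S \<Longrightarrow> 1 \<le> m p \<and> m p \<le> 5" and sum: "(\<Sum>p\<in>S. m p) = 14"
    and dvd: "\<And>p. p \<in> S \<Longrightarrow> [:-p, 1:] ^ m p dvd b - smult p a"
  shows "card S = 6" "degree R = 6"
    "\<And>p. p \<in> S \<Longrightarrow> poly R p = 0 \<and> poly a p \<noteq> 0 \<and> poly (pderiv R) p \<noteq> 0"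
    "\<And>p. p \<in> S \<Longrightarrow> m p = 1 \<Longrightarrow> poly a p + poly (pderiv R) p \<noteq> 0"
    "\<And>p. p \<in> S \<Longrightarrow> m p \<ge> 2 \<Longrightarrow> poly a p + poly (pderiv R) p = 0"
    "(\<Sum>p\<in>S. - poly a p / poly (pderiv R) p) = 1"
proof -
  define W where "W = a * pderiv b - pderiv a * b"
  \<comment> \<open>\<open>W\<close> does not change when \<open>b\<close> is replaced by
    \<open>b - p a\<close>, and \<open>R\<close> equals \<open>(b - p a) - (y - p) a\<close>. So at
    \<open>p\<close> everything is expressed by \<open>a\<close> and the one polynomial whose order
    is prescribed.\<close>
  have Wg: "W = a * pderiv (b - smult p a) - pderiv a * (b - smult p a)" for p
    by (simp add: W_def pderiv_diff pderiv_smult algebra_simps)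
  have Rg: "R = (b - smult p a) - [:-p, 1:] * a" for p
  proof -
    have "[:-p, 1:] * a = [:0, 1:] * a - smult p a" by simp
    then show ?thesis by (simp add: R_def)
  qed
  have big: "f = 0" if "(\<Prod>p\<in>T. [:-p, 1:] ^ m p) dvd f" "degree f \<le> 5" "(\<Sum>p\<in>T. m p) > 5" "finite T"
    for T and f :: "complex poly"
  proof (rule ccontr)
    assume "f \<noteq> 0"
    with dvd_imp_degree_le[OF that(1)] degree_prod_linear_powers[OF that(4), of m] that(2,3)
    show False by simp
  qed
  have a0: "a \<noteq> 0"
  proof
    assume "a = 0"
    then have "b = 0" using prod_linear_powers_dvd[OF fin, of m b] dvd deg sum fin
      by (intro big[of S]) auto
    with \<open>a = 0\<close> R0 show False by (simp add: R_def)
  qed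
  have W0: "W \<noteq> 0"
  proof
    assume "W = 0"
    then obtain c where c: "b = smult c a" using wronskian_0_proportional a0 by (auto simp: W_def)
    \<comment> \<open>If \<open>b = c a\<close>, each \<open>b - p a\<close> is a multiple of
      \<open>a\<close>, so \<open>a\<close> would be divisible by all the powers with
      \<open>p \<noteq> c\<close>; their total degree is at least 14 - 5 = 9.\<close>
    have "(\<Sum>p\<in>S. m p) \<le> (\<Sum>p\<in>S - {c}. m p) + 5"
      using m by (cases "c \<in> S") (auto simp: sum.remove[OF fin, of c m])
    then have "a = 0"
    proof (intro big[of "S - {c}"] prod_linear_powers_dvd)
      fix p assume p: "p \<in> S - {c}"
      have "b - smult p a = smult (c - p) a" by (simp add: c smult_diff_left)
      with dvd[of p] p show "[:-p, 1:] ^ m p dvd a" by (auto dest: dvd_smult_cancel)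
    qed (use fin deg sum in auto)
    with a0 show False by simp
  qed
  have dR: "degree R \<le> 6"
    unfolding R_def using deg degree_mult_le[of "[:0,1:]" a] by (intro degree_diff_le) auto
  have dW: "degree W \<le> 8" unfolding W_def by (rule degree_wronskian_le[OF deg])
  have Wm: "[:-p, 1:] ^ (m p - 1) dvd W" if "p \<in> S" for p
  proof -
    from m[OF that] obtain k where k: "m p = Suc k" by (cases "m p") auto
    have d: "[:-p, 1:] ^ Suc k dvd b - smult p a" using dvd[OF that] k by simp
    then have "[:-p, 1:] ^ k dvd b - smult p a" by (rule power_le_dvd) simp
    moreover have "[:-p, 1:] ^ k dvd pderiv (b - smult p a)" by (rule linear_power_dvd_pderiv[OF d])
    ultimately show ?thesis unfolding Wg[of p] k diff_Suc_1 by (rule dvd_diff[OF dvd_mult dvd_mult, rotated])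
  qed
  have g0: "poly (b - smult p a) p = 0" if "p \<in> S" for p
    using linear_power_dvd_poly_0(1)[OF dvd[OF that]] m[OF that] by blast
  have Rp: "poly R p = 0" if "p \<in> S" for p
    using g0[OF that] unfolding Rg[of p] by simp
  let ?P = "\<Prod>p\<in>S. [:-p, 1:] ^ m p"
  have "?P dvd R * W"
  proof (rule prod_linear_powers_dvd[OF fin])
    fix p assume p: "p \<in> S"
    have "[:-p, 1:] * [:-p, 1:] ^ (m p - 1) dvd R * W"
      using Rp[OF p] Wm[OF p] by (intro mult_dvd_mono) (simp_all add: poly_eq_0_iff_dvd)
    then show "[:-p, 1:] ^ m p dvd R * W" using m[OF p] by (cases "m p") auto
  qed
  then obtain k where k: "R * W = ?P * k" by (auto elim: dvdE)
  have RW0: "R * W \<noteq> 0" using R0 W0 by simp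
  have dP: "degree ?P = 14" using degree_prod_linear_powers[OF fin, of m] sum by simp
  have "degree (R * W) = degree ?P + degree k" unfolding k using k RW0 by (intro degree_mult_eq) auto
  moreover have "degree (R * W) = degree R + degree W" using R0 W0 by (rule degree_mult_eq)
  ultimately have k0: "degree k = 0" and d6: "degree R = 6" using dP dR dW by auto
  then obtain c where c: "k = [:c:]" using degree_eq_zeroE by blast
  \<comment> \<open>The cofactor \<open>k\<close> is a nonzero constant, so no point of
    \<open>S\<close> can be a root of higher order than prescribed.\<close>
  have exact: "\<not> [:-p, 1:] ^ (m p + 1) dvd R * W" if "p \<in> S" for p
  proof
    let ?Q = "\<Prod>q\<in>S - {p}. [:-q, 1:] ^ m q"
    assume "[:-p, 1:] ^ (m p + 1) dvd R * W"
    also have "R * W = [:-p, 1:] ^ m p * (?Q * k)"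
      unfolding k prod.remove[OF fin that] by (simp add: mult_ac)
    finally have "[:-p, 1:] ^ m p * [:-p, 1:] dvd [:-p, 1:] ^ m p * (?Q * k)"
      by (simp only: Suc_eq_plus1[symmetric] power_Suc2)
    moreover have "[:-p, 1:] ^ m p \<noteq> 0" by simp
    ultimately have "[:-p, 1:] dvd ?Q * k" using dvd_times_left_cancel_iff by blast
    then have "poly (?Q * k) p = 0" by (simp only: poly_eq_0_iff_dvd)
    moreover have "poly ?Q p \<noteq> 0" using fin by (auto simp: poly_prod)
    moreover have "c \<noteq> 0" using k RW0 c by auto
    ultimately show False by (simp add: c)
  qed
  have ap: "poly a p \<noteq> 0" if "p \<in> S" for p
  proof
    assume "poly a p = 0"
    then have a1: "[:-p, 1:] dvd a" by (simp only: poly_eq_0_iff_dvd)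
    from m[OF that] obtain j where j: "m p = Suc j" by (cases "m p") auto
    have d: "[:-p, 1:] ^ Suc j dvd b - smult p a" using dvd[OF that] j by simp
    have "[:-p, 1:] * [:-p, 1:] ^ j dvd a * pderiv (b - smult p a)"
      by (rule mult_dvd_mono[OF a1 linear_power_dvd_pderiv[OF d]])
    then have "[:-p, 1:] ^ Suc j dvd W" unfolding Wg[of p] power_Suc
      by (rule dvd_diff) (rule dvd_mult[OF d[unfolded power_Suc]])
    then have "[:-p, 1:] * [:-p, 1:] ^ Suc j dvd R * W"
      using Rp[OF that] by (intro mult_dvd_mono) (simp_all add: poly_eq_0_iff_dvd)
    with exact[OF that] j show False by simp
  qed
  have dRp: "poly (pderiv R) p \<noteq> 0" if pS: "p \<in> S" for p
  proof
    assume z: "poly (pderiv R) p = 0"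
    have "[:-p, 1:] dvd R" using Rp[OF pS] by (simp only: poly_eq_0_iff_dvd)
    then obtain R1 where R1: "R = [:-p, 1:] * R1" by (rule dvdE)
    have "pderiv R = R1 + [:-p, 1:] * pderiv R1"
      unfolding R1 pderiv_mult by (simp add: pderiv_pCons add.commute)
    with z have "poly R1 p = 0" by simp
    then have "[:-p, 1:] * [:-p, 1:] dvd R"
      unfolding R1 by (intro mult_dvd_mono) (simp_all only: poly_eq_0_iff_dvd dvd_refl)
    then have "[:-p, 1:] * [:-p, 1:] * [:-p, 1:] ^ (m p - 1) dvd R * W"
      by (intro mult_dvd_mono Wm[OF pS])
    moreover have "l * l * l ^ (m p - 1) = l ^ (m p + 1)" for l :: "complex poly"
      using m[OF pS] by (cases "m p") (auto simp: mult.assoc)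
    ultimately show False using exact[OF pS] by (simp only:)
  qed
  \<comment> \<open>At \<open>p\<close> the derivative of \<open>y a\<close> is
    \<open>a + p a'\<close>. Hence \<open>R' + a\<close> is there the derivative of
    \<open>b - p a\<close>, which vanishes as soon as \<open>m p\<close> is at least 2.\<close>
  have dRa: "poly (pderiv R) p + poly a p = poly (pderiv (b - smult p a)) p" for p
    unfolding R_def by (simp only: pderiv_diff pderiv_mult pderiv_smult poly_diff poly_add poly_mult poly_smult)
      (simp add: pderiv_pCons)
  show "\<And>p. p \<in> S \<Longrightarrow> poly R p = 0 \<and> poly a p \<noteq> 0 \<and> poly (pderiv R) p \<noteq> 0"
    using Rp ap dRp by blast
  show "\<And>p. p \<in> S \<Longrightarrow> m p \<ge> 2 \<Longrightarrow> poly a p + poly (pderiv R) p = 0"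
    using linear_power_dvd_poly_0(2)[OF dvd] dRa by (simp add: add.commute)
  show "poly a p + poly (pderiv R) p \<noteq> 0" if p: "p \<in> S" "m p = 1" for p
  proof
    assume "poly a p + poly (pderiv R) p = 0"
    then have "poly W p = 0" using dRa[of p] g0[OF p(1)] unfolding Wg[of p] by (simp add: add.commute)
    then have "[:-p, 1:] * [:-p, 1:] dvd R * W"
      using Rp[OF p(1)] by (intro mult_dvd_mono) (simp_all add: poly_eq_0_iff_dvd)
    with exact[OF p(1)] p show False by (simp add: power2_eq_square)
  qed
  have roots: "{z. poly R z = 0} = S"
  proof (intro equalityI subsetI)
    fix z assume "z \<in> {z. poly R z = 0}"
    then have "poly (R * W) z = 0" by simp
    then have "c * poly ?P z = 0" by (auto simp add: k c)
    moreover have "c \<noteq> 0" using k RW0 c by auto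
    ultimately show "z \<in> S" using fin by (auto simp: poly_prod)
  qed (use Rp in auto)
  have "rsquarefree R" unfolding rsquarefree_roots using roots dRp by auto
  then have dec: "R = smult (lead_coeff R) (\<Prod>p\<in>S. [:-p, 1:])"
    using complex_poly_decompose_rsquarefree[of R] roots by simp
  then have "degree R = degree (\<Prod>p\<in>S. [:-p, 1:])" using R0 by (metis degree_smult_eq leading_coeff_0_iff)
  also have "\<dots> = card S" by (subst degree_prod_sum_eq) auto
  finally show c6: "card S = 6" using d6 by simp
  show "degree R = 6" by (rule d6)
  have "coeff R 6 = - coeff a 5"
  proof -
    have "coeff b 6 = 0" using deg by (simp add: coeff_eq_0)
    then show ?thesis by (simp add: R_def coeff_pCons split: nat.split)
  qed
  from residue_sum_eq_1[OF deg(1) d6 this fin c6 dec]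
  show "(\<Sum>p\<in>S. - poly a p / poly (pderiv R) p) = 1" .
qed

section \<open>Equations for the index at a node, one for each pattern of multiplicities\<close>

lemma degree_le_5E:
  assumes "degree (p :: complex poly) \<le> 5"
  obtains c0 c1 c2 c3 c4 c5 where "p = [:c0, c1, c2, c3, c4, c5:]"
proof -
  have "p = [:coeff p 0, coeff p 1, coeff p 2, coeff p 3, coeff p 4, coeff p 5:]"
  proof (rule poly_eqI)
    fix n show "coeff p n = coeff [:coeff p 0, coeff p 1, coeff p 2, coeff p 3, coeff p 4, coeff p 5:] n"
    proof (cases "n \<le> 5")
      case True
      then have "n \<in> {0,1,2,3,4,5}" by auto
      then show ?thesis by (auto simp: coeff_pCons numeral_eq_Suc)
    next
      case False
      then have "coeff p n = 0" using assms by (simp add: coeff_eq_0)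
      moreover have "coeff [:coeff p 0, coeff p 1, coeff p 2, coeff p 3, coeff p 4, coeff p 5:] n = 0"
        using False by (intro coeff_eq_0) (auto simp: degree_pCons_eq_if)
      ultimately show ?thesis by simp
    qed
  qed
  then show thesis by (rule that)
qed

text \<open>
  The number \<open>lam\<close> is the Camacho-Sad index at a point through which only two invariant lines
  pass. The next lemmas normalise some of the other singular points on the line to \<open>\<infinity>\<close>, \<open>0\<close>, \<open>1\<close>.
\<close>

lemma cs_type_44:
  assumes "degree a = 0" "degree b \<le> 5" "[:-0, 1:] ^ 5 dvd b - smult 0 a" "R = b - [:0, 1:] * a"
    "poly R w = 0" "w \<noteq> 0" "poly a w \<noteq> 0" "lam * poly (pderiv R) w = - poly a w"
  shows "4 * lam + 1 = (0::complex)"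
proof -
  obtain c where a: "a = [:c:]" using assms(1) by (rule degree_eq_zeroE)
  obtain b0 b1 b2 b3 b4 b5 where b: "b = [:b0, b1, b2, b3, b4, b5:]" using assms(2) by (rule degree_le_5E)
  have z: "b0 = 0" "b1 = 0" "b2 = 0" "b3 = 0" "b4 = 0"
    using linear_power_dvd_poly_0[OF assms(3)] by (auto simp: a b pderiv_pCons)
  have c: "c \<noteq> 0" using assms(7) a by simp
  have "w * (b5 * w ^ 4 - c) = 0" using assms(5) by (simp add: assms(4) a b z algebra_simps power_numeral_reduce)
  then have e: "b5 * w ^ 4 = c" using assms(6) by simp
  have "lam * (5 * b5 * w ^ 4 - c) = - c"
    using assms(8) by (simp add: assms(4) a b z pderiv_pCons algebra_simps power_numeral_reduce)
  then have "c * (4 * lam + 1) = 0" using e by algebra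
  with c show ?thesis by simp
qed

text \<open>The digits in these names are the values r - 2 at the points with r >= 3; they add up to
  8. Here infinity is 6-fold, which makes \<open>a\<close> constant, 0 is 5-fold and 1 is 3-fold.
  This determines \<open>b\<close> up to a factor, and the three nodes are the roots of
  \<open>4 w^3 - w^2 - w - 1\<close>.\<close>

lemma cs_type_431:
  assumes "degree a = 0" "degree b \<le> 5" "[:-0, 1:] ^ 4 dvd b - smult 0 a" "[:-1, 1:] ^ 2 dvd b - smult 1 a"
    "R = b - [:0, 1:] * a"
    "poly R w = 0" "w \<noteq> 0" "w \<noteq> 1" "poly a w \<noteq> 0" "lam * poly (pderiv R) w = - poly a w"
  shows "491 * lam ^ 3 + 982 * lam ^ 2 + 463 * lam + 64 = (0::complex)"
proof -
  obtain c where a: "a = [:c:]" using assms(1) by (rule degree_eq_zeroE)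
  obtain b0 b1 b2 b3 b4 b5 where b: "b = [:b0, b1, b2, b3, b4, b5:]" using assms(2) by (rule degree_le_5E)
  have z: "b0 = 0" "b1 = 0" "b2 = 0" "b3 = 0"
    using linear_power_dvd_poly_0[OF assms(3)] by (auto simp: a b pderiv_pCons)
  have "b4 + b5 - c = 0" "4 * b4 + 5 * b5 = 0"
    using linear_power_dvd_poly_0[OF assms(4)] by (auto simp: a b z pderiv_pCons algebra_simps)
  then have y: "b4 = 5 * c" "b5 = - 4 * c" by - algebra+
  have c: "c \<noteq> 0" using assms(9) a by simp
  have "c * w * (w - 1) * (4 * w ^ 3 - w ^ 2 - w - 1) = 0"
    using assms(6) by (simp add: assms(5) a b z y algebra_simps power_numeral_reduce)
  then have e: "4 * w ^ 3 - w ^ 2 - w - 1 = 0" using assms(7,8) c by simp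
  have "c * (lam * (20 * w ^ 3 - 20 * w ^ 4 - 1) + 1) = 0"
    using assms(10) by (simp add: assms(5) a b z y pderiv_pCons algebra_simps power_numeral_reduce)
  then have "lam * (20 * w ^ 3 - 20 * w ^ 4 - 1) + 1 = 0" using c by simp
  with e have f: "lam * (5 * w ^ 2 + 5 * w - 11) = 4" by algebra
  \<comment> \<open>With \<open>v = 5 w^2 + 5 w - 11\<close>, the left side is \<open>v^3\<close>
    times the claimed cubic at \<open>lam = 4 / v\<close>. The second factor on the right is the
    quotient by the cubic equation for \<open>w\<close>.\<close>
  have "64 * (5 * w ^ 2 + 5 * w - 11) ^ 3 + 463 * 4 * (5 * w ^ 2 + 5 * w - 11) ^ 2
     + 982 * 16 * (5 * w ^ 2 + 5 * w - 11) + 491 * 64 = (4 * w ^ 3 - w ^ 2 - w - 1) *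
     ((2500) * w ^ 0 + (6500) * w ^ 1 + (6500) * w ^ 2 + (2000) * w ^ 3)" by algebra
  then have "64 * (5 * w ^ 2 + 5 * w - 11) ^ 3 + 463 * 4 * (5 * w ^ 2 + 5 * w - 11) ^ 2
     + 982 * 16 * (5 * w ^ 2 + 5 * w - 11) + 491 * 64 = 0" using e by simp
  then have "lam ^ 3 * (64 * (5 * w ^ 2 + 5 * w - 11) ^ 3 + 463 * 4 * (5 * w ^ 2 + 5 * w - 11) ^ 2
     + 982 * 16 * (5 * w ^ 2 + 5 * w - 11) + 491 * 64) = 0" by simp
  then have "64 * (lam * (5 * w ^ 2 + 5 * w - 11)) ^ 3 + 463 * 4 * lam * (lam * (5 * w ^ 2 + 5 * w - 11)) ^ 2
     + 982 * 16 * lam ^ 2 * (lam * (5 * w ^ 2 + 5 * w - 11)) + 491 * 64 * lam ^ 3 = 0" by algebra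
  then have "64 * (491 * lam ^ 3 + 982 * lam ^ 2 + 463 * lam + 64) = 0" unfolding f by algebra
  then show ?thesis by (subst (asm) mult_eq_0_iff) simp
qed

text \<open>With a 6-fold point at infinity and 4-fold points at 0 and 1, \<open>b\<close> is a
  multiple of \<open>6 y^5 - 15 y^4 + 10 y^3\<close>. One node is the midpoint 1/2, the other two
  are exchanged by \<open>y -> 1 - y\<close>; hence two values of the index.\<close>

lemma cs_type_422:
  assumes "degree a = 0" "degree b \<le> 5" "[:-0, 1:] ^ 3 dvd b - smult 0 a" "[:-1, 1:] ^ 3 dvd b - smult 1 a"
    "R = b - [:0, 1:] * a"
    "poly R w = 0" "w \<noteq> 0" "w \<noteq> 1" "poly a w \<noteq> 0" "lam * poly (pderiv R) w = - poly a w"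
  shows "7 * lam + 8 = 0 \<or> 7 * lam + 3 = (0::complex)"
proof -
  obtain c where a: "a = [:c:]" using assms(1) by (rule degree_eq_zeroE)
  obtain b0 b1 b2 b3 b4 b5 where b: "b = [:b0, b1, b2, b3, b4, b5:]" using assms(2) by (rule degree_le_5E)
  have z: "b0 = 0" "b1 = 0" "b2 = 0"
    using linear_power_dvd_poly_0[OF assms(3)] by (auto simp: a b pderiv_pCons)
  have "b3 + b4 + b5 - c = 0" "3 * b3 + 4 * b4 + 5 * b5 = 0" "6 * b3 + 12 * b4 + 20 * b5 = 0"
    using linear_power_dvd_poly_0[OF assms(4)] by (auto simp: a b z pderiv_pCons algebra_simps)
  then have y: "b3 = 10 * c" "b4 = - 15 * c" "b5 = 6 * c" by - algebra+
  have c: "c \<noteq> 0" using assms(9) a by simp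
  have "c * w * (w - 1) * ((2 * w - 1) * (3 * w ^ 2 - 3 * w - 1)) = 0"
    using assms(6) by (simp add: assms(5) a b z y algebra_simps power_numeral_reduce)
  then have e: "2 * w - 1 = 0 \<or> 3 * w ^ 2 - 3 * w - 1 = 0" using assms(7,8) c by simp
  have "c * (lam * (30 * w ^ 4 - 60 * w ^ 3 + 30 * w ^ 2 - 1) + 1) = 0"
    using assms(10) by (simp add: assms(5) a b z y pderiv_pCons algebra_simps power_numeral_reduce)
  then have f: "lam * (30 * w ^ 4 - 60 * w ^ 3 + 30 * w ^ 2 - 1) + 1 = 0" using c by simp
  from e show ?thesis
  proof
    assume "2 * w - 1 = 0"
    then have "16 * (lam * (30 * w ^ 4 - 60 * w ^ 3 + 30 * w ^ 2 - 1) + 1) = 14 * lam + 16" by algebra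
    then show ?thesis using f by algebra
  next
    assume "3 * w ^ 2 - 3 * w - 1 = 0"
    then have "3 * (lam * (30 * w ^ 4 - 60 * w ^ 3 + 30 * w ^ 2 - 1) + 1) = 7 * lam + 3" by algebra
    then show ?thesis using f by simp
  qed
qed

text \<open>Infinity is 6-fold, 0 is 4-fold, 1 and \<open>p\<close> are 3-fold. The tangency at
  \<open>p\<close> leaves only \<open>p = -1\<close> and \<open>3 p^2 - 5 p + 3 = 0\<close>. In each
  case the two nodes are the roots of the quadratic that remains after removal of the roots 1 and
  \<open>p\<close>; the two cases give the two disjuncts.\<close>

lemma cs_type_4211:
  assumes "degree a = 0" "degree b \<le> 5" "[:-0, 1:] ^ 3 dvd b - smult 0 a" "[:-1, 1:] ^ 2 dvd b - smult 1 a"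
    "[:-p, 1:] ^ 2 dvd b - smult p a"
    "R = b - [:0, 1:] * a"
    "poly R w = 0" "w \<noteq> 0" "w \<noteq> 1" "w \<noteq> p" "p \<noteq> 0" "p \<noteq> 1"
    "poly a w \<noteq> 0" "lam * poly (pderiv R) w = - poly a w"
  shows "2 * lam + 3 = 0 \<or> 59 * lam ^ 2 + 177 * lam + 64 = (0::complex)"
proof -
  obtain c where a: "a = [:c:]" using assms(1) by (rule degree_eq_zeroE)
  obtain b0 b1 b2 b3 b4 b5 where b: "b = [:b0, b1, b2, b3, b4, b5:]" using assms(2) by (rule degree_le_5E)
  have z: "b0 = 0" "b1 = 0" "b2 = 0"
    using linear_power_dvd_poly_0[OF assms(3)] by (auto simp: a b pderiv_pCons)
  have 1: "b3 + b4 + b5 - c = 0" "3 * b3 + 4 * b4 + 5 * b5 = 0"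
    using linear_power_dvd_poly_0[OF assms(4)] by (auto simp: a b z pderiv_pCons algebra_simps)
  have "p * (p ^ 2 * (b3 + b4 * p + b5 * p ^ 2) - c) = 0" "p ^ 2 * (3 * b3 + 4 * b4 * p + 5 * b5 * p ^ 2) = 0"
    using linear_power_dvd_poly_0[OF assms(5)] by (auto simp: a b z pderiv_pCons algebra_simps power_numeral_reduce)
  then have 2: "p ^ 2 * (b3 + b4 * p + b5 * p ^ 2) - c = 0" "3 * b3 + 4 * b4 * p + 5 * b5 * p ^ 2 = 0"
    using assms(11) by simp_all
  have "(p - 1) * (4 * b4 + 5 * b5 * (p + 1)) = 0" using 1(2) 2(2) by algebra
  then have b4: "4 * b4 = - 5 * b5 * (p + 1)" using assms(12) by (simp add: eq_neg_iff_add_eq_0)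
  have b3: "3 * b3 = 5 * b5 * p" using 1(2) b4 by algebra
  have cb: "12 * c = b5 * (5 * p - 3)" using 1 b3 b4 by algebra
  have c: "c \<noteq> 0" using assms(13) a by simp
  then have b5: "b5 \<noteq> 0" using cb by auto
  have "b5 * (p ^ 3 * (5 - 3 * p) - (5 * p - 3)) = 0" using 2(1) b3 b4 cb by algebra
  then have "p ^ 3 * (5 - 3 * p) - (5 * p - 3) = 0" using b5 by simp
  then have "(p - 1) * ((p + 1) * (3 * p ^ 2 - 5 * p + 3)) = 0" by algebra
  then have p: "p + 1 = 0 \<or> 3 * p ^ 2 - 5 * p + 3 = 0" using assms(12) by simp
  have "b5 * (w * (12 * w ^ 4 - 15 * (p + 1) * w ^ 3 + 20 * p * w ^ 2 - (5 * p - 3))) = 12 * poly R w"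
    unfolding assms(6) a b z using b3 b4 cb by (simp add: algebra_simps) algebra
  then have e: "12 * w ^ 4 - 15 * (p + 1) * w ^ 3 + 20 * p * w ^ 2 - (5 * p - 3) = 0" using b5 assms(7,8) by simp
  have "b5 * (lam * (60 * w ^ 4 - 60 * (p + 1) * w ^ 3 + 60 * p * w ^ 2 - (5 * p - 3)) + (5 * p - 3))
     = 12 * (lam * poly (pderiv R) w + poly a w)"
    unfolding assms(6) a b z using b3 b4 cb by (simp add: pderiv_pCons algebra_simps) algebra
  then have f: "lam * (60 * w ^ 4 - 60 * (p + 1) * w ^ 3 + 60 * p * w ^ 2 - (5 * p - 3)) + (5 * p - 3) = 0"
    using b5 assms(14) by simp
  from p show ?thesis
  proof
    assume "p + 1 = 0"
    then have p: "p = - 1" by (simp add: eq_neg_iff_add_eq_0)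
    have "(w - 1) * (w - p) * (3 * w ^ 2 - 2) = 0" using e unfolding p by algebra
    then have "3 * w ^ 2 - 2 = 0" using assms(9,10) by simp
    then have "8 * (2 * lam + 3) = 0" using f unfolding p by algebra
    then have "2 * lam + 3 = 0" by (subst (asm) mult_eq_0_iff) simp
    then show ?thesis ..
  next
    assume p: "3 * p ^ 2 - 5 * p + 3 = 0"
    have "(w - 1) * (w - p) * (12 * w ^ 2 - 3 * (p + 1) * w - 3 * p) = 0" using e p by algebra
    then have q: "12 * w ^ 2 - 3 * (p + 1) * w - 3 * p = 0" using assms(9,10) by simp
    have "59 * lam ^ 2 + 177 * lam + 64 = 0" using f p q by algebra
    then show ?thesis ..
  qed
qed

text \<open>The point at infinity is only 5-fold, so \<open>a\<close> may be linear. With 0 also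
  5-fold and 1 a 4-fold point, \<open>a\<close> and \<open>b\<close> are determined up to a common
  factor, and the nodes are -1 and the roots of \<open>3 w^2 - 5 w + 3\<close>.\<close>

lemma cs_type_332:
  assumes "degree a \<le> 1" "degree b \<le> 5" "[:-0, 1:] ^ 4 dvd b - smult 0 a" "[:-1, 1:] ^ 3 dvd b - smult 1 a"
    "R = b - [:0, 1:] * a"
    "poly R w = 0" "w \<noteq> 0" "w \<noteq> 1" "poly a w \<noteq> 0" "lam * poly (pderiv R) w = - poly a w"
  shows "11 * lam + 4 = 0 \<or> 11 * lam + 9 = (0::complex)"
proof -
  have "degree a \<le> 5" using assms(1) by simp
  then obtain a0 a1 a2 a3 a4 a5 where a': "a = [:a0, a1, a2, a3, a4, a5:]" by (rule degree_le_5E)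
  have "coeff a 2 = a2" "coeff a 3 = a3" "coeff a 4 = a4" "coeff a 5 = a5"
    by (simp_all add: a' numeral_eq_Suc)
  moreover have "coeff a n = 0" if "n > 1" for n using assms(1) that by (simp add: coeff_eq_0)
  ultimately have "a2 = 0" "a3 = 0" "a4 = 0" "a5 = 0" by (metis one_less_numeral_iff semiring_norm(76,77))+
  then have a: "a = [:a0, a1:]" using a' by simp
  obtain b0 b1 b2 b3 b4 b5 where b: "b = [:b0, b1, b2, b3, b4, b5:]" using assms(2) by (rule degree_le_5E)
  have z: "b0 = 0" "b1 = 0" "b2 = 0" "b3 = 0"
    using linear_power_dvd_poly_0[OF assms(3)] by (auto simp: a b pderiv_pCons)
  have "b4 + b5 - (a0 + a1) = 0" "4 * b4 + 5 * b5 - a1 = 0" "12 * b4 + 20 * b5 = 0"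
    using linear_power_dvd_poly_0[OF assms(4)] by (auto simp: a b z pderiv_pCons algebra_simps)
  then have y: "3 * b4 = - 5 * b5" "3 * a1 = - 5 * b5" "a0 = b5" by - algebra+
  have c: "b5 \<noteq> 0" using assms(9) a y by auto
  have "b5 * (w * (w - 1) * ((w + 1) * (3 * w ^ 2 - 5 * w + 3))) = 3 * poly R w"
    unfolding assms(5) a b z using y by (simp add: algebra_simps) algebra
  then have e: "w + 1 = 0 \<or> 3 * w ^ 2 - 5 * w + 3 = 0" using assms(6,7,8) c by simp
  have "b5 * (lam * (15 * w ^ 4 - 20 * w ^ 3 + 10 * w - 3) + (3 - 5 * w)) = 3 * (lam * poly (pderiv R) w + poly a w)"
    unfolding assms(5) a b z using y by (simp add: pderiv_pCons algebra_simps) algebra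
  then have f: "lam * (15 * w ^ 4 - 20 * w ^ 3 + 10 * w - 3) + (3 - 5 * w) = 0" using c assms(10) by simp
  from e show ?thesis
  proof
    assume "w + 1 = 0"
    then have "11 * lam + 4 = 0" using f by algebra
    then show ?thesis ..
  next
    assume p: "3 * w ^ 2 - 5 * w + 3 = 0"
    have "11 * lam + 9 = 0" using f p by algebra
    then show ?thesis ..
  qed
qed

lemma coeff_quartic:
  fixes p q r t :: complex
  defines "g \<equiv> [:-p, 1:] * [:-q, 1:] * [:-r, 1:] * [:-t, 1:]"
  shows "coeff g 0 = p * q * r * t" "coeff g 1 = - (p * q * (r + t) + (p + q) * (r * t))"
    "coeff g 2 = p * q + r * t + (p + q) * (r + t)" "coeff g 3 = - (p + q + r + t)" "coeff g 4 = 1"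
  by (simp_all add: g_def numeral_eq_Suc algebra_simps)

text \<open>
  With two such points at \<open>0\<close> and \<open>\<infinity>\<close>, the function \<open>f = y\<^sup>\<lambda> g\<close> satisfies \<open>R / a = - f / f'\<close>, so that the
  tangency conditions say that \<open>f''\<close> vanishes at the zeros of \<open>g\<close> to prescribed orders.
\<close>

lemma cs_two_double_points:
  fixes a b :: "complex poly" and e :: "complex \<Rightarrow> nat" and S :: "complex set"
  defines "g \<equiv> \<Prod>p\<in>S. [:-p, 1:]" and "h \<equiv> \<Prod>p\<in>S. [:-p, 1:] ^ (e p - 1)"
  assumes deg: "degree a \<le> 4" "degree b \<le> 5" and R: "R = b - [:0, 1:] * a" "R \<noteq> 0"
    and R0: "poly R 0 = 0" and lam: "lam * poly (pderiv R) 0 = - poly a 0"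
    and S: "finite S" "card S = 4" "0 \<notin> S" and e: "\<And>p. p \<in> S \<Longrightarrow> 1 \<le> e p" "(\<Sum>p\<in>S. e p) = 8"
    and dvd: "\<And>p. p \<in> S \<Longrightarrow> [:-p, 1:] ^ (e p + 1) dvd b - smult p a"
  obtains c where "\<And>k. (lam + of_nat k) * (lam + of_nat k - 1) * coeff g k = c * coeff h k"
proof -
  define y where "y = [:0, 1::complex:]"
  have y: "pderiv y = 1" "poly y = (\<lambda>x. x)" by (auto simp: y_def pderiv_pCons)
  have Ry: "R = b - y * a" by (simp add: R y_def)
  have Rp: "poly R p = 0" and ap: "poly a p = - poly (pderiv R) p" if "p \<in> S" for p
  proof -
    have *: "poly (b - smult p a) p = 0" "poly (pderiv (b - smult p a)) p = 0"
      using linear_power_dvd_poly_0(1,2)[OF dvd[OF that]] e(1)[OF that] by auto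
    show "poly R p = 0" using *(1) by (simp add: Ry y)
    have "poly (pderiv R) p = poly (pderiv (b - smult p a)) p - poly a p"
      by (simp add: Ry y pderiv_diff pderiv_mult pderiv_smult)
    with * show "poly a p = - poly (pderiv R) p" by simp
  qed
  have g4: "degree g = 4" unfolding g_def using S by (subst degree_prod_sum_eq) auto
  have "(\<Prod>p\<in>insert 0 S. [:-p, 1:] ^ 1) dvd R"
    by (rule prod_linear_powers_dvd) (use S Rp R0 in \<open>auto simp: dvd_iff_poly_eq_0\<close>)
  moreover have "(\<Prod>p\<in>insert 0 S. [:-p, 1:] ^ 1) = y * g" using S by (simp add: g_def y_def)
  ultimately obtain k where k: "R = y * g * k" by (auto elim: dvdE)
  have nz: "y \<noteq> 0" "g \<noteq> 0" "k \<noteq> 0" using R(2) k by auto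
  have "degree R \<le> 5"
    unfolding Ry using deg degree_mult_le[of y a] by (intro degree_diff_le) (auto simp: y_def)
  moreover have "degree R = 5 + degree k"
    unfolding k using nz g4 by (simp add: degree_mult_eq) (simp add: y_def)
  ultimately have "degree k = 0" by simp
  then obtain r where r: "k = [:r:]" by (rule degree_eq_zeroE)
  with nz have r0: "r \<noteq> 0" by simp
  have Rr: "R = smult r (y * g)" by (simp add: k r)
  have dR: "pderiv R = smult r (g + y * pderiv g)" by (simp add: Rr pderiv_smult pderiv_mult y add.commute)
  define L where "L = [:lam:]"
  have L: "pderiv L = 0" "\<And>f. smult lam f = L * f" "poly L = (\<lambda>_. lam)" by (auto simp: L_def)
  have g0: "poly g p = 0" if "p \<in> S" for p using that S by (auto simp: g_def poly_prod)
  have dyg: "degree (y * pderiv g) \<le> 4" using degree_mult_le[of y "pderiv g"] g4 by (simp add: degree_pderiv y_def)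
  \<comment> \<open>Both sides have degree at most 4 and agree at the five points of
    \<open>insert 0 S\<close>. Together with \<open>R = r y g\<close> this is the relation
    \<open>a / R = - f' / f\<close> for \<open>f = y^lam g\<close>.\<close>
  have a: "a = smult (- r) (L * g + y * pderiv g)"
  proof (rule poly_eqI_degree[of "insert 0 S"])
    fix x assume "x \<in> insert 0 S"
    then show "poly a x = poly (smult (- r) (L * g + y * pderiv g)) x"
      using ap g0 lam by (auto simp: dR y L algebra_simps)
  next
    show "degree a < card (insert 0 S)" using deg S by simp
    have "degree (L * g + y * pderiv g) \<le> 4"
      using dyg g4 degree_mult_le[of L g] by (intro degree_add_le) (auto simp: L_def)
    then show "degree (smult (- r) (L * g + y * pderiv g)) < card (insert 0 S)"
      using S degree_smult_le[of "- r" "L * g + y * pderiv g"] by simp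
  qed
  define g1 g2 where "g1 = pderiv g" and "g2 = pderiv g1"
  \<comment> \<open>\<open>T\<close> is \<open>y^(2 - lam)\<close> times the second derivative of
    \<open>y^lam g\<close>.\<close>
  define T where "T = y * y * g2 + 2 * L * y * g1 + L * (L - 1) * g"
  have T: "[:-p, 1:] ^ (e p - 1) dvd T" if p: "p \<in> S" for p
  proof -
    define l where "l = [:-p, 1:]"
    have l: "pderiv l = 1" by (simp add: l_def pderiv_pCons)
    define U where "U = y * g - l * (L * g + y * g1)"
    have "b - smult p a = R + l * a" by (simp add: Ry l_def y_def)
    also have "\<dots> = smult r U" unfolding U_def Rr by (subst a) (simp add: g1_def algebra_simps smult_diff_right)
    finally have "l ^ (e p + 1) dvd U" using dvd[OF p] r0 dvd_smult_cancel unfolding l_def by metis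
    then have 1: "l ^ Suc (e p) dvd U" by simp
    then have 2: "l ^ e p dvd U" by (rule power_le_dvd) simp
    have 3: "l ^ e p dvd pderiv U" using linear_power_dvd_pderiv 1 unfolding l_def by blast
    have dU: "pderiv U = g + y * g1 - (L * g + y * g1) - l * (L * g1 + g1 + y * g2)"
      unfolding U_def by (simp add: pderiv_diff pderiv_mult pderiv_add y l L g1_def[symmetric] g2_def[symmetric])
    \<comment> \<open>This identity carries the vanishing order \<open>e p + 1\<close> of
      \<open>U\<close> over to \<open>T\<close>; two orders are lost, one to the derivative of
      \<open>U\<close> and one to the factor \<open>l\<close>.\<close>
    have "l * T = (1 - L) * U - y * (g + y * g1 - (L * g + y * g1) - l * (L * g1 + g1 + y * g2))"
      unfolding T_def U_def by (simp add: algebra_simps)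
    then have "l * T = (1 - L) * U - y * pderiv U" by (simp only: dU)
    then have "l ^ e p dvd l * T" using 2 3 by (simp add: dvd_diff)
    moreover have "l ^ e p = l * l ^ (e p - 1)" using e(1)[OF p] by (cases "e p") auto
    moreover have "l \<noteq> 0" by (simp add: l_def)
    ultimately show ?thesis unfolding l_def[symmetric] by (metis dvd_times_left_cancel_iff)
  qed
  \<comment> \<open>On a monomial \<open>y^k\<close> the operator is multiplication by the factor
    that arises when \<open>y^(lam + k)\<close> is differentiated twice, so the differential
    equation splits into one scalar equation for each coefficient.\<close>
  have cT: "coeff T k = (lam + of_nat k) * (lam + of_nat k - 1) * coeff g k" for k
  proof -
    have LL: "L * (L - 1) * g = smult (lam * (lam - 1)) g" "2 * L * y * g1 = smult (2 * lam) (y * g1)"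
      by (simp_all add: L_def one_pCons numeral_poly algebra_simps)
    consider "k = 0" | "k = 1" | j where "k = Suc (Suc j)" by (cases k; cases "k - 1") auto
    then show ?thesis unfolding T_def LL
      by cases (simp_all add: y_def g1_def g2_def coeff_pderiv algebra_simps)
  qed
  have "h dvd T" unfolding h_def by (rule prod_linear_powers_dvd[OF S(1) T])
  then obtain t where t: "T = h * t" by (rule dvdE)
  have "degree h = (\<Sum>p\<in>S. e p - 1)" unfolding h_def by (rule degree_prod_linear_powers[OF S(1)])
  also have "\<dots> = 4" using e S(2) sum_subtractf_nat[of S "\<lambda>_. 1" e] by simp
  finally have h4: "degree h = 4" .
  have "degree T \<le> 4"
    by (rule degree_le) (simp add: cT coeff_eq_0 g4)
  have "\<exists>c. T = smult c h"
  proof (cases "T = 0")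
    case True then show ?thesis by (intro exI[of _ 0]) simp
  next
    case False
    then have "degree T = degree h + degree t" unfolding t by (intro degree_mult_eq) auto
    then have "degree t = 0" using h4 \<open>degree T \<le> 4\<close> by simp
    then obtain c where "t = [:c:]" by (rule degree_eq_zeroE)
    then show ?thesis using t by (intro exI[of _ c]) simp
  qed
  then obtain c where "T = smult c h" by blast
  with cT have "(lam + of_nat k) * (lam + of_nat k - 1) * coeff g k = c * coeff h k" for k
    by (metis coeff_smult)
  then show thesis by (rule that)
qed

text \<open>All tangency orders are equal, so \<open>h = g\<close>. The coefficients in degrees 0
  and 4 are nonzero and give \<open>(lam + 4) (lam + 3) = lam (lam - 1)\<close>.\<close>

lemma cs_type_2222:
  assumes "\<And>k. (lam + of_nat k) * (lam + of_nat k - 1) * coeff g k = c * coeff g k"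
    "g = [:-p, 1:] * [:-q, 1:] * [:-r, 1:] * [:-t, 1:]" "p * q * r * t \<noteq> 0"
  shows "2 * lam + 3 = (0::complex)"
proof -
  have "(lam + 4) * (lam + 3) - c = 0"
    using assms(1)[of 4] unfolding assms(2) coeff_quartic by (simp add: add.commute)
  moreover have "lam * (lam - 1) - c = 0"
    using assms(1)[of 0] assms(3) unfolding assms(2) coeff_quartic by simp
  ultimately show ?thesis by algebra
qed

text \<open>Here \<open>p\<close>, \<open>q\<close> are the 5-fold points and \<open>r\<close>,
  \<open>t\<close> the 3-fold ones. After elimination of \<open>c\<close> and of the symmetric
  functions of \<open>r\<close> and \<open>t\<close>, the outcome depends on whether
  \<open>p + q\<close> vanishes: if it does, degree 2 gives the quadratic equation for
  \<open>lam\<close>; otherwise degrees 1 and 3 give the linear one.\<close>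

lemma cs_type_3311:
  assumes E: "\<And>k. (lam + of_nat k) * (lam + of_nat k - 1) * coeff g k = c * coeff h k"
    and g: "g = [:-p, 1:] * [:-q, 1:] * [:-r, 1:] * [:-t, 1:]" and h: "h = [:-p, 1:] * [:-q, 1:] * [:-p, 1:] * [:-q, 1:]"
    and nz: "p * q \<noteq> 0" "r * t \<noteq> 0" "lam \<noteq> 0" "lam \<noteq> 1"
  shows "2 * lam + 3 = 0 \<or> lam ^ 2 + 3 * lam + 1 = (0::complex)"
proof -
  define s u s' u' where d: "s = p + q" "u = p * q" "s' = r + t" "u' = r * t"
  have c: "c = (lam + 4) * (lam + 3)"
    using E[of 4] unfolding g h coeff_quartic by (simp add: add.commute)
  have "u * (lam * (lam - 1) * u') = u * (c * u)"
    using E[of 0] unfolding g h coeff_quartic by (simp add: d mult_ac)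
  then have E0: "lam * (lam - 1) * u' = c * u" using nz d by simp
  have E1: "(lam + 1) * lam * (u * s' + s * u') = 2 * c * s * u"
    using E[of 1] unfolding g h coeff_quartic by (simp add: d) algebra
  have E2: "(lam + 2) * (lam + 1) * (u + u' + s * s') = c * (2 * u + s ^ 2)"
    using E[of 2] unfolding g h coeff_quartic by (simp add: d power2_eq_square) algebra
  have E3: "(lam + 3) * (lam + 2) * (s + s') = 2 * c * s"
    using E[of 3] unfolding g h coeff_quartic by (simp add: d) algebra
  have nz': "u \<noteq> 0" "u' \<noteq> 0" using nz d by auto
  have c0: "c \<noteq> 0" using E0 nz nz' by auto
  then have l3: "lam + 3 \<noteq> 0" "lam + 4 \<noteq> 0" using c by auto
  show ?thesis
  proof (cases "s = 0")
    case True
    have "(lam + 2) * s' = 0" using E3 True l3 by simp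
    moreover have "(lam + 1) * s' = 0" using E1 True nz nz' by simp
    ultimately have s': "s' = 0" by algebra
    have "(lam + 2) * (lam + 1) * (u + u') = 2 * c * u" using E2 True by simp
    then have "u * ((lam + 2) * (lam + 1) * (lam * (lam - 1) + c) - 2 * c * (lam * (lam - 1))) = 0" using E0 by algebra
    then have "(lam + 2) * (lam + 1) * (lam * (lam - 1) + c) - 2 * c * (lam * (lam - 1)) = 0" using nz' by simp
    moreover have "(lam + 2) * (lam + 1) * (lam * (lam - 1) + c) - 2 * c * (lam * (lam - 1)) = 24 * (lam ^ 2 + 3 * lam + 1)"
      unfolding c by algebra
    ultimately have "24 * (lam ^ 2 + 3 * lam + 1) = 0" by (simp only:)
    then have "lam ^ 2 + 3 * lam + 1 = 0" by (subst (asm) mult_eq_0_iff) simp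
    then show ?thesis ..
  next
    case False
    have "(lam + 3) * ((lam + 2) * (s + s') - 2 * (lam + 4) * s) = 0" using E3 c by algebra
    then have "(lam + 2) * (s + s') - 2 * (lam + 4) * s = 0" using l3 by simp
    then have s': "(lam + 2) * s' = (lam + 6) * s" by algebra
    have "s * u * ((lam + 1) * ((lam + 2) * c + lam * (lam - 1) * (lam + 6)) - 2 * c * (lam - 1) * (lam + 2)) = 0"
      using E1 E0 s' by algebra
    then have "(lam + 1) * ((lam + 2) * c + lam * (lam - 1) * (lam + 6)) - 2 * c * (lam - 1) * (lam + 2) = 0"
      using False nz' by simp
    moreover have "(lam + 1) * ((lam + 2) * c + lam * (lam - 1) * (lam + 6)) - 2 * c * (lam - 1) * (lam + 2)
        = 24 * (2 * lam + 3)"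
      unfolding c by algebra
    ultimately have "24 * (2 * lam + 3) = 0" by (simp only:)
    then have "2 * lam + 3 = 0" by (subst (asm) mult_eq_0_iff) simp
    then show ?thesis ..
  qed
qed

text \<open>Here \<open>p\<close> is 5-fold, \<open>q\<close> and \<open>r\<close> are 4-fold and
  \<open>t\<close> is 3-fold. Degrees 0, 3 and 4 determine \<open>t\<close>, \<open>q + r\<close>
  and \<open>c\<close>; the two other equations are linear in \<open>q r\<close>. The result is a
  polynomial in \<open>lam^2 + 3 lam\<close>, in accordance with the indices \<open>lam\<close> and
  \<open>- 3 - lam\<close> of the two nodes, which complete four indices 1 to the sum 1.\<close>

lemma cs_type_3221:
  assumes E: "\<And>k. (lam + of_nat k) * (lam + of_nat k - 1) * coeff g k = c * coeff h k"
    and g: "g = [:-p, 1:] * [:-t, 1:] * [:-q, 1:] * [:-r, 1:]" and h: "h = [:-p, 1:] * [:-p, 1:] * [:-q, 1:] * [:-r, 1:]"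
    and nz: "p \<noteq> 0" "q * r \<noteq> 0" "t \<noteq> 0" "lam \<noteq> 0" "lam \<noteq> 1"
  shows "197 * (lam ^ 2 + 3 * lam) ^ 2 + 604 * (lam ^ 2 + 3 * lam) + 432 = (0::complex)"
proof -
  define s u where d: "s = q + r" "u = q * r"
  define w where "w = lam * (lam - 1)"
  have c: "c = (lam + 4) * (lam + 3)"
    using E[of 4] unfolding g h coeff_quartic by (simp add: add.commute)
  have "p * u * (w * t) = p * u * (c * p)"
    using E[of 0] unfolding g h coeff_quartic by (simp add: d w_def mult_ac)
  then have E0: "w * t = c * p" using nz d by simp
  have E1: "(lam + 1) * lam * (p * t * s + (p + t) * u) = c * (p * p * s + 2 * p * u)"
    using E[of 1] unfolding g h coeff_quartic by (simp add: d) algebra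
  have E2: "(lam + 2) * (lam + 1) * (p * t + u + (p + t) * s) = c * (p * p + u + 2 * p * s)"
    using E[of 2] unfolding g h coeff_quartic by (simp add: d) algebra
  have E3: "(lam + 3) * (lam + 2) * (p + t + s) = c * (2 * p + s)"
    using E[of 3] unfolding g h coeff_quartic by (simp add: d) algebra
  have w0: "w \<noteq> 0" using nz by (simp add: w_def)
  have c0: "c \<noteq> 0" using E0 nz w0 by auto
  then have l3: "lam + 3 \<noteq> 0" using c by auto
  have "(lam + 3) * ((lam + 2) * (p + t + s) - (lam + 4) * (2 * p + s)) = 0" using E3 c by algebra
  then have "(lam + 2) * (p + t + s) - (lam + 4) * (2 * p + s) = 0" using l3 by simp
  then have s: "2 * w * s = ((lam + 2) * c - (lam + 6) * w) * p" using E0 by algebra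
  define S where "S = (lam + 2) * c - (lam + 6) * w"
  define w1 w2 where "w1 = (lam + 1) * lam" and "w2 = (lam + 2) * (lam + 1)"
  have s: "2 * w * s = S * p" using s S_def by simp
  have F2: "w2 * (p * t + u + (p + t) * s) = c * (p * p + u + 2 * p * s)" using E2 by (simp add: w2_def)
  have F1: "w1 * (p * t * s + (p + t) * u) = c * (p * p * s + 2 * p * u)" using E1 by (simp add: w1_def)
  have G2: "2 * w * w * (w2 - c) * u = (2 * w * (c * w - w2 * c) - S * (w2 * (w + c) - 2 * c * w)) * (p * p)"
    using F2 E0 s by algebra
  have "p * (2 * w * (w1 * (w + c) - 2 * c * w) * u + S * (w1 * c - c * w) * (p * p)) = 0"
    using F1 E0 s by algebra
  then have G1: "2 * w * (w1 * (w + c) - 2 * c * w) * u = - (S * (w1 * c - c * w)) * (p * p)"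
    using nz(1) by (simp add: eq_neg_iff_add_eq_0)
  have "p * p * (2 * w * (w1 * (w + c) - 2 * c * w) * (2 * w * (c * w - w2 * c) - S * (w2 * (w + c) - 2 * c * w))
      + 2 * w * w * (w2 - c) * (S * (w1 * c - c * w))) = 0"
    using G1 G2 by algebra
  then have "2 * w * (w1 * (w + c) - 2 * c * w) * (2 * w * (c * w - w2 * c) - S * (w2 * (w + c) - 2 * c * w))
      + 2 * w * w * (w2 - c) * (S * (w1 * c - c * w)) = 0" using nz(1) by simp
  also have "2 * w * (w1 * (w + c) - 2 * c * w) * (2 * w * (c * w - w2 * c) - S * (w2 * (w + c) - 2 * c * w))
      + 2 * w * w * (w2 - c) * (S * (w1 * c - c * w))
    = - 96 * lam ^ 2 * (lam - 1) * (197 * (lam ^ 2 + 3 * lam) ^ 2 + 604 * (lam ^ 2 + 3 * lam) + 432)"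
    unfolding S_def w1_def w2_def w_def c by algebra
  finally show ?thesis using nz by simp
qed

text \<open>The values of the index that will be excluded. They stem from the patterns other than 44
  and 3311, except that \<open>2 x + 3 = 0\<close> is also the unwanted alternative for 3311. The
  last polynomial is \<open>197 (x^2 + 3 x)^2 + 604 (x^2 + 3 x) + 432\<close>, expanded.\<close>

definition cs_bad :: "complex \<Rightarrow> bool" where
  "cs_bad x \<longleftrightarrow> (\<exists>f \<in> {[:3, 2:], [:8, 7:], [:3, 7:], [:4, 11:], [:9, 11:], [:64, 177, 59:], [:64, 463, 982, 491:], [:432, 1812, 2377, 1182, 197:]}. poly f x = 0)"

text \<open>The values -1/4, -4 and the roots of the palindromic polynomial x^2 + 3 x + 1: a set
  closed under inversion.\<close>

definition cs_good :: "complex \<Rightarrow> bool" where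
  "cs_good x \<longleftrightarrow> (\<exists>f \<in> {[:1, 4:], [:4, 1:], [:1, 3, 1:]}. poly f x = 0)"

lemma no_common_root:
  "u * f + v * g = [:k:] \<Longrightarrow> k \<noteq> 0 \<Longrightarrow> poly f x = 0 \<Longrightarrow> poly g x = (0::complex) \<Longrightarrow> False"
  by (drule arg_cong[of _ _ "\<lambda>p. poly p x"]) simp

lemma reversed_root:
  fixes x y :: complex
  assumes "x * y = 1"
  shows "poly [:a, b:] y = 0 \<Longrightarrow> poly [:b, a:] x = 0"
    "poly [:a, b, c:] y = 0 \<Longrightarrow> poly [:c, b, a:] x = 0"
    "poly [:a, b, c, d:] y = 0 \<Longrightarrow> poly [:d, c, b, a:] x = 0"
    "poly [:a, b, c, d, e:] y = 0 \<Longrightarrow> poly [:e, d, c, b, a:] x = 0"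
proof -
  have e: "poly [:b, a:] x = x * poly [:a, b:] y"
    "poly [:c, b, a:] x = x ^ 2 * poly [:a, b, c:] y"
    "poly [:d, c, b, a:] x = x ^ 3 * poly [:a, b, c, d:] y"
    "poly [:e, d, c, b, a:] x = x ^ 4 * poly [:a, b, c, d, e:] y"
    using assms by (simp_all del: mult_eq_0_iff) algebra+
  show "poly [:a, b:] y = 0 \<Longrightarrow> poly [:b, a:] x = 0" by (simp only: e mult_zero_right)
  show "poly [:a, b, c:] y = 0 \<Longrightarrow> poly [:c, b, a:] x = 0" by (simp only: e mult_zero_right)
  show "poly [:a, b, c, d:] y = 0 \<Longrightarrow> poly [:d, c, b, a:] x = 0" by (simp only: e mult_zero_right)
  show "poly [:a, b, c, d, e:] y = 0 \<Longrightarrow> poly [:e, d, c, b, a:] x = 0" by (simp only: e mult_zero_right)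
qed

text \<open>The reciprocal of a root is a root of the reversed polynomial, so the claim is that no
  polynomial of \<open>cs_bad\<close> has a common root with a reversed one. Rational roots are
  simply substituted.\<close>

lemma cs_bad_not_reciprocal:
  assumes x: "cs_bad x" and y: "cs_bad y \<or> cs_good y"
  shows "x * y \<noteq> 1"
proof
  assume xy: "x * y = 1"
  note rev = reversed_root[OF xy]
  have L: "(poly [:2, 3:] x = 0 \<or> poly [:7, 8:] x = 0 \<or> poly [:7, 3:] x = 0 \<or> poly [:11, 4:] x = 0 \<or> poly [:11, 9:] x = 0 \<or> poly [:4, 1:] x = 0 \<or> poly [:1, 4:] x = 0) \<or> (poly [:59, 177, 64:] x = 0 \<or> poly [:491, 982, 463, 64:] x = 0 \<or> poly [:197, 1182, 2377, 1812, 432:] x = 0 \<or> poly [:1, 3, 1:] x = 0)"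
    using y unfolding cs_bad_def cs_good_def
    by (simp only: bex_simps insert_iff bex_empty simp_thms) (use rev in blast)
  have M: "(poly [:3, 2:] x = 0 \<or> poly [:8, 7:] x = 0 \<or> poly [:3, 7:] x = 0 \<or> poly [:4, 11:] x = 0 \<or> poly [:9, 11:] x = 0) \<or> (poly [:64, 177, 59:] x = 0 \<or> poly [:64, 463, 982, 491:] x = 0 \<or> poly [:432, 1812, 2377, 1182, 197:] x = 0)"
    using x unfolding cs_bad_def by (simp only: bex_simps insert_iff bex_empty simp_thms) blast
  have lin: "x = - (a / b)" if "poly [:a, b:] x = 0" "b \<noteq> 0" for a b
    using that by (simp add: field_simps eq_neg_iff_add_eq_0)
  \<comment> \<open>These pairs are coprime. The witnesses are Bezout cofactors, cleared of
    denominators, which combine the two polynomials to a nonzero constant.\<close>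
  have nonlinear:
    "poly [:64, 177, 59:] x = 0 \<Longrightarrow> poly [:59, 177, 64:] x \<noteq> 0"
    "poly [:64, 177, 59:] x = 0 \<Longrightarrow> poly [:491, 982, 463, 64:] x \<noteq> 0"
    "poly [:64, 177, 59:] x = 0 \<Longrightarrow> poly [:197, 1182, 2377, 1812, 432:] x \<noteq> 0"
    "poly [:64, 177, 59:] x = 0 \<Longrightarrow> poly [:1, 3, 1:] x \<noteq> 0"
    "poly [:64, 463, 982, 491:] x = 0 \<Longrightarrow> poly [:59, 177, 64:] x \<noteq> 0"
    "poly [:64, 463, 982, 491:] x = 0 \<Longrightarrow> poly [:491, 982, 463, 64:] x \<noteq> 0"
    "poly [:64, 463, 982, 491:] x = 0 \<Longrightarrow> poly [:197, 1182, 2377, 1812, 432:] x \<noteq> 0"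
    "poly [:64, 463, 982, 491:] x = 0 \<Longrightarrow> poly [:1, 3, 1:] x \<noteq> 0"
    "poly [:432, 1812, 2377, 1182, 197:] x = 0 \<Longrightarrow> poly [:59, 177, 64:] x \<noteq> 0"
    "poly [:432, 1812, 2377, 1182, 197:] x = 0 \<Longrightarrow> poly [:491, 982, 463, 64:] x \<noteq> 0"
    "poly [:432, 1812, 2377, 1182, 197:] x = 0 \<Longrightarrow> poly [:197, 1182, 2377, 1812, 432:] x \<noteq> 0"
    "poly [:432, 1812, 2377, 1182, 197:] x = 0 \<Longrightarrow> poly [:1, 3, 1:] x \<noteq> 0"
    apply safe
    subgoal by (rule no_common_root[of "[:-500416, -241664:]" "[:64, 177, 59:]" "[:513536, 222784:]" "[:59, 177, 64:]" "-1728000" x]) simp_all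
    subgoal by (rule no_common_root[of "[:1043597, 932731, 177472:]" "[:64, 177, 59:]" "[:-167088, -163607:]" "[:491, 982, 463, 64:]" "-15250000" x]) simp_all
    subgoal by (rule no_common_root[of "[:-590583223, -2124134461, -2047616004, -542868912:]" "[:64, 177, 59:]" "[:191092976, 74141819:]" "[:197, 1182, 2377, 1812, 432:]" "-152010000" x]) simp_all
    subgoal by (rule no_common_root[of "[:1:]" "[:64, 177, 59:]" "[:-59:]" "[:1, 3, 1:]" "5" x]) simp_all
    subgoal by (rule no_common_root[of "[:-21418176512, -9019588608:]" "[:64, 463, 982, 491:]" "[:22174564352, 111338500096, 69197156352:]" "[:59, 177, 64:]" "-62464000000" x]) simp_all
    subgoal by (rule no_common_root[of "[:42325792913923607, 26201524149169021, 4055059303623872:]" "[:64, 463, 982, 491:]" "[:-2576739564328128, -38173892897195979, -31109908094989393:]" "[:491, 982, 463, 64:]" "1443671620406000000" x]) simp_all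
    subgoal by (rule no_common_root[of "[:-2595589959796253749, -8517701440793220123, -7911877243873004892, -2062476595213238736:]" "[:64, 463, 982, 491:]" "[:836525985871645888, 3848311311147949919, 2344157426503935693:]" "[:197, 1182, 2377, 1812, 432:]" "-1322138210246000000" x]) simp_all
    subgoal by (rule no_common_root[of "[:-756, -289:]" "[:64, 463, 982, 491:]" "[:46409, 229297, 141899:]" "[:1, 3, 1:]" "-1975" x]) simp_all
    subgoal by (rule no_common_root[of "[:-2384902488064, -1554258067456:]" "[:432, 1812, 2377, 1182, 197:]" "[:16786938396672, 34264316903424, 22814926831616, 4784200613888:]" "[:59, 177, 64:]" "-39848509440000" x]) simp_all
    subgoal by (rule no_common_root[of "[:1264914161799910978413, 833698436318044626079, 135887437010478931008:]" "[:432, 1812, 2377, 1182, 197:]" "[:-1155767460132187268176, -3090058125908403409372, -2049915454810503672443, -418278517047880459509:]" "[:491, 982, 463, 64:]" "-21038905027342406000000" x]) simp_all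
    subgoal by (rule no_common_root[of "[:77147066908536047816277, 292819440051921843746539, 293210239867340106551196, 79462983636036143175888:]" "[:432, 1812, 2377, 1182, 197:]" "[:-168892165309559352516912, -338365197689331982064004, -199136479333758928049661, -36236592074766481957523:]" "[:197, 1182, 2377, 1812, 432:]" "55776338504380210800000" x]) simp_all
    subgoal by (rule no_common_root[of "[:1:]" "[:432, 1812, 2377, 1182, 197:]" "[:-407, -591, -197:]" "[:1, 3, 1:]" "25" x]) simp_all
    done
  show False
    using M
  proof
    assume "poly [:3, 2:] x = 0 \<or> poly [:8, 7:] x = 0 \<or> poly [:3, 7:] x = 0 \<or> poly [:4, 11:] x = 0 \<or> poly [:9, 11:] x = 0"
    then have "x = - (3 / 2) \<or> x = - (8 / 7) \<or> x = - (3 / 7) \<or> x = - (4 / 11) \<or> x = - (9 / 11)" using lin by fastforce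
    then show False using L by (elim disjE) simp_all
  next
    assume N: "poly [:64, 177, 59:] x = 0 \<or> poly [:64, 463, 982, 491:] x = 0 \<or> poly [:432, 1812, 2377, 1182, 197:] x = 0"
    from L show False
    proof
      assume "poly [:2, 3:] x = 0 \<or> poly [:7, 8:] x = 0 \<or> poly [:7, 3:] x = 0 \<or> poly [:11, 4:] x = 0 \<or> poly [:11, 9:] x = 0 \<or> poly [:4, 1:] x = 0 \<or> poly [:1, 4:] x = 0"
      then have "x = - (2 / 3) \<or> x = - (7 / 8) \<or> x = - (7 / 3) \<or> x = - (11 / 4) \<or> x = - (11 / 9) \<or> x = - (4 / 1) \<or> x = - (1 / 4)" using lin by fastforce
      then show False using N by (elim disjE) simp_all
    next
      assume "poly [:59, 177, 64:] x = 0 \<or> poly [:491, 982, 463, 64:] x = 0 \<or> poly [:197, 1182, 2377, 1812, 432:] x = 0 \<or> poly [:1, 3, 1:] x = 0"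
      then show False using nonlinear N by blast
    qed
  qed
qed

section \<open>The Camacho-Sad index\<close>

lemma invariant_line_iff:
  assumes "cr a b \<noteq> 0"
  shows "invariant_line w (line_of (cr a b)) \<longleftrightarrow>
    (\<forall>x y. dot3 (w (x *s a + y *s b)) a = 0 \<and> dot3 (w (x *s a + y *s b)) b = 0)"
proof
  assume *: "invariant_line w (line_of (cr a b))"
  have "a \<in> line_of (cr a b)" "b \<in> line_of (cr a b)" by (simp_all add: line_of_def)
  then show "\<forall>x y. dot3 (w (x *s a + y *s b)) a = 0 \<and> dot3 (w (x *s a + y *s b)) b = 0"
    using * unfolding invariant_line_def by (meson line_of_subspace)
next
  assume *: "\<forall>x y. dot3 (w (x *s a + y *s b)) a = 0 \<and> dot3 (w (x *s a + y *s b)) b = 0"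
  have "dot3 (w p) q = 0" if pq: "p \<in> line_of (cr a b)" "q \<in> line_of (cr a b)" for p q
  proof -
    obtain x y where "p = x *s a + y *s b" using line_of_cr_E[OF assms] pq by (auto simp: line_of_def)
    moreover obtain x' y' where "q = x' *s a + y' *s b" using line_of_cr_E[OF assms] pq by (auto simp: line_of_def)
    ultimately show ?thesis using * by simp
  qed
  then show "invariant_line w (line_of (cr a b))"
    using assms by (auto simp: invariant_line_def proj_line_def)
qed

lemma poly_zero_at_0:
  assumes "\<And>t. t \<noteq> 0 \<Longrightarrow> poly p t = 0" shows "poly p (0::complex) = 0"
proof -
  have "poly ([:0, 1:] * p) t = 0" for t using assms by (cases "t = 0") auto
  then have "[:0, 1:] * p = 0" using poly_all_0_iff_0 by blast
  then show ?thesis by simp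
qed

definition dform :: "(complex^3 \<Rightarrow> complex^3) \<Rightarrow> complex^3 \<Rightarrow> complex^3 \<Rightarrow> complex^3 \<Rightarrow> complex" where
  "dform w p u v = deriv (\<lambda>t. dot3 (w (p + t *s u)) v) 0"

text \<open>Let \<open>y\<close> and \<open>z\<close> be local coordinates along \<open>u\<close>
  and \<open>n\<close>. The form reads \<open>A dy + B dz\<close> with \<open>A = 0\<close> on the
  line \<open>z = 0\<close>, the foliation is given by the field with components \<open>B\<close>
  and \<open>- A\<close>, and the Camacho-Sad index of the line at a simple zero of \<open>B\<close>
  is \<open>- (dA/dz) / (dB/dy)\<close>.\<close>

definition cs :: "(complex^3 \<Rightarrow> complex^3) \<Rightarrow> complex^3 \<Rightarrow> complex^3 \<Rightarrow> complex^3 \<Rightarrow> complex" where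
  "cs w p u n = - dform w p n u / dform w p u n"

text \<open>This keeps \<open>cs\<close> from being a division by zero, also after an exchange of
  the two directions.\<close>

definition dform_nz :: "(complex^3 \<Rightarrow> complex^3) \<Rightarrow> complex^3 \<Rightarrow> complex^3 \<Rightarrow> complex^3 \<Rightarrow> bool" where
  "dform_nz w p u n \<longleftrightarrow> dform w p n u \<noteq> 0 \<and> dform w p u n \<noteq> 0"

locale hom_form =
  fixes w :: "complex^3 \<Rightarrow> complex^3" and e :: nat
  assumes hp: "\<And>i. hp e (\<lambda>v. w v $ i)"
    and radial: "\<And>v. dot3 (w v) v = 0"
begin

lemma hp_w: "hp e (\<lambda>v. dot3 (w v) p)" by (rule hp_dot3[OF hp])

lemma dform_gradient:
  obtains G where "\<And>u v. ((\<lambda>t. dot3 (w (p + t *s u)) v) has_field_derivative dform w p u v) (at 0)"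
    "\<And>u v. dform w p u v = (\<Sum>i\<in>UNIV. dot3 (G i) u * v $ i)"
proof -
  have "\<forall>i. \<exists>G. \<forall>v u. ((\<lambda>t. w (v + t *s u) $ i) has_field_derivative dot3 (G v) u) (at 0)"
    using hp_gradient[OF hp] by blast
  then obtain G where G: "\<And>i v u. ((\<lambda>t. w (v + t *s u) $ i) has_field_derivative dot3 (G i v) u) (at 0)"
    by metis
  have "((\<lambda>t. dot3 (w (p + t *s u)) v) has_field_derivative (\<Sum>i\<in>UNIV. dot3 (G i p) u * v $ i)) (at 0)" for u v
    unfolding dot3_def[of "w _"] by (intro DERIV_sum DERIV_cmult_right G)
  moreover from this have "dform w p u v = (\<Sum>i\<in>UNIV. dot3 (G i p) u * v $ i)" for u v
    unfolding dform_def by (rule DERIV_imp_deriv)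
  ultimately show thesis by (intro that[of "\<lambda>i. G i p"]) simp_all
qed

lemma dform_DERIV: "((\<lambda>t. dot3 (w (p + t *s u)) v) has_field_derivative dform w p u v) (at 0)"
  by (rule dform_gradient[of p])

lemma dform_linear [simp]:
  "dform w p (u + u') v = dform w p u v + dform w p u' v"
  "dform w p u (v + v') = dform w p u v + dform w p u v'"
  "dform w p (c *s u) v = c * dform w p u v"
  "dform w p u (c *s v) = c * dform w p u v"
proof -
  obtain G where G: "\<And>u v. dform w p u v = (\<Sum>i\<in>UNIV. dot3 (G i) u * v $ i)"
  proof (rule dform_gradient[of p])
    fix G assume "\<And>u v. dform w p u v = (\<Sum>i\<in>UNIV. dot3 (G i) u * v $ i)"
    then show thesis by (rule that)
  qed
  show "dform w p (u + u') v = dform w p u v + dform w p u' v"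
    "dform w p u (v + v') = dform w p u v + dform w p u v'"
    "dform w p (c *s u) v = c * dform w p u v"
    "dform w p u (c *s v) = c * dform w p u v"
    by (simp_all add: G sum.distrib[symmetric] sum_distrib_left algebra_simps)
qed

lemma w_scale: "w (c *s v) = c ^ e *s w v"
  by (simp add: vec_eq_iff hp_scale[OF hp])

lemma dform_point_left:
  assumes "w p = 0" shows "dform w p p v = 0"
proof -
  have "w (p + t *s p) = 0" for t
    using w_scale[of "1 + t" p] assms by (simp add: vec.scale_left_distrib)
  then show ?thesis by (simp add: dform_def)
qed

text \<open>The radial relation at \<open>p + t u\<close> says that the value on \<open>p\<close> is
  \<open>- t\<close> times the value on \<open>u\<close>, and the latter vanishes at
  \<open>t = 0\<close> because \<open>p\<close> is singular.\<close>

lemma dform_point_right: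
  assumes "w p = 0" shows "dform w p u p = 0"
proof -
  have eq: "(\<lambda>t. dot3 (w (p + t *s u)) p) = (\<lambda>t. - (t * dot3 (w (p + t *s u)) u))"
  proof
    fix t
    show "dot3 (w (p + t *s u)) p = - (t * dot3 (w (p + t *s u)) u)"
      using radial[of "p + t *s u"] by (simp add: eq_neg_iff_add_eq_0)
  qed
  have "((\<lambda>t. - (t * dot3 (w (p + t *s u)) u)) has_field_derivative 0) (at 0)"
    by (rule derivative_eq_intros dform_DERIV refl)+ (simp add: assms)
  then show ?thesis unfolding dform_def eq by (rule DERIV_imp_deriv)
qed

lemma dform_tangent:
  assumes "cr p u \<noteq> 0" "invariant_line w (line_of (cr p u))" shows "dform w p u u = 0"
proof -
  have "dot3 (w (1 *s p + t *s u)) u = 0" for t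
    using assms(2) unfolding invariant_line_iff[OF assms(1)] by blast
  then show ?thesis by (simp add: dform_def)
qed

lemma dform_scale_point:
  assumes "c \<noteq> 0" shows "c * dform w (c *s p) u v = c ^ e * dform w p u v"
proof -
  have eq: "(\<lambda>t. dot3 (w (c *s p + (c * t) *s u)) v) = (\<lambda>t. c ^ e * dot3 (w (p + t *s u)) v)"
  proof
    fix t
    have "c *s p + (c * t) *s u = c *s (p + t *s u)" by (simp add: vec.scale_right_distrib)
    then show "dot3 (w (c *s p + (c * t) *s u)) v = c ^ e * dot3 (w (p + t *s u)) v"
      by (simp only: w_scale dot3_scale)
  qed
  have "((\<lambda>t. dot3 (w (c *s p + t *s u)) v) has_field_derivative dform w (c *s p) u v) (at (c * 0))"
    using dform_DERIV[of "c *s p"] by simp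
  moreover have "((\<lambda>t. c * t) has_field_derivative c) (at 0)" by (auto intro!: derivative_eq_intros)
  ultimately
  have "((\<lambda>t. dot3 (w (c *s p + (c * t) *s u)) v) has_field_derivative c * dform w (c *s p) u v) (at 0)"
    using DERIV_chain'[where f = "\<lambda>t. c * t" and x = 0 and s = UNIV and D = c and
        g = "\<lambda>t. dot3 (w (c *s p + t *s u)) v" and E = "dform w (c *s p) u v"]
    by (simp add: mult.commute)
  moreover have "((\<lambda>t. c ^ e * dot3 (w (p + t *s u)) v) has_field_derivative c ^ e * dform w p u v) (at 0)"
    by (intro DERIV_cmult dform_DERIV)
  ultimately show ?thesis unfolding eq by (rule DERIV_unique)
qed

text \<open>In the bilinear expansion every term with an argument \<open>p\<close> vanishes, and so
  does the term with \<open>u\<close> in both places. What remains multiplies numerator and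
  denominator by the same factor \<open>y z'\<close>, and the rescaling of \<open>p\<close>
  multiplies both by \<open>c^e / c\<close>.\<close>

lemma cs_independent:
  assumes p: "w p = 0" and u: "cr p u \<noteq> 0" "invariant_line w (line_of (cr p u))" "dot3 (cr p u) n \<noteq> 0"
    and c: "c \<noteq> 0" and u': "cr p u' \<noteq> 0" "line_of (cr p u') = line_of (cr p u)" "dot3 (cr p u') n' \<noteq> 0"
  shows "cs w (c *s p) u' n' = cs w p u n" "dform_nz w (c *s p) u' n' \<longleftrightarrow> dform_nz w p u n"
proof -
  have "u' \<in> line_of (cr p u)" using u'(2) by (metis dot3_cr(2) line_of_def mem_Collect_eq)
  then obtain x y where xy: "u' = x *s p + y *s u"
    using line_of_cr_E[OF u(1)] by (auto simp: line_of_def)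
  have y: "y \<noteq> 0" using u'(1) xy by auto
  obtain x' y' z' where n': "n' = x' *s p + y' *s u + z' *s n" using basis_E[OF u(3)] .
  have z: "z' \<noteq> 0" using u'(3) xy n' by auto
  note d = dform_point_left[OF p] dform_point_right[OF p] dform_tangent[OF u(1,2)]
  have 1: "dform w p u' n' = y * z' * dform w p u n" "dform w p n' u' = y * z' * dform w p n u"
    by (simp_all add: xy n' d algebra_simps)
  have s: "dform w (c *s p) a b = c ^ e / c * dform w p a b" for a b
    using dform_scale_point[OF c, of p a b] c by (simp add: field_simps)
  show "cs w (c *s p) u' n' = cs w p u n" "dform_nz w (c *s p) u' n' \<longleftrightarrow> dform_nz w p u n"
    using y z c by (simp_all add: cs_def dform_nz_def s 1)
qed

end

section \<open>The geometry of invariant lines\<close>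

text \<open>A foliation of degree 5 has coefficients of degree 6, and 15 is the maximal number of
  invariant lines; \<open>reduced_convex_formI\<close> derives these assumptions from
  \<open>reduced_convex 5 w\<close>.\<close>

locale reduced_convex_form = hom_form w 6 for w +
  assumes iso: "isolated_singularities w"
    and card_inv: "card {L. invariant_line w L} = 15"
begin

definition Inv where "Inv = {L. invariant_line w L}"

definition nrm where "nrm L = (SOME l. l \<noteq> 0 \<and> L = line_of l)"

text \<open>The multiplicity \<open>r\<close> of the overview, for a point given as a set of
  vectors.\<close>

definition mu where "mu P = card {L \<in> Inv. P \<subseteq> L}"

definition pts where "pts L = {vec.span {p} |p. p \<noteq> 0 \<and> p \<in> L \<and> mu (vec.span {p}) \<ge> 2}"

lemma finite_Inv: "finite Inv" and card_Inv: "card Inv = 15"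
  using card_inv by (auto simp: Inv_def intro: card_ge_0_finite)

lemma nrm: assumes "L \<in> Inv" shows "nrm L \<noteq> 0" "line_of (nrm L) = L"
proof -
  have "\<exists>l. l \<noteq> 0 \<and> L = line_of l" using assms by (auto simp: Inv_def invariant_line_def proj_line_def)
  from someI_ex[OF this] show "nrm L \<noteq> 0" "line_of (nrm L) = L" by (simp_all add: nrm_def)
qed

lemma mem_iff: "L \<in> Inv \<Longrightarrow> v \<in> L \<longleftrightarrow> dot3 (nrm L) v = 0"
  using nrm[of L] by (auto simp: line_of_def)

lemma span_subset_iff: "L \<in> Inv \<Longrightarrow> vec.span {p} \<subseteq> L \<longleftrightarrow> p \<in> L"
  using nrm[of L] span_single_subset_line by metis

lemma cr_nrm: "L \<in> Inv \<Longrightarrow> M \<in> Inv \<Longrightarrow> L \<noteq> M \<Longrightarrow> cr (nrm L) (nrm M) \<noteq> 0"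
  using nrm line_of_eq_iff by metis

lemma mu_span: "mu (vec.span {p}) = card {L \<in> Inv. p \<in> L}"
  unfolding mu_def by (simp add: span_subset_iff cong: conj_cong)

lemma InvD: "L \<in> Inv \<Longrightarrow> p \<in> L \<Longrightarrow> q \<in> L \<Longrightarrow> dot3 (w p) q = 0"
  by (auto simp: Inv_def invariant_line_def)

text \<open>Otherwise the radial relation would make every line joining \<open>p\<close> to a point
  \<open>q + t n\<close> invariant, and these are infinitely many.\<close>

lemma not_all_tangent:
  assumes "p \<noteq> 0" shows "\<exists>v. dot3 (w v) p \<noteq> 0"
proof (rule ccontr)
  assume "\<not> ?thesis"
  then have z: "dot3 (w v) p = 0" for v by blast
  obtain l where l: "dot3 p l = 1" using exists_dot3_1 assms by blast
  have "p \<in> line_of (cr p (cr p l))" by (simp add: line_of_def)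
  obtain q where q: "cr p q \<noteq> 0"
  proof (rule ccontr)
    assume "\<not> thesis"
    then have "cr p q = 0" for q using that by blast
    from this[of "vector [1,0,0]"] this[of "vector [0,1,0]"] assms show False by (auto simp: vec3_eq_iff)
  qed
  obtain n where n: "dot3 (cr p q) n = 1" using exists_dot3_1 q by blast
  \<comment> \<open>The points \<open>q + t n\<close> run along a line that misses \<open>p\<close>,
    so their joins with \<open>p\<close> are pairwise distinct; \<open>cc\<close> makes this
    explicit.\<close>
  define u where "u t = q + t *s n" for t
  have cc: "cr (cr p (u s)) (cr p (u t)) = (t - s) *s p" for s t
  proof -
    have "cr (cr p (u s)) (cr p (u t)) = ((t - s) * dot3 (cr p q) n) *s p"
      unfolding u_def by (simp add: vec3_eq_iff dot3_3) algebra
    then show ?thesis using n by simp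
  qed
  have cu: "cr p (u t) \<noteq> 0" for t
    using cc[of t "t + 1"] assms by auto
  have "line_of (cr p (u t)) \<in> Inv" for t
  proof -
    have "dot3 (w (x *s p + y *s u t)) (u t) = 0" for x y
    proof -
      obtain f where f: "\<And>s. dot3 (w (x *s p + s *s u t)) (u t) = poly f s"
        using hp_restrict[OF hp_w[of "u t"], of "x *s p" "u t"] by blast
      have nz: "poly f s = 0" if "s \<noteq> 0" for s
        using radial[of "x *s p + s *s u t"] z that by (simp add: f)
      then have "poly f y = 0" using poly_zero_at_0[OF nz] by (cases "y = 0") simp_all
      then show ?thesis using f[of y] by simp
    qed
    then show ?thesis using z by (simp add: Inv_def invariant_line_iff[OF cu])
  qed
  then have "range (\<lambda>t. line_of (cr p (u t))) \<subseteq> Inv" by blast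
  then have "finite (range (\<lambda>t. line_of (cr p (u t))))" using finite_Inv finite_subset by blast
  moreover have "inj (\<lambda>t. line_of (cr p (u t)))"
  proof (rule injI)
    fix s t assume "line_of (cr p (u s)) = line_of (cr p (u t))"
    then have "(t - s) *s p = 0" using line_of_eq_iff[OF cu cu] cc by simp
    then show "s = t" using assms by (simp add: vec.scale_eq_0_iff)
  qed
  ultimately have "finite (UNIV :: complex set)" using finite_imageD by blast
  then show False using infinite_UNIV_char_0 by blast
qed

text \<open>The polynomial \<open>dot3 (w v) p\<close> of degree 6 vanishes on every invariant line
  through \<open>p\<close>. As it is not identically zero, there are at most six such lines.\<close>

lemma tangency_factor:
  assumes p: "p \<noteq> 0"
  obtains g where "hp (6 - mu (vec.span {p})) g"
    "\<And>v. dot3 (w v) p = (\<Prod>L \<in> {L \<in> Inv. p \<in> L}. dot3 (nrm L) v) * g v"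
    "mu (vec.span {p}) \<le> 6"
proof -
  let ?C = "{L \<in> Inv. p \<in> L}"
  have inj: "inj_on nrm ?C" by (rule inj_onI) (metis (no_types, lifting) mem_Collect_eq nrm(2))
  have fin: "finite (nrm ` ?C)" using finite_Inv by simp
  have card: "card (nrm ` ?C) = mu (vec.span {p})" using card_image[OF inj] mu_span by simp
  have "\<exists>g. hp (6 - card (nrm ` ?C)) g \<and> (\<forall>v. dot3 (w v) p = (\<Prod>l\<in>nrm ` ?C. dot3 l v) * g v) \<and>
      (6 < card (nrm ` ?C) \<longrightarrow> g = (\<lambda>_. 0))"
  proof (rule hp_factor_lines[OF fin hp_w])
    show "\<And>l. l \<in> nrm ` ?C \<Longrightarrow> l \<noteq> 0" using nrm by auto
    show "\<And>l m. l \<in> nrm ` ?C \<Longrightarrow> m \<in> nrm ` ?C \<Longrightarrow> l \<noteq> m \<Longrightarrow> cr l m \<noteq> 0"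
      using cr_nrm by auto
    show "\<And>l v. l \<in> nrm ` ?C \<Longrightarrow> v \<in> line_of l \<Longrightarrow> dot3 (w v) p = 0"
      using nrm InvD by auto
  qed
  then obtain g where g: "hp (6 - mu (vec.span {p})) g"
    "\<And>v. dot3 (w v) p = (\<Prod>l\<in>nrm ` ?C. dot3 l v) * g v" "6 < mu (vec.span {p}) \<longrightarrow> g = (\<lambda>_. 0)"
    unfolding card by blast
  have "mu (vec.span {p}) \<le> 6"
  proof (rule ccontr)
    assume "\<not> mu (vec.span {p}) \<le> 6"
    then have "g v = 0" for v using g(3) by auto
    then show False using not_all_tangent[OF p] g(2) by simp
  qed
  moreover have "dot3 (w v) p = (\<Prod>L \<in> ?C. dot3 (nrm L) v) * g v" for v
    using g(2) by (simp add: prod.reindex[OF inj])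
  ultimately show thesis using that g(1) by blast
qed

lemma mu_le_6: "p \<noteq> 0 \<Longrightarrow> mu (vec.span {p}) \<le> 6"
  using tangency_factor by blast

text \<open>Pairing the form with \<open>b\<close> and with \<open>a\<close> gives multiples
  \<open>l A\<close> and \<open>- l B\<close> of the equation \<open>l\<close> of the line, and
  \<open>f\<close>, \<open>g\<close> are the restrictions of \<open>A\<close>, \<open>B\<close> to
  it: the form to first order along the line. Its value on the transversal vector \<open>n\<close>
  is then \<open>g - y f\<close>. The orders come from the factors that
  \<open>tangency_factor\<close> provides at the points of the line.\<close>

lemma chart:
  assumes L: "L \<in> Inv" and ab: "cr a b \<noteq> 0" "L = line_of (cr a b)" and n: "dot3 (cr a b) n = 1"
  obtains f g where "degree f \<le> 5" "degree g \<le> 5"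
    "\<And>y. poly (g - [:0, 1:] * f) y = dot3 (w (a + y *s b)) n"
    "\<And>p. [:-p, 1:] ^ (mu (vec.span {a + p *s b}) - 1) dvd g - smult p f"
    "degree f + mu (vec.span {b}) \<le> 6"
    "\<And>y. dform w (a + y *s b) n b = poly f y"
    "\<And>y. dform w (a + y *s b) b n = poly (pderiv (g - [:0, 1:] * f)) y"
proof -
  define l where "l = cr a b"
  have l0: "l \<noteq> 0" using ab l_def by simp
  have lv: "dot3 l a = 0" "dot3 l b = 0" "dot3 l n = 1" using n by (simp_all add: l_def)
  have inL: "v \<in> L" if "dot3 l v = 0" for v using that ab by (simp add: line_of_def l_def)
  have aL: "a \<in> L" "b \<in> L" using inL lv by auto
  obtain A where A: "hp 5 A" "\<And>v. dot3 (w v) b = dot3 l v * A v"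
    using hp_factor[OF hp_w[of b] l0] InvD[OF L] aL(2) inL by (auto simp: line_of_def)
  obtain B' where B': "hp 5 B'" "\<And>v. dot3 (w v) a = dot3 l v * B' v"
    using hp_factor[OF hp_w[of a] l0] InvD[OF L] aL(1) inL by (auto simp: line_of_def)
  define B where "B v = - B' v" for v
  have B: "hp 5 B" "\<And>v. dot3 (w v) a = - dot3 l v * B v"
    using B' hp_minus[OF B'(1)] by (simp_all add: B_def[abs_def])
  obtain f where f: "degree f \<le> 5" "\<And>y. A (a + y *s b) = poly f y" using hp_restrict[OF A(1)] by blast
  obtain g where g: "degree g \<le> 5" "\<And>y. B (a + y *s b) = poly g y" using hp_restrict[OF B(1)] by blast
  have ab0: "a + p *s b \<noteq> 0" "b \<noteq> 0" for p
  proof -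
    have "cr (a + p *s b) b \<noteq> 0" using ab(1) by simp
    then show "a + p *s b \<noteq> 0" "b \<noteq> 0" using cr_zero by metis+
  qed
  \<comment> \<open>At a point at height \<open>z\<close> above the line, the radial relation is
    divisible by \<open>z\<close>; the quotient, a polynomial in \<open>z\<close>, is then evaluated
    at \<open>z = 0\<close>.\<close>
  have wn: "dot3 (w (a + y *s b)) n = poly (g - [:0, 1:] * f) y" for y
  proof -
    define v where "v z = (a + y *s b) + z *s n" for z
    obtain k where k: "\<And>z. dot3 (w (v z)) n = poly k z"
      unfolding v_def using hp_restrict[OF hp_w[of n], of "a + y *s b" n] by blast
    obtain A' where A': "\<And>z. A (v z) = poly A' z"
      unfolding v_def using hp_restrict[OF A(1), of "a + y *s b" n] by blast
    obtain B' where B': "\<And>z. B (v z) = poly B' z"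
      unfolding v_def using hp_restrict[OF B(1), of "a + y *s b" n] by blast
    have "poly (k - B' + smult y A') z = 0" if z: "z \<noteq> 0" for z
    proof -
      have lz: "dot3 l (v z) = z" by (simp add: v_def lv)
      have "dot3 (w (v z)) (v z) = dot3 (w (v z)) a + y * dot3 (w (v z)) b + z * dot3 (w (v z)) n"
        unfolding v_def[of z, THEN arg_cong, of "dot3 (w (v z))"] by simp
      then have "z * poly (k - B' + smult y A') z = 0"
        using radial[of "v z"] unfolding A B lz by (simp add: k A' B' algebra_simps)
      then show ?thesis using z by simp
    qed
    from poly_zero_at_0[OF this] have "poly (k - B' + smult y A') 0 = 0" by blast
    then have "dot3 (w (v 0)) n = B (v 0) - y * A (v 0)" unfolding k A' B' by (simp add: algebra_simps)
    then show ?thesis by (simp add: v_def f g)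
  qed
  \<comment> \<open>For a point \<open>P = x a + z b\<close> of the line, one factor of
    \<open>dot3 (w v) P\<close> is the equation of \<open>L\<close> itself. After division by it,
    the equations of the other invariant lines through \<open>P\<close> remain as factors along
    \<open>L\<close>.\<close>
  have main: "\<exists>q. degree q \<le> 6 - mu (vec.span {P}) \<and> mu (vec.span {P}) \<le> 6 \<and>
      (\<forall>y. x * - B (a + y *s b) + z * A (a + y *s b) =
       (\<Prod>M\<in>{M \<in> Inv. P \<in> M} - {L}. dot3 (nrm M) (a + y *s b)) * poly q y)"
    if P: "P = x *s a + z *s b" "P \<noteq> 0" for P x z
  proof -
    obtain h where h: "hp (6 - mu (vec.span {P})) h"
      "\<And>v. dot3 (w v) P = (\<Prod>M \<in> {M \<in> Inv. P \<in> M}. dot3 (nrm M) v) * h v" "mu (vec.span {P}) \<le> 6"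
      using tangency_factor[OF P(2)] by blast
    let ?C = "{M \<in> Inv. P \<in> M}"
    have LC: "L \<in> ?C" using L inL[of P] P lv by simp
    have finC: "finite ?C" using finite_Inv by simp
    have "cr (nrm L) l = 0" using line_of_eq_iff[OF nrm(1)[OF L] l0] nrm(2)[OF L] ab by (simp add: l_def)
    then obtain c where c: "l = c *s nrm L" using cr_eq_0D nrm(1)[OF L] by metis
    have c0: "c \<noteq> 0" using c l0 by auto
    have nl: "dot3 (nrm L) v = dot3 l v / c" for v using c c0 by simp
    define k where "k v = (\<Prod>M\<in>?C - {L}. dot3 (nrm M) v) * (h v / c)" for v
    have kp: "hp 5 k"
    proof -
      have inj: "inj_on nrm (?C - {L})" by (rule inj_onI) (metis (no_types, lifting) DiffD1 mem_Collect_eq nrm(2))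
      have "hp (card (nrm ` (?C - {L}))) (\<lambda>v. \<Prod>l\<in>nrm ` (?C - {L}). dot3 l v)"
        by (rule hp_prod) (use finC in simp)
      moreover have "card (nrm ` (?C - {L})) = mu (vec.span {P}) - 1"
        using card_image[OF inj] mu_span LC finC by simp
      ultimately have "hp (mu (vec.span {P}) - 1) (\<lambda>v. \<Prod>M\<in>?C - {L}. dot3 (nrm M) v)"
        by (simp add: prod.reindex[OF inj])
      from hp_mult[OF this hp_cmult[OF h(1), of "1 / c"]]
      have "hp (mu (vec.span {P}) - 1 + (6 - mu (vec.span {P}))) k" by (simp add: k_def[abs_def])
      moreover have "0 < card ?C" unfolding card_gt_0_iff using LC finC by blast
      then have "mu (vec.span {P}) \<ge> 1" unfolding mu_span by simp
      ultimately show ?thesis using h(3) by simp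
    qed
    have e: "x * - B v + z * A v = k v" for v
    proof -
      have d: "hp 5 (\<lambda>v. (x * - B v + z * A v) - k v)"
        by (intro hp_diff hp_add hp_cmult hp_minus A B kp)
      have "dot3 l v * ((x * - B v + z * A v) - k v) = 0" for v
      proof -
        have "dot3 l v * k v = (\<Prod>M\<in>?C. dot3 (nrm M) v) * h v"
          unfolding prod.remove[OF finC LC] nl k_def by simp
        also have "\<dots> = dot3 (w v) P" using h(2) by simp
        also have "\<dots> = dot3 l v * (x * - B v + z * A v)" using A(2) B(2) P(1) by (simp add: algebra_simps)
        finally show ?thesis by (simp add: algebra_simps)
      qed
      from hp_cancel[OF hp_linear d _ this, of n] lv show ?thesis by simp
    qed
    obtain q where q: "degree q \<le> 6 - mu (vec.span {P})" "\<And>y. h (a + y *s b) = poly q y"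
      using hp_restrict[OF h(1)] by blast
    show ?thesis
    proof (intro exI[of _ "smult (1 / c) q"] conjI allI)
      show "degree (smult (1 / c) q) \<le> 6 - mu (vec.span {P})" using q degree_smult_le order_trans by blast
    qed (use h(3) e q in \<open>simp_all add: k_def\<close>)
  qed
  show thesis
  proof (rule that[OF f(1) g(1)])
    show "poly (g - [:0, 1:] * f) y = dot3 (w (a + y *s b)) n" for y using wn by simp
    show "[:-p, 1:] ^ (mu (vec.span {a + p *s b}) - 1) dvd g - smult p f" for p
    proof -
      let ?P = "a + p *s b"
      let ?C = "{M \<in> Inv. ?P \<in> M}"
      have "?P = 1 *s a + p *s b" by simp
      from main[OF this ab0(1)] obtain q where
        q: "\<And>y. 1 * - B (a + y *s b) + p * A (a + y *s b) = (\<Prod>M\<in>?C - {L}. dot3 (nrm M) (a + y *s b)) * poly q y"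
        by blast
      have "dot3 (nrm M) (a + y *s b) = (y - p) * dot3 (nrm M) b" if "M \<in> ?C - {L}" for M y
      proof -
        have "dot3 (nrm M) ?P = 0" using that mem_iff by blast
        then have "dot3 (nrm M) a = - p * dot3 (nrm M) b" by (simp add: eq_neg_iff_add_eq_0)
        then show ?thesis by (simp add: algebra_simps)
      qed
      then have "(\<Prod>M\<in>?C - {L}. dot3 (nrm M) (a + y *s b)) = (y - p) ^ card (?C - {L}) * (\<Prod>M\<in>?C - {L}. dot3 (nrm M) b)" for y
        by (simp add: prod.distrib)
      then have "poly (g - smult p f) y = poly ([:-p, 1:] ^ card (?C - {L}) * smult (- (\<Prod>M\<in>?C - {L}. dot3 (nrm M) b)) q) y" for y
        using q[of y] by (simp add: f g algebra_simps)
      then have eq: "g - smult p f = [:-p, 1:] ^ card (?C - {L}) * smult (- (\<Prod>M\<in>?C - {L}. dot3 (nrm M) b)) q"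
        using poly_eq_poly_eq_iff by blast
      have "L \<in> ?C" using L inL[of ?P] lv by simp
      then have c: "card (?C - {L}) = mu (vec.span {?P}) - 1" using mu_span finite_Inv by simp
      show ?thesis unfolding eq c[symmetric] by (rule dvd_triv_left)
    qed
    show "degree f + mu (vec.span {b}) \<le> 6"
    proof -
      let ?C = "{M \<in> Inv. b \<in> M}"
      have "b = 0 *s a + 1 *s b" by simp
      from main[OF this ab0(2)] obtain q where q: "degree q \<le> 6 - mu (vec.span {b})" "mu (vec.span {b}) \<le> 6"
        "\<And>y. 0 * - B (a + y *s b) + 1 * A (a + y *s b) = (\<Prod>M\<in>?C - {L}. dot3 (nrm M) (a + y *s b)) * poly q y"
        by blast
      \<comment> \<open>Lines through \<open>b\<close>, the point at infinity of the chart, have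
        equations that are constant along \<open>a + y b\<close>: they lower the degree of
        \<open>f\<close> instead of producing zeros.\<close>
      have "dot3 (nrm M) (a + y *s b) = dot3 (nrm M) a" if "M \<in> ?C - {L}" for M y
        using that mem_iff[of M b] by simp
      then have "(\<Prod>M\<in>?C - {L}. dot3 (nrm M) (a + y *s b)) = (\<Prod>M\<in>?C - {L}. dot3 (nrm M) a)" for y
        by (rule prod.cong[OF refl])
      then have "poly f y = poly (smult (\<Prod>M\<in>?C - {L}. dot3 (nrm M) a) q) y" for y
        using q(3)[of y] by (simp only: f) simp
      then have fs: "f = smult (\<Prod>M\<in>?C - {L}. dot3 (nrm M) a) q" using poly_eq_poly_eq_iff by blast
      have "degree f \<le> degree q" unfolding fs by (rule degree_smult_le)
      then show ?thesis using q by linarith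
    qed
    show "dform w (a + y *s b) n b = poly f y" for y
    proof -
      obtain k where k: "\<And>t. A ((a + y *s b) + t *s n) = poly k t"
        using hp_restrict[OF A(1), of "a + y *s b" n] by blast
      have "(\<lambda>t. dot3 (w ((a + y *s b) + t *s n)) b) = (\<lambda>t. t * poly k t)"
        by (simp add: A k lv)
      moreover have "((\<lambda>t. t * poly k t) has_field_derivative poly k 0) (at 0)"
        by (auto intro!: derivative_eq_intros poly_DERIV)
      ultimately have "dform w (a + y *s b) n b = poly k 0"
        unfolding dform_def by (simp add: DERIV_imp_deriv)
      then show ?thesis using k[of 0] f by simp
    qed
    show "dform w (a + y *s b) b n = poly (pderiv (g - [:0, 1:] * f)) y" for y
    proof -
      let ?R = "g - [:0, 1:] * f"
      have "(\<lambda>t. dot3 (w ((a + y *s b) + t *s b)) n) = (\<lambda>t. poly ?R (y + t))"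
      proof
        fix t
        have "(a + y *s b) + t *s b = a + (y + t) *s b" by (simp add: vec.scale_left_distrib)
        then show "dot3 (w ((a + y *s b) + t *s b)) n = poly ?R (y + t)" by (simp only: wn)
      qed
      moreover have "((\<lambda>t. poly ?R (y + t)) has_field_derivative poly (pderiv ?R) y) (at 0)"
        using DERIV_shift[of "poly ?R" "poly (pderiv ?R) y" 0 y] poly_DERIV[of ?R y] by (simp add: add.commute)
      ultimately show ?thesis unfolding dform_def by (simp add: DERIV_imp_deriv)
    qed
  qed
qed


text \<open>The Camacho-Sad index as a function of the line and the point as sets; at singular
  points \<open>lam_eq\<close> shows that the chosen vectors do not matter.\<close>

definition lam where
  "lam L P = (SOME x. \<exists>p u n. P = vec.span {p} \<and> cr p u \<noteq> 0 \<and> L = line_of (cr p u) \<and>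
     dot3 (cr p u) n \<noteq> 0 \<and> x = cs w p u n)"

lemma singular:
  assumes "L \<in> Inv" "M \<in> Inv" "L \<noteq> M" "p \<in> L" "p \<in> M" shows "w p = 0"
proof -
  have c: "cr (nrm L) (nrm M) \<noteq> 0" by (rule cr_nrm[OF assms(1-3)])
  have z: "dot3 (w p) q = 0" if "dot3 (nrm L) q = 0 \<or> dot3 (nrm M) q = 0" for q
    using that assms InvD mem_iff by blast
  show ?thesis
  proof (rule ccontr)
    assume w: "w p \<noteq> 0"
    have "cr (nrm K) (w p) = 0" if "K \<in> {L, M}" for K
    proof (rule ccontr)
      assume "cr (nrm K) (w p) \<noteq> 0"
      then obtain v where "v \<in> line_of (nrm K)" "dot3 (w p) v \<noteq> 0" using exists_not_on_line by blast
      then show False using z that by (auto simp: line_of_def)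
    qed
    then have "cr (w p) (nrm L) = 0" "cr (w p) (nrm M) = 0" using cr_anti[of "w p"] by auto
    then obtain c d where "nrm L = c *s w p" "nrm M = d *s w p" using cr_eq_0D w by metis
    then show False using c by simp
  qed
qed

lemma mu_2_singular:
  assumes "mu (vec.span {p}) \<ge> 2" shows "w p = 0"
proof -
  have "card {L \<in> Inv. p \<in> L} \<ge> 2" using assms mu_span by simp
  then obtain L M where "L \<in> {L \<in> Inv. p \<in> L}" "M \<in> {L \<in> Inv. p \<in> L}" "L \<noteq> M"
    using card_le_Suc0_iff_eq[of "{L \<in> Inv. p \<in> L}"] finite_Inv by fastforce
  then show ?thesis using singular by blast
qed

lemma lam_eq:
  assumes "L \<in> Inv" "w p = 0" "cr p u \<noteq> 0" "L = line_of (cr p u)" "dot3 (cr p u) n \<noteq> 0"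
  shows "lam L (vec.span {p}) = cs w p u n"
proof -
  let ?Q = "\<lambda>x. \<exists>p' u' n'. vec.span {p} = vec.span {p'} \<and> cr p' u' \<noteq> 0 \<and> L = line_of (cr p' u') \<and>
     dot3 (cr p' u') n' \<noteq> 0 \<and> x = cs w p' u' n'"
  have "?Q (cs w p u n)" using assms by blast
  then have "?Q (lam L (vec.span {p}))" unfolding lam_def by (rule someI)
  then obtain p' u' n' where q: "vec.span {p} = vec.span {p'}" "cr p' u' \<noteq> 0" "L = line_of (cr p' u')"
     "dot3 (cr p' u') n' \<noteq> 0" "lam L (vec.span {p}) = cs w p' u' n'" by blast
  have p0: "p \<noteq> 0" "p' \<noteq> 0" using assms(3) q(2) by auto
  then have "cr p p' = 0" using q(1) span_single_eq_iff by blast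
  then obtain c where c: "p' = c *s p" using cr_eq_0D p0 by blast
  with p0 have "c \<noteq> 0" by auto
  moreover have "invariant_line w (line_of (cr p u))" using assms by (simp add: Inv_def)
  ultimately show ?thesis
    using cs_independent(1)[of p u n c u' n'] assms q c by simp
qed

text \<open>This is where isolatedness enters: on a line of singular points, \<open>a + r b\<close>
  with small \<open>r\<close> would be a singular vector near \<open>a\<close> that is not
  proportional to it.\<close>

lemma nonzero_on_line:
  assumes "cr a b \<noteq> 0" "L = line_of (cr a b)" "L \<in> Inv"
  shows "\<exists>y. w (a + y *s b) \<noteq> 0"
proof (rule ccontr)
  assume "\<not> ?thesis"
  then have z: "w (a + y *s b) = 0" for y by blast
  have nz: "a + y *s b \<noteq> 0" for y
  proof -
    have "cr (a + y *s b) b \<noteq> 0" using assms by simp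
    then show ?thesis using cr_zero by metis
  qed
  have "a \<in> singular_vectors w" using z[of 0] nz[of 0] by (simp add: singular_vectors_def)
  then obtain \<epsilon> where \<epsilon>: "\<epsilon> > 0" "\<And>v. v \<in> singular_vectors w \<Longrightarrow> dist v a < \<epsilon> \<Longrightarrow> v \<in> vec.span {a}"
    using iso unfolding isolated_singularities_def by blast
  have b0: "norm b > 0" using assms(1) by auto
  define r where "r = \<epsilon> / (2 * norm b)"
  have r: "r > 0" "r * norm b < \<epsilon>" using \<epsilon> b0 by (simp_all add: r_def)
  have sR: "complex_of_real r *s b = r *\<^sub>R b" by (simp add: vec_eq_iff scaleR_conv_of_real[where 'a=complex])
  have "a + of_real r *s b \<in> vec.span {a}"
  proof (rule \<epsilon>(2))
    show "a + of_real r *s b \<in> singular_vectors w" using z nz by (simp add: singular_vectors_def)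
    show "dist (a + of_real r *s b) a < \<epsilon>" using r by (simp add: sR dist_norm)
  qed
  then obtain c where "a + of_real r *s b = c *s a" by (auto simp: span_single)
  then have "cr a (a + of_real r *s b) = 0" by simp
  then show False using assms(1) r by simp
qed

text \<open>The point at infinity \<open>b\<close> avoids the finitely many intersections with the
  other invariant lines, so that all of these are visible in the chart
  \<open>a + y b\<close>.\<close>

lemma good_basis:
  assumes "L \<in> Inv"
  obtains a b where "cr a b \<noteq> 0" "L = line_of (cr a b)" "\<And>M. M \<in> Inv \<Longrightarrow> M \<noteq> L \<Longrightarrow> b \<notin> M"
proof -
  obtain a b0 where ab: "cr a b0 \<noteq> 0" "L = line_of (cr a b0)" using nrm[OF assms] line_basis_E by metis
  define T where "T = (\<Union>M\<in>Inv - {L}. {t. poly [:dot3 (nrm M) b0, dot3 (nrm M) a:] t = 0})"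
  have inL: "a \<in> L" "b0 \<in> L" unfolding ab(2) line_of_def by simp_all
  have "finite T" unfolding T_def
  proof (intro finite_UN_I poly_roots_finite)
    fix M assume M: "M \<in> Inv - {L}"
    show "[:dot3 (nrm M) b0, dot3 (nrm M) a:] \<noteq> 0"
    proof
      assume "[:dot3 (nrm M) b0, dot3 (nrm M) a:] = 0"
      then have "a \<in> line_of (nrm M)" "b0 \<in> line_of (nrm M)" by (auto simp: line_of_def)
      then have "line_of (nrm M) = line_of (cr a b0)" using ab M nrm line_of_through by blast
      then show False using M ab nrm by blast
    qed
  qed (use finite_Inv in auto)
  then obtain t where t: "t \<notin> T" using ex_new_if_finite[OF infinite_UNIV_char_0] by blast
  show thesis
  proof (rule that[of a "b0 + t *s a"])
    fix M assume M: "M \<in> Inv" "M \<noteq> L"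
    then have "dot3 (nrm M) (b0 + t *s a) \<noteq> 0" using t by (auto simp: T_def)
    then show "b0 + t *s a \<notin> M" using mem_iff M by blast
  qed (use ab in simp_all)
qed

lemma pts_span: "p \<in> L \<Longrightarrow> p \<noteq> 0 \<Longrightarrow> vec.span {p} \<in> pts L \<longleftrightarrow> mu (vec.span {p}) \<ge> 2"
  by (auto simp: pts_def)

lemma on_line_E:
  assumes "L = line_of (cr a b)" "cr a b \<noteq> 0" "P \<in> pts L" "P \<noteq> vec.span {b}"
  obtains y where "P = vec.span {a + y *s b}"
proof -
  obtain p where p: "P = vec.span {p}" "p \<noteq> 0" "p \<in> L" using assms(3) by (auto simp: pts_def)
  obtain x y where xy: "p = x *s a + y *s b" using line_of_cr_E[OF assms(2)] p assms(1) by (auto simp: line_of_def)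
  have b0: "b \<noteq> 0" using assms(2) by auto
  have x: "x \<noteq> 0"
  proof
    assume "x = 0"
    then have "cr p b = 0" using xy by simp
    then show False using assms(4) p span_single_eq_iff b0 by blast
  qed
  have c: "cr (a + (y / x) *s b) b \<noteq> 0" using assms(2) by simp
  have "cr p (a + (y / x) *s b) = 0" using x by (simp add: xy vec3_eq_iff field_simps)
  moreover have "a + (y / x) *s b \<noteq> 0" using c cr_zero by metis
  ultimately have "P = vec.span {a + (y / x) *s b}" using p span_single_eq_iff by blast
  then show thesis by (rule that)
qed

lemma span_affine_eq_iff:
  assumes "cr a b \<noteq> 0" shows "vec.span {a + y *s b} = vec.span {a + z *s b} \<longleftrightarrow> y = z"
proof -
  have "cr (a + x *s b) b \<noteq> 0" for x using assms by simp
  then have nz: "a + x *s b \<noteq> 0" for x using cr_zero by metis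
  have "cr (a + y *s b) (a + z *s b) = (z - y) *s cr a b" by (simp add: vec3_eq_iff algebra_simps)
  then show ?thesis using span_single_eq_iff[OF nz nz, of y z] assms by (auto simp: vec.scale_eq_0_iff)
qed

text \<open>\<open>line_polynomials\<close> in the chart of \<open>good_basis\<close>:
  \<open>\<phi> M\<close> is the coordinate of the intersection with \<open>M\<close>, and
  \<open>m y\<close> is \<open>mu - 1\<close>. Since \<open>f + R'\<close> vanishes precisely at
  those of the six points through which at least three invariant lines pass, the index is 1
  precisely there. The sum 20 of the multiplicities is 14 + 6.\<close>

lemma line_main:
  assumes L: "L \<in> Inv"
  shows "card (pts L) = 6" "(\<Sum>P\<in>pts L. mu P) = 20" "(\<Sum>P\<in>pts L. lam L P) = 1"
    "\<And>P. P \<in> pts L \<Longrightarrow> 2 \<le> mu P \<and> mu P \<le> 6"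
    "\<And>P. P \<in> pts L \<Longrightarrow> mu P \<ge> 3 \<Longrightarrow> lam L P = 1"
    "\<And>P. P \<in> pts L \<Longrightarrow> mu P = 2 \<Longrightarrow> lam L P \<noteq> 1"
    "\<And>p u n. cr p u \<noteq> 0 \<Longrightarrow> L = line_of (cr p u) \<Longrightarrow> dot3 (cr p u) n \<noteq> 0 \<Longrightarrow> vec.span {p} \<in> pts L \<Longrightarrow> dform_nz w p u n"
proof -
  obtain a b where ab: "cr a b \<noteq> 0" "L = line_of (cr a b)" "\<And>M. M \<in> Inv \<Longrightarrow> M \<noteq> L \<Longrightarrow> b \<notin> M"
    using good_basis[OF L] by blast
  obtain n where n: "dot3 (cr a b) n = 1" using exists_dot3_1 ab(1) by blast
  obtain f g where fg: "degree f \<le> 5" "degree g \<le> 5"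
    "\<And>y. poly (g - [:0, 1:] * f) y = dot3 (w (a + y *s b)) n"
    "\<And>p. [:-p, 1:] ^ (mu (vec.span {a + p *s b}) - 1) dvd g - smult p f"
    "\<And>y. dform w (a + y *s b) n b = poly f y"
    "\<And>y. dform w (a + y *s b) b n = poly (pderiv (g - [:0, 1:] * f)) y"
    using chart[OF L ab(1,2) n] by metis
  have nz: "a + y *s b \<noteq> 0" for y
  proof -
    have "cr (a + y *s b) b \<noteq> 0" using ab by simp
    then show ?thesis using cr_zero by metis
  qed
  have inL: "x *s a + y *s b \<in> L" for x y unfolding ab(2) line_of_def by simp
  then have inL': "a + y *s b \<in> L" for y using inL[of 1 y] by simp
  define \<phi> where "\<phi> M = - dot3 (nrm M) a / dot3 (nrm M) b" for M
  have \<phi>: "a + y *s b \<in> M \<longleftrightarrow> \<phi> M = y" if "M \<in> Inv - {L}" for M y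
  proof -
    have "dot3 (nrm M) b \<noteq> 0" using that ab(3) mem_iff by blast
    moreover have "a + y *s b \<in> M \<longleftrightarrow> dot3 (nrm M) a + y * dot3 (nrm M) b = 0"
      using mem_iff[of M "a + y *s b"] that by simp
    ultimately show ?thesis unfolding \<phi>_def by (simp add: neg_eq_iff_add_eq_0 divide_add_eq_iff)
  qed
  define S where "S = \<phi> ` (Inv - {L})"
  define m where "m y = mu (vec.span {a + y *s b}) - 1" for y
  have finS: "finite S" using finite_Inv by (simp add: S_def)
  have mu_m: "mu (vec.span {a + y *s b}) = m y + 1" and m_card: "m y = card {M \<in> Inv - {L}. \<phi> M = y}" for y
  proof -
    have "{M \<in> Inv. a + y *s b \<in> M} = insert L {M \<in> Inv - {L}. \<phi> M = y}" using \<phi> inL' L by auto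
    then have "mu (vec.span {a + y *s b}) = Suc (card {M \<in> Inv - {L}. \<phi> M = y})"
      unfolding mu_span using finite_Inv by simp
    then show "mu (vec.span {a + y *s b}) = m y + 1" "m y = card {M \<in> Inv - {L}. \<phi> M = y}"
      by (simp_all add: m_def)
  qed
  have S_iff: "y \<in> S \<longleftrightarrow> m y \<ge> 1" for y
  proof -
    have "m y \<ge> 1 \<longleftrightarrow> {M \<in> Inv - {L}. \<phi> M = y} \<noteq> {}" unfolding m_card using finite_Inv
      by (simp add: Suc_le_eq card_gt_0_iff)
    then show ?thesis by (auto simp: S_def)
  qed
  have m5: "m y \<le> 5" for y using mu_le_6[OF nz, of y] mu_m[of y] by simp
  \<comment> \<open>Each of the 14 other invariant lines meets \<open>L\<close> in exactly one point
    of the chart.\<close>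
  have "(\<Sum>y\<in>S. m y) = (\<Sum>y\<in>S. \<Sum>M | M \<in> Inv - {L} \<and> \<phi> M = y. 1)" by (simp add: m_card)
  also have "\<dots> = (\<Sum>M\<in>Inv - {L}. 1)" unfolding S_def by (rule sum.image_gen[symmetric]) (use finite_Inv in auto)
  also have "\<dots> = 14" using finite_Inv card_Inv L by simp
  finally have sum_m: "(\<Sum>y\<in>S. m y) = 14" .
  let ?R = "g - [:0, 1:] * f"
  have R0: "?R \<noteq> 0"
  proof
    assume R: "?R = 0"
    obtain y where y: "w (a + y *s b) \<noteq> 0" using nonzero_on_line[OF ab(1,2) L] by blast
    have "dot3 (w (a + y *s b)) v = 0" for v
    proof -
      have "dot3 (cr a b) n \<noteq> 0" using n by simp
      from basis_E[OF this, of v] obtain x' y' z' where v: "v = x' *s a + y' *s b + z' *s n" .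
      have "dot3 (w (a + y *s b)) n = 0" using fg(3)[of y] R by simp
      moreover have "dot3 (w (a + y *s b)) (x' *s a + y' *s b) = 0" using InvD[OF L inL' inL] .
      ultimately show ?thesis unfolding v by simp
    qed
    moreover obtain v where "dot3 (w (a + y *s b)) v = 1" using exists_dot3_1[OF y] by blast
    ultimately show False by simp
  qed
  have dvd: "[:-p, 1:] ^ m p dvd g - smult p f" if "p \<in> S" for p using fg(4)[of p] by (simp add: m_def)
  have mb: "1 \<le> m p \<and> m p \<le> 5" if "p \<in> S" for p using that S_iff m5 by simp
  have lp: "card S = 6"
    "degree ?R = 6"
    "\<And>y. y \<in> S \<Longrightarrow> poly ?R y = 0 \<and> poly f y \<noteq> 0 \<and> poly (pderiv ?R) y \<noteq> 0"
    "\<And>y. y \<in> S \<Longrightarrow> m y = 1 \<Longrightarrow> poly f y + poly (pderiv ?R) y \<noteq> 0"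
    "\<And>y. y \<in> S \<Longrightarrow> m y \<ge> 2 \<Longrightarrow> poly f y + poly (pderiv ?R) y = 0"
    "(\<Sum>y\<in>S. - poly f y / poly (pderiv ?R) y) = 1"
    using line_polynomials[OF fg(1,2) R0 finS mb sum_m dvd] by blast+
  have pts: "pts L = (\<lambda>y. vec.span {a + y *s b}) ` S"
  proof (intro equalityI subsetI)
    fix P assume P: "P \<in> pts L"
    have "mu (vec.span {b}) = card {L}" unfolding mu_span using ab(3) inL[of 0 1] L by (intro arg_cong[of _ _ card]) auto
    then have "P \<noteq> vec.span {b}" using P by (auto simp: pts_def)
    from on_line_E[OF ab(2,1) P this] obtain y where y: "P = vec.span {a + y *s b}" .
    then have "mu P \<ge> 2" using P by (auto simp: pts_def)
    then have "y \<in> S" using mu_m[of y] y S_iff by simp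
    then show "P \<in> (\<lambda>y. vec.span {a + y *s b}) ` S" using y by blast
  next
    fix P assume "P \<in> (\<lambda>y. vec.span {a + y *s b}) ` S"
    then show "P \<in> pts L" using pts_span[OF inL' nz] mu_m S_iff by force
  qed
  have inj: "inj_on (\<lambda>y. vec.span {a + y *s b}) S" using span_affine_eq_iff[OF ab(1)] by (auto intro: inj_onI)
  have lam: "lam L (vec.span {a + y *s b}) = - poly f y / poly (pderiv ?R) y" if "y \<in> S" for y
  proof -
    have "w (a + y *s b) = 0" by (rule mu_2_singular) (use mu_m[of y] S_iff[of y] that in simp)
    moreover have "cr (a + y *s b) b = cr a b" by simp
    ultimately have "lam L (vec.span {a + y *s b}) = cs w (a + y *s b) b n"
      using ab n L by (intro lam_eq) simp_all
    then show ?thesis by (simp only: cs_def fg)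
  qed
  show "card (pts L) = 6" unfolding pts using lp(1) inj by (simp add: card_image)
  show "(\<Sum>P\<in>pts L. lam L P) = 1" unfolding pts sum.reindex[OF inj] using lp(6) lam by simp
  have "(\<Sum>P\<in>pts L. mu P) = (\<Sum>y\<in>S. m y + 1)" unfolding pts sum.reindex[OF inj] using mu_m by simp
  also have "\<dots> = 20" using sum_m lp(1) by (simp only: sum.distrib) simp
  finally show "(\<Sum>P\<in>pts L. mu P) = 20" .
  show "2 \<le> mu P \<and> mu P \<le> 6" if P: "P \<in> pts L" for P
  proof -
    obtain y where "y \<in> S" "P = vec.span {a + y *s b}" using P unfolding pts by blast
    then show ?thesis using mb[of y] mu_m[of y] by simp
  qed
  show "lam L P = 1" if P: "P \<in> pts L" "mu P \<ge> 3" for P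
  proof -
    obtain y where y: "y \<in> S" "P = vec.span {a + y *s b}" using P unfolding pts by blast
    then have "m y \<ge> 2" using P mu_m[of y] by simp
    then have "poly f y + poly (pderiv ?R) y = 0" using lp(5) y by blast
    then have "- poly f y = poly (pderiv ?R) y" by (simp only: neg_eq_iff_add_eq_0)
    then show ?thesis using lam[OF y(1)] lp(3)[OF y(1)] y by simp
  qed
  show "lam L P \<noteq> 1" if P: "P \<in> pts L" "mu P = 2" for P
  proof
    assume 1: "lam L P = 1"
    obtain y where y: "y \<in> S" "P = vec.span {a + y *s b}" using P unfolding pts by blast
    then have "m y = 1" using P mu_m[of y] by simp
    then have ne: "poly f y + poly (pderiv ?R) y \<noteq> 0" using lp(4) y by blast
    have "- poly f y = poly (pderiv ?R) y" using lam[OF y(1)] lp(3)[OF y(1)] y 1 by (simp add: field_simps)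
    then show False using ne by (simp only: neg_eq_iff_add_eq_0)
  qed
  show "dform_nz w p u k" if pu: "cr p u \<noteq> 0" "L = line_of (cr p u)" "dot3 (cr p u) k \<noteq> 0" "vec.span {p} \<in> pts L" for p u k
  proof -
    obtain y where y: "y \<in> S" "vec.span {p} = vec.span {a + y *s b}" using pu(4) unfolding pts by blast
    have p0: "p \<noteq> 0" using pu(1) by auto
    have "cr (a + y *s b) p = 0" using span_single_eq_iff[OF nz p0, of y] y by simp
    then obtain c where c: "p = c *s (a + y *s b)" using cr_eq_0D nz by blast
    have c0: "c \<noteq> 0" using c p0 by auto
    have w0: "w (a + y *s b) = 0" by (rule mu_2_singular) (use mu_m[of y] S_iff[of y] y in simp)
    have e: "cr (a + y *s b) b = cr a b" by simp
    have "dform_nz w (a + y *s b) b n" using lp(3)[OF y(1)] by (simp only: dform_nz_def fg) simp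
    moreover define q where "q = a + y *s b"
    ultimately have q: "dform_nz w q b n" "w q = 0" "p = c *s q" "cr q b = cr a b" using w0 e c by simp_all
    then have "cr q b \<noteq> 0" "invariant_line w (line_of (cr q b))" "dot3 (cr q b) n \<noteq> 0"
      "cr q u \<noteq> 0" "line_of (cr q u) = line_of (cr q b)" "dot3 (cr q u) k \<noteq> 0"
      using pu ab n L c0 by (auto simp: Inv_def)
    from cs_independent(2)[OF q(2) this(1-3) c0 this(4-6)] show ?thesis using q by simp
  qed
qed

end

section \<open>Possible indices at the nodes of an invariant line\<close>

context reduced_convex_form
begin

lemma ptsE:
  assumes "P \<in> pts L" obtains p where "p \<noteq> 0" "P = vec.span {p}" "p \<in> L" "w p = 0"
  using assms mu_2_singular by (auto simp: pts_def)

lemma chart_pts: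
  assumes L: "L \<in> Inv" and ab: "cr a b \<noteq> 0" "L = line_of (cr a b)"
  obtains f g where "degree f \<le> 5" "degree g \<le> 5" "degree f + mu (vec.span {b}) \<le> 6"
    "\<And>y. vec.span {a + y *s b} \<in> pts L \<Longrightarrow> [:-y, 1:] ^ (mu (vec.span {a + y *s b}) - 1) dvd g - smult y f"
    "\<And>y. vec.span {a + y *s b} \<in> pts L \<Longrightarrow> poly (g - [:0, 1:] * f) y = 0"
    "\<And>y. vec.span {a + y *s b} \<in> pts L \<Longrightarrow> poly f y \<noteq> 0"
    "\<And>y. vec.span {a + y *s b} \<in> pts L \<Longrightarrow>
      lam L (vec.span {a + y *s b}) * poly (pderiv (g - [:0, 1:] * f)) y = - poly f y"
proof -
  obtain n where n: "dot3 (cr a b) n = 1" using exists_dot3_1 ab(1) by blast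
  obtain f g where fg: "degree f \<le> 5" "degree g \<le> 5"
    "\<And>y. poly (g - [:0, 1:] * f) y = dot3 (w (a + y *s b)) n"
    "\<And>p. [:-p, 1:] ^ (mu (vec.span {a + p *s b}) - 1) dvd g - smult p f"
    "degree f + mu (vec.span {b}) \<le> 6"
    "\<And>y. dform w (a + y *s b) n b = poly f y"
    "\<And>y. dform w (a + y *s b) b n = poly (pderiv (g - [:0, 1:] * f)) y"
    using chart[OF L ab n] by metis
  have w0: "w (a + y *s b) = 0" if "vec.span {a + y *s b} \<in> pts L" for y
    using that line_main(4)[OF L that] by (intro mu_2_singular) simp
  have e: "cr (a + y *s b) b = cr a b" for y by simp
  have nz: "dform_nz w (a + y *s b) b n" if "vec.span {a + y *s b} \<in> pts L" for y
    using line_main(7)[OF L, of "a + y *s b" b n] that ab n by (simp add: e)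
  show thesis
  proof (rule that[OF fg(1,2,5)])
    fix y assume y: "vec.span {a + y *s b} \<in> pts L"
    show "[:-y, 1:] ^ (mu (vec.span {a + y *s b}) - 1) dvd g - smult y f" by (rule fg(4))
    show "poly (g - [:0, 1:] * f) y = 0" unfolding fg(3) w0[OF y] by simp
    show "poly f y \<noteq> 0" using nz[OF y] unfolding dform_nz_def fg by simp
    have "lam L (vec.span {a + y *s b}) = cs w (a + y *s b) b n"
      using w0[OF y] ab n L by (intro lam_eq) (simp_all add: e)
    then show "lam L (vec.span {a + y *s b}) * poly (pderiv (g - [:0, 1:] * f)) y = - poly f y"
      using nz[OF y] by (simp only: cs_def dform_nz_def fg) simp
  qed
qed

lemma coords2:
  assumes L: "L \<in> Inv" and P: "P \<in> pts L" "Q \<in> pts L" "P \<noteq> Q"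
  obtains a b where "cr a b \<noteq> 0" "L = line_of (cr a b)" "P = vec.span {b}" "Q = vec.span {a}"
proof -
  obtain b where b: "b \<noteq> 0" "P = vec.span {b}" "b \<in> L" using P ptsE by metis
  obtain a where a: "a \<noteq> 0" "Q = vec.span {a}" "a \<in> L" using P ptsE by metis
  have c: "cr a b \<noteq> 0" using span_single_eq_iff a b P(3) by metis
  have "L = line_of (cr a b)" using line_of_through[OF c, of "nrm L"] a b nrm[OF L] by simp
  then show thesis using that c a b by blast
qed

lemma coords3:
  assumes L: "L \<in> Inv" and P: "P \<in> pts L" "Q \<in> pts L" "T \<in> pts L" "P \<noteq> Q" "T \<noteq> P" "T \<noteq> Q"
  obtains a b where "cr a b \<noteq> 0" "L = line_of (cr a b)" "P = vec.span {b}" "Q = vec.span {a}" "T = vec.span {a + b}"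
proof -
  obtain a b where ab: "cr a b \<noteq> 0" "L = line_of (cr a b)" "P = vec.span {b}" "Q = vec.span {a}"
    using coords2[OF L P(1,2,4)] by blast
  have "T \<noteq> vec.span {b}" using ab P by simp
  then obtain y where y: "T = vec.span {a + y *s b}" using on_line_E[OF ab(2,1) P(3)] by blast
  have y0: "y \<noteq> 0" using y ab P(6) by auto
  have b0: "b \<noteq> 0" "y *s b \<noteq> 0" using ab(1) y0 by auto
  show thesis
  proof (rule that[of a "y *s b"])
    show "P = vec.span {y *s b}" using ab(3) span_single_eq_iff[of b "y *s b"] b0 by simp
    show "L = line_of (cr a (y *s b))" using y0 ab by simp
  qed (use ab y y0 in \<open>auto simp: vec.scale_eq_0_iff\<close>)
qed

lemma coord:
  assumes "cr a b \<noteq> 0" "L = line_of (cr a b)" "Q \<in> pts L" "Q \<noteq> vec.span {b}"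
  obtains y where "Q = vec.span {a + y *s b}" "Q \<noteq> vec.span {a} \<Longrightarrow> y \<noteq> 0" "Q \<noteq> vec.span {a + b} \<Longrightarrow> y \<noteq> 1"
proof -
  obtain y where y: "Q = vec.span {a + y *s b}" using on_line_E[OF assms(2,1,3,4)] .
  show thesis
  proof (rule that[OF y])
    show "Q \<noteq> vec.span {a} \<Longrightarrow> y \<noteq> 0" "Q \<noteq> vec.span {a + b} \<Longrightarrow> y \<noteq> 1" using y by auto
  qed
qed

lemma lam_44:
  assumes L: "L \<in> Inv" and P: "P \<in> pts L" "Q \<in> pts L" "A \<in> pts L" "P \<noteq> Q" "A \<noteq> P" "A \<noteq> Q"
    and mu: "mu P = 6" "mu Q = 6"
  shows "4 * lam L A + 1 = 0"
proof -
  obtain a b where ab: "cr a b \<noteq> 0" "L = line_of (cr a b)" "P = vec.span {b}" "Q = vec.span {a}"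
    using coords2[OF L P(1,2,4)] by blast
  obtain f g where fg: "degree f \<le> 5" "degree g \<le> 5" "degree f + mu (vec.span {b}) \<le> 6"
    "\<And>y. vec.span {a + y *s b} \<in> pts L \<Longrightarrow> [:-y, 1:] ^ (mu (vec.span {a + y *s b}) - 1) dvd g - smult y f"
    "\<And>y. vec.span {a + y *s b} \<in> pts L \<Longrightarrow> poly (g - [:0, 1:] * f) y = 0"
    "\<And>y. vec.span {a + y *s b} \<in> pts L \<Longrightarrow> poly f y \<noteq> 0"
    "\<And>y. vec.span {a + y *s b} \<in> pts L \<Longrightarrow>
      lam L (vec.span {a + y *s b}) * poly (pderiv (g - [:0, 1:] * f)) y = - poly f y"
    using chart_pts[OF L ab(1,2)] by metis
  obtain y where y: "A = vec.span {a + y *s b}" "y \<noteq> 0" using coord[OF ab(1,2) P(3)] ab P by metis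
  have A: "vec.span {a + y *s b} \<in> pts L" using y P by simp
  show ?thesis unfolding y(1)
  proof (rule cs_type_44[OF _ fg(2) _ refl fg(5)[OF A] y(2) fg(6)[OF A] fg(7)[OF A]])
    show "degree f = 0" using fg(3) mu ab by simp
    show "[:-0, 1:] ^ 5 dvd g - smult 0 f" using fg(4)[of 0] P ab mu by simp
  qed
qed

text \<open>\<open>P\<close>, \<open>Q\<close>, \<open>T\<close> become infinity, 0 and 1, and
  \<open>y\<close> is the coordinate of the node \<open>A\<close>. The last clause supplies the
  tangency at one more special point, as the pattern 4211 requires.\<close>

lemma lam_three:
  assumes L: "L \<in> Inv" and P: "P \<in> pts L" "Q \<in> pts L" "T \<in> pts L" "P \<noteq> Q" "T \<noteq> P" "T \<noteq> Q"
    and A: "A \<in> pts L" "A \<noteq> P" "A \<noteq> Q" "A \<noteq> T"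
  obtains f g y where "degree f + mu P \<le> 6" "degree g \<le> 5"
    "[:-0, 1:] ^ (mu Q - 1) dvd g - smult 0 f" "[:-1, 1:] ^ (mu T - 1) dvd g - smult 1 f"
    "poly (g - [:0, 1:] * f) y = 0" "y \<noteq> 0" "y \<noteq> 1" "poly f y \<noteq> 0"
    "lam L A * poly (pderiv (g - [:0, 1:] * f)) y = - poly f y"
    "\<And>U. U \<in> pts L \<Longrightarrow> U \<noteq> P \<Longrightarrow> U \<noteq> Q \<Longrightarrow> U \<noteq> T \<Longrightarrow> U \<noteq> A \<Longrightarrow>
      \<exists>u. u \<noteq> 0 \<and> u \<noteq> 1 \<and> y \<noteq> u \<and> [:-u, 1:] ^ (mu U - 1) dvd g - smult u f"
proof -
  obtain a b where ab: "cr a b \<noteq> 0" "L = line_of (cr a b)" "P = vec.span {b}" "Q = vec.span {a}" "T = vec.span {a + b}"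
    using coords3[OF L P] by blast
  obtain f g where fg: "degree f \<le> 5" "degree g \<le> 5" "degree f + mu (vec.span {b}) \<le> 6"
    "\<And>y. vec.span {a + y *s b} \<in> pts L \<Longrightarrow> [:-y, 1:] ^ (mu (vec.span {a + y *s b}) - 1) dvd g - smult y f"
    "\<And>y. vec.span {a + y *s b} \<in> pts L \<Longrightarrow> poly (g - [:0, 1:] * f) y = 0"
    "\<And>y. vec.span {a + y *s b} \<in> pts L \<Longrightarrow> poly f y \<noteq> 0"
    "\<And>y. vec.span {a + y *s b} \<in> pts L \<Longrightarrow>
      lam L (vec.span {a + y *s b}) * poly (pderiv (g - [:0, 1:] * f)) y = - poly f y"
    using chart_pts[OF L ab(1,2)] by metis
  obtain y where y: "A = vec.span {a + y *s b}" "y \<noteq> 0" "y \<noteq> 1" using coord[OF ab(1,2) A(1)] ab A by metis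
  have A': "vec.span {a + y *s b} \<in> pts L" using y A by simp
  show thesis
  proof (rule that[of f g y])
    show "degree f + mu P \<le> 6" using fg(3) ab by simp
    show "[:-0, 1:] ^ (mu Q - 1) dvd g - smult 0 f" using fg(4)[of 0] P ab by simp
    show "[:-1, 1:] ^ (mu T - 1) dvd g - smult 1 f" using fg(4)[of 1] P ab by simp
    show "lam L A * poly (pderiv (g - [:0, 1:] * f)) y = - poly f y" using fg(7)[OF A'] y by simp
    fix U assume U: "U \<in> pts L" "U \<noteq> P" "U \<noteq> Q" "U \<noteq> T" "U \<noteq> A"
    obtain u where u: "U = vec.span {a + u *s b}" "u \<noteq> 0" "u \<noteq> 1" using coord[OF ab(1,2) U(1)] ab U by metis
    then show "\<exists>u. u \<noteq> 0 \<and> u \<noteq> 1 \<and> y \<noteq> u \<and> [:-u, 1:] ^ (mu U - 1) dvd g - smult u f"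
      using fg(4)[of u] U y by (intro exI[of _ u]) auto
  qed (use fg y A' in auto)
qed

lemma lam_three_bad:
  assumes L: "L \<in> Inv" and P: "P \<in> pts L" "Q \<in> pts L" "T \<in> pts L" "P \<noteq> Q" "T \<noteq> P" "T \<noteq> Q"
    and A: "A \<in> pts L" "A \<noteq> P" "A \<noteq> Q" "A \<noteq> T"
    and mu: "mu P = 6 \<and> mu Q = 5 \<and> mu T = 3 \<or> mu P = 6 \<and> mu Q = 4 \<and> mu T = 4 \<or> mu P = 5 \<and> mu Q = 5 \<and> mu T = 4 \<or>
      mu P = 6 \<and> mu Q = 4 \<and> mu T = 3 \<and> (\<exists>U. U \<in> pts L \<and> U \<noteq> P \<and> U \<noteq> Q \<and> U \<noteq> T \<and> U \<noteq> A \<and> mu U = 3)"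
  shows "cs_bad (lam L A)"
proof -
  obtain f g y where fg: "degree f + mu P \<le> 6" "degree g \<le> 5"
    "[:-0, 1:] ^ (mu Q - 1) dvd g - smult 0 f" "[:-1, 1:] ^ (mu T - 1) dvd g - smult 1 f"
    "poly (g - [:0, 1:] * f) y = 0" "y \<noteq> 0" "y \<noteq> 1" "poly f y \<noteq> 0"
    "lam L A * poly (pderiv (g - [:0, 1:] * f)) y = - poly f y"
    and U: "\<And>U. U \<in> pts L \<Longrightarrow> U \<noteq> P \<Longrightarrow> U \<noteq> Q \<Longrightarrow> U \<noteq> T \<Longrightarrow> U \<noteq> A \<Longrightarrow>
      \<exists>u. u \<noteq> 0 \<and> u \<noteq> 1 \<and> y \<noteq> u \<and> [:-u, 1:] ^ (mu U - 1) dvd g - smult u f"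
    using lam_three[OF L P A] by (metis (no_types, lifting))
  from mu show ?thesis
  proof (elim disjE conjE exE)
    assume m: "mu P = 6" "mu Q = 5" "mu T = 3"
    have "491 * lam L A ^ 3 + 982 * lam L A ^ 2 + 463 * lam L A + 64 = 0"
      by (rule cs_type_431[OF _ fg(2) _ _ refl fg(5-9)]) (use fg(1,3,4) m in simp_all)
    then have "poly [:64, 463, 982, 491:] (lam L A) = 0" by (simp add: algebra_simps power2_eq_square power3_eq_cube)
    then show ?thesis unfolding cs_bad_def by blast
  next
    assume m: "mu P = 6" "mu Q = 4" "mu T = 4"
    have "7 * lam L A + 8 = 0 \<or> 7 * lam L A + 3 = 0"
      by (rule cs_type_422[OF _ fg(2) _ _ refl fg(5-9)]) (use fg(1,3,4) m in simp_all)
    then have "poly [:8, 7:] (lam L A) = 0 \<or> poly [:3, 7:] (lam L A) = 0" by (simp add: algebra_simps)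
    then show ?thesis unfolding cs_bad_def by blast
  next
    assume m: "mu P = 5" "mu Q = 5" "mu T = 4"
    have "11 * lam L A + 4 = 0 \<or> 11 * lam L A + 9 = 0"
      by (rule cs_type_332[OF _ fg(2) _ _ refl fg(5-9)]) (use fg(1,3,4) m in simp_all)
    then have "poly [:4, 11:] (lam L A) = 0 \<or> poly [:9, 11:] (lam L A) = 0" by (simp add: algebra_simps)
    then show ?thesis unfolding cs_bad_def by blast
  next
    fix V assume m: "mu P = 6" "mu Q = 4" "mu T = 3"
      and V: "V \<in> pts L" "V \<noteq> P" "V \<noteq> Q" "V \<noteq> T" "V \<noteq> A" "mu V = 3"
    obtain u where u: "u \<noteq> 0" "u \<noteq> 1" "y \<noteq> u" "[:-u, 1:] ^ (mu V - 1) dvd g - smult u f" using U[OF V(1-5)] by blast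
    have "2 * lam L A + 3 = 0 \<or> 59 * lam L A ^ 2 + 177 * lam L A + 64 = 0"
      by (rule cs_type_4211[OF _ fg(2) _ _ _ refl fg(5-7) u(3,1,2) fg(8,9)]) (use fg(1,3,4) m u V in simp_all)
    then have "poly [:3, 2:] (lam L A) = 0 \<or> poly [:64, 177, 59:] (lam L A) = 0"
      by (simp add: algebra_simps power2_eq_square)
    then show ?thesis unfolding cs_bad_def by blast
  qed
qed

text \<open>The nodes \<open>A\<close> and \<open>B\<close> are placed at 0 and infinity. The
  exponents \<open>mu - 2\<close> are one less than the tangency orders \<open>mu - 1\<close>, which
  is the shift built into \<open>cs_two_double_points\<close>.\<close>

lemma lam_two:
  assumes L: "L \<in> Inv" and pts: "pts L = {A, B, Q1, Q2, Q3, Q4}" "distinct [A, B, Q1, Q2, Q3, Q4]"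
    and mu: "mu A = 2" "mu B = 2" "mu Q1 = e1 + 2" "mu Q2 = e2 + 2" "mu Q3 = e3 + 2" "mu Q4 = e4 + 2"
    and e: "1 \<le> e1" "1 \<le> e2" "1 \<le> e3" "1 \<le> e4" "e1 + e2 + e3 + e4 = 8"
  obtains p1 p2 p3 p4 c where "p1 \<noteq> 0" "p2 \<noteq> 0" "p3 \<noteq> 0" "p4 \<noteq> 0" "lam L A \<noteq> 0" "lam L A \<noteq> 1"
    "\<And>k. (lam L A + of_nat k) * (lam L A + of_nat k - 1) * coeff ([:-p1, 1:] * [:-p2, 1:] * [:-p3, 1:] * [:-p4, 1:]) k
       = c * coeff ([:-p1, 1:] ^ (e1 - 1) * [:-p2, 1:] ^ (e2 - 1) * [:-p3, 1:] ^ (e3 - 1) * [:-p4, 1:] ^ (e4 - 1)) k"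
proof -
  have in_pts: "A \<in> pts L" "B \<in> pts L" "Q1 \<in> pts L" "Q2 \<in> pts L" "Q3 \<in> pts L" "Q4 \<in> pts L" using pts by auto
  have d: "B \<noteq> A" "Q1 \<noteq> A" "Q1 \<noteq> B" "Q2 \<noteq> A" "Q2 \<noteq> B" "Q3 \<noteq> A" "Q3 \<noteq> B" "Q4 \<noteq> A" "Q4 \<noteq> B"
    "Q1 \<noteq> Q2" "Q1 \<noteq> Q3" "Q1 \<noteq> Q4" "Q2 \<noteq> Q3" "Q2 \<noteq> Q4" "Q3 \<noteq> Q4" using pts(2) by auto
  from coords2[OF L in_pts(2,1) d(1)]
  obtain a b where ab: "cr a b \<noteq> 0" "L = line_of (cr a b)" "B = vec.span {b}" "A = vec.span {a}" by blast
  obtain f g where fg: "degree f \<le> 5" "degree g \<le> 5" "degree f + mu (vec.span {b}) \<le> 6"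
    "\<And>y. vec.span {a + y *s b} \<in> pts L \<Longrightarrow> [:-y, 1:] ^ (mu (vec.span {a + y *s b}) - 1) dvd g - smult y f"
    "\<And>y. vec.span {a + y *s b} \<in> pts L \<Longrightarrow> poly (g - [:0, 1:] * f) y = 0"
    "\<And>y. vec.span {a + y *s b} \<in> pts L \<Longrightarrow> poly f y \<noteq> 0"
    "\<And>y. vec.span {a + y *s b} \<in> pts L \<Longrightarrow>
      lam L (vec.span {a + y *s b}) * poly (pderiv (g - [:0, 1:] * f)) y = - poly f y"
    using chart_pts[OF L ab(1,2)] by metis
  have c: "\<exists>y. Q = vec.span {a + y *s b} \<and> y \<noteq> 0" if Q: "Q \<in> pts L" "Q \<noteq> A" "Q \<noteq> B" for Q
  proof -
    have "Q \<noteq> vec.span {b}" using Q ab by simp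
    from on_line_E[OF ab(2,1) Q(1) this] obtain y where y: "Q = vec.span {a + y *s b}" .
    then have "y \<noteq> 0" using Q ab by auto
    with y show ?thesis by blast
  qed
  obtain p1 where p1: "Q1 = vec.span {a + p1 *s b}" "p1 \<noteq> 0" using c[OF in_pts(3) d(2,3)] by blast
  obtain p2 where p2: "Q2 = vec.span {a + p2 *s b}" "p2 \<noteq> 0" using c[OF in_pts(4) d(4,5)] by blast
  obtain p3 where p3: "Q3 = vec.span {a + p3 *s b}" "p3 \<noteq> 0" using c[OF in_pts(5) d(6,7)] by blast
  obtain p4 where p4: "Q4 = vec.span {a + p4 *s b}" "p4 \<noteq> 0" using c[OF in_pts(6) d(8,9)] by blast
  have dist: "p1 \<noteq> p2" "p1 \<noteq> p3" "p1 \<noteq> p4" "p2 \<noteq> p3" "p2 \<noteq> p4" "p3 \<noteq> p4"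
    using d(10-15) unfolding p1(1) p2(1) p3(1) p4(1) by auto
  let ?S = "{p1, p2, p3, p4}"
  define e where "e p = mu (vec.span {a + p *s b}) - 2" for p
  have ee: "e p1 = e1" "e p2 = e2" "e p3 = e3" "e p4 = e4" using mu p1 p2 p3 p4 by (simp_all add: e_def)
  have A0: "vec.span {a + 0 *s b} \<in> pts L" using in_pts ab by simp
  have Sp: "vec.span {a + p *s b} \<in> pts L" if "p \<in> ?S" for p using that in_pts p1 p2 p3 p4 by auto
  have R0: "g - [:0, 1:] * f \<noteq> 0"
  proof
    assume "g - [:0, 1:] * f = 0"
    then show False using fg(6,7)[OF A0] by simp
  qed
  have lam: "lam L A * poly (pderiv (g - [:0, 1:] * f)) 0 = - poly f 0" using fg(7)[OF A0] ab by simp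
  have df: "degree f \<le> 4" using fg(3) mu ab by simp
  have 0: "0 \<notin> ?S" using p1 p2 p3 p4 by auto
  have e1': "1 \<le> e p" if "p \<in> ?S" for p using that ee e by auto
  have es: "(\<Sum>p\<in>?S. e p) = 8" using dist ee e(5) by simp
  have dv: "[:-p, 1:] ^ (e p + 1) dvd g - smult p f" if "p \<in> ?S" for p
  proof -
    have "mu (vec.span {a + p *s b}) - 1 = e p + 1" using e1'[OF that] by (simp add: e_def)
    then show ?thesis using fg(4)[OF Sp[OF that]] by simp
  qed
  have cS: "card ?S = 4" using dist by simp
  obtain c where c: "\<And>k. (lam L A + of_nat k) * (lam L A + of_nat k - 1) * coeff (\<Prod>p\<in>?S. [:-p, 1:]) k
      = c * coeff (\<Prod>p\<in>?S. [:-p, 1:] ^ (e p - 1)) k"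
    using cs_two_double_points[OF df fg(2) refl R0 fg(5)[OF A0] lam _ cS 0 e1' es dv] by blast
  have prods: "(\<Prod>p\<in>?S. h p) = h p1 * h p2 * h p3 * h p4" for h :: "complex \<Rightarrow> complex poly"
    using dist by (simp add: mult.assoc)
  show thesis
  proof (rule that[OF p1(2) p2(2) p3(2) p4(2)])
    show "lam L A \<noteq> 0" using lam fg(6)[OF A0] by auto
    show "lam L A \<noteq> 1" using line_main(6)[OF L in_pts(1) mu(1)] .
  qed (rule c[unfolded prods ee])
qed

lemma lam_two_values:
  assumes L: "L \<in> Inv" and pts: "pts L = {A, B, Q1, Q2, Q3, Q4}" "distinct [A, B, Q1, Q2, Q3, Q4]"
    and mu: "mu A = 2" "mu B = 2"
  shows "mu Q1 = 4 \<Longrightarrow> mu Q2 = 4 \<Longrightarrow> mu Q3 = 4 \<Longrightarrow> mu Q4 = 4 \<Longrightarrow> cs_bad (lam L A)"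
    "mu Q1 = 5 \<Longrightarrow> mu Q2 = 4 \<Longrightarrow> mu Q3 = 4 \<Longrightarrow> mu Q4 = 3 \<Longrightarrow> cs_bad (lam L A)"
    "mu Q1 = 5 \<Longrightarrow> mu Q2 = 5 \<Longrightarrow> mu Q3 = 3 \<Longrightarrow> mu Q4 = 3 \<Longrightarrow>
      cs_bad (lam L A) \<or> lam L A ^ 2 + 3 * lam L A + 1 = 0"
proof -
  note two = lam_two[OF L pts mu]
  have n: "(1::nat) \<le> 1" "(1::nat) \<le> 2" "(1::nat) \<le> 3" "2 + 2 + 2 + 2 = (8::nat)"
    "3 + 2 + 2 + 1 = (8::nat)" "3 + 3 + 1 + 1 = (8::nat)" by simp_all
  have two_minus_one: "2 - 1 = (1::nat)" by simp
  have b3: "cs_bad x" if "2 * x + 3 = 0" for x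
  proof -
    from that have "poly [:3, 2:] x = 0" by (simp add: algebra_simps)
    then show ?thesis unfolding cs_bad_def by blast
  qed
  show "cs_bad (lam L A)" if m: "mu Q1 = 4" "mu Q2 = 4" "mu Q3 = 4" "mu Q4 = 4"
  proof -
    have "mu Q1 = 2 + 2" "mu Q2 = 2 + 2" "mu Q3 = 2 + 2" "mu Q4 = 2 + 2" using m by simp_all
    note e = this n(2) n(2) n(2) n(2) n(4)
    obtain p1 p2 p3 p4 c where p: "p1 \<noteq> 0" "p2 \<noteq> 0" "p3 \<noteq> 0" "p4 \<noteq> 0" "lam L A \<noteq> 0" "lam L A \<noteq> 1"
      "\<And>k. (lam L A + of_nat k) * (lam L A + of_nat k - 1) * coeff ([:-p1, 1:] * [:-p2, 1:] * [:-p3, 1:] * [:-p4, 1:]) k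
         = c * coeff ([:-p1, 1:] ^ (2 - 1) * [:-p2, 1:] ^ (2 - 1) * [:-p3, 1:] ^ (2 - 1) * [:-p4, 1:] ^ (2 - 1)) k"
      by (rule two[OF e], rule that)
    have "2 * lam L A + 3 = 0"
      by (rule cs_type_2222[OF _ refl, of _ p1 p2 p3 p4 c]) (use p in \<open>simp_all only: two_minus_one power_one_right, simp_all\<close>)
    then show ?thesis by (rule b3)
  qed
  show "cs_bad (lam L A)" if m: "mu Q1 = 5" "mu Q2 = 4" "mu Q3 = 4" "mu Q4 = 3"
  proof -
    have "mu Q1 = 3 + 2" "mu Q2 = 2 + 2" "mu Q3 = 2 + 2" "mu Q4 = 1 + 2" using m by simp_all
    note e = this n(3) n(2) n(2) n(1) n(5)
    obtain p1 p2 p3 p4 c where p: "p1 \<noteq> 0" "p2 \<noteq> 0" "p3 \<noteq> 0" "p4 \<noteq> 0" "lam L A \<noteq> 0" "lam L A \<noteq> 1"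
      and E: "\<And>k. (lam L A + of_nat k) * (lam L A + of_nat k - 1) * coeff ([:-p1, 1:] * [:-p2, 1:] * [:-p3, 1:] * [:-p4, 1:]) k
         = c * coeff ([:-p1, 1:] ^ (3 - 1) * [:-p2, 1:] ^ (2 - 1) * [:-p3, 1:] ^ (2 - 1) * [:-p4, 1:] ^ (1 - 1)) k"
      by (rule two[OF e], rule that)
    have comm: "x * y * z * t = x * t * y * (z :: complex poly)" for x y z t by (simp only: mult_ac)
    have sq: "x ^ (3 - 1) * y ^ (2 - 1) * z ^ (2 - 1) * t ^ (1 - 1) = x * x * y * (z :: complex poly)" for x y z t
      by (simp add: power2_eq_square)
    have "197 * (lam L A ^ 2 + 3 * lam L A) ^ 2 + 604 * (lam L A ^ 2 + 3 * lam L A) + 432 = 0"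
      by (rule cs_type_3221[OF E[unfolded sq] comm refl]) (use p in simp_all)
    then have "poly [:432, 1812, 2377, 1182, 197:] (lam L A) = 0" by simp algebra
    then show ?thesis unfolding cs_bad_def by blast
  qed
  show "cs_bad (lam L A) \<or> lam L A ^ 2 + 3 * lam L A + 1 = 0"
    if m: "mu Q1 = 5" "mu Q2 = 5" "mu Q3 = 3" "mu Q4 = 3"
  proof -
    have "mu Q1 = 3 + 2" "mu Q2 = 3 + 2" "mu Q3 = 1 + 2" "mu Q4 = 1 + 2" using m by simp_all
    note e = this n(3) n(3) n(1) n(1) n(6)
    obtain p1 p2 p3 p4 c where p: "p1 \<noteq> 0" "p2 \<noteq> 0" "p3 \<noteq> 0" "p4 \<noteq> 0" "lam L A \<noteq> 0" "lam L A \<noteq> 1"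
      and E: "\<And>k. (lam L A + of_nat k) * (lam L A + of_nat k - 1) * coeff ([:-p1, 1:] * [:-p2, 1:] * [:-p3, 1:] * [:-p4, 1:]) k
         = c * coeff ([:-p1, 1:] ^ (3 - 1) * [:-p2, 1:] ^ (3 - 1) * [:-p3, 1:] ^ (1 - 1) * [:-p4, 1:] ^ (1 - 1)) k"
      by (rule two[OF e], rule that)
    have sq: "x ^ (3 - 1) * y ^ (3 - 1) * z ^ (1 - 1) * t ^ (1 - 1) = x * y * x * (y :: complex poly)" for x y z t
      by (simp add: power2_eq_square mult_ac)
    have "2 * lam L A + 3 = 0 \<or> lam L A ^ 2 + 3 * lam L A + 1 = 0"
      by (rule cs_type_3311[OF E[unfolded sq] refl refl]) (use p in simp_all)
    then show ?thesis using b3 by blast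
  qed
qed

lemma sorted_points:
  assumes L: "L \<in> Inv"
  obtains P1 P2 P3 P4 P5 P6 where "pts L = {P1, P2, P3, P4, P5, P6}" "distinct [P1, P2, P3, P4, P5, P6]"
    "mu P1 \<ge> mu P2" "mu P2 \<ge> mu P3" "mu P3 \<ge> mu P4" "mu P4 \<ge> mu P5" "mu P5 \<ge> mu P6" "mu P6 \<ge> 2" "mu P1 \<le> 6"
    "mu P1 + mu P2 + mu P3 + mu P4 + mu P5 + mu P6 = 20"
    "lam L P1 + lam L P2 + lam L P3 + lam L P4 + lam L P5 + lam L P6 = 1"
proof -
  have fin: "finite (pts L)" using line_main(1)[OF L] card_ge_0_finite by force
  obtain xs where xs: "set xs = pts L" "distinct xs" using finite_distinct_list[OF fin] by blast
  define ys where "ys = rev (sort_key mu xs)"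
  have ys: "set ys = pts L" "distinct ys" "sorted_wrt (\<ge>) (map mu ys)"
    using xs sorted_sort_key[of mu xs]
    unfolding ys_def rev_map[symmetric] sorted_wrt_rev by simp_all
  have "length ys = 6" using line_main(1)[OF L] ys distinct_card by fastforce
  then obtain P1 P2 P3 P4 P5 P6 where P: "ys = [P1, P2, P3, P4, P5, P6]"
    by (auto simp: length_Suc_conv numeral_eq_Suc)
  have set: "pts L = {P1, P2, P3, P4, P5, P6}" and d: "distinct [P1, P2, P3, P4, P5, P6]" using ys P by auto
  show thesis
  proof (rule that[OF set d])
    show "mu P1 \<ge> mu P2" "mu P2 \<ge> mu P3" "mu P3 \<ge> mu P4" "mu P4 \<ge> mu P5" "mu P5 \<ge> mu P6" using ys(3) P by simp_all
    show "mu P6 \<ge> 2" "mu P1 \<le> 6" using line_main(4)[OF L] set by auto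
    show "mu P1 + mu P2 + mu P3 + mu P4 + mu P5 + mu P6 = 20"
      using line_main(2)[OF L] d unfolding set by simp
    show "lam L P1 + lam L P2 + lam L P3 + lam L P4 + lam L P5 + lam L P6 = 1"
      using line_main(3)[OF L] d unfolding set by (simp add: add.assoc)
  qed
qed

definition type_44 where
  "type_44 L \<longleftrightarrow> (\<exists>P Q. P \<noteq> Q \<and> P \<in> pts L \<and> Q \<in> pts L \<and> mu P = 6 \<and> mu Q = 6)"

definition type_3311 where
  "type_3311 L \<longleftrightarrow> card {P \<in> pts L. mu P = 5} = 2 \<and> card {P \<in> pts L. mu P = 3} = 2 \<and> (\<forall>P\<in>pts L. mu P \<in> {2, 3, 5})"

text \<open>Subtraction of 2 from each number leaves the partitions of 8 into at most four parts of
  size at most 4. The lemma serves lines with two nodes, whose other four multiplicities have sum 20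
  - 4.\<close>

lemma multiplicities:
  fixes a b c d :: nat
  assumes "a \<le> 6" "b \<le> a" "c \<le> b" "d \<le> c" "2 \<le> d" "a + b + c + d = 16"
  shows "(a, b, c, d) \<in> {(6,6,2,2), (6,5,3,2), (6,4,4,2), (6,4,3,3), (5,5,4,2), (5,5,3,3), (5,4,4,3), (4,4,4,4)}"
proof -
  have all: "\<forall>a\<in>set [2..<7]. \<forall>b\<in>set [2..<7]. \<forall>c\<in>set [2..<7]. \<forall>d\<in>set [2..<7]. b \<le> a \<longrightarrow> c \<le> b \<longrightarrow> d \<le> c \<longrightarrow>
     a + b + c + d = 16 \<longrightarrow>
     (a, b, c, d) = (6,6,2,2) \<or> (a, b, c, d) = (6,5,3,2) \<or> (a, b, c, d) = (6,4,4,2) \<or> (a, b, c, d) = (6,4,3,3) \<or>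
     (a, b, c, d) = (5,5,4,2) \<or> (a, b, c, d) = (5,5,3,3) \<or> (a, b, c, d) = (5,4,4,3) \<or> (a, b, c, d) = (4,4,4,4)"
    by code_simp
  have mem: "a \<in> set [2..<7]" "b \<in> set [2..<7]" "c \<in> set [2..<7]" "d \<in> set [2..<7]" using assms by auto
  have "(a, b, c, d) = (6,6,2,2) \<or> (a, b, c, d) = (6,5,3,2) \<or> (a, b, c, d) = (6,4,4,2) \<or> (a, b, c, d) = (6,4,3,3) \<or>
     (a, b, c, d) = (5,5,4,2) \<or> (a, b, c, d) = (5,5,3,3) \<or> (a, b, c, d) = (5,4,4,3) \<or> (a, b, c, d) = (4,4,4,4)"
    using all[rule_format, OF mem assms(2,3,4,6)] .
  then show ?thesis by (elim disjE) simp_all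
qed

lemma line_types:
  assumes L: "L \<in> Inv"
  shows "\<exists>A\<in>pts L. mu A = 2"
    "\<And>A. A \<in> pts L \<Longrightarrow> mu A = 2 \<Longrightarrow> cs_bad (lam L A) \<or> 4 * lam L A + 1 = 0 \<and> type_44 L \<or>
      lam L A + 4 = 0 \<or> lam L A ^ 2 + 3 * lam L A + 1 = 0 \<and> type_3311 L"
proof -
  obtain P1 P2 P3 P4 P5 P6 where pts: "pts L = {P1, P2, P3, P4, P5, P6}" "distinct [P1, P2, P3, P4, P5, P6]"
    and m: "mu P1 \<ge> mu P2" "mu P2 \<ge> mu P3" "mu P3 \<ge> mu P4" "mu P4 \<ge> mu P5" "mu P5 \<ge> mu P6" "mu P6 \<ge> 2" "mu P1 \<le> 6"
      "mu P1 + mu P2 + mu P3 + mu P4 + mu P5 + mu P6 = 20"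
    and lam: "lam L P1 + lam L P2 + lam L P3 + lam L P4 + lam L P5 + lam L P6 = 1"
    using sorted_points[OF L] by blast
  have P: "P1 \<in> pts L" "P2 \<in> pts L" "P3 \<in> pts L" "P4 \<in> pts L" "P5 \<in> pts L" "P6 \<in> pts L" using pts by auto
  have lam1: "lam L Q = 1" if "Q \<in> pts L" "mu Q \<ge> 3" for Q using line_main(5)[OF L that] .
  \<comment> \<open>Without a node all six indices would be 1, but their sum is 1.\<close>
  have m6: "mu P6 = 2"
  proof (rule ccontr)
    assume "mu P6 \<noteq> 2"
    then have "mu P6 \<ge> 3" using m by simp
    then have "lam L P1 = 1" "lam L P2 = 1" "lam L P3 = 1" "lam L P4 = 1" "lam L P5 = 1" "lam L P6 = 1"
      using m by (auto intro!: lam1 P)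
    then show False using lam by simp
  qed
  then show "\<exists>A\<in>pts L. mu A = 2" using P by blast
  show "cs_bad (lam L A) \<or> 4 * lam L A + 1 = 0 \<and> type_44 L \<or>
      lam L A + 4 = 0 \<or> lam L A ^ 2 + 3 * lam L A + 1 = 0 \<and> type_3311 L" if AA: "A \<in> pts L" "mu A = 2" for A
  proof (cases "mu P5 = 2")
    case False
    then have "mu P5 \<ge> 3" using m by simp
    then have ge: "mu P1 \<ge> 3" "mu P2 \<ge> 3" "mu P3 \<ge> 3" "mu P4 \<ge> 3" "mu P5 \<ge> 3" using m by auto
    then have "lam L P1 = 1" "lam L P2 = 1" "lam L P3 = 1" "lam L P4 = 1" "lam L P5 = 1"
      by (simp_all add: lam1 P)
    \<comment> \<open>A single node has to compensate five indices 1, whatever the five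
      multiplicities are.\<close>
    then have "5 + lam L P6 = 1" using lam by simp
    then have "lam L P6 + 4 = 0" by algebra
    moreover have "A = P6" using AA ge unfolding pts(1) by auto
    ultimately show ?thesis by blast
  next
    case m5: True
    have ne: "A \<noteq> Q" if "mu Q \<noteq> 2" for Q using AA that by auto
    have d: "P1 \<noteq> P2" "P3 \<noteq> P1" "P3 \<noteq> P2" "P4 \<noteq> P1" "P4 \<noteq> P2" "P4 \<noteq> P3" using pts(2) by auto
    have 56: "A = P5 \<or> A = P6 \<or> mu P4 = 2" using AA m unfolding pts(1) by auto
    have "distinct (rotate 4 [P1, P2, P3, P4, P5, P6])" "set (rotate 4 [P1, P2, P3, P4, P5, P6]) = set [P1, P2, P3, P4, P5, P6]"
      using pts(2) by (simp_all only: distinct_rotate set_rotate)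
    then have pts5: "pts L = {P5, P6, P1, P2, P3, P4}" "distinct [P5, P6, P1, P2, P3, P4]"
      unfolding pts(1) by (simp_all add: numeral_eq_Suc)
    have pts6: "pts L = {P6, P5, P1, P2, P3, P4}" unfolding pts5(1) by (rule insert_commute)
    have pts6: "pts L = {P6, P5, P1, P2, P3, P4}" "distinct [P6, P5, P1, P2, P3, P4]"
      using pts6 pts5(2) by (simp_all only: distinct.simps list.set insert_iff empty_iff) blast
    have "(mu P1, mu P2, mu P3, mu P4) \<in> {(6,6,2,2), (6,5,3,2), (6,4,4,2), (6,4,3,3), (5,5,4,2), (5,5,3,3), (5,4,4,3), (4,4,4,4)}"
      by (rule multiplicities) (use m m5 m6 in auto)
    then consider (A) "mu P1 = 6" "mu P2 = 6"
      | (three) "mu P1 = 6 \<and> mu P2 = 5 \<and> mu P3 = 3 \<or> mu P1 = 6 \<and> mu P2 = 4 \<and> mu P3 = 4 \<or> mu P1 = 5 \<and> mu P2 = 5 \<and> mu P3 = 4"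
      | (D) "mu P1 = 6" "mu P2 = 4" "mu P3 = 3" "mu P4 = 3"
      | (G) "mu P1 = 5" "mu P2 = 5" "mu P3 = 3" "mu P4 = 3"
      | (H) "mu P1 = 5" "mu P2 = 4" "mu P3 = 4" "mu P4 = 3"
      | (J) "mu P1 = 4" "mu P2 = 4" "mu P3 = 4" "mu P4 = 4"
      by (elim insertE emptyE) simp_all
    then show ?thesis
    proof cases
      case A
      have "A \<noteq> P1" "A \<noteq> P2" using ne A by simp_all
      then have "4 * lam L A + 1 = 0" by (rule lam_44[OF L P(1,2) AA(1) d(1) _ _ A])
      moreover have "type_44 L" unfolding type_44_def using A P d(1) by blast
      ultimately show ?thesis by blast
    next
      case three
      then have "mu P1 \<noteq> 2" "mu P2 \<noteq> 2" "mu P3 \<noteq> 2" by auto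
      then have "A \<noteq> P1" "A \<noteq> P2" "A \<noteq> P3" using ne by blast+
      then have "cs_bad (lam L A)" using three
        by (intro lam_three_bad[OF L P(1,2,3) d(1-3) AA(1)]) (assumption | (elim disjE; simp))+
      then show ?thesis ..
    next
      case D
      then have "A \<noteq> P1" "A \<noteq> P2" "A \<noteq> P3" "P4 \<noteq> A" using ne[of P1] ne[of P2] ne[of P3] ne[of P4] by auto
      then have "cs_bad (lam L A)"
      proof (intro lam_three_bad[OF L P(1,2,3) d(1-3) AA(1)])
        have "\<exists>U. U \<in> pts L \<and> U \<noteq> P1 \<and> U \<noteq> P2 \<and> U \<noteq> P3 \<and> U \<noteq> A \<and> mu U = 3"
          using P(4) d(4-6) D \<open>P4 \<noteq> A\<close> by (intro exI[of _ P4]) simp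
        then show "mu P1 = 6 \<and> mu P2 = 5 \<and> mu P3 = 3 \<or> mu P1 = 6 \<and> mu P2 = 4 \<and> mu P3 = 4 \<or>
          mu P1 = 5 \<and> mu P2 = 5 \<and> mu P3 = 4 \<or> mu P1 = 6 \<and> mu P2 = 4 \<and> mu P3 = 3 \<and>
          (\<exists>U. U \<in> pts L \<and> U \<noteq> P1 \<and> U \<noteq> P2 \<and> U \<noteq> P3 \<and> U \<noteq> A \<and> mu U = 3)"
          using D by simp
      qed
      then show ?thesis ..
    next
      case G
      then have "A = P5 \<or> A = P6" using 56 by auto
      then have "cs_bad (lam L A) \<or> lam L A ^ 2 + 3 * lam L A + 1 = 0"
        using lam_two_values(3)[OF L pts5 m5 m6 G] lam_two_values(3)[OF L pts6 m6 m5 G] by blast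
      moreover have "{P \<in> pts L. mu P = 5} = {P1, P2}" "{P \<in> pts L. mu P = 3} = {P3, P4}"
        using G m5 m6 unfolding pts(1) by auto
      then have "type_3311 L" using pts G m5 m6 d unfolding type_3311_def by auto
      ultimately show ?thesis by blast
    next
      case H
      then have "A = P5 \<or> A = P6" using 56 by auto
      then have "cs_bad (lam L A)"
        using lam_two_values(2)[OF L pts5 m5 m6 H] lam_two_values(2)[OF L pts6 m6 m5 H] by blast
      then show ?thesis ..
    next
      case J
      then have "A = P5 \<or> A = P6" using 56 by auto
      then have "cs_bad (lam L A)"
        using lam_two_values(1)[OF L pts5 m5 m6 J] lam_two_values(1)[OF L pts6 m6 m5 J] by blast
      then show ?thesis ..
    qed
  qed
qed

section \<open>Incidence geometry of the invariant lines\<close>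

lemma pts_subset: assumes "P \<in> pts L" "L \<in> Inv" shows "P \<subseteq> L"
proof -
  obtain p where "P = vec.span {p}" "p \<in> L" using assms by (auto simp: pts_def)
  then show ?thesis using span_subset_iff[OF assms(2)] by simp
qed

lemma pts_mem: assumes "P \<in> pts L" "M \<in> Inv" "P \<subseteq> M" "L \<in> Inv" shows "P \<in> pts M"
proof -
  obtain p where p: "P = vec.span {p}" "p \<noteq> 0" "mu P \<ge> 2" using assms by (auto simp: pts_def)
  then have "p \<in> M" using span_subset_iff[OF assms(2)] assms(3) by simp
  then show ?thesis using p by (auto simp: pts_def)
qed

lemma point_unique:
  assumes "L \<in> Inv" "M \<in> Inv" "L \<noteq> M" "P \<in> pts L" "Q \<in> pts K" "P \<subseteq> M" "Q \<subseteq> L" "Q \<subseteq> M"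
  shows "P = Q"
proof -
  obtain p where p: "p \<noteq> 0" "P = vec.span {p}" using assms(4) by (auto simp: pts_def)
  obtain q where q: "q \<noteq> 0" "Q = vec.span {q}" using assms(5) by (auto simp: pts_def)
  let ?c = "cr (nrm L) (nrm M)"
  have c: "?c \<noteq> 0" by (rule cr_nrm[OF assms(1-3)])
  have i: "L \<inter> M = vec.span {?c}" using line_Int_line[OF c] nrm assms by simp
  have "P \<subseteq> vec.span {?c}" "Q \<subseteq> vec.span {?c}" using assms pts_subset[OF assms(4,1)] i by blast+
  then have "p \<in> vec.span {?c}" "q \<in> vec.span {?c}" unfolding p q by (meson subsetD vec.span_base insertI1)+
  then have "vec.span {p} = vec.span {?c}" "vec.span {q} = vec.span {?c}"
    using span_single_eq_iff[OF p(1) c] span_single_eq_iff[OF q(1) c] by (auto simp: span_single)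
  then show ?thesis using p q by simp
qed

lemma other_line:
  assumes "P \<in> pts L" "L \<in> Inv" obtains M where "M \<in> Inv" "M \<noteq> L" "P \<in> pts M" "P \<subseteq> M"
proof -
  have "mu P \<ge> 2" using line_main(4) assms by blast
  moreover have "card {M \<in> Inv. P \<subseteq> M} \<le> 1" if "{M \<in> Inv. P \<subseteq> M} \<subseteq> {L}"
    using card_mono[OF _ that] by simp
  ultimately obtain M where "M \<in> Inv" "P \<subseteq> M" "M \<noteq> L" unfolding mu_def by fastforce
  then show thesis using that pts_mem assms by blast
qed

text \<open>The direction of each line is a transversal direction for the other one. Exchanging them
  exchanges numerator and denominator of the index.\<close>

lemma lam_reciprocal:
  assumes "L \<in> Inv" "M \<in> Inv" "L \<noteq> M" "P \<in> pts L" "P \<subseteq> M"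
  shows "lam L P * lam M P = 1"
proof -
  obtain p where p: "p \<noteq> 0" "P = vec.span {p}" "p \<in> L" "w p = 0" using assms ptsE by metis
  have pM: "p \<in> M" using assms p span_subset_iff by blast
  obtain u where u: "u \<in> L" "cr p u \<noteq> 0" using line_point_E[of "nrm L" p] nrm[OF assms(1)] p by metis
  obtain v where v: "v \<in> M" "cr p v \<noteq> 0" using line_point_E[of "nrm M" p] nrm[OF assms(2)] p pM by metis
  have L: "L = line_of (cr p u)" using line_of_through[OF u(2), of "nrm L"] u p nrm assms by simp
  have M: "M = line_of (cr p v)" using line_of_through[OF v(2), of "nrm M"] v pM nrm assms by simp
  have uv: "dot3 (cr p u) v \<noteq> 0"
  proof
    assume "dot3 (cr p u) v = 0"
    then have "v \<in> L" using L by (simp add: line_of_def)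
    then have "L = line_of (cr p v)" using line_of_through[OF v(2), of "nrm L"] p nrm assms by simp
    then show False using M assms by simp
  qed
  have vu: "dot3 (cr p v) u = - dot3 (cr p u) v" by (simp add: dot3_3 algebra_simps)
  have "dform_nz w p u v" using line_main(7)[OF assms(1) u(2) L uv] assms p by simp
  moreover have "lam L P = cs w p u v" unfolding p(2) by (rule lam_eq[OF assms(1) p(4) u(2) L uv])
  moreover have "lam M P = cs w p v u" unfolding p(2) by (rule lam_eq[OF assms(2) p(4) v(2) M]) (use uv vu in simp)
  ultimately show ?thesis by (simp add: cs_def dform_nz_def)
qed

lemma cs_goodI: "4 * x + 1 = 0 \<Longrightarrow> cs_good x" "x + 4 = 0 \<Longrightarrow> cs_good x" "x ^ 2 + 3 * x + 1 = 0 \<Longrightarrow> cs_good x"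
proof -
  show "cs_good x" if "4 * x + 1 = 0"
  proof -
    have "poly [:1, 4:] x = 0" using that by (simp add: algebra_simps)
    then show ?thesis unfolding cs_good_def by blast
  qed
  show "cs_good x" if "x + 4 = 0"
  proof -
    have "poly [:4, 1:] x = 0" using that by (simp add: algebra_simps)
    then show ?thesis unfolding cs_good_def by blast
  qed
  show "cs_good x" if "x ^ 2 + 3 * x + 1 = 0"
  proof -
    have "poly [:1, 3, 1:] x = 0" using that by (simp add: algebra_simps power2_eq_square)
    then show ?thesis unfolding cs_good_def by blast
  qed
qed

text \<open>The second invariant line through the node \<open>A\<close> has the reciprocal index
  there, and a value satisfying \<open>cs_bad\<close> has no admissible reciprocal.\<close>

lemma good_types:
  assumes "L \<in> Inv" "A \<in> pts L" "mu A = 2"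
  shows "4 * lam L A + 1 = 0 \<and> type_44 L \<or> lam L A + 4 = 0 \<or> lam L A ^ 2 + 3 * lam L A + 1 = 0 \<and> type_3311 L"
proof -
  obtain M where M: "M \<in> Inv" "M \<noteq> L" "A \<in> pts M" "A \<subseteq> M" using other_line assms by blast
  have "lam L A * lam M A = 1" by (rule lam_reciprocal) (use M assms in auto)
  moreover have "cs_bad (lam M A) \<or> cs_good (lam M A)" using line_types(2)[OF M(1,3) assms(3)] cs_goodI by blast
  ultimately have "\<not> cs_bad (lam L A)" using cs_bad_not_reciprocal by blast
  then show ?thesis using line_types(2)[OF assms] by blast
qed

text \<open>The reciprocal of -4 is -1/4, and among the remaining possibilities this value occurs
  only on lines with two 6-fold points.\<close>

lemma partner:
  assumes "L \<in> Inv" "A \<in> pts L" "mu A = 2" "lam L A + 4 = 0"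
  obtains M where "M \<in> Inv" "M \<noteq> L" "A \<in> pts M" "type_44 M"
proof -
  obtain M where M: "M \<in> Inv" "M \<noteq> L" "A \<in> pts M" "A \<subseteq> M" using other_line assms by blast
  have r: "lam L A * lam M A = 1" by (rule lam_reciprocal) (use M assms in auto)
  have l: "lam L A = - 4" using assms(4) by (simp add: eq_neg_iff_add_eq_0)
  have "lam M A = - (1 / 4)" using r unfolding l by (simp add: field_simps) algebra
  then have "type_44 M" using good_types[OF M(1,3) assms(3)] by (auto simp: power2_eq_square)
  then show thesis using that M by blast
qed

text \<open>Let \<open>K\<close> be a line with 6-fold points \<open>P\<close> and \<open>Q\<close>.
  A second line \<open>M\<close> through \<open>P\<close> cannot be of type 3311. So either
  \<open>M\<close> itself or the second line through a node of \<open>M\<close> is another line with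
  two 6-fold points, and these cannot both lie on \<open>K\<close>.\<close>

lemma six_fold_triangle:
  assumes L: "L \<in> Inv" and not: "\<not> type_3311 L"
  obtains P Q R K M where "K \<in> Inv" "P \<in> pts K" "Q \<in> pts K" "P \<noteq> Q" "mu P = 6" "mu Q = 6"
    "R \<in> pts M" "M \<in> Inv" "\<not> R \<subseteq> K" "mu R = 6"
proof -
  obtain A where A: "A \<in> pts L" "mu A = 2" using line_types(1)[OF L] by blast
  have "\<exists>K\<in>Inv. type_44 K" using good_types[OF L A] partner[OF L A] not L by metis
  then obtain K where K: "K \<in> Inv" "type_44 K" by blast
  obtain P Q where PQ: "P \<noteq> Q" "P \<in> pts K" "Q \<in> pts K" "mu P = 6" "mu Q = 6" using K(2) unfolding type_44_def by blast
  obtain M where M: "M \<in> Inv" "M \<noteq> K" "P \<in> pts M" "P \<subseteq> M" using other_line[OF PQ(2) K(1)] by blast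
  obtain B where B: "B \<in> pts M" "mu B = 2" using line_types(1)[OF M(1)] by blast
  have M1: "\<not> type_3311 M"
  proof
    assume "type_3311 M"
    then have "mu P \<in> {2, 3, 5}" using M(3) unfolding type_3311_def by blast
    then show False using PQ by simp
  qed
  have triangle: "\<exists>N R. N \<in> Inv \<and> R \<in> pts N \<and> \<not> R \<subseteq> K \<and> mu R = 6" if N: "N \<in> Inv" "N \<noteq> K" "type_44 N" for N
  proof -
    obtain S T where ST: "S \<noteq> T" "S \<in> pts N" "T \<in> pts N" "mu S = 6" "mu T = 6" using N(3) unfolding type_44_def by blast
    have "\<not> (S \<subseteq> K \<and> T \<subseteq> K)"
      using point_unique[OF N(1) K(1) N(2) ST(2,3)] pts_subset ST N by blast
    then show ?thesis using N ST by blast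
  qed
  have "\<exists>N. N \<in> Inv \<and> N \<noteq> K \<and> type_44 N"
  proof (cases "type_44 M")
    case True
    then show ?thesis using M by blast
  next
    case False
    then have "lam M B + 4 = 0" using good_types[OF M(1) B] M1 by blast
    from partner[OF M(1) B this] obtain N where N: "N \<in> Inv" "N \<noteq> M" "B \<in> pts N" "type_44 N" .
    have "N \<noteq> K"
    proof
      assume "N = K"
      then have "B \<subseteq> K" using N pts_subset by blast
      then have "B = P" using point_unique[OF M(1) K(1) M(2) B(1) PQ(2)] M pts_subset PQ K by blast
      then show False using B PQ by simp
    qed
    then show ?thesis using N by blast
  qed
  then obtain N R where "N \<in> Inv" "R \<in> pts N" "\<not> R \<subseteq> K" "mu R = 6" using triangle by blast
  then show thesis using that K PQ by blast
qed

end

section \<open>Normal forms\<close>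

definition cols :: "complex^3 \<Rightarrow> complex^3 \<Rightarrow> complex^3 \<Rightarrow> complex^3^3" where
  "cols a b c = vector [vector [a$1, b$1, c$1], vector [a$2, b$2, c$2], vector [a$3, b$3, c$3]]"

lemma cols_mult: "cols a b c *v v = v$1 *s a + v$2 *s b + v$3 *s c"
  by (simp add: vec3_eq_iff cols_def matrix_vector_mult_def sum_3 mult.commute)

lemma invertible_cols:
  assumes "dot3 (cr a b) c \<noteq> 0" shows "invertible (cols a b c)"
proof -
  have "det (cols a b c) = dot3 (cr a b) c"
    by (simp add: det_3 cols_def dot3_3 algebra_simps)
  then show ?thesis using assms by (simp add: invertible_det_nz)
qed

lemma pullback_mult: "pullback N (pullback M w) = pullback (M ** N) w"
  by (rule ext) (simp only: pullback_def matrix_transpose_mul matrix_vector_mul_assoc[symmetric])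

lemma vec3_eqI_dot3:
  assumes "dot3 u (vector [1,0,0]) = dot3 v (vector [1,0,0])" "dot3 u (vector [0,1,0]) = dot3 v (vector [0,1,0])"
    "dot3 u (vector [0,0,1]) = dot3 v (vector [0,0,1])"
  shows "u = v"
  using assms by (simp add: vec3_eq_iff dot3_3)

lemma pullback_cols:
  "pullback (cols a b c) w v = vector [dot3 (w (cols a b c *v v)) a, dot3 (w (cols a b c *v v)) b, dot3 (w (cols a b c *v v)) c]"
  by (rule vec3_eqI_dot3; simp only: dot3_pullback; simp add: cols_mult dot3_3)

lemma (in hom_form) hom_form_pullback: "hom_form (pullback M w) e"
proof
  fix i :: 3
  have e: "(\<lambda>v. pullback M w v $ i) = (\<lambda>v. dot3 (w (M *v v)) (M *v axis i 1))"
  proof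
    fix v
    have "dot3 u (axis i 1) = u $ i" for u :: "complex^3"
      by (simp add: dot3_def axis_def if_distrib[of "\<lambda>x. _ * x"] cong: if_cong)
    then show "pullback M w v $ i = dot3 (w (M *v v)) (M *v axis i 1)" using dot3_pullback[of M w v "axis i 1"] by simp
  qed
  show "hp e (\<lambda>v. pullback M w v $ i)" unfolding e
  proof (rule hp_subst[OF hp_w])
    show "hp (Suc 0) (\<lambda>v. (M *v v) $ j)" for j
      by (simp add: matrix_vector_mult_def sum_3) (intro hp_add hp_cmult hp_nth)
  qed
qed (simp add: dot3_pullback radial)

section \<open>The Fermat normal form\<close>

lemma fourth_root: "\<exists>z::complex. z ^ 4 = c"
proof
  have "csqrt (csqrt c) ^ (2 * 2) = (csqrt (csqrt c) ^ 2) ^ 2" by (rule power_mult)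
  then show "csqrt (csqrt c) ^ 4 = c" unfolding power2_csqrt by simp
qed

lemma fermat5_nth:
  "fermat5 v $ 1 = v$2 * v$3 ^ 5 - v$3 * v$2 ^ 5"
  "fermat5 v $ 2 = v$3 * v$1 ^ 5 - v$1 * v$3 ^ 5"
  "fermat5 v $ 3 = v$1 * v$2 ^ 5 - v$2 * v$1 ^ 5"
  by (simp_all add: fermat5_def homogenized_form_def) algebra+

text \<open>Replace \<open>y\<close>, \<open>z\<close> by \<open>t y\<close>, \<open>t z\<close> and
  compare the coefficients of \<open>t^6\<close>: only the terms of degree 5 of \<open>f\<close> and
  \<open>g\<close> contribute.\<close>

lemma homogeneous_split:
  fixes F :: "complex \<Rightarrow> complex \<Rightarrow> complex"
  assumes F: "\<And>y z. F y z = y * poly f z + z * poly g y" and h: "\<And>t y z. F (t * y) (t * z) = t ^ 6 * F y z"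
  shows "F y z = coeff f 5 * y * z ^ 5 + coeff g 5 * z * y ^ 5"
proof -
  define P where "P = smult y (pcompose f [:0, z:]) + smult z (pcompose g [:0, y:])"
  have "poly ([:0, 1:] * P) t = poly (monom (F y z) 6) t" for t
    using h[of t y z] by (simp add: P_def F poly_pcompose poly_monom algebra_simps)
  then have "[:0, 1:] * P = monom (F y z) 6" using poly_eq_poly_eq_iff by blast
  then have "coeff (pCons 0 P) 6 = F y z" by simp
  moreover have "coeff (pCons 0 P) (Suc 5) = coeff P 5" by (rule coeff_pCons_Suc)
  ultimately have "coeff P 5 = F y z" by simp
  moreover have "coeff P 5 = y * (z ^ 5 * coeff f 5) + z * (y ^ 5 * coeff g 5)"
    by (simp add: P_def coeff_pcompose_linear)
  ultimately show ?thesis by (simp add: mult_ac)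
qed

context reduced_convex_form
begin

text \<open>Of the six invariant lines through \<open>p\<close>, at most two contain
  \<open>q\<close> or \<open>r\<close>. Any other one gives a relation
  \<open>\<alpha> z'^4 + \<beta> y'^4 = 0\<close> with nonzero \<open>y'\<close>, \<open>z'\<close>,
  so one coefficient can vanish only together with the other.\<close>

lemma six_fold_coefficients:
  assumes d: "dot3 (cr p q) r \<noteq> 0" and mu: "mu (vec.span {p}) = 6"
    and F: "\<And>x y z. dot3 (w (x *s p + y *s q + z *s r)) p = \<alpha> * y * z ^ 5 + \<beta> * z * y ^ 5"
  shows "\<alpha> \<noteq> 0" "\<beta> \<noteq> 0"
proof -
  have p0: "p \<noteq> 0" using d by auto
  have pq: "cr p q \<noteq> 0" using d by auto
  have pr: "cr p r \<noteq> 0"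
  proof
    assume "cr p r = 0"
    then obtain c where "r = c *s p" using cr_eq_0D p0 by blast
    then show False using d by simp
  qed
  have card: "card {L \<in> Inv. p \<in> L} = 6" using mu mu_span by simp
  obtain v where v: "dot3 (w v) p \<noteq> 0" using not_all_tangent[OF p0] by blast
  obtain x y z where xyz: "v = x *s p + y *s q + z *s r" using basis_E[OF d] .
  have nz: "\<alpha> \<noteq> 0 \<or> \<beta> \<noteq> 0" using v F[of x y z] xyz by auto
  have *: "\<exists>L\<in>Inv. p \<in> L \<and> q \<notin> L \<and> r \<notin> L"
  proof (rule ccontr)
    assume n: "\<not> ?thesis"
    have "{L \<in> Inv. p \<in> L} \<subseteq> {line_of (cr p q), line_of (cr p r)}"
    proof
      fix L assume L: "L \<in> {L \<in> Inv. p \<in> L}"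
      with n have "q \<in> L \<or> r \<in> L" by blast
      then show "L \<in> {line_of (cr p q), line_of (cr p r)}"
        using line_of_through[OF pq, of "nrm L"] line_of_through[OF pr, of "nrm L"] L nrm by auto
    qed
    then have "card {L \<in> Inv. p \<in> L} \<le> card {line_of (cr p q), line_of (cr p r)}" by (intro card_mono) auto
    also have "\<dots> \<le> 2" by (simp add: card_insert_if)
    finally show False using card by simp
  qed
  then obtain L where L: "L \<in> Inv" "p \<in> L" "q \<notin> L" "r \<notin> L" by blast
  define y' z' where "y' = dot3 (nrm L) r" and "z' = - dot3 (nrm L) q"
  have nz': "y' \<noteq> 0" "z' \<noteq> 0" using L mem_iff by (auto simp: y'_def z'_def)
  have "0 *s p + y' *s q + z' *s r \<in> L" using mem_iff[OF L(1)] by (simp add: y'_def z'_def)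
  then have "dot3 (w (0 *s p + y' *s q + z' *s r)) p = 0" using InvD L by blast
  then have "y' * z' * (\<alpha> * z' ^ 4 + \<beta> * y' ^ 4) = 0" unfolding F by algebra
  then have "\<alpha> * z' ^ 4 + \<beta> * y' ^ 4 = 0" using nz' by simp
  then show "\<alpha> \<noteq> 0" "\<beta> \<noteq> 0" using nz nz' by auto
qed

text \<open>At a 6-fold point, \<open>dot3 (w v) p\<close> is a constant times the product of the
  six linear forms of the lines through \<open>p\<close>, and these do not change when a multiple of
  \<open>p\<close> is added to \<open>v\<close>.\<close>

lemma tangency_independent:
  assumes "mu (vec.span {p}) = 6" "p \<noteq> 0"
  shows "dot3 (w (x *s p + v)) p = dot3 (w v) p"
proof -
  obtain g where g: "hp (6 - mu (vec.span {p})) g"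
    "\<And>v. dot3 (w v) p = (\<Prod>L \<in> {L \<in> Inv. p \<in> L}. dot3 (nrm L) v) * g v"
    using tangency_factor[OF assms(2)] by blast
  obtain k where k: "\<And>t. g (v + t *s (x *s p)) = poly k t" "degree k \<le> 0"
    using hp_restrict[OF g(1), of v "x *s p"] assms(1) by auto
  then obtain c where "k = [:c:]" using degree_eq_zeroE by blast
  then have "g (x *s p + v) = g v" using k(1)[of 1] k(1)[of 0] by (simp add: add.commute)
  moreover have "(\<Prod>L \<in> {L \<in> Inv. p \<in> L}. dot3 (nrm L) (x *s p + v)) = (\<Prod>L \<in> {L \<in> Inv. p \<in> L}. dot3 (nrm L) v)"
    by (rule prod.cong) (auto simp: mem_iff)
  ultimately show ?thesis by (simp add: g(2))
qed

text \<open>In the frame \<open>p\<close>, \<open>q\<close>, \<open>r\<close> each component depends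
  on two coordinates only, and the radial relation leaves two monomials in each. What is left of
  that relation makes the coefficients antisymmetric, and a diagonal change of coordinates
  normalises them.\<close>

lemma fermat_form:
  assumes d: "dot3 (cr p q) r \<noteq> 0"
    and mu: "mu (vec.span {p}) = 6" "mu (vec.span {q}) = 6" "mu (vec.span {r}) = 6"
  shows "conjugate_foliations w fermat5"
proof -
  have p0: "p \<noteq> 0" "q \<noteq> 0" "r \<noteq> 0" using d by auto
  define F1 where "F1 y z = dot3 (w (y *s q + z *s r)) p" for y z
  define F2 where "F2 x z = dot3 (w (x *s p + z *s r)) q" for x z
  define F3 where "F3 x y = dot3 (w (x *s p + y *s q)) r" for x y
  have W1: "dot3 (w (x *s p + y *s q + z *s r)) p = F1 y z" for x y z
    using tangency_independent[OF mu(1) p0(1), of x "y *s q + z *s r"] by (simp add: F1_def add.assoc)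
  have W2: "dot3 (w (x *s p + y *s q + z *s r)) q = F2 x z" for x y z
    using tangency_independent[OF mu(2) p0(2), of y "x *s p + z *s r"] by (simp add: F2_def add_ac)
  have W3: "dot3 (w (x *s p + y *s q + z *s r)) r = F3 x y" for x y z
    using tangency_independent[OF mu(3) p0(3), of z "x *s p + y *s q"] by (simp add: F3_def add_ac)
  have rel: "x * F1 y z + y * F2 x z + z * F3 x y = 0" for x y z
    using radial[of "x *s p + y *s q + z *s r"] by (simp only: dot3_add dot3_scale W1 W2 W3)
  have hom: "F1 (t * y) (t * z) = t ^ 6 * F1 y z" "F2 (t * y) (t * z) = t ^ 6 * F2 y z"
    "F3 (t * y) (t * z) = t ^ 6 * F3 y z" for t y z
  proof -
    have e: "(t * y) *s a + (t * z) *s b = t *s (y *s a + z *s b)" for a b :: "complex^3"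
      by (simp add: vec.scale_right_distrib)
    show "F1 (t * y) (t * z) = t ^ 6 * F1 y z" "F2 (t * y) (t * z) = t ^ 6 * F2 y z"
      "F3 (t * y) (t * z) = t ^ 6 * F3 y z" unfolding F1_def F2_def F3_def e w_scale by simp_all
  qed
  have ex: "\<exists>f. \<forall>t. dot3 (w (a + t *s b)) c = poly f t" for a b c
    using hp_restrict[OF hp_w] by blast
  obtain f1 where f1: "\<And>z. F1 1 z = poly f1 z" using ex[of q r p] by (auto simp: F1_def)
  obtain f2 where f2: "\<And>z. F2 1 z = poly f2 z" using ex[of p r q] by (auto simp: F2_def)
  obtain f3 where f3: "\<And>z. F3 1 z = poly f3 z" using ex[of p q r] by (auto simp: F3_def)
  obtain g3 where g3: "\<And>z. F3 z 1 = poly g3 z" using ex[of q p r] by (auto simp: F3_def add.commute)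
  obtain g2 where g2: "\<And>z. F2 z 1 = poly g2 z" using ex[of r p q] by (auto simp: F2_def add.commute)
  obtain g1 where g1: "\<And>z. F1 z 1 = poly g1 z" using ex[of r q p] by (auto simp: F1_def add.commute)
  have "F1 y z = y * poly (- f2) z + z * poly (- f3) y" for y z
    using rel[of 1 y z] unfolding f2 f3 by (simp add: eq_neg_iff_add_eq_0 add_ac) algebra
  from homogeneous_split[OF this hom(1)] obtain a1 b1 where 1: "\<And>y z. F1 y z = a1 * y * z ^ 5 + b1 * z * y ^ 5" by blast
  have "F2 x z = x * poly (- f1) z + z * poly (- g3) x" for x z
    using rel[of x 1 z] unfolding f1 g3 by simp algebra
  from homogeneous_split[OF this hom(2)] obtain a2 b2 where 2: "\<And>x z. F2 x z = a2 * x * z ^ 5 + b2 * z * x ^ 5" by blast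
  have "F3 x y = x * poly (- g1) y + y * poly (- g2) x" for x y
    using rel[of x y 1] unfolding g1 g2 by simp algebra
  from homogeneous_split[OF this hom(3)] obtain a3 b3 where 3: "\<And>x y. F3 x y = a3 * x * y ^ 5 + b3 * y * x ^ 5" by blast
  \<comment> \<open>The radial relation is a combination of \<open>x y z^5\<close>,
    \<open>x z y^5\<close> and \<open>y z x^5\<close>; the points (1,1,1), (1,1,2) and (1,2,1)
    separate these monomials.\<close>
  have "a1 + b1 + a2 + b2 + a3 + b3 = 0" using rel[of 1 1 1] unfolding 1 2 3 by simp algebra
  moreover have "16 * (a1 + a2) + (b1 + a3) + (b2 + b3) = 0" using rel[of 1 1 2] unfolding 1 2 3 by simp algebra
  moreover have "(a1 + a2) + 16 * (b1 + a3) + (b2 + b3) = 0" using rel[of 1 2 1] unfolding 1 2 3 by simp algebra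
  ultimately have z: "15 * (a1 + a2) = 0" "15 * (b1 + a3) = 0" "15 * (b2 + b3) = 0" by - algebra+
  have "x = 0" if "15 * x = 0" for x :: complex using that by simp
  from this[OF z(1)] this[OF z(2)] this[OF z(3)] have s: "a2 = - a1" "a3 = - b1" "b3 = - b2"
    by (simp_all add: eq_neg_iff_add_eq_0 add.commute)
  have nz1: "a1 \<noteq> 0" "b1 \<noteq> 0" using six_fold_coefficients[OF d mu(1), of a1 b1] W1 1 by auto
  have d2: "dot3 (cr q p) r \<noteq> 0" using d by (simp add: dot3_3 algebra_simps)
  have W2': "dot3 (w (y *s q + x *s p + z *s r)) q = a2 * x * z ^ 5 + b2 * z * x ^ 5" for x y z
    using W2[of x y z] 2 by (simp add: add.commute)
  have nz2: "b2 \<noteq> 0" using six_fold_coefficients(2)[OF d2 mu(2) W2'] .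
  \<comment> \<open>The scalings are chosen so that \<open>b2 s'^4 = 1\<close>,
    \<open>b1 t^4 = -1\<close> and \<open>a1 u^4 = 1\<close>; each component then acquires the
    common factor \<open>s' t u\<close>.\<close>
  obtain s' where s': "s' ^ 4 = 1 / b2" using fourth_root by blast
  obtain t where t: "t ^ 4 = - 1 / b1" using fourth_root by blast
  obtain u where u: "u ^ 4 = 1 / a1" using fourth_root by blast
  have e: "b2 * s' ^ 4 = 1" "b1 * t ^ 4 = - 1" "a1 * u ^ 4 = 1" using s' t u nz1 nz2 by simp_all
  have nz: "s' \<noteq> 0" "t \<noteq> 0" "u \<noteq> 0" using e by auto
  let ?M = "cols (s' *s p) (t *s q) (u *s r)"
  have inv: "invertible ?M" by (rule invertible_cols) (use d nz in simp)
  have "pullback ?M w v = (s' * t * u) *s fermat5 v" for v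
  proof -
    have m: "?M *v v = (v$1 * s') *s p + (v$2 * t) *s q + (v$3 * u) *s r" by (simp add: cols_mult)
    have "s' * F1 (v$2 * t) (v$3 * u) = s' * t * u * (v$2 * v$3 ^ 5 - v$3 * v$2 ^ 5)"
      unfolding 1 using e(2,3) by algebra
    moreover have "t * F2 (v$1 * s') (v$3 * u) = s' * t * u * (v$3 * v$1 ^ 5 - v$1 * v$3 ^ 5)"
      unfolding 2 s using e(1,3) by algebra
    moreover have "u * F3 (v$1 * s') (v$2 * t) = s' * t * u * (v$1 * v$2 ^ 5 - v$2 * v$1 ^ 5)"
      unfolding 3 s using e(1,2) by algebra
    ultimately show ?thesis unfolding pullback_cols m dot3_scale W1 W2 W3 by (simp add: vec3_eq_iff fermat5_nth)
  qed
  then show ?thesis unfolding conjugate_foliations_def same_foliation_def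
    using inv nz by (intro exI[of _ ?M] conjI exI[of _ "s' * t * u"]) simp_all
qed

lemma fermat_case:
  assumes "L \<in> Inv" "\<not> type_3311 L" shows "conjugate_foliations w fermat5"
proof -
  obtain P Q R K M where PQR: "K \<in> Inv" "P \<in> pts K" "Q \<in> pts K" "P \<noteq> Q" "mu P = 6" "mu Q = 6"
    "R \<in> pts M" "M \<in> Inv" "\<not> R \<subseteq> K" "mu R = 6" by (rule six_fold_triangle[OF assms], rule that)
  obtain b a where ab: "cr a b \<noteq> 0" "K = line_of (cr a b)" "P = vec.span {b}" "Q = vec.span {a}"
    using coords2[OF PQR(1-4)] by blast
  obtain r where r: "r \<noteq> 0" "R = vec.span {r}" using PQR(7) by (auto simp: pts_def)
  have "r \<notin> K" using PQR(9) span_subset_iff[OF PQR(1)] r by simp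
  then have "dot3 (cr a b) r \<noteq> 0" using ab by (simp add: line_of_def)
  then show ?thesis by (rule fermat_form) (use ab r PQR in simp_all)
qed

end

section \<open>Six points joined by invariant lines, and the Hilbert modular normal form\<close>

definition inv2 :: "(complex^3 \<Rightarrow> complex^3) \<Rightarrow> complex^3 \<Rightarrow> complex^3 \<Rightarrow> bool" where
  "inv2 w a b \<longleftrightarrow> (\<forall>x y. dot3 (w (x *s a + y *s b)) a = 0 \<and> dot3 (w (x *s a + y *s b)) b = 0)"

lemma cr_minus [simp]: "cr (- u) v = - cr u v" "cr u (- v) = - cr u v"
  by (simp_all add: vec3_eq_iff)

lemma dot3_minus [simp]: "dot3 (- u) v = - dot3 u v" "dot3 u (- v) = - dot3 u v"
  by (simp_all add: dot3_3)

lemma inv2_scale: "inv2 w a b \<Longrightarrow> inv2 w (k *s a) (l *s b)"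
  by (simp add: inv2_def)

lemma inv2_unscale:
  assumes "inv2 w (k *s a) (l *s b)" "k \<noteq> 0" "l \<noteq> 0" shows "inv2 w a b"
  using inv2_scale[OF assms(1), of "1 / k" "1 / l"] assms(2,3) by simp

lemma inv2_pullback: "inv2 w (M *v a) (M *v b) \<Longrightarrow> inv2 (pullback M w) a b"
  by (simp add: inv2_def dot3_pullback matrix_vector_right_distrib vector_scalar_commute)

lemma invariant_line_inv2: "cr a b \<noteq> 0 \<Longrightarrow> invariant_line w (line_of (cr a b)) \<longleftrightarrow> inv2 w a b"
  unfolding inv2_def by (rule invariant_line_iff)

definition concurrent :: "complex^3 \<Rightarrow> complex^3 \<Rightarrow> complex^3 \<Rightarrow> complex^3 \<Rightarrow> complex^3 \<Rightarrow> complex^3 \<Rightarrow> bool" where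
  "concurrent a b c d e f \<longleftrightarrow> (\<exists>t. t \<noteq> 0 \<and> dot3 (cr a b) t = 0 \<and> dot3 (cr c d) t = 0 \<and> dot3 (cr e f) t = 0)"

lemma concurrent_swap: "concurrent a b c d e f \<Longrightarrow> concurrent a b c d f e"
proof -
  have "dot3 (cr f e) t = - dot3 (cr e f) t" for t by (simp add: dot3_3 algebra_simps)
  then show "concurrent a b c d e f \<Longrightarrow> concurrent a b c d f e" unfolding concurrent_def by simp
qed

definition two_of_three :: "bool \<Rightarrow> bool \<Rightarrow> bool \<Rightarrow> bool" where
  "two_of_three x y z \<longleftrightarrow> x \<and> y \<or> x \<and> z \<or> y \<and> z"

lemma det_cols_mult:
  "dot3 (cr (cols f g h *v a) (cols f g h *v b)) (cols f g h *v c) = dot3 (cr f g) h * dot3 (cr a b) c"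
proof -
  have "dot3 (cr g h) f = dot3 (cr f g) h" "dot3 (cr h f) g = dot3 (cr f g) h"
    "dot3 (cr g f) h = - dot3 (cr f g) h" "dot3 (cr h g) f = - dot3 (cr f g) h" "dot3 (cr f h) g = - dot3 (cr f g) h"
    by (simp_all add: dot3_3 algebra_simps)
  then show ?thesis unfolding cols_mult by (simp add: dot3_3[of "cr a b"] algebra_simps)
qed

text \<open>A common point of three lines makes their normals linearly dependent; passing to the
  frame \<open>f\<close>, \<open>g\<close>, \<open>h\<close> and rescaling the points contributes
  only nonzero factors.\<close>

lemma concurrent_det:
  assumes "concurrent (k1 *s (cols f g h *v a1)) (k2 *s (cols f g h *v a2)) (k3 *s (cols f g h *v a3))
      (k4 *s (cols f g h *v a4)) (k5 *s (cols f g h *v a5)) (k6 *s (cols f g h *v a6))"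
    and k: "k1 \<noteq> 0" "k2 \<noteq> 0" "k3 \<noteq> 0" "k4 \<noteq> 0" "k5 \<noteq> 0" "k6 \<noteq> 0" and d: "dot3 (cr f g) h \<noteq> 0"
  shows "dot3 (cr (cr a1 a2) (cr a3 a4)) (cr a5 a6) = 0"
proof -
  let ?M = "cols f g h"
  obtain t where t: "t \<noteq> 0" "dot3 (cr (?M *v a1) (?M *v a2)) t = 0" "dot3 (cr (?M *v a3) (?M *v a4)) t = 0"
    "dot3 (cr (?M *v a5) (?M *v a6)) t = 0" using assms by (auto simp: concurrent_def)
  obtain x y z where "t = x *s f + y *s g + z *s h" using basis_E[OF d] .
  then have ts: "t = ?M *v vector [x, y, z]" by (simp add: cols_mult)
  let ?s = "vector [x, y, z] :: complex^3"
  have s: "dot3 (cr a1 a2) ?s = 0" "dot3 (cr a3 a4) ?s = 0" "dot3 (cr a5 a6) ?s = 0"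
    using t d unfolding ts det_cols_mult by simp_all
  have s0: "?s \<noteq> 0"
  proof
    assume "?s = 0"
    then show False using t(1) ts by simp
  qed
  have "dot3 (cr n1 n2) n3 *s v = dot3 n1 v *s cr n2 n3 + dot3 n2 v *s cr n3 n1 + dot3 n3 v *s cr n1 n2" for n1 n2 n3 v
    by (simp add: vec3_eq_iff dot3_3 algebra_simps)
  from this[of "cr a1 a2" "cr a3 a4" "cr a5 a6" ?s] s
  have "dot3 (cr (cr a1 a2) (cr a3 a4)) (cr a5 a6) *s ?s = 0" by simp
  then show ?thesis using s0 by (simp only: vec.scale_eq_0_iff) simp
qed

text \<open>In the chart z = 1: the points at infinity of the two axes, and the vertices of a
  parallelogram centred at the origin whose diagonals are y = - x and y = x.\<close>

definition six_points :: "complex \<Rightarrow> (complex^3) set" where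
  "six_points c = {vector [0, 1, 0], vector [1, 0, 0], vector [1, -1, 1], vector [-1, 1, 1], vector [c, c, 1], vector [-c, -c, 1]}"

lemma six_points_minus: "six_points (- c) = six_points c"
  unfolding six_points_def by auto

definition joins :: "(complex^3 \<Rightarrow> complex^3) \<Rightarrow> (complex^3) set \<Rightarrow> bool" where
  "joins w S \<longleftrightarrow> (\<forall>a\<in>S. \<forall>b\<in>S. a \<noteq> b \<longrightarrow> inv2 w a b)"

lemma hp_1_linear:
  assumes "hp (Suc 0) f" shows "\<exists>m. \<forall>v. f v = dot3 m v"
proof -
  have "hp e f \<Longrightarrow> (e = 0 \<longrightarrow> (\<exists>c. f = (\<lambda>_. c))) \<and> (e = Suc 0 \<longrightarrow> (\<exists>m. f = (\<lambda>v. dot3 m v)))" for e f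
  proof (induction rule: hp.induct)
    case (hp_coord e f i)
    have "dot3 (axis i 1) v = v $ i" for v :: "complex^3"
      by (simp add: dot3_def axis_def if_distrib[of "\<lambda>x. x * _"] cong: if_cong)
    then have m: "(\<lambda>v. v $ i * c) = (\<lambda>v. dot3 (c *s axis i 1) v)" for c :: complex
      by (simp add: fun_eq_iff mult.commute)
    show ?case
    proof (intro conjI impI)
      assume "Suc e = Suc 0"
      then obtain c where "f = (\<lambda>_. c)" using hp_coord by auto
      then show "\<exists>m. (\<lambda>v. v $ i * f v) = (\<lambda>v. dot3 m v)" using m[of c] by blast
    qed simp
  next
    case (hp_add e f g)
    have m: "(\<lambda>v. dot3 m v + dot3 n v) = dot3 (m + n)" for m n by (rule ext) simp
    show ?case
    proof (intro conjI impI)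
      assume "e = 0"
      then obtain c d where "f = (\<lambda>_. c)" "g = (\<lambda>_. d)" using hp_add by blast
      then show "\<exists>c. (\<lambda>v. f v + g v) = (\<lambda>_. c)" by blast
    next
      assume "e = Suc 0"
      then obtain k l where "f = dot3 k" "g = dot3 l" using hp_add by blast
      then show "\<exists>k. (\<lambda>v. f v + g v) = dot3 k" using m[of k l] by blast
    qed
  qed auto
  from this[OF assms] obtain m where "f = dot3 m" by blast
  then show ?thesis by auto
qed

definition sq5 :: complex where "sq5 = complex_of_real (sqrt 5)"

lemma sq5_squared: "sq5 ^ 2 = 5"
proof -
  have "sq5 ^ 2 = of_real (sqrt 5 ^ 2)" unfolding sq5_def by (simp only: of_real_power)
  then show ?thesis by simp
qed

lemma hilbert5_nth:
  fixes v :: "complex^3"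
  shows "hilbert5 v $ 1 = v$3 * ((v$2 ^ 2 - v$3 ^ 2) * (v$2 ^ 2 - (sq5 - 2) ^ 2 * v$3 ^ 2) * (v$2 + sq5 * v$1))"
  "hilbert5 v $ 2 = v$3 * - ((v$1 ^ 2 - v$3 ^ 2) * (v$1 ^ 2 - (sq5 - 2) ^ 2 * v$3 ^ 2) * (v$1 + sq5 * v$2))"
  "hilbert5 v $ 3 = - (v$1 * ((v$2 ^ 2 - v$3 ^ 2) * (v$2 ^ 2 - (sq5 - 2) ^ 2 * v$3 ^ 2) * (v$2 + sq5 * v$1)) +
    v$2 * - ((v$1 ^ 2 - v$3 ^ 2) * (v$1 ^ 2 - (sq5 - 2) ^ 2 * v$3 ^ 2) * (v$1 + sq5 * v$2)))"
  unfolding hilbert5_def homogenized_form_def Let_def vector_3 sq5_def by (rule refl)+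

lemma hp_hilbert5: "hp 6 (\<lambda>v. hilbert5 v $ i)"
proof -
  have q: "hp 2 (\<lambda>v. v $ i ^ 2 - c * v $ j ^ 2)" for i j :: 3 and c
    using hp_power[OF hp_nth, of 2] by (intro hp_diff hp_cmult) simp_all
  have q1: "hp 2 (\<lambda>v. v $ i ^ 2 - v $ j ^ 2)" for i j :: 3 using q[of i 1 j] by simp
  have l: "hp (Suc 0) (\<lambda>v. v $ i + c * v $ j)" for i j :: 3 and c by (intro hp_add hp_cmult hp_nth)
  have a: "hp 5 (\<lambda>v. (v $ i ^ 2 - v $ k ^ 2) * (v $ i ^ 2 - c * v $ k ^ 2) * (v $ i + d * v $ j))" for i j k :: 3 and c d
    using hp_mult[OF hp_mult[OF q1 q] l] by simp
  have b: "hp 6 (\<lambda>v. v $ m * ((v $ i ^ 2 - v $ k ^ 2) * (v $ i ^ 2 - c * v $ k ^ 2) * (v $ i + d * v $ j)))" for i j k m :: 3 and c d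
    using hp_mult[OF hp_nth a] by simp
  consider "i = 1" | "i = 2" | "i = 3" using exhaust_3[of i] by auto
  then show ?thesis
  proof cases
    case 1 then show ?thesis by (simp only: hilbert5_nth b)
  next
    case 2 then show ?thesis by (simp only: hilbert5_nth mult_minus_right) (rule hp_minus[OF b])
  next
    case 3 then show ?thesis by (simp only: hilbert5_nth mult_minus_right) (rule hp_minus[OF hp_add[OF b hp_minus[OF b]]])
  qed
qed

lemma hilbert5_radial: "dot3 (hilbert5 v) v = 0"
  unfolding dot3_3 hilbert5_nth by (simp add: algebra_simps)

lemma (in hom_form) five_lines_factor:
  assumes e: "e = 6" and p: "A = {n1, n2, n3, n4, n5}" "card A = 5"
    and ne: "\<And>l. l \<in> A \<Longrightarrow> l \<noteq> 0" "\<And>l m. l \<in> A \<Longrightarrow> m \<in> A \<Longrightarrow> l \<noteq> m \<Longrightarrow> cr l m \<noteq> 0"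
    and z: "\<And>l v. l \<in> A \<Longrightarrow> v \<in> line_of l \<Longrightarrow> dot3 (w v) p = 0"
  shows "\<exists>m. \<forall>v. dot3 (w v) p = (\<Prod>l\<in>A. dot3 l v) * dot3 m v"
proof -
  have "finite A" using p by simp
  then have "\<exists>g. hp (e - card A) g \<and> (\<forall>v. dot3 (w v) p = (\<Prod>l\<in>A. dot3 l v) * g v) \<and> (e < card A \<longrightarrow> g = (\<lambda>_. 0))"
    by (rule hp_factor_lines[OF _ hp_w[of p] ne z])
  then obtain g where g: "hp (e - card A) g"
    "\<And>v. dot3 (w v) p = (\<Prod>l\<in>A. dot3 l v) * g v" by blast
  then have "hp (Suc 0) g" using e p by simp
  then obtain m where m: "\<And>v. g v = dot3 m v" using hp_1_linear by blast
  show ?thesis by (rule exI[of _ m]) (simp only: g(2) m simp_thms)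
qed

text \<open>Five joins pass through each of the two points at infinity, so two components of
  \<open>w\<close> are known up to linear forms \<open>m2\<close> and \<open>m1\<close>. The two
  diagonals give four linear equations for their six coefficients, one side of the parallelogram
  gives a fifth, and the radial relation then yields the third component.\<close>

lemma hilbert_final:
  assumes hf: "hom_form w 6" and j: "joins w (six_points t)" and t: "t = sq5 - 2"
  obtains k where "\<And>v. w v = k *s hilbert5 v"
proof -
  interpret hom_form w 6 by (rule hf)
  define s where "s = sq5"
  have s2: "s ^ 2 = 5" using sq5_squared s_def by simp
  have ts: "t = s - 2" "s = t + 2" using t s_def by auto
  have "(t + 2) ^ 2 - 5 = 0" using s2 unfolding ts(2) by simp
  then have t2: "t ^ 2 + 4 * t - 1 = 0" by algebra
  have t0: "t \<noteq> 0" using t2 by auto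
  have tn: "t \<noteq> 1" "t \<noteq> -1" "1 - 2 * t \<noteq> 0" "t ^ 2 \<noteq> 4"
  proof -
    show "t \<noteq> 1" "t \<noteq> -1" using t2 by auto
    show "1 - 2 * t \<noteq> 0"
    proof
      assume "1 - 2 * t = 0"
      then have "(5::complex) = 0" using t2 by algebra
      then show False by simp
    qed
    show "t ^ 2 \<noteq> 4"
    proof
      assume "t ^ 2 = 4"
      then have "t ^ 2 - 4 = 0" by simp
      then have "(55::complex) = 0" using t2 by algebra
      then show False by simp
    qed
  qed
  have tt: "t ^ 2 \<noteq> 1"
  proof
    assume "t ^ 2 = 1"
    then have "t ^ 2 - 1 = 0" by simp
    then have "(16::complex) = 0" using t2 by algebra
    then show False by simp
  qed
  define q1 q2 q3 q4 q5 q6 :: "complex^3" where q: "q1 = vector [0, 1, 0]" "q2 = vector [1, 0, 0]" "q3 = vector [1, -1, 1]"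
    "q4 = vector [-1, 1, 1]" "q5 = vector [t, t, 1]" "q6 = vector [-t, -t, 1]"
  have tt': "t \<noteq> - t" "- t \<noteq> 1" using t0 tn by (auto simp: minus_equation_iff[of t])
  have J: "inv2 w a b" if "a \<in> {q1, q2, q3, q4, q5, q6}" "b \<in> {q1, q2, q3, q4, q5, q6}" "a \<noteq> b" for a b
    using j that unfolding joins_def six_points_def q by blast
  have d: "q1 \<noteq> q2" "q1 \<noteq> q3" "q1 \<noteq> q4" "q1 \<noteq> q5" "q1 \<noteq> q6" "q2 \<noteq> q3" "q2 \<noteq> q4" "q2 \<noteq> q5" "q2 \<noteq> q6"
    "q3 \<noteq> q4" "q5 \<noteq> q6" "q3 \<noteq> q5"
    using tn t0 tt' by (auto simp: q vec3_eq_iff)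
  have I: "inv2 w q1 q2" "inv2 w q1 q3" "inv2 w q1 q4" "inv2 w q1 q5" "inv2 w q1 q6"
    "inv2 w q2 q1" "inv2 w q2 q3" "inv2 w q2 q4" "inv2 w q2 q5" "inv2 w q2 q6" "inv2 w q3 q4" "inv2 w q5 q6" "inv2 w q3 q5"
    by (rule J; use d in simp)+
  have zero: "dot3 (w v) a = 0" "dot3 (w v) b = 0" if "inv2 w a b" "v = x *s a + y *s b" for a b v x y
    using that unfolding inv2_def by blast+
  define A1 :: "(complex^3) set" where "A1 = {vector [0,0,1], vector [1,0,-1], vector [1,0,1], vector [1,0,-t], vector [1,0,t]}"
  define A2 :: "(complex^3) set" where "A2 = {vector [0,0,1], vector [0,1,-1], vector [0,1,1], vector [0,1,-t], vector [0,1,t]}"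
  have cA: "card A1 = 5" "card A2 = 5"
    using tn t0 tt' by (auto simp: A1_def A2_def vec3_eq_iff card_insert_if eq_commute[of _ t])
  have "\<exists>m. \<forall>v. dot3 (w v) q1 = (\<Prod>l\<in>A1. dot3 l v) * dot3 m v"
  proof (rule five_lines_factor[OF refl A1_def cA(1)])
    show "\<And>l. l \<in> A1 \<Longrightarrow> l \<noteq> 0" by (auto simp: A1_def vec3_eq_iff)
    show "\<And>l m. l \<in> A1 \<Longrightarrow> m \<in> A1 \<Longrightarrow> l \<noteq> m \<Longrightarrow> cr l m \<noteq> 0" by (auto simp: A1_def vec3_eq_iff)
    fix l v assume "l \<in> A1" "v \<in> line_of l"
    then consider "v$3 = 0" | "v$1 = v$3" | "v$1 = - v$3" | "v$1 = t * v$3" | "v$1 = - t * v$3"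
      by (auto simp: A1_def line_of_def dot3_3 eq_neg_iff_add_eq_0)
    then show "dot3 (w v) q1 = 0"
    proof cases
      case 1 show ?thesis by (rule zero(1)[OF I(1), of v "v$2" "v$1"]) (use 1 in \<open>simp add: vec3_eq_iff q\<close>)
    next
      case 2 show ?thesis by (rule zero(1)[OF I(2), of v "v$2 + v$3" "v$3"]) (use 2 in \<open>simp add: vec3_eq_iff q\<close>)
    next
      case 3 show ?thesis by (rule zero(1)[OF I(3), of v "v$2 - v$3" "v$3"]) (use 3 in \<open>simp add: vec3_eq_iff q\<close>)
    next
      case 4 show ?thesis by (rule zero(1)[OF I(4), of v "v$2 - t * v$3" "v$3"]) (use 4 in \<open>simp add: vec3_eq_iff q\<close>)
    next
      case 5 show ?thesis by (rule zero(1)[OF I(5), of v "v$2 + t * v$3" "v$3"]) (use 5 in \<open>simp add: vec3_eq_iff q\<close>)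
    qed
  qed
  then obtain m1 where m1: "\<And>v. dot3 (w v) q1 = (\<Prod>l\<in>A1. dot3 l v) * dot3 m1 v" by blast
  have "\<exists>m. \<forall>v. dot3 (w v) q2 = (\<Prod>l\<in>A2. dot3 l v) * dot3 m v"
  proof (rule five_lines_factor[OF refl A2_def cA(2)])
    show "\<And>l. l \<in> A2 \<Longrightarrow> l \<noteq> 0" by (auto simp: A2_def vec3_eq_iff)
    show "\<And>l m. l \<in> A2 \<Longrightarrow> m \<in> A2 \<Longrightarrow> l \<noteq> m \<Longrightarrow> cr l m \<noteq> 0" by (auto simp: A2_def vec3_eq_iff)
    fix l v assume "l \<in> A2" "v \<in> line_of l"
    then consider "v$3 = 0" | "v$2 = v$3" | "v$2 = - v$3" | "v$2 = t * v$3" | "v$2 = - t * v$3"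
      by (auto simp: A2_def line_of_def dot3_3 eq_neg_iff_add_eq_0)
    then show "dot3 (w v) q2 = 0"
    proof cases
      case 1 show ?thesis by (rule zero(1)[OF I(6), of v "v$1" "v$2"]) (use 1 in \<open>simp add: vec3_eq_iff q\<close>)
    next
      case 2 show ?thesis by (rule zero(1)[OF I(8), of v "v$1 + v$3" "v$3"]) (use 2 in \<open>simp add: vec3_eq_iff q\<close>)
    next
      case 3 show ?thesis by (rule zero(1)[OF I(7), of v "v$1 - v$3" "v$3"]) (use 3 in \<open>simp add: vec3_eq_iff q\<close>)
    next
      case 4 show ?thesis by (rule zero(1)[OF I(9), of v "v$1 - t * v$3" "v$3"]) (use 4 in \<open>simp add: vec3_eq_iff q\<close>)
    next
      case 5 show ?thesis by (rule zero(1)[OF I(10), of v "v$1 + t * v$3" "v$3"]) (use 5 in \<open>simp add: vec3_eq_iff q\<close>)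
    qed
  qed
  then obtain m2 where m2: "\<And>v. dot3 (w v) q2 = (\<Prod>l\<in>A2. dot3 l v) * dot3 m2 v" by blast
  have A1v: "(\<Prod>l\<in>A1. dot3 l v) = v$3 * (v$1 ^ 2 - v$3 ^ 2) * (v$1 ^ 2 - t ^ 2 * v$3 ^ 2)" for v
  proof -
    let ?L = "[vector [0,0,1], vector [1,0,-1], vector [1,0,1], vector [1,0,-t], vector [1,0,t]] :: (complex^3) list"
    have "distinct ?L" using cA(1) unfolding A1_def by (intro card_distinct) simp
    then have "(\<Prod>l\<in>set ?L. dot3 l v) = prod_list (map (\<lambda>l. dot3 l v) ?L)" by (rule prod.distinct_set_conv_list)
    also have "\<dots> = v$3 * ((v$1 - v$3) * ((v$1 + v$3) * ((v$1 - t * v$3) * (v$1 + t * v$3))))"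
      by (simp add: dot3_3)
    also have "\<dots> = v$3 * (v$1 ^ 2 - v$3 ^ 2) * (v$1 ^ 2 - t ^ 2 * v$3 ^ 2)" by algebra
    finally show ?thesis by (simp add: A1_def)
  qed
  have A2v: "(\<Prod>l\<in>A2. dot3 l v) = v$3 * (v$2 ^ 2 - v$3 ^ 2) * (v$2 ^ 2 - t ^ 2 * v$3 ^ 2)" for v
  proof -
    let ?L = "[vector [0,0,1], vector [0,1,-1], vector [0,1,1], vector [0,1,-t], vector [0,1,t]] :: (complex^3) list"
    have "distinct ?L" using cA(2) unfolding A2_def by (intro card_distinct) simp
    then have "(\<Prod>l\<in>set ?L. dot3 l v) = prod_list (map (\<lambda>l. dot3 l v) ?L)" by (rule prod.distinct_set_conv_list)
    also have "\<dots> = v$3 * ((v$2 - v$3) * ((v$2 + v$3) * ((v$2 - t * v$3) * (v$2 + t * v$3))))"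
      by (simp add: dot3_3)
    also have "\<dots> = v$3 * (v$2 ^ 2 - v$3 ^ 2) * (v$2 ^ 2 - t ^ 2 * v$3 ^ 2)" by algebra
    finally show ?thesis by (simp add: A2_def)
  qed
  have w1: "w v $ 1 = v$3 * (v$2 ^ 2 - v$3 ^ 2) * (v$2 ^ 2 - t ^ 2 * v$3 ^ 2) * dot3 m2 v" for v
    using m2[of v] unfolding A2v by (simp add: q dot3_3[of "w v"])
  have w2: "w v $ 2 = v$3 * (v$1 ^ 2 - v$3 ^ 2) * (v$1 ^ 2 - t ^ 2 * v$3 ^ 2) * dot3 m1 v" for v
    using m1[of v] unfolding A1v by (simp add: q dot3_3[of "w v"])
  have diag: "w (vector [x, x, 1]) $ 1 + w (vector [x, x, 1]) $ 2 = 0" for x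
  proof -
    have v: "vector [x, x, 1] = ((x / t + 1) / 2) *s q5 + ((1 - x / t) / 2) *s q6"
      using t0 by (simp add: vec3_eq_iff q field_simps)
    have "dot3 (w (vector [x, x, 1])) (q5 - q6) = 0" using zero[OF I(12) v] by simp
    then have "2 * t * (w (vector [x, x, 1]) $ 1 + w (vector [x, x, 1]) $ 2) = 0" by (simp add: q dot3_3 algebra_simps)
    then show ?thesis using t0 by simp
  qed
  have anti: "w (vector [x, -x, 1]) $ 1 - w (vector [x, -x, 1]) $ 2 = 0" for x
  proof -
    have v: "vector [x, -x, 1] = ((1 + x) / 2) *s q3 + ((1 - x) / 2) *s q4"
      by (simp add: vec3_eq_iff q field_simps)
    have "dot3 (w (vector [x, -x, 1])) (q3 - q4) = 0" using zero[OF I(11) v] by simp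
    then have "2 * (w (vector [x, -x, 1]) $ 1 - w (vector [x, -x, 1]) $ 2) = 0" by (simp add: q dot3_3 algebra_simps)
    then show ?thesis by simp
  qed
  have c: "4 - t ^ 2 \<noteq> 0" using tn by simp
  \<comment> \<open>The components share the factor \<open>(x^2 - 1) (x^2 - t^2)\<close>. It is
    nonzero at \<open>x = 0\<close> and at \<open>x = 2\<close>, where it is \<open>t^2\<close> and
    \<open>3 (4 - t^2)\<close>, so these two points give the equations for the linear forms.\<close>
  have d0: "m2$3 + m1$3 = 0" using diag[of 0] t0 unfolding w1 w2 by (simp add: dot3_3; algebra)
  have "3 * (4 - t ^ 2) * (2 * (m2$1 + m2$2 + m1$1 + m1$2) + (m2$3 + m1$3)) = 0"
    using diag[of 2] unfolding w1 w2 by (simp add: dot3_3; algebra)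
  then have d1: "m2$1 + m2$2 + m1$1 + m1$2 = 0" using c unfolding d0 add_0_right
    by (metis mult_eq_0_iff zero_neq_numeral)
  have a0: "m2$3 - m1$3 = 0" using anti[of 0] t0 unfolding w1 w2 by (simp add: dot3_3; algebra)
  have "w (vector [2, -2, 1]) $ 1 - w (vector [2, -2, 1]) $ 2
      = 3 * (4 - t ^ 2) * (2 * (m2$1 - m2$2 - m1$1 + m1$2) + (m2$3 - m1$3))"
    unfolding w1 w2 by (simp add: dot3_3 algebra_simps power2_eq_square)
  then have "3 * (4 - t ^ 2) * (2 * (m2$1 - m2$2 - m1$1 + m1$2) + (m2$3 - m1$3)) = 0"
    using anti[of 2] by simp
  then have a1: "m2$1 - m2$2 - m1$1 + m1$2 = 0" using c unfolding a0 add_0_right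
    by (metis mult_eq_0_iff zero_neq_numeral)
  have "2 * m2$3 = 0" "2 * m1$3 = 0" "2 * (m1$2 + m2$1) = 0" "2 * (m1$1 + m2$2) = 0" using d0 d1 a0 a1 by - algebra+
  then have m: "m2$3 = 0" "m1$3 = 0" "m1$2 = - m2$1" "m1$1 = - m2$2"
    by (simp_all only: eq_neg_iff_add_eq_0 mult_eq_0_iff zero_neq_numeral[symmetric]) simp_all
  \<comment> \<open>A point of the side joining \<open>q3\<close> and \<open>q5\<close>. Invariance
    of this side fixes the last free ratio as \<open>t + 2\<close>, which is
    \<open>sq5\<close>.\<close>
  define v where "v = (vector [1 + t, t - 1, 2] :: complex^3)"
  have "v = 1 *s q3 + 1 *s q5" by (simp add: v_def q vec3_eq_iff)
  from zero[OF I(13) this] have "dot3 (w v) (q5 - q3) = 0" by simp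
  then have "(t - 1) * w v $ 1 + (t + 1) * w v $ 2 = 0" by (simp add: dot3_3 q algebra_simps)
  then have "(t - 1) * (2 * ((t - 1) ^ 2 - 4) * ((t - 1) ^ 2 - t ^ 2 * 4) * (m2$1 * (1 + t) + m2$2 * (t - 1)))
    + (t + 1) * (2 * ((1 + t) ^ 2 - 4) * ((1 + t) ^ 2 - t ^ 2 * 4) * (- m2$2 * (1 + t) - m2$1 * (t - 1))) = 0"
    unfolding w1 w2 by (simp add: v_def dot3_3 m)
  then have "(t - 1) * (t + 1) * (t * ((1 - 2 * t) * (m2$1 - (t + 2) * m2$2))) * 32 = 0" using t2 by algebra
  moreover have "t + 1 \<noteq> 0" unfolding eq_neg_iff_add_eq_0[symmetric] using tn by blast
  moreover have "t - 1 \<noteq> 0" "1 - 2 * t \<noteq> 0" using tn by simp_all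
  ultimately have "m2$1 - (t + 2) * m2$2 = 0" using t0 by (simp only: mult_eq_0_iff) simp
  then have m21: "m2$1 = s * m2$2" using ts(2) by simp
  have w12: "w v $ 1 = m2$2 * hilbert5 v $ 1" "w v $ 2 = m2$2 * hilbert5 v $ 2" for v
    unfolding w1 w2 hilbert5_nth s_def[symmetric] ts(1)[symmetric] dot3_3 m m21 by (simp_all add: algebra_simps)
  \<comment> \<open>The radial relations give this equality multiplied by \<open>v$3\<close>; that
    factor is then cancelled as a polynomial.\<close>
  have "w v $ 3 = m2$2 * hilbert5 v $ 3" for v
  proof -
    have A: "hp 6 (\<lambda>v. w v $ 3 - m2$2 * hilbert5 v $ 3)" by (intro hp_diff hp_cmult hp hp_hilbert5)
    have B: "v$3 * (w v $ 3 - m2$2 * hilbert5 v $ 3) = 0" for v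
      using radial[of v] hilbert5_radial[of v] unfolding dot3_3 w12 by algebra
    have "w v $ 3 - m2$2 * hilbert5 v $ 3 = 0"
      by (rule hp_cancel[OF hp_nth[of 3] A, of "vector [0, 0, 1]"]) (simp, rule B)
    then show ?thesis by simp
  qed
  then have "w v = m2$2 *s hilbert5 v" for v by (simp add: vec3_eq_iff w12)
  then show thesis by (rule that)
qed

text \<open>The equations \<open>E\<close> say that the opposite sides of the quadrilateral (1,-1),
  (c,d), (-1,1), (c',d') are parallel, so the last two vertices are opposite. \<open>T1\<close> and
  \<open>T2\<close> state the concurrencies on the joins of the third point with the two points at
  infinity, already simplified for \<open>c' = - c\<close>, \<open>d' = - d\<close>. The two
  quadratics differ by the sign of \<open>c\<close>, which \<open>six_points_minus\<close>
  absorbs.\<close>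

lemma parallelogram_parameters:
  fixes c d c' d' :: complex
  assumes E: "(c - 1) * (d' - 1) - (d + 1) * (c' + 1) = 0" "(c' - 1) * (d - 1) - (d' + 1) * (c + 1) = 0"
    and ne: "c + d \<noteq> 0"
    and T1: "c' = - c \<Longrightarrow> d' = - d \<Longrightarrow>
      two_of_three (d - c = 0) (3 * d + 1 - c * d + c = 0) (3 * d - 1 + c * d + c = 0)"
    and T2: "c' = - c \<Longrightarrow> d' = - d \<Longrightarrow>
      two_of_three (d - c = 0) (c * d + 3 * c + d - 1 = 0) ((1 - c) * (d - 1) + 2 * (c + 1) = 0)"
  shows "c' = - c" "d' = - d" "d = c" "c ^ 2 + 4 * c - 1 = 0 \<or> c ^ 2 - 4 * c - 1 = 0"
proof -
  have "2 * (c + d + c' + d') = 0" using E by algebra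
  then have s: "c + d + c' + d' = 0" by (simp only: mult_eq_0_iff) simp
  have "(c + d) * (c + c') = 0" using E s by algebra
  then have cc: "c + c' = 0" using ne by simp
  then show c': "c' = - c" by (simp add: eq_neg_iff_add_eq_0 add.commute)
  have "d + d' = 0" using s cc by algebra
  then show d': "d' = - d" by (simp add: eq_neg_iff_add_eq_0 add.commute)
  \<comment> \<open>If the concurrency expressed by \<open>d = c\<close> fails, the other two must
    hold on each of the two lines; together they force both \<open>c d = 1\<close> and
    \<open>d = 0\<close>.\<close>
  have "d - c = 0"
  proof (rule ccontr)
    assume n: "d - c \<noteq> 0"
    then have e: "3 * d + 1 - c * d + c = 0" "3 * d - 1 + c * d + c = 0" "c * d + 3 * c + d - 1 = 0"
      using T1[OF c' d'] T2[OF c' d'] by (auto simp: two_of_three_def)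
    have "2 * (c * d - 1) = 0" using e(1,2) by algebra
    then have cd: "c * d - 1 = 0" by (simp only: mult_eq_0_iff) simp
    have "8 * d = 0" using cd e by algebra
    then have "d = 0" by simp
    then show False using cd by simp
  qed
  then show dc: "d = c" by simp
  show "c ^ 2 + 4 * c - 1 = 0 \<or> c ^ 2 - 4 * c - 1 = 0"
  proof -
    have "3 * d + 1 - c * d + c = 0 \<or> 3 * d - 1 + c * d + c = 0" using T1[OF c' d'] by (auto simp: two_of_three_def)
    then show ?thesis
    proof
      assume "3 * d + 1 - c * d + c = 0"
      then have "c ^ 2 - 4 * c - 1 = 0" unfolding dc by algebra
      then show ?thesis ..
    next
      assume "3 * d - 1 + c * d + c = 0"
      then have "c ^ 2 + 4 * c - 1 = 0" unfolding dc by algebra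
      then show ?thesis ..
    qed
  qed
qed

lemma joins_pullback:
  assumes "joins w T" "\<And>a. a \<in> S \<Longrightarrow> \<exists>k. k \<noteq> 0 \<and> k *s (M *v a) \<in> T"
    "\<And>a b k l. a \<in> S \<Longrightarrow> b \<in> S \<Longrightarrow> k *s (M *v a) = l *s (M *v b) \<Longrightarrow> k \<noteq> 0 \<Longrightarrow> l \<noteq> 0 \<Longrightarrow> a = b"
  shows "joins (pullback M w) S"
  unfolding joins_def
proof (intro ballI impI)
  fix a b assume ab: "a \<in> S" "b \<in> S" "a \<noteq> b"
  obtain k where k: "k \<noteq> 0" "k *s (M *v a) \<in> T" using assms(2) ab by blast
  obtain l where l: "l \<noteq> 0" "l *s (M *v b) \<in> T" using assms(2) ab by blast
  have "k *s (M *v a) \<noteq> l *s (M *v b)" using assms(3) ab k l by blast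
  then have "inv2 w (k *s (M *v a)) (l *s (M *v b))" using assms(1) k l unfolding joins_def by blast
  then show "inv2 (pullback M w) a b" using inv2_unscale inv2_pullback k l by blast
qed

text \<open>The two roots \<open>sq5 - 2\<close> and \<open>- sq5 - 2\<close> have product -1. The
  diagonal matrix with entries \<open>c\<close>, \<open>- c\<close>, 1 takes the six points with
  parameter \<open>- 1 / c\<close> to those with parameter \<open>c\<close>, exchanging the two
  diagonals of the parallelogram, so both roots lead to the same normal form.\<close>

lemma hilbert_from_six_points:
  assumes hf: "hom_form w 6" and j: "joins w (six_points c)" and c: "c ^ 2 + 4 * c - 1 = 0"
  obtains M k where "invertible M" "\<And>v. pullback M w v = k *s hilbert5 v"
proof -
  interpret hom_form w 6 by (rule hf)
  have c0: "c \<noteq> 0" using c by auto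
  have sq5_0: "sq5 ^ 2 - 5 = 0" using sq5_squared by simp
  have "(c - (sq5 - 2)) * (c - (- sq5 - 2)) = 0" using c sq5_0 by algebra
  then consider "c = sq5 - 2" | "c = - sq5 - 2" by auto
  then show thesis
  proof cases
    case 1
    obtain k where k: "\<And>v. w v = k *s hilbert5 v" by (rule hilbert_final[OF hf j 1], rule that)
    have "pullback (mat 1) w = w" by (rule ext) (simp add: pullback_def)
    then show thesis using k by (intro that[of "mat 1" k]) (auto simp: invertible_def intro: exI[of _ "mat 1"])
  next
    case 2
    define t where "t = sq5 - 2"
    have ct: "c * t = - 1" unfolding 2 t_def using sq5_0 by algebra
    have tc: "t = - (1 / c)" using ct c0 by (simp add: field_simps)
    let ?M = "cols (vector [c, 0, 0]) (vector [0, - c, 0]) (vector [0, 0, 1])"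
    have inv: "invertible ?M" by (rule invertible_cols) (simp add: dot3_3 c0)
    have M: "?M *v v = vector [c * v$1, - c * v$2, v$3]" for v
      by (simp add: cols_mult vec3_eq_iff mult.commute)
    have jt: "joins (pullback ?M w) (six_points t)"
    proof (rule joins_pullback[OF j])
      show "\<exists>k. k \<noteq> 0 \<and> k *s (?M *v a) \<in> six_points c" if "a \<in> six_points t" for a
      proof -
        from that consider "a = vector [0, 1, 0]" | "a = vector [1, 0, 0]" | "a = vector [1, -1, 1]"
          | "a = vector [-1, 1, 1]" | "a = vector [t, t, 1]" | "a = vector [-t, -t, 1]"
          unfolding six_points_def by blast
        then show ?thesis
        proof cases
          case 1
          have "(- 1 / c) *s (?M *v a) = vector [0, 1, 0]" unfolding M using c0 1 by (simp add: vec3_eq_iff)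
          then show ?thesis using c0 by (intro exI[of _ "- 1 / c"]) (simp add: six_points_def)
        next
          case 2
          have "(1 / c) *s (?M *v a) = vector [1, 0, 0]" unfolding M using c0 2 by (simp add: vec3_eq_iff)
          then show ?thesis using c0 by (intro exI[of _ "1 / c"]) (simp add: six_points_def)
        next
          case 3
          have "1 *s (?M *v a) = vector [c, c, 1]" unfolding M using 3 by (simp add: vec3_eq_iff)
          then show ?thesis by (intro exI[of _ 1]) (simp add: six_points_def)
        next
          case 4
          have "1 *s (?M *v a) = vector [-c, -c, 1]" unfolding M using 4 by (simp add: vec3_eq_iff)
          then show ?thesis by (intro exI[of _ 1]) (simp add: six_points_def)
        next
          case 5
          have "1 *s (?M *v a) = vector [-1, 1, 1]" unfolding M using 5 ct by (simp add: vec3_eq_iff)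
          then show ?thesis by (intro exI[of _ 1]) (simp add: six_points_def)
        next
          case 6
          have "1 *s (?M *v a) = vector [1, -1, 1]" unfolding M using 6 ct by (simp add: vec3_eq_iff)
          then show ?thesis by (intro exI[of _ 1]) (simp add: six_points_def)
        qed
      qed
      show "a = b" if ab: "a \<in> six_points t" "b \<in> six_points t" and
        e: "k *s (?M *v a) = l *s (?M *v b)" "k \<noteq> 0" "l \<noteq> 0" for a b k l
      proof -
        have x: "k * a$1 = l * b$1" "k * a$2 = l * b$2" "k * a$3 = l * b$3"
          using e(1) c0 unfolding M by (simp_all add: vec3_eq_iff)
        have "a$3 = 1 \<or> a = vector [0, 1, 0] \<or> a = vector [1, 0, 0]" "b$3 = 1 \<or> b = vector [0, 1, 0] \<or> b = vector [1, 0, 0]"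
          using ab unfolding six_points_def by auto
        then show ?thesis using x e(2,3) by (elim disjE) (simp_all add: vec3_eq_iff)
      qed
    qed
    obtain k where k: "\<And>v. pullback ?M w v = k *s hilbert5 v"
      by (rule hilbert_final[OF hom_form_pullback jt t_def], rule that)
    show thesis by (rule that[OF inv k])
  qed
qed

text \<open>The points \<open>p1\<close> to \<open>p4\<close> form a projective frame and are moved
  to the first four points of \<open>six_points\<close>. The line through \<open>p1\<close> and
  \<open>p2\<close> becomes the line at infinity, so \<open>C\<close> says that
  \<open>p3 p5 p4 p6\<close> is a parallelogram, which turns the concurrency conditions into those
  of \<open>parallelogram_parameters\<close>.\<close>

lemma hilbert_from_configuration:
  assumes hf: "hom_form w 6"
    and V: "distinct [p1, p2, p3, p4, p5, p6]"
    and J: "\<And>a b. a \<in> {p1, p2, p3, p4, p5, p6} \<Longrightarrow> b \<in> {p1, p2, p3, p4, p5, p6} \<Longrightarrow> a \<noteq> b \<Longrightarrow> inv2 w a b"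
    and D: "\<And>a b c. a \<in> {p1, p2, p3, p4, p5, p6} \<Longrightarrow> b \<in> {p1, p2, p3, p4, p5, p6} \<Longrightarrow> c \<in> {p1, p2, p3, p4, p5, p6} \<Longrightarrow>
      a \<noteq> b \<Longrightarrow> a \<noteq> c \<Longrightarrow> b \<noteq> c \<Longrightarrow> dot3 (cr a b) c \<noteq> 0"
    and C: "concurrent p1 p2 p3 p5 p4 p6" "concurrent p1 p2 p3 p6 p4 p5"
    and T1: "two_of_three (concurrent p1 p3 p2 p4 p5 p6) (concurrent p1 p3 p2 p5 p4 p6) (concurrent p1 p3 p2 p6 p4 p5)"
    and T2: "two_of_three (concurrent p2 p3 p1 p4 p5 p6) (concurrent p2 p3 p1 p5 p4 p6) (concurrent p2 p3 p1 p6 p4 p5)"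
  obtains M k where "invertible M" "\<And>v. pullback M w v = k *s hilbert5 v"
proof -
  interpret hom_form w 6 by (rule hf)
  have ne: "p1 \<noteq> p2" "p1 \<noteq> p3" "p1 \<noteq> p4" "p1 \<noteq> p5" "p1 \<noteq> p6" "p2 \<noteq> p3" "p2 \<noteq> p4" "p2 \<noteq> p5" "p2 \<noteq> p6"
    "p3 \<noteq> p4" "p3 \<noteq> p5" "p4 \<noteq> p5" using V by auto
  have d: "dot3 (cr p1 p2) p3 \<noteq> 0" "dot3 (cr p1 p2) p4 \<noteq> 0" "dot3 (cr p1 p3) p4 \<noteq> 0" "dot3 (cr p2 p3) p4 \<noteq> 0"
    "dot3 (cr p1 p2) p5 \<noteq> 0" "dot3 (cr p1 p2) p6 \<noteq> 0" "dot3 (cr p3 p4) p5 \<noteq> 0"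
    by (rule D; use ne in simp)+
  obtain \<alpha> \<beta> \<gamma> where p4: "p4 = \<alpha> *s p1 + \<beta> *s p2 + \<gamma> *s p3" using basis_E[OF d(1)] .
  have nz: "\<alpha> \<noteq> 0" "\<beta> \<noteq> 0" "\<gamma> \<noteq> 0" using d(2-4) unfolding p4 by auto
  \<comment> \<open>The basis is chosen so that \<open>\<gamma> p3 = f1 - f2 + f3\<close> and
    \<open>p4 = - f1 + f2 + f3\<close>.\<close>
  define f1 f2 f3 where f: "f1 = (- \<beta> / 2) *s p2" "f2 = (\<alpha> / 2) *s p1" "f3 = \<gamma> *s p3 - f1 + f2"
  let ?M = "cols f1 f2 f3"
  have "dot3 (cr p2 p1) p3 = - dot3 (cr p1 p2) p3" by (simp add: dot3_3 algebra_simps)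
  then have df: "dot3 (cr f1 f2) f3 \<noteq> 0" using d(1) nz by (simp add: f)
  have inv: "invertible ?M" by (rule invertible_cols[OF df])
  define q1 q2 q3 q4 :: "complex^3" where q: "q1 = vector [0, 1, 0]" "q2 = vector [1, 0, 0]" "q3 = vector [1, -1, 1]" "q4 = vector [-1, 1, 1]"
  have P1: "p1 = (2 / \<alpha>) *s (?M *v q1)" using nz by (simp add: cols_mult q f)
  have P2: "p2 = (- 2 / \<beta>) *s (?M *v q2)" using nz by (simp add: cols_mult q f)
  have P3: "p3 = (1 / \<gamma>) *s (?M *v q3)" using nz by (simp add: cols_mult q f vec.scale_left_diff_distrib)
  have P4: "p4 = 1 *s (?M *v q4)"
    by (simp add: cols_mult q f p4 vec3_eq_iff algebra_simps)
  have third: "\<exists>c d Z. Z \<noteq> 0 \<and> p = Z *s (?M *v vector [c, d, 1])" if "dot3 (cr p1 p2) p \<noteq> 0" for p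
  proof -
    obtain X Y Z where xyz: "p = X *s f1 + Y *s f2 + Z *s f3" using basis_E[OF df] .
    have Z: "Z \<noteq> 0" using that unfolding xyz by (auto simp: f)
    then have "p = Z *s (?M *v vector [X / Z, Y / Z, 1])"
      by (simp add: xyz cols_mult vec.scale_right_distrib)
    then show ?thesis using Z by blast
  qed
  obtain c d' Z where P5: "Z \<noteq> 0" "p5 = Z *s (?M *v vector [c, d', 1])" using third d(5) by blast
  obtain c2 d2 Z' where P6: "Z' \<noteq> 0" "p6 = Z' *s (?M *v vector [c2, d2, 1])" using third d(6) by blast
  let ?q5 = "vector [c, d', 1] :: complex^3" and ?q6 = "vector [c2, d2, 1] :: complex^3"
  have k: "2 / \<alpha> \<noteq> 0" "- 2 / \<beta> \<noteq> 0" "1 / \<gamma> \<noteq> 0" "(1::complex) \<noteq> 0" using nz by auto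
  note cd = concurrent_det[OF _ _ _ _ _ _ _ df]
  have E1: "(c - 1) * (d2 - 1) - (d' + 1) * (c2 + 1) = 0"
  proof -
    have "dot3 (cr (cr q1 q2) (cr q3 ?q5)) (cr q4 ?q6) = 0"
      by (rule cd[OF C(1)[unfolded P1 P2 P3 P4 P5(2) P6(2)]]; (intro k P5 P6)?)
    then show ?thesis by (simp add: q dot3_3; algebra)
  qed
  have E2: "(c2 - 1) * (d' - 1) - (d2 + 1) * (c + 1) = 0"
  proof -
    have "dot3 (cr (cr q1 q2) (cr q3 ?q6)) (cr q4 ?q5) = 0"
      by (rule cd[OF C(2)[unfolded P1 P2 P3 P4 P5(2) P6(2)]]; (intro k P5 P6)?)
    then show ?thesis by (simp add: q dot3_3; algebra)
  qed
  have E3: "c + d' \<noteq> 0"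
  proof
    assume "c + d' = 0"
    then have "dot3 (cr q3 q4) ?q5 = 0" by (simp add: q dot3_3; algebra)
    then have "dot3 (cr (?M *v q3) (?M *v q4)) (?M *v ?q5) = 0" unfolding det_cols_mult by simp
    then show False using d(7) unfolding P3 P4 P5(2) by simp
  qed
  have two: "z = 0" if "2 * z = 0" for z :: complex using that by simp
  have T1': "two_of_three (d' - c = 0) (3 * d' + 1 - c * d' + c = 0) (3 * d' - 1 + c * d' + c = 0)"
    if s: "c2 = - c" "d2 = - d'"
  proof -
    have "concurrent p1 p3 p2 p4 p5 p6 \<Longrightarrow> d' - c = 0"
    proof -
      assume x: "concurrent p1 p3 p2 p4 p5 p6"
      have "dot3 (cr (cr q1 q3) (cr q2 q4)) (cr ?q5 ?q6) = 0"
        by (intro cd[OF x[unfolded P1 P2 P3 P4 P5(2) P6(2)]] k P5 P6)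
      then have "2 * (d' - c) = 0" unfolding s by (simp add: q dot3_3; algebra)
      then show ?thesis by (rule two)
    qed
    moreover have "concurrent p1 p3 p2 p5 p4 p6 \<Longrightarrow> 3 * d' + 1 - c * d' + c = 0"
    proof -
      assume x: "concurrent p1 p3 p2 p5 p4 p6"
      have "dot3 (cr (cr q1 q3) (cr q2 ?q5)) (cr q4 ?q6) = 0"
        by (intro cd[OF x[unfolded P1 P2 P3 P4 P5(2) P6(2)]] k P5 P6)
      then show ?thesis unfolding s by (simp add: q dot3_3; algebra)
    qed
    moreover have "concurrent p1 p3 p2 p6 p4 p5 \<Longrightarrow> 3 * d' - 1 + c * d' + c = 0"
    proof -
      assume x: "concurrent p1 p3 p2 p6 p4 p5"
      have "dot3 (cr (cr q1 q3) (cr q2 ?q6)) (cr q4 ?q5) = 0"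
        by (intro cd[OF x[unfolded P1 P2 P3 P4 P5(2) P6(2)]] k P5 P6)
      then show ?thesis unfolding s by (simp add: q dot3_3; algebra)
    qed
    ultimately show ?thesis using T1 unfolding two_of_three_def by blast
  qed
  have T2': "two_of_three (d' - c = 0) (c * d' + 3 * c + d' - 1 = 0) ((1 - c) * (d' - 1) + 2 * (c + 1) = 0)"
    if s: "c2 = - c" "d2 = - d'"
  proof -
    have "concurrent p2 p3 p1 p4 p5 p6 \<Longrightarrow> d' - c = 0"
    proof -
      assume x: "concurrent p2 p3 p1 p4 p5 p6"
      have "dot3 (cr (cr q2 q3) (cr q1 q4)) (cr ?q5 ?q6) = 0"
        by (intro cd[OF x[unfolded P1 P2 P3 P4 P5(2) P6(2)]] k P5 P6)
      then have "2 * (d' - c) = 0" unfolding s by (simp add: q dot3_3; algebra)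
      then show ?thesis by (rule two)
    qed
    moreover have "concurrent p2 p3 p1 p5 p4 p6 \<Longrightarrow> c * d' + 3 * c + d' - 1 = 0"
    proof -
      assume x: "concurrent p2 p3 p1 p5 p4 p6"
      have "dot3 (cr (cr q2 q3) (cr q1 ?q5)) (cr q4 ?q6) = 0"
        by (intro cd[OF x[unfolded P1 P2 P3 P4 P5(2) P6(2)]] k P5 P6)
      then show ?thesis unfolding s by (simp add: q dot3_3; algebra)
    qed
    moreover have "concurrent p2 p3 p1 p6 p4 p5 \<Longrightarrow> (1 - c) * (d' - 1) + 2 * (c + 1) = 0"
    proof -
      assume x: "concurrent p2 p3 p1 p6 p4 p5"
      have "dot3 (cr (cr q2 q3) (cr q1 ?q6)) (cr q4 ?q5) = 0"
        by (intro cd[OF x[unfolded P1 P2 P3 P4 P5(2) P6(2)]] k P5 P6)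
      then show ?thesis unfolding s by (simp add: q dot3_3; algebra)
    qed
    ultimately show ?thesis using T2 unfolding two_of_three_def by blast
  qed
  note par = parallelogram_parameters[OF E1 E2 E3 T1' T2']
  have par: "c2 = - c" "d2 = - d'" "d' = c" "c ^ 2 + 4 * c - 1 = 0 \<or> c ^ 2 - 4 * c - 1 = 0"
    using par by blast+
  have S: "six_points c = {q1, q2, q3, q4, ?q5, ?q6}" unfolding six_points_def q par by simp
  have inj: "a = b" if e: "a \<in> six_points c" "b \<in> six_points c" "k *s (?M *v a) = l *s (?M *v b)" "k \<noteq> 0" "l \<noteq> 0" for a b k l
  proof -
    have "?M *v (k *s a) = ?M *v (l *s b)" using e(3) by (simp add: vector_scalar_commute)
    moreover have "inj ((*v) ?M)" using inv invertible_def matrix_left_invertible_injective by blast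
    ultimately have "k *s a = l *s b" by (simp add: inj_eq)
    then have x: "k * a$1 = l * b$1" "k * a$2 = l * b$2" "k * a$3 = l * b$3" by (simp_all add: vec3_eq_iff)
    have "a$3 = 1 \<or> a = vector [0, 1, 0] \<or> a = vector [1, 0, 0]" "b$3 = 1 \<or> b = vector [0, 1, 0] \<or> b = vector [1, 0, 0]"
      using e(1,2) unfolding six_points_def by auto
    then show ?thesis using x e(4,5) by (elim disjE) (simp_all add: vec3_eq_iff)
  qed
  have j: "joins (pullback ?M w) (six_points c)"
  proof (rule joins_pullback[OF _ _ inj])
    show "joins w {p1, p2, p3, p4, p5, p6}" unfolding joins_def using J by blast
    fix a assume "a \<in> six_points c"
    then consider "a = q1" | "a = q2" | "a = q3" | "a = q4" | "a = ?q5" | "a = ?q6" unfolding S by blast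
    then show "\<exists>k. k \<noteq> 0 \<and> k *s (?M *v a) \<in> {p1, p2, p3, p4, p5, p6}"
      by cases (use k P1 P2 P3 P4 P5 P6 in blast)+
  qed
  have "\<exists>c'. joins (pullback ?M w) (six_points c') \<and> c' ^ 2 + 4 * c' - 1 = 0"
    using par(4)
  proof
    assume "c ^ 2 - 4 * c - 1 = 0"
    then show ?thesis using j six_points_minus[of c] by (intro exI[of _ "- c"]) simp
  qed (use j in blast)
  then obtain c' where c': "joins (pullback ?M w) (six_points c')" "c' ^ 2 + 4 * c' - 1 = 0" by blast
  obtain N k where N: "invertible N" "\<And>v. pullback N (pullback ?M w) v = k *s hilbert5 v"
    by (rule hilbert_from_six_points[OF hom_form_pullback c'], rule that)
  show thesis by (rule that[of "?M ** N" k]) (use N inv in \<open>simp_all add: pullback_mult invertible_mult\<close>)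
qed


section \<open>The configuration of the 5-fold points\<close>

context reduced_convex_form
begin

lemma distinct_permute: "distinct [a, b, c, d, e, f] \<Longrightarrow> distinct [a, c, b, d, e, f]"
    "distinct [a, b, c, d, e, f] \<Longrightarrow> distinct [b, c, a, d, e, f]"
    "distinct [a, b, c, d, e, f] \<Longrightarrow> distinct [a, b, c, f, d, e]"
    "distinct [a, b, c, d, e, f] \<Longrightarrow> distinct [a, b, c, e, d, f]"
  by auto

lemma insert_permute: "{a, b, c, d, e, f} = {a, c, b, d, e, f}" "{a, b, c, d, e, f} = {b, c, a, d, e, f}"
    "{a, b, c, d, e, f} = {a, b, c, f, d, e}" "{a, b, c, d, e, f} = {a, b, c, e, d, f}"
  by blast+

definition five_fold where "five_fold = {P. mu P = 5 \<and> (\<exists>L\<in>Inv. P \<in> pts L)}"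

definition rep where "rep P = (SOME p. p \<noteq> 0 \<and> P = vec.span {p :: complex^3})"

lemma rep: assumes "P \<in> five_fold" shows "rep P \<noteq> 0" "P = vec.span {rep P}"
proof -
  have "\<exists>p. p \<noteq> 0 \<and> P = vec.span {p}" using assms by (auto simp: five_fold_def pts_def)
  from someI_ex[OF this] show "rep P \<noteq> 0" "P = vec.span {rep P}" unfolding rep_def by blast+
qed

lemma five_fold_on: "L \<in> Inv \<Longrightarrow> {P \<in> five_fold. P \<subseteq> L} = {P \<in> pts L. mu P = 5}"
proof (rule set_eqI)
  fix P
  assume L: "L \<in> Inv"
  show "P \<in> {P \<in> five_fold. P \<subseteq> L} \<longleftrightarrow> P \<in> {P \<in> pts L. mu P = 5}"
    unfolding five_fold_def mem_Collect_eq using pts_mem[of P] pts_subset[of P L] L by meson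
qed

lemma rep_mem: "P \<in> five_fold \<Longrightarrow> L \<in> Inv \<Longrightarrow> rep P \<in> L \<longleftrightarrow> P \<subseteq> L"
  using rep span_subset_iff by metis

context
  assumes all: "\<And>L. L \<in> Inv \<Longrightarrow> type_3311 L"
begin

lemma finite_five_fold: "finite five_fold"
proof -
  have "finite (pts L)" if "L \<in> Inv" for L using line_main(1)[OF that] card_ge_0_finite by force
  then have "finite (\<Union>L\<in>Inv. pts L)" using finite_Inv by blast
  then show ?thesis by (rule rev_finite_subset) (auto simp: five_fold_def)
qed

lemma two_on_line: "L \<in> Inv \<Longrightarrow> card {P \<in> five_fold. P \<subseteq> L} = 2"
  using all five_fold_on by (simp add: type_3311_def)

text \<open>Incidences counted twice: 15 lines carry two such points each, and each point lies on
  five lines.\<close>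

lemma card_five_fold: "card five_fold = 6"
proof -
  have "(\<Sum>L\<in>Inv. card {P \<in> five_fold. P \<subseteq> L}) = (\<Sum>L\<in>Inv. \<Sum>P\<in>five_fold. if P \<subseteq> L then 1 else 0)"
    using finite_five_fold by (simp add: sum.If_cases Int_def)
  also have "\<dots> = (\<Sum>P\<in>five_fold. \<Sum>L\<in>Inv. if P \<subseteq> L then 1 else 0)" by (rule sum.swap)
  also have "\<dots> = (\<Sum>P\<in>five_fold. mu P)"
    using finite_Inv by (simp add: sum.If_cases Int_def mu_def)
  also have "\<dots> = (\<Sum>P\<in>five_fold. 5)" by (rule sum.cong) (auto simp: five_fold_def)
  finally show ?thesis using two_on_line card_Inv by simp
qed

lemma five_fold_unique_line:
  assumes "P \<in> five_fold" "Q \<in> five_fold" "P \<noteq> Q" "L \<in> Inv" "M \<in> Inv" "P \<subseteq> L" "Q \<subseteq> L" "P \<subseteq> M" "Q \<subseteq> M"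
  shows "L = M"
proof (rule ccontr)
  assume "L \<noteq> M"
  moreover have "P \<in> pts L" "Q \<in> pts L" using assms five_fold_on[OF assms(4)] by blast+
  ultimately show False using point_unique[OF assms(4,5)] assms by blast
qed

text \<open>Each of the five lines through \<open>P\<close> carries one more 5-fold point. Distinct
  lines give distinct points, so the five other points are all reached.\<close>

lemma joined:
  assumes P: "P \<in> five_fold" and Q: "Q \<in> five_fold" and ne: "P \<noteq> Q"
  shows "\<exists>L\<in>Inv. P \<subseteq> L \<and> Q \<subseteq> L"
proof -
  let ?C = "{L \<in> Inv. P \<subseteq> L}"
  define f where "f L = (SOME T. T \<in> five_fold \<and> T \<subseteq> L \<and> T \<noteq> P)" for L
  have f: "f L \<in> five_fold \<and> f L \<subseteq> L \<and> f L \<noteq> P" if "L \<in> ?C" for L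
  proof -
    have "\<exists>T. T \<in> five_fold \<and> T \<subseteq> L \<and> T \<noteq> P"
    proof (rule ccontr)
      assume "\<not> ?thesis"
      then have "{P \<in> five_fold. P \<subseteq> L} \<subseteq> {P}" by blast
      then have "card {P \<in> five_fold. P \<subseteq> L} \<le> card {P}" by (intro card_mono) auto
      then show False using two_on_line that by simp
    qed
    then show ?thesis unfolding f_def by (rule someI_ex)
  qed
  have inj: "inj_on f ?C"
  proof (rule inj_onI)
    fix L M assume LM: "L \<in> ?C" "M \<in> ?C" "f L = f M"
    then show "L = M" using five_fold_unique_line[of P "f L" L M] f[OF LM(1)] f[OF LM(2)] P by auto
  qed
  have "f ` ?C = five_fold - {P}"
  proof (rule card_subset_eq)
    show "finite (five_fold - {P})" using finite_five_fold by simp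
    show "f ` ?C \<subseteq> five_fold - {P}" using f by blast
    have "card ?C = 5" using P by (simp add: five_fold_def mu_def)
    then show "card (f ` ?C) = card (five_fold - {P})"
      using card_image[OF inj] card_five_fold P finite_five_fold by simp
  qed
  then have "Q \<in> f ` ?C" using Q ne by blast
  then show ?thesis using f by blast
qed

lemma no_three:
  assumes "P \<in> five_fold" "Q \<in> five_fold" "T \<in> five_fold" "P \<noteq> Q" "P \<noteq> T" "Q \<noteq> T" "L \<in> Inv"
  shows "\<not> (P \<subseteq> L \<and> Q \<subseteq> L \<and> T \<subseteq> L)"
proof
  assume "P \<subseteq> L \<and> Q \<subseteq> L \<and> T \<subseteq> L"
  then have "{P, Q, T} \<subseteq> {P \<in> five_fold. P \<subseteq> L}" using assms by blast
  then have "card {P, Q, T} \<le> card {P \<in> five_fold. P \<subseteq> L}" by (intro card_mono) (use finite_five_fold in auto)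
  then show False using two_on_line[OF assms(7)] assms by simp
qed

lemma join_line:
  assumes "P \<in> five_fold" "Q \<in> five_fold" "L \<in> Inv" "P \<subseteq> L" "Q \<subseteq> L" "P \<noteq> Q"
  shows "cr (rep P) (rep Q) \<noteq> 0" "L = line_of (cr (rep P) (rep Q))"
proof -
  show c: "cr (rep P) (rep Q) \<noteq> 0" using span_single_eq_iff[OF rep(1)[OF assms(1)] rep(1)[OF assms(2)]] rep(2) assms by metis
  show "L = line_of (cr (rep P) (rep Q))"
    using line_of_through[OF c, of "nrm L"] nrm[OF assms(3)] rep_mem assms by metis
qed

lemma inv2_rep:
  assumes "P \<in> five_fold" "Q \<in> five_fold" "P \<noteq> Q" shows "inv2 w (rep P) (rep Q)"
proof -
  obtain L where L: "L \<in> Inv" "P \<subseteq> L" "Q \<subseteq> L" using joined[OF assms] by blast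
  note j = join_line[OF assms(1,2) L assms(3)]
  show ?thesis using invariant_line_inv2[OF j(1)] j(2) L(1) by (simp add: Inv_def)
qed

lemma det_rep:
  assumes "P \<in> five_fold" "Q \<in> five_fold" "T \<in> five_fold" "P \<noteq> Q" "P \<noteq> T" "Q \<noteq> T"
  shows "dot3 (cr (rep P) (rep Q)) (rep T) \<noteq> 0"
proof
  assume z: "dot3 (cr (rep P) (rep Q)) (rep T) = 0"
  obtain L where L: "L \<in> Inv" "P \<subseteq> L" "Q \<subseteq> L" using joined[OF assms(1,2,4)] by blast
  have "rep T \<in> L" using z join_line(2)[OF assms(1,2) L assms(4)] by (simp add: line_of_def)
  then show False using no_three[OF assms L(1)] L rep_mem[OF assms(3) L(1)] by blast
qed

lemma rep_inj: "P \<in> five_fold \<Longrightarrow> Q \<in> five_fold \<Longrightarrow> P \<noteq> Q \<Longrightarrow> rep P \<noteq> rep Q"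
  using rep(2) by metis

definition meets where "meets T P Q \<longleftrightarrow> (\<exists>M\<in>Inv. T \<subseteq> M \<and> P \<subseteq> M \<and> Q \<subseteq> M)"

lemma meets_commute: "meets T P Q \<longleftrightarrow> meets T Q P"
  by (auto simp: meets_def)

text \<open>
  Besides the line through \<open>P\<close> and \<open>Q\<close>, two more lines pass through each of its two triple points.
  They join the four other points of multiplicity five in pairs.
\<close>

lemma two_pairings:
  assumes S: "five_fold = {P, Q, A, B, C, D}" and dist: "distinct [P, Q, A, B, C, D]"
  shows "two_of_three (concurrent (rep P) (rep Q) (rep A) (rep B) (rep C) (rep D))
    (concurrent (rep P) (rep Q) (rep A) (rep C) (rep B) (rep D)) (concurrent (rep P) (rep Q) (rep A) (rep D) (rep B) (rep C))"
proof -
  have mem: "P \<in> five_fold" "Q \<in> five_fold" "A \<in> five_fold" "B \<in> five_fold" "C \<in> five_fold" "D \<in> five_fold"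
    unfolding S by simp_all
  have ne: "P \<noteq> Q" "A \<noteq> B" "A \<noteq> C" "A \<noteq> D" "B \<noteq> C" "B \<noteq> D" "C \<noteq> D" and neP: "A \<noteq> P" "B \<noteq> P" "C \<noteq> P" "D \<noteq> P"
    "A \<noteq> Q" "B \<noteq> Q" "C \<noteq> Q" "D \<noteq> Q" using dist by auto
  obtain L where L: "L \<in> Inv" "P \<subseteq> L" "Q \<subseteq> L" using joined[OF mem(1,2) ne(1)] by blast
  have "card {T \<in> pts L. mu T = 3} = 2" using all[OF L(1)] by (simp add: type_3311_def)
  then obtain T1 T2 where T: "{T \<in> pts L. mu T = 3} = {T1, T2}" "T1 \<noteq> T2" by (auto simp: card_2_iff)
  have share: "X = T" if "M \<in> Inv" "N \<in> Inv" "M \<noteq> N" "T \<in> pts L" "T \<subseteq> M" "T \<subseteq> N" "X \<in> five_fold" "X \<subseteq> M" "X \<subseteq> N" for X T M N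
  proof -
    have "T \<in> pts M" using that pts_mem L(1) by blast
    moreover have "X \<in> pts M" using that five_fold_on by blast
    ultimately show ?thesis using point_unique[OF that(1,2,3), of T X M] that by simp
  qed
  have pairing: "meets T A B \<and> meets T C D \<or> meets T A C \<and> meets T B D \<or> meets T A D \<and> meets T B C"
    if T: "T \<in> pts L" "mu T = 3" for T
  proof -
    have "card ({M \<in> Inv. T \<subseteq> M} - {L}) = 2"
      using T L pts_subset finite_Inv unfolding mu_def by simp
    then obtain M N where MN: "{M \<in> Inv. T \<subseteq> M} - {L} = {M, N}" "M \<noteq> N" by (auto simp: card_2_iff)
    then have M: "M \<in> Inv" "T \<subseteq> M" "M \<noteq> L" and N: "N \<in> Inv" "T \<subseteq> N" "N \<noteq> L" by blast+
    have TL: "T \<subseteq> L" using T L pts_subset by blast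
    have n5: "T \<notin> five_fold" using T by (simp add: five_fold_def)
    have off: "\<not> P \<subseteq> K \<and> \<not> Q \<subseteq> K" if "K \<in> Inv" "T \<subseteq> K" "K \<noteq> L" for K
      using share[OF that(1) L(1) that(3) T(1) that(2) TL] mem n5 L by blast
    have two: "\<exists>X Y. X \<noteq> Y \<and> X \<in> {A, B, C, D} \<and> Y \<in> {A, B, C, D} \<and> X \<subseteq> K \<and> Y \<subseteq> K"
      if K: "K \<in> Inv" "T \<subseteq> K" "K \<noteq> L" for K
    proof -
      obtain X Y where XY: "{P \<in> five_fold. P \<subseteq> K} = {X, Y}" "X \<noteq> Y" using two_on_line[OF K(1)] by (auto simp: card_2_iff)
      then have "X \<in> five_fold" "Y \<in> five_fold" "X \<subseteq> K" "Y \<subseteq> K" by blast+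
      then show ?thesis using XY(2) off[OF K] unfolding S by blast
    qed
    obtain X Y where XY: "X \<noteq> Y" "X \<in> {A, B, C, D}" "Y \<in> {A, B, C, D}" "X \<subseteq> M" "Y \<subseteq> M" using two[OF M] by blast
    obtain Z W where ZW: "Z \<noteq> W" "Z \<in> {A, B, C, D}" "W \<in> {A, B, C, D}" "Z \<subseteq> N" "W \<subseteq> N" using two[OF N] by blast
    have disj: "X' \<noteq> Z'" if "X' \<in> {A, B, C, D}" "X' \<subseteq> M" "Z' \<subseteq> N" for X' Z'
      using share[OF M(1) N(1) MN(2) T(1) M(2) N(2), of X'] that mem n5 by blast
    have d: "X \<noteq> Z" "X \<noteq> W" "Y \<noteq> Z" "Y \<noteq> W"
      by (rule disj[OF XY(2,4) ZW(4)], rule disj[OF XY(2,4) ZW(5)], rule disj[OF XY(3,5) ZW(4)], rule disj[OF XY(3,5) ZW(5)])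
    have m: "meets T X Y" "meets T Z W"
      unfolding meets_def by (rule bexI[OF _ M(1)], intro conjI M(2) XY(4,5)) (rule bexI[OF _ N(1)], intro conjI N(2) ZW(4,5))
    have m': "meets T Y X" "meets T W Z"
      by (rule iffD1[OF meets_commute m(1)], rule iffD1[OF meets_commute m(2)])
    show ?thesis using XY(1-3) ZW(1-3) d m m' by (elim insertE emptyE) simp_all
  qed
  \<comment> \<open>The two 3-fold points realise different pairings: if the line through
    \<open>A\<close> and \<open>X\<close> contained both of them it would be \<open>L\<close>, which
    would then carry three 5-fold points.\<close>
  have once: "\<not> (meets T1 A X \<and> meets T2 A X)" if X: "X \<in> five_fold" "A \<noteq> X" "X \<noteq> P" "X \<noteq> Q" for X
  proof
    assume "meets T1 A X \<and> meets T2 A X"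
    then obtain M N where MN: "M \<in> Inv" "N \<in> Inv" "T1 \<subseteq> M" "A \<subseteq> M" "X \<subseteq> M" "T2 \<subseteq> N" "A \<subseteq> N" "X \<subseteq> N"
      by (auto simp: meets_def)
    then have "M = N" using five_fold_unique_line[OF mem(3) X(1,2)] by blast
    moreover have "M \<noteq> L"
      using no_three[OF mem(1,2,3) ne(1) neP(1)[symmetric] neP(5)[symmetric] L(1)] L MN by blast
    moreover have "T1 \<in> pts L" "T2 \<in> pts L" using T(1) by blast+
    ultimately have "T1 = T2"
      using point_unique[OF L(1) MN(1), of T1 T2 L] MN pts_subset[OF _ L(1)] by blast
    then show False using T(2) by simp
  qed
  have conc: "concurrent (rep P) (rep Q) (rep X) (rep Y) (rep Z) (rep W)"
    if m: "meets T X Y" "meets T Z W" "T \<in> pts L" and XY: "X \<in> five_fold" "Y \<in> five_fold" "Z \<in> five_fold" "W \<in> five_fold" "X \<noteq> Y" "Z \<noteq> W"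
    for T X Y Z W
  proof -
    obtain t where t: "t \<noteq> 0" "T = vec.span {t}" "t \<in> L" using m(3) by (auto simp: pts_def)
    have on: "dot3 (cr (rep X) (rep Y)) t = 0" if XY: "meets T X Y" "X \<in> five_fold" "Y \<in> five_fold" "X \<noteq> Y" for X Y
    proof -
      obtain M where M: "M \<in> Inv" "T \<subseteq> M" "X \<subseteq> M" "Y \<subseteq> M" using XY(1) unfolding meets_def by metis
      then have "t \<in> M" using t span_subset_iff by blast
      then show ?thesis using join_line(2)[OF XY(2,3) M(1,3,4) XY(4)] by (simp add: line_of_def)
    qed
    have "meets T P Q" unfolding meets_def using L pts_subset[OF m(3) L(1)] by metis
    then have "dot3 (cr (rep P) (rep Q)) t = 0" by (rule on[OF _ mem(1,2) ne(1)])
    then show ?thesis unfolding concurrent_def using t(1) on[OF m(1) XY(1,2,5)] on[OF m(2) XY(3,4,6)] by blast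
  qed
  have T12: "T1 \<in> pts L" "mu T1 = 3" "T2 \<in> pts L" "mu T2 = 3" using T(1) by blast+
  have c1: "\<And>T. T \<in> pts L \<Longrightarrow> meets T A B \<Longrightarrow> meets T C D \<Longrightarrow> concurrent (rep P) (rep Q) (rep A) (rep B) (rep C) (rep D)"
    "\<And>T. T \<in> pts L \<Longrightarrow> meets T A C \<Longrightarrow> meets T B D \<Longrightarrow> concurrent (rep P) (rep Q) (rep A) (rep C) (rep B) (rep D)"
    "\<And>T. T \<in> pts L \<Longrightarrow> meets T A D \<Longrightarrow> meets T B C \<Longrightarrow> concurrent (rep P) (rep Q) (rep A) (rep D) (rep B) (rep C)"
    by (rule conc[rotated 2, OF _ mem(3,4,5,6) ne(2,7)], assumption+, rule conc[rotated 2, OF _ mem(3,5,4,6) ne(3,6)], assumption+,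
        rule conc[rotated 2, OF _ mem(3,6,4,5) ne(4,5)], assumption+)
  have "\<not> (meets T1 A B \<and> meets T2 A B)" "\<not> (meets T1 A C \<and> meets T2 A C)" "\<not> (meets T1 A D \<and> meets T2 A D)"
    using once[OF mem(4) ne(2) neP(2) neP(6)] once[OF mem(5) ne(3) neP(3) neP(7)] once[OF mem(6) ne(4) neP(4) neP(8)] by simp_all
  then show ?thesis using pairing[OF T12(1,2)] pairing[OF T12(3,4)] c1[OF T12(1)] c1[OF T12(3)]
    unfolding two_of_three_def by argo
qed

text \<open>On the line through the first two points, two of the three pairings of the remaining
  four are realised. The points are relabelled so that the missing pairing is \<open>P3 P4\<close>
  with \<open>P5 P6\<close>, and the realised ones make \<open>P3 P5 P4 P6\<close> a
  parallelogram.\<close>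

lemma hilbert_case: "conjugate_foliations w hilbert5"
proof -
  obtain xs where xs: "set xs = five_fold" "distinct xs" using finite_distinct_list[OF finite_five_fold] by blast
  then have "length xs = 6" using card_five_fold distinct_card by fastforce
  then obtain P Q A B C D where P: "xs = [P, Q, A, B, C, D]" by (auto simp: length_Suc_conv numeral_eq_Suc)
  have main: "conjugate_foliations w hilbert5"
    if S: "five_fold = {P1, P2, P3, P4, P5, P6}" and d: "distinct [P1, P2, P3, P4, P5, P6]"
      and C: "concurrent (rep P1) (rep P2) (rep P3) (rep P5) (rep P4) (rep P6)"
        "concurrent (rep P1) (rep P2) (rep P3) (rep P6) (rep P4) (rep P5)" for P1 P2 P3 P4 P5 P6
  proof -
    have mem: "P1 \<in> five_fold" "P2 \<in> five_fold" "P3 \<in> five_fold" "P4 \<in> five_fold" "P5 \<in> five_fold" "P6 \<in> five_fold"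
      unfolding S by simp_all
    have R: "{rep P1, rep P2, rep P3, rep P4, rep P5, rep P6} = rep ` five_fold" unfolding S by simp
    have inj: "inj_on rep five_fold" using rep_inj by (auto intro: inj_onI)
    have "distinct (map rep [P1, P2, P3, P4, P5, P6])" using d inj S by (simp add: distinct_map)
    then have dr: "distinct [rep P1, rep P2, rep P3, rep P4, rep P5, rep P6]" by simp
    have S2: "five_fold = {P1, P3, P2, P4, P5, P6}" "distinct [P1, P3, P2, P4, P5, P6]"
      by (rule trans[OF S], rule insert_permute(1)) (rule distinct_permute(1)[OF d])
    have S3: "five_fold = {P2, P3, P1, P4, P5, P6}" "distinct [P2, P3, P1, P4, P5, P6]"
      by (rule trans[OF S], rule insert_permute(2)) (rule distinct_permute(2)[OF d])
    have T1: "two_of_three (concurrent (rep P1) (rep P3) (rep P2) (rep P4) (rep P5) (rep P6))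
       (concurrent (rep P1) (rep P3) (rep P2) (rep P5) (rep P4) (rep P6)) (concurrent (rep P1) (rep P3) (rep P2) (rep P6) (rep P4) (rep P5))"
      by (rule two_pairings[OF S2])
    have T2: "two_of_three (concurrent (rep P2) (rep P3) (rep P1) (rep P4) (rep P5) (rep P6))
       (concurrent (rep P2) (rep P3) (rep P1) (rep P5) (rep P4) (rep P6)) (concurrent (rep P2) (rep P3) (rep P1) (rep P6) (rep P4) (rep P5))"
      by (rule two_pairings[OF S3])
    have J: "inv2 w a b" if "a \<in> rep ` five_fold" "b \<in> rep ` five_fold" "a \<noteq> b" for a b
      using that inv2_rep by blast
    have D: "dot3 (cr a b) c \<noteq> 0" if abc: "a \<in> rep ` five_fold" "b \<in> rep ` five_fold" "c \<in> rep ` five_fold" "a \<noteq> b" "a \<noteq> c" "b \<noteq> c" for a b c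
    proof -
      obtain A B C where "A \<in> five_fold" "B \<in> five_fold" "C \<in> five_fold" "a = rep A" "b = rep B" "c = rep C" using abc(1-3) by blast
      then show ?thesis using det_rep[of A B C] abc(4-6) by metis
    qed
    obtain M k where M: "invertible M" "\<And>v. pullback M w v = k *s hilbert5 v"
      by (rule hilbert_from_configuration[OF hom_form_axioms dr _ _ C T1 T2], rule J[folded R], assumption+,
        rule D[folded R], assumption+, rule that)
    \<comment> \<open>\<open>same_foliation\<close> asks for a nonzero factor. With
      \<open>k = 0\<close> the form \<open>w\<close> itself would vanish identically.\<close>
    have "k \<noteq> 0"
    proof
      assume "k = 0"
      then have "dot3 (w (M *v v)) (M *v u) = 0" for u v using M(2)[of v] dot3_pullback[of M w v u] by simp
      moreover obtain N where N: "M ** N = mat 1" using M(1) by (auto simp: invertible_def)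
      ultimately have z: "dot3 (w v) u = 0" for u v
        by (metis matrix_vector_mul_assoc matrix_vector_mul_lid)
      show False using not_all_tangent[OF rep(1)[OF mem(1)]] z by blast
    qed
    then show ?thesis unfolding conjugate_foliations_def same_foliation_def using M by blast
  qed
  have S: "five_fold = {P, Q, A, B, C, D}" and d: "distinct [P, Q, A, B, C, D]" using xs P by auto
  from two_pairings[OF S d] consider
    "concurrent (rep P) (rep Q) (rep A) (rep B) (rep C) (rep D)" "concurrent (rep P) (rep Q) (rep A) (rep C) (rep B) (rep D)"
    | "concurrent (rep P) (rep Q) (rep A) (rep B) (rep C) (rep D)" "concurrent (rep P) (rep Q) (rep A) (rep D) (rep B) (rep C)"
    | "concurrent (rep P) (rep Q) (rep A) (rep C) (rep B) (rep D)" "concurrent (rep P) (rep Q) (rep A) (rep D) (rep B) (rep C)"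
    unfolding two_of_three_def by blast
  then show ?thesis
  proof cases
    case 1
    show ?thesis
    proof (rule main[of P Q A D B C])
      show "five_fold = {P, Q, A, D, B, C}" by (rule trans[OF S], rule insert_permute(3))
      show "distinct [P, Q, A, D, B, C]" by (rule distinct_permute(3)[OF d])
    qed (use 1 concurrent_swap in blast)+
  next
    case 2
    show ?thesis
    proof (rule main[of P Q A C B D])
      show "five_fold = {P, Q, A, C, B, D}" by (rule trans[OF S], rule insert_permute(4))
      show "distinct [P, Q, A, C, B, D]" by (rule distinct_permute(4)[OF d])
    qed (use 2 concurrent_swap in blast)+
  next
    case 3
    show ?thesis
      by (rule main[OF S d]) (use 3 in blast)+
  qed
qed

end

lemma classification: "conjugate_foliations w fermat5 \<or> conjugate_foliations w hilbert5"
  using fermat_case hilbert_case by blast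

end

section \<open>Tangencies with a line\<close>

lemma sum_order_complex:
  fixes p :: "complex poly"
  assumes "p \<noteq> 0" shows "(\<Sum>x | poly p x = 0. order x p) = degree p"
  using assms size_proots_complex[of p] by (simp add: size_multiset_overloaded_eq)

context hom_form
begin

lemma noninvariant_line_E:
  assumes "\<not> invariant_line w (line_of l)" "l \<noteq> 0"
  obtains a b where "cr a b \<noteq> 0" "line_of l = line_of (cr a b)" "dot3 (w b) a \<noteq> 0"
proof -
  obtain b a where ab: "b \<in> line_of l" "a \<in> line_of l" "dot3 (w b) a \<noteq> 0"
    using assms by (auto simp: invariant_line_def proj_line_def)
  have "cr a b \<noteq> 0"
  proof
    assume c: "cr a b = 0"
    show False
    proof (cases "a = 0")
      case False
      then obtain k where "b = k *s a" using cr_eq_0D c by metis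
      then have "dot3 (w b) a = k ^ e * dot3 (w a) a" by (simp add: w_scale)
      then show False using ab(3) radial by simp
    qed (use ab in simp)
  qed
  then show thesis using line_of_through[OF _ ab(2,1) assms(2)] ab(3) that by blast
qed

text \<open>Seen from the point at infinity \<open>b\<close>, the polynomial is reversed; its
  constant term is \<open>dot3 (w b) a\<close>, so no degree is lost exactly because
  \<open>b\<close> is not a point of tangency.\<close>

lemma degree_along_line:
  assumes g: "\<And>t. poly g t = dot3 (w (a + t *s b)) a" and nz: "dot3 (w b) a \<noteq> 0"
  shows "degree g = e" "g \<noteq> 0"
proof -
  obtain h where h: "degree h \<le> e" "\<And>t. dot3 (w (b + t *s a)) a = poly h t"
    using hp_restrict[OF hp_w[of a], of b a] by blast
  have h0: "coeff h 0 \<noteq> 0" using nz h(2)[of 0] by (simp add: poly_0_coeff_0)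
  have "poly g t = poly (monom 1 (e - degree h) * reflect_poly h) t" if t: "t \<noteq> 0" for t
  proof -
    have "a + t *s b = t *s (b + inverse t *s a)" using t by (simp add: vector_add_ldistrib vector_smult_assoc)
    then have "poly g t = t ^ e * poly h (inverse t)" unfolding g by (simp only: w_scale dot3_scale h(2))
    also have "\<dots> = t ^ (e - degree h) * (t ^ degree h * poly h (inverse t))"
      using h(1) by (simp flip: power_add mult.assoc)
    finally show ?thesis using t by (simp add: poly_monom poly_reflect_poly_nz)
  qed
  then have "poly ([:0, 1:] * g) t = poly ([:0, 1:] * (monom 1 (e - degree h) * reflect_poly h)) t" for t
    by (cases "t = 0") simp_all
  then have "[:0, 1:] * g = [:0, 1:] * (monom 1 (e - degree h) * reflect_poly h)" by (rule poly_ext)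
  then have G: "g = monom 1 (e - degree h) * reflect_poly h" by simp
  have "h \<noteq> 0" using h0 by auto
  then show "g \<noteq> 0" unfolding G by (simp add: monom_eq_0_iff)
  show "degree g = e" unfolding G using h0 h(1) \<open>h \<noteq> 0\<close> by (subst degree_mult_eq) (simp_all add: monom_eq_0_iff degree_monom_eq)
qed

text \<open>
  In the parameter \<open>t\<close> of the line, the parametrisation \<open>s \<mapsto> p + s q\<close> is a Moebius transformation.
\<close>

lemma zorder_along_line:
  assumes f: "\<And>t. poly f t = dot3 (w (a + t *s b)) b" "f \<noteq> 0" and c: "c \<noteq> 0" and q: "\<beta> - \<alpha> * t \<noteq> 0"
    and p: "p = c *s (a + t *s b)" "q = \<alpha> *s a + \<beta> *s b"
    and e: "e \<ge> 1"
  shows "zorder (\<lambda>s. dot3 (w (p + s *s q)) q) 0 = int (order t f)"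
proof -
  obtain h where h: "f = [:- t, 1:] ^ order t f * h" "\<not> [:- t, 1:] dvd h" using order_decomp[OF f(2)] by blast
  define n where "n = order t f"
  have fh: "poly f x = (x - t) ^ n * poly h x" for x
    by (subst h(1)) (simp add: n_def algebra_simps)
  have ht: "poly h t \<noteq> 0" using h(2) by (simp add: poly_eq_0_iff_dvd)
  define \<delta> where "\<delta> = \<beta> - \<alpha> * t"
  \<comment> \<open>These are set up so that \<open>p + s q = m s (a + \<tau> s b)\<close>. The
    function \<open>H\<close> is the cofactor of \<open>s^n\<close>; its exponent
    \<open>e - 1\<close> arises because one factor \<open>m s\<close> combines with
    \<open>\<beta> - \<alpha> \<tau> s\<close> to the constant \<open>c \<delta>\<close>.\<close>
  define m where "m s = c + s * \<alpha>" for s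
  define \<tau> where "\<tau> s = (c * t + s * \<beta>) / m s" for s
  define S where "S = {s. m s \<noteq> 0}"
  define H where "H s = m s ^ (e - 1) * c * \<delta> * (\<delta> / m s) ^ n * poly h (\<tau> s)" for s
  show ?thesis unfolding n_def[symmetric]
  proof (rule zorder_eqI)
    show "open S" unfolding S_def m_def by (intro open_Collect_neq continuous_intros)
    show "0 \<in> S" using c by (simp add: S_def m_def)
    have m: "m holomorphic_on S" unfolding m_def by (intro holomorphic_intros)
    have "\<tau> holomorphic_on S" unfolding \<tau>_def by (intro holomorphic_intros m) (simp add: S_def)
    then show "H holomorphic_on S" unfolding H_def
      by (intro holomorphic_intros m) (simp_all add: S_def)
    have "\<tau> 0 = t" using c by (simp add: \<tau>_def m_def)
    then show "H 0 \<noteq> 0" using c q ht by (simp add: H_def m_def \<delta>_def)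
    fix s assume s: "s \<in> S" "s \<noteq> 0"
    then have m0: "m s \<noteq> 0" by (simp add: S_def)
    have mt: "m s * \<tau> s = c * t + s * \<beta>" using m0 by (simp add: \<tau>_def)
    have pq: "p + s *s q = m s *s (a + \<tau> s *s b)"
      unfolding vector_add_ldistrib vector_smult_assoc mt unfolding p m_def by (simp add: vec_eq_iff algebra_simps)
    have "dot3 (w (a + \<tau> s *s b)) (a + \<tau> s *s b) = 0" by (rule radial)
    then have "dot3 (w (a + \<tau> s *s b)) a = - \<tau> s * poly f (\<tau> s)" by (simp add: f(1) add_eq_0_iff)
    then have "dot3 (w (p + s *s q)) q = m s ^ e * ((\<beta> - \<alpha> * \<tau> s) * poly f (\<tau> s))"
      unfolding pq w_scale unfolding p(2) by (simp add: f(1) algebra_simps)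
    also have "\<dots> = m s ^ (e - 1) * ((m s * \<beta> - \<alpha> * (m s * \<tau> s)) * poly f (\<tau> s))"
      using e by (cases e) (simp_all add: algebra_simps)
    also have "m s * \<beta> - \<alpha> * (m s * \<tau> s) = c * \<delta>" unfolding mt by (simp add: m_def \<delta>_def algebra_simps)
    also have "\<tau> s - t = s * (\<delta> / m s)" using m0 by (simp add: \<tau>_def \<delta>_def m_def field_simps)
    then have "poly f (\<tau> s) = s ^ n * (\<delta> / m s) ^ n * poly h (\<tau> s)" unfolding fh by (simp only: power_mult_distrib)
    finally show "dot3 (w (p + s *s q)) q = H s * (s - 0) powi int n"
      by (simp add: H_def algebra_simps)
  qed
qed

text \<open>The pair selected in \<open>tangency_mult\<close> is arbitrary, but every admissible one
  has the shape treated in \<open>zorder_along_line\<close>: \<open>p\<close> is a nonzero multiple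
  of \<open>a + t b\<close>, and \<open>q\<close> is not a multiple of it.\<close>

lemma tangency_mult_eq_order:
  assumes f: "\<And>t. poly f t = dot3 (w (a + t *s b)) b" "f \<noteq> 0" and ab: "cr a b \<noteq> 0" and e: "e \<ge> 1"
  shows "tangency_mult w (line_of (cr a b)) (vec.span {a + t *s b}) = order t f"
proof -
  let ?Q = "\<lambda>(p, q). vec.span {a + t *s b} = vec.span {p} \<and> line_of (cr a b) = vec.span {p, q}"
  have "cr (a + t *s b) b \<noteq> 0" using ab by simp
  from span_pair_eq_line_of[OF this] have "?Q (a + t *s b, b)" by simp
  then have "?Q (SOME x. ?Q x)" by (rule someI)
  moreover obtain p q where pq1: "(SOME x. ?Q x) = (p, q)" by (rule prod.exhaust)
  ultimately have pq: "(SOME x. ?Q x) = (p, q)" "vec.span {a + t *s b} = vec.span {p}"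
    "line_of (cr a b) = vec.span {p, q}" by simp_all
  have "p \<in> vec.span {a + t *s b}" unfolding pq(2) by (simp add: vec.span_base)
  then obtain c where c: "p = c *s (a + t *s b)" by (auto simp: span_single)
  have c0: "c \<noteq> 0"
  proof
    assume "c = 0"
    then have "p = 0" using c by simp
    have "a + t *s b \<in> vec.span {p}" unfolding pq(2)[symmetric] by (simp add: vec.span_base)
    then have "a + t *s b = 0" unfolding \<open>p = 0\<close> span_single by auto
    then have "cr (a + t *s b) b = 0" by simp
    then show False using ab by simp
  qed
  have "q \<in> line_of (cr a b)" unfolding pq(3) by (simp add: vec.span_base)
  then obtain \<alpha> \<beta> where q: "q = \<alpha> *s a + \<beta> *s b" using line_of_cr_E[OF ab] by (auto simp: line_of_def)
  have "\<beta> - \<alpha> * t \<noteq> 0"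
  proof
    assume "\<beta> - \<alpha> * t = 0"
    then have q': "q = \<alpha> *s (a + t *s b)" unfolding q by (simp add: vec_eq_iff algebra_simps)
    have "cr (a + t *s b) v = 0" if "v \<in> line_of (cr a b)" for v
    proof -
      from that obtain x y where "v = x *s p + y *s q" unfolding pq(3) span_pair by auto
      then have "v = (x * c + y * \<alpha>) *s (a + t *s b)" unfolding c q' by (simp only: vector_smult_assoc vector_sadd_rdistrib)
      then show ?thesis by (simp only: cr_scale cr_self vector_smult_rzero)
    qed
    from this[of b] have "cr (a + t *s b) b = 0" by (simp add: line_of_def)
    then show False using ab by simp
  qed
  from zorder_along_line[OF f c0 this c q e] show ?thesis
    unfolding tangency_mult_def pq(1) by simp
qed

text \<open>The radial relation gives \<open>g = - t f\<close> along the line, so \<open>f\<close>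
  has degree \<open>e - 1\<close>. The point \<open>b\<close> at infinity is not a tangency, hence
  all tangencies are zeros of \<open>f\<close>, and the orders of these add up to its
  degree.\<close>

lemma tangency_number_eq:
  assumes "\<not> invariant_line w (line_of l)" "l \<noteq> 0"
  shows "e \<ge> 1" "tangency_number w (line_of l) = e - 1"
proof -
  obtain a b where ab: "cr a b \<noteq> 0" "line_of l = line_of (cr a b)" "dot3 (w b) a \<noteq> 0"
    by (rule noninvariant_line_E[OF assms])
  obtain f g where f: "\<And>t. dot3 (w (a + t *s b)) b = poly f t" and g: "\<And>t. dot3 (w (a + t *s b)) a = poly g t"
    using hp_restrict[OF hp_w] by metis
  have gf: "poly g t = - t * poly f t" for t
    using radial[of "a + t *s b"] by (simp add: f g add_eq_0_iff)
  then have "poly g t = poly ([:0, -1:] * f) t" for t by simp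
  then have G: "g = [:0, -1:] * f" by (rule poly_ext)
  note dg = degree_along_line[OF g[symmetric] ab(3)]
  have f0: "f \<noteq> 0" using dg(2) G by auto
  have "degree g = Suc (degree f)" unfolding G using f0 by (subst degree_mult_eq) simp_all
  then have df: "e = Suc (degree f)" using dg(1) by simp
  then show e: "e \<ge> 1" by simp
  define T where "T t = vec.span {a + t *s b}" for t
  have nz: "a + t *s b \<noteq> 0" for t
  proof
    assume "a + t *s b = 0"
    then have "cr (a + t *s b) b = 0" by simp
    then show False using ab by simp
  qed
  have inj: "inj T"
  proof (rule injI)
    fix s t assume "T s = T t"
    then have "cr (a + s *s b) (a + t *s b) = 0" unfolding T_def span_single_eq_iff[OF nz nz] .
    moreover have "cr (a + s *s b) (a + t *s b) = (t - s) *s cr a b" by (simp add: vec3_eq_iff algebra_simps)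
    ultimately show "s = t" using ab(1) by (simp add: vec_eq_iff) metis
  qed
  have tang: "(\<forall>q\<in>line_of l. dot3 (w v) q = 0) \<longleftrightarrow> dot3 (w v) a = 0 \<and> dot3 (w v) b = 0" for v
  proof
    assume "\<forall>q\<in>line_of l. dot3 (w v) q = 0"
    then show "dot3 (w v) a = 0 \<and> dot3 (w v) b = 0" unfolding ab(2) by (simp add: line_of_def)
  next
    assume z: "dot3 (w v) a = 0 \<and> dot3 (w v) b = 0"
    show "\<forall>q\<in>line_of l. dot3 (w v) q = 0"
    proof
      fix q assume "q \<in> line_of l"
      then obtain x y where "q = x *s a + y *s b" unfolding ab(2) using line_of_cr_E[OF ab(1)] by (auto simp: line_of_def)
      then show "dot3 (w v) q = 0" using z by simp
    qed
  qed
  have "tangency_points w (line_of l) = T ` {t. poly f t = 0}"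
  proof (intro equalityI subsetI)
    fix P assume "P \<in> tangency_points w (line_of l)"
    then obtain p where p: "p \<noteq> 0" "P = vec.span {p}" "P \<subseteq> line_of l" "\<forall>p\<in>P. \<forall>q\<in>line_of l. dot3 (w p) q = 0"
      by (auto simp: tangency_points_def proj_point_def)
    have pP: "p \<in> P" unfolding p(2) by (simp add: vec.span_base)
    then have "p \<in> line_of (cr a b)" using p(3) ab(2) by blast
    then obtain x y where xy: "p = x *s a + y *s b" using line_of_cr_E[OF ab(1)] by (auto simp: line_of_def)
    have pa: "dot3 (w p) a = 0" "dot3 (w p) b = 0" using p(4) pP tang by blast+
    have x: "x \<noteq> 0"
    proof
      assume x: "x = 0"
      then have "y \<noteq> 0" using p(1) xy by auto
      moreover have "y ^ e * dot3 (w b) a = 0" using pa(1) unfolding xy x by (simp add: w_scale)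
      ultimately show False using ab(3) by simp
    qed
    have px: "p = x *s (a + (y / x) *s b)" using x unfolding xy by (simp add: vec_eq_iff algebra_simps)
    have "cr p (a + (y / x) *s b) = 0" by (subst px) (simp only: cr_scale cr_self vector_smult_rzero)
    then have "P = T (y / x)" unfolding T_def p(2) span_single_eq_iff[OF p(1) nz] .
    moreover have "poly f (y / x) = 0"
    proof -
      have "x ^ e * poly f (y / x) = 0" using pa(2) by (subst (asm) px) (simp only: w_scale dot3_scale f)
      then show ?thesis using x by simp
    qed
    ultimately show "P \<in> T ` {t. poly f t = 0}" by blast
  next
    fix P assume "P \<in> T ` {t. poly f t = 0}"
    then obtain t where t: "poly f t = 0" "P = vec.span {a + t *s b}" by (auto simp: T_def)
    have "dot3 (w (a + t *s b)) a = 0 \<and> dot3 (w (a + t *s b)) b = 0" unfolding f g gf t(1) by simp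
    then have "\<forall>q\<in>line_of l. dot3 (w (c *s (a + t *s b))) q = 0" for c
      unfolding w_scale using tang by simp
    then have "\<forall>p\<in>P. \<forall>q\<in>line_of l. dot3 (w p) q = 0" unfolding t(2) span_single by auto
    moreover have "a + t *s b \<in> line_of l" unfolding ab(2) by (simp add: line_of_def)
    ultimately show "P \<in> tangency_points w (line_of l)"
      unfolding tangency_points_def proj_point_def t(2) mem_Collect_eq span_single_subset_line
      by (intro conjI exI[of _ "a + t *s b"] nz refl)
  qed
  then have "tangency_number w (line_of l) = (\<Sum>t | poly f t = 0. tangency_mult w (line_of l) (T t))"
    unfolding tangency_number_def using inj by (simp add: sum.reindex inj_on_def)
  also have "\<dots> = (\<Sum>t | poly f t = 0. order t f)"
    unfolding ab(2) T_def using tangency_mult_eq_order[OF f[symmetric] f0 ab(1) e] by simp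
  also have "\<dots> = e - 1" using sum_order_complex[OF f0] df by simp
  finally show "tangency_number w (line_of l) = e - 1" .
qed

lemma has_degree_imp: assumes "has_degree w d" shows "e = Suc d"
proof -
  obtain m g l where g: "hom_poly m g" "g l \<noteq> 0"
    "\<And>l. l \<noteq> 0 \<Longrightarrow> g l \<noteq> 0 \<Longrightarrow> \<not> invariant_line w (line_of l) \<and> tangency_number w (line_of l) = d"
    using assms unfolding has_degree_def by metis
  have "\<exists>l. l \<noteq> 0 \<and> g l \<noteq> 0"
  proof (cases "l = 0")
    case True
    \<comment> \<open>The witness may be the vector 0, which is no line. In that case homogeneity
      shows that \<open>g\<close> is nonzero at a coordinate vector as well.\<close>
    have "g (0 *s axis 1 1) = 0 ^ m * g (axis 1 1)" using g(1) unfolding hom_poly_iff_hp by (rule hp_scale)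
    then have "g (axis 1 1) \<noteq> 0" using g(2) True by auto
    then show ?thesis by (intro exI[of _ "axis 1 1"]) (simp add: axis_eq_0_iff)
  qed (use g(2) in blast)
  then obtain l where "l \<noteq> 0" "\<not> invariant_line w (line_of l)" "tangency_number w (line_of l) = d" using g(3) by blast
  then show ?thesis using tangency_number_eq[of l] by simp
qed

end

section \<open>Reduced convexity in terms of the homogeneous form\<close>

lemma reduced_convex_formI:
  assumes "reduced_convex 5 w" shows "reduced_convex_form w"
proof -
  have *: "foliation w" "has_degree w 5" "card {L. invariant_line w L} = 15"
    using assms by (auto simp: reduced_convex_def foliation_of_degree_def)
  then obtain e where e: "\<And>i. hp e (\<lambda>v. w v $ i)" "\<And>v. dot3 (w v) v = 0" "isolated_singularities w"
    unfolding foliation_def hom_poly_iff_hp by blast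
  interpret hom_form w e by standard (rule e)+
  have "e = 6" using has_degree_imp[OF *(2)] by simp
  then show ?thesis using e *(3) by unfold_locales simp_all
qed

text \<open>The polynomial \<open>g\<close> on the dual plane vanishes at the normals of all
  invariant lines; its complement is the set of generic lines in the definition of the
  degree.\<close>

lemma reduced_convexI:
  assumes "hom_form w 6" "isolated_singularities w" "card {L. invariant_line w L} = 15"
    and g: "hp m g" "g l0 \<noteq> 0" "\<And>l. l \<noteq> 0 \<Longrightarrow> invariant_line w (line_of l) \<Longrightarrow> g l = 0"
  shows "reduced_convex 5 w"
proof -
  interpret hom_form w 6 by fact
  have "has_degree w 5"
    unfolding has_degree_def hom_poly_iff_hp using g tangency_number_eq(2)
    by (intro exI[of _ m] exI[of _ g] conjI exI[of _ l0]) auto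
  moreover have "foliation w" unfolding foliation_def hom_poly_iff_hp using hp radial assms(2) by blast
  ultimately show ?thesis using assms(3) by (simp add: reduced_convex_def foliation_of_degree_def)
qed

section \<open>The Fermat and the Hilbert modular foliation\<close>

text \<open>\<open>K\<close> contains representatives of all singular points of the plane. The open
  set \<open>U\<close> around \<open>v\<close> excludes the points of \<open>K\<close> that differ
  from that of \<open>v\<close>.\<close>

lemma isolated_singularitiesI:
  assumes K: "finite K" and s: "\<And>v. v \<noteq> 0 \<Longrightarrow> w v = 0 \<Longrightarrow> \<exists>u\<in>K. u \<noteq> 0 \<and> cr u v = 0"
  shows "isolated_singularities w"
  unfolding isolated_singularities_def
proof
  fix v assume "v \<in> singular_vectors w"
  then have v: "v \<noteq> 0" "w v = 0" by (auto simp: singular_vectors_def)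
  define U where "U = (\<Inter>u \<in> {u\<in>K. cr u v \<noteq> 0}. {x. cr u x \<noteq> 0})"
  have "open {x. cr u x \<noteq> 0}" for u
    unfolding vec3_eq_iff de_Morgan_conj cr_nth zero_index
    by (intro open_Collect_disj open_Collect_neq continuous_intros)
  then have "open U" unfolding U_def using K by (intro open_INT) auto
  moreover have "v \<in> U" by (auto simp: U_def)
  ultimately obtain \<epsilon> where \<epsilon>: "\<epsilon> > 0" "ball v \<epsilon> \<subseteq> U" by (auto simp: open_contains_ball)
  have "x \<in> vec.span {v}" if x: "x \<in> singular_vectors w" "dist x v < \<epsilon>" for x
  proof -
    have x0: "x \<noteq> 0" "w x = 0" using x(1) by (auto simp: singular_vectors_def)
    then obtain u where u: "u \<in> K" "u \<noteq> 0" "cr u x = 0" using s by blast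
    have "x \<in> U" using \<epsilon>(2) x(2) by (auto simp: dist_commute)
    then have "cr u v = 0" using u by (auto simp: U_def)
    then have "vec.span {u} = vec.span {v}" using span_single_eq_iff[OF u(2) v(1)] by simp
    moreover have "vec.span {u} = vec.span {x}" using span_single_eq_iff[OF u(2) x0(1)] u(3) by simp
    ultimately show ?thesis using vec.span_base[of x "{x}"] by auto
  qed
  then show "\<exists>\<epsilon>>0. \<forall>x\<in>singular_vectors w. dist x v < \<epsilon> \<longrightarrow> x \<in> vec.span {v}" using \<epsilon>(1) by blast
qed

lemma vec3_cases:
  fixes v :: "complex^3"
  assumes "v \<noteq> 0"
  obtains k x y where "k \<noteq> 0" "v = k *s vector [x, y, 1]"
    | k y where "k \<noteq> 0" "v = k *s vector [1, y, 0]"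
    | k where "k \<noteq> 0" "v = k *s vector [0, 1, 0]"
proof -
  consider "v$3 \<noteq> 0" | "v$3 = 0" "v$1 \<noteq> 0" | "v$3 = 0" "v$1 = 0" "v$2 \<noteq> 0" using assms by (auto simp: vec3_eq_iff)
  then show thesis
  proof cases
    case 1 then show thesis using that(1)[of "v$3" "v$1 / v$3" "v$2 / v$3"] by (simp add: vec3_eq_iff)
  next
    case 2 then show thesis using that(2)[of "v$1" "v$2 / v$1"] by (simp add: vec3_eq_iff)
  next
    case 3 then show thesis using that(3)[of "v$2"] by (simp add: vec3_eq_iff)
  qed
qed

lemma (in hom_form) isolated_singularities_chart:
  assumes K: "finite K" and aff: "\<And>x y. w (vector [x, y, 1]) = 0 \<Longrightarrow> x \<in> K \<and> y \<in> K"
    and inf: "\<And>y. w (vector [1, y, 0]) = 0 \<Longrightarrow> y \<in> K"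
  shows "isolated_singularities w"
proof (rule isolated_singularitiesI)
  let ?K = "(\<lambda>(x, y). vector [x, y, 1] :: complex^3) ` (K \<times> K) \<union> (\<lambda>y. vector [1, y, 0]) ` K \<union> {vector [0, 1, 0]}"
  show "finite ?K" using K by simp
  fix v :: "complex^3" assume v: "v \<noteq> 0" "w v = 0"
  from v(1) show "\<exists>u\<in>?K. u \<noteq> 0 \<and> cr u v = 0"
  proof (cases rule: vec3_cases)
    case (1 k x y)
    have "k ^ e *s w (vector [x, y, 1]) = 0" using v(2) unfolding 1(2) w_scale .
    then have "x \<in> K \<and> y \<in> K" using 1(1) by (intro aff) simp
    then have "vector [x, y, 1] \<in> ?K" by auto
    then show ?thesis by (rule bexI[rotated]) (simp add: 1 vec3_eq_iff)
  next
    case (2 k y)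
    have "k ^ e *s w (vector [1, y, 0]) = 0" using v(2) unfolding 2(2) w_scale .
    then have "y \<in> K" using 2(1) by (intro inf) simp
    then have "vector [1, y, 0] \<in> ?K" by auto
    then show ?thesis by (rule bexI[rotated]) (simp add: 2 vec3_eq_iff)
  next
    case (3 k)
    have "vector [0, 1, 0] \<in> ?K" by simp
    then show ?thesis by (rule bexI[rotated]) (simp add: 3 vec3_eq_iff)
  qed
qed

lemma line_normal_cases:
  fixes l :: "complex^3"
  assumes "l \<noteq> 0"
  obtains c m k where "c \<noteq> 0" "l = c *s vector [m, -1, k]"
    | c d where "c \<noteq> 0" "l = c *s vector [1, 0, -d]"
    | c where "c \<noteq> 0" "l = c *s vector [0, 0, 1]"
proof -
  consider "l$2 \<noteq> 0" | "l$2 = 0" "l$1 \<noteq> 0" | "l$2 = 0" "l$1 = 0" "l$3 \<noteq> 0" using assms by (auto simp: vec3_eq_iff)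
  then show thesis
  proof cases
    case 1 then show thesis using that(1)[of "- l$2" "- l$1 / l$2" "- l$3 / l$2"] by (simp add: vec3_eq_iff)
  next
    case 2 then show thesis using that(2)[of "l$1" "- l$3 / l$1"] by (simp add: vec3_eq_iff)
  next
    case 3 then show thesis using that(3)[of "l$3"] by (simp add: vec3_eq_iff)
  qed
qed

lemma invariant_line_normal:
  "invariant_line w (line_of (vector [m, -1, k])) \<longleftrightarrow> (\<forall>x z. w (vector [x, m * x + k * z, z]) $ 1 + m * w (vector [x, m * x + k * z, z]) $ 2 = 0 \<and>
      k * w (vector [x, m * x + k * z, z]) $ 2 + w (vector [x, m * x + k * z, z]) $ 3 = 0)"
  "invariant_line w (line_of (vector [1, 0, -c])) \<longleftrightarrow> (\<forall>y z. w (vector [c * z, y, z]) $ 2 = 0 \<and>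
      c * w (vector [c * z, y, z]) $ 1 + w (vector [c * z, y, z]) $ 3 = 0)"
  "invariant_line w (line_of (vector [0, 0, 1])) \<longleftrightarrow> (\<forall>x y. w (vector [x, y, 0]) $ 1 = 0 \<and> w (vector [x, y, 0]) $ 2 = 0)"
proof -
  have c: "cr (vector [1, m, 0]) (vector [0, k, 1]) = vector [m, -1, k]" "cr (vector [0, 1, 0]) (vector [c, 0, 1]) = vector [1, 0, -c]"
    "cr (vector [1, 0, 0]) (vector [0, 1, 0]) = vector [0, 0, 1]" by (simp_all add: vec3_eq_iff)
  have v: "x *s vector [1, m, 0] + z *s vector [0, k, 1] = (vector [x, m * x + k * z, z] :: complex^3)"
    "x *s vector [0, 1, 0] + z *s vector [c, 0, 1] = (vector [c * z, x, z] :: complex^3)"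
    "x *s vector [1, 0, 0] + z *s vector [0, 1, 0] = (vector [x, z, 0] :: complex^3)" for x z by (simp_all add: vec3_eq_iff algebra_simps)
  show "invariant_line w (line_of (vector [m, -1, k])) \<longleftrightarrow> (\<forall>x z. w (vector [x, m * x + k * z, z]) $ 1 + m * w (vector [x, m * x + k * z, z]) $ 2 = 0 \<and>
      k * w (vector [x, m * x + k * z, z]) $ 2 + w (vector [x, m * x + k * z, z]) $ 3 = 0)"
    unfolding c(1)[symmetric] by (subst invariant_line_iff) (unfold c v, simp_all add: vec3_eq_iff dot3_3 mult.commute)
  show "invariant_line w (line_of (vector [1, 0, -c])) \<longleftrightarrow> (\<forall>y z. w (vector [c * z, y, z]) $ 2 = 0 \<and>
      c * w (vector [c * z, y, z]) $ 1 + w (vector [c * z, y, z]) $ 3 = 0)"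
    unfolding c(2)[symmetric] by (subst invariant_line_iff) (unfold c v, simp_all add: vec3_eq_iff dot3_3 mult.commute)
  show "invariant_line w (line_of (vector [0, 0, 1])) \<longleftrightarrow> (\<forall>x y. w (vector [x, y, 0]) $ 1 = 0 \<and> w (vector [x, y, 0]) $ 2 = 0)"
    unfolding c(3)[symmetric] by (subst invariant_line_iff) (unfold c v, simp_all add: vec3_eq_iff dot3_3 mult.commute)
qed

text \<open>Every line is of exactly one of the forms y = m x + k z, x = c z, z = 0. So 14 invariant
  lines of the first two forms and the line at infinity make 15.\<close>

lemma reduced_convex_by_lines:
  assumes hf: "hom_form w 6" and iso: "isolated_singularities w"
    and A: "\<And>m k. invariant_line w (line_of (vector [m, -1, k])) \<longleftrightarrow> (m, k) \<in> A"
    and B: "\<And>c. invariant_line w (line_of (vector [1, 0, -c])) \<longleftrightarrow> c \<in> B"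
    and C: "invariant_line w (line_of (vector [0, 0, 1]))"
    and card: "finite A" "finite B" "card A + card B = 14"
    and g: "hp d g" "g l0 \<noteq> 0" "\<And>m k. (m, k) \<in> A \<Longrightarrow> g (vector [m, -1, k]) = 0"
      "\<And>c. c \<in> B \<Longrightarrow> g (vector [1, 0, -c]) = 0" "g (vector [0, 0, 1]) = 0"
  shows "reduced_convex 5 w"
proof (rule reduced_convexI[OF hf iso _ g(1,2)])
  have nz: "vector [m, -1, k] \<noteq> (0 :: complex^3)" "vector [1, 0, -c] \<noteq> (0 :: complex^3)" "vector [0, 0, 1] \<noteq> (0 :: complex^3)" for m k c :: complex
    by (simp_all add: vec3_eq_iff)
  let ?f = "\<lambda>(m, k). line_of (vector [m, -1, k])" and ?g = "\<lambda>c. line_of (vector [1, 0, -c])" and ?l = "line_of (vector [0, 0, 1])"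
  have eq: "{L. invariant_line w L} = ?f ` A \<union> ?g ` B \<union> {?l}"
  proof (intro equalityI subsetI)
    fix L assume "L \<in> {L. invariant_line w L}"
    then have i: "invariant_line w L" by simp
    then obtain l where l: "l \<noteq> 0" "L = line_of l" by (auto simp: invariant_line_def proj_line_def)
    from l(1) show "L \<in> ?f ` A \<union> ?g ` B \<union> {?l}"
    proof (cases rule: line_normal_cases)
      case (1 c m k)
      then have "L = ?f (m, k)" using l(2) by simp
      then show ?thesis using i A[of m k] by (intro UnI1 image_eqI[of _ _ "(m, k)"]) simp_all
    next
      case (2 c d)
      then have "L = ?g d" using l(2) by simp
      then show ?thesis using i B[of d] by (intro UnI1[of _ "?f ` A \<union> ?g ` B"] UnI2[of _ "?g ` B"] image_eqI[of _ _ d]) simp_all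
    next
      case (3 c)
      then show ?thesis using l(2) by simp
    qed
  qed (use A B C in auto)
  have f: "inj_on ?f A" by (rule inj_onI) (clarsimp simp: line_of_eq_iff nz vec3_eq_iff)
  have g': "inj_on ?g B" by (rule inj_onI) (clarsimp simp: line_of_eq_iff nz vec3_eq_iff)
  have "?f ` A \<inter> ?g ` B = {}" "(?f ` A \<union> ?g ` B) \<inter> {?l} = {}"
    by (auto simp: line_of_eq_iff nz vec3_eq_iff)
  then have "card (?f ` A \<union> ?g ` B \<union> {?l}) = card (?f ` A) + card (?g ` B) + 1"
    using card(1,2) by (subst card_Un_disjoint; (subst card_Un_disjoint)?) simp_all
  then show "card {L. invariant_line w L} = 15" unfolding eq using card(3) card_image[OF f] card_image[OF g'] by simp
  fix l assume l: "l \<noteq> 0" "invariant_line w (line_of l)"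
  from l(1) show "g l = 0"
  proof (cases rule: line_normal_cases)
    case (1 c m k) then show ?thesis using l(2) A[of m k] g(3)[of m k] by (simp add: hp_scale[OF g(1)])
  next
    case (2 c d) then show ?thesis using l(2) B[of d] g(4)[of d] by (simp add: hp_scale[OF g(1)])
  next
    case (3 c) then show ?thesis using g(5) by (simp add: hp_scale[OF g(1)])
  qed
qed

section \<open>Invariant lines of the Fermat foliation\<close>

lemma fifth_power_eq_self: "{c :: complex. c ^ 5 = c} = {0, 1, -1, \<i>, -\<i>}"
proof -
  have "c ^ 5 - c = c * (c - 1) * (c + 1) * (c - j) * (c + j)" if "j ^ 2 + 1 = 0" for c j :: complex
    using that by algebra
  from this[of \<i>] have "c ^ 5 - c = c * (c - 1) * (c + 1) * (c - \<i>) * (c + \<i>)" for c by simp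
  then have "c ^ 5 = c \<longleftrightarrow> c * (c - 1) * (c + 1) * (c - \<i>) * (c + \<i>) = 0" for c
    by (metis eq_iff_diff_eq_0)
  then show ?thesis unfolding mult_eq_0_iff eq_neg_iff_add_eq_0[symmetric] right_minus_eq by blast
qed

lemma hom_form_fermat5: "hom_form fermat5 6"
proof
  have "hp (1 + 5 * 1) (\<lambda>v. v $ i * v $ j ^ 5)" for i j :: 3 using hp_mult[OF hp_nth[of i] hp_power[OF hp_nth[of j], of 5]] by simp
  then have *: "hp 6 (\<lambda>v. v $ i * v $ j ^ 5)" for i j :: 3 by simp
  fix i :: 3
  from exhaust_3[of i] show "hp 6 (\<lambda>v. fermat5 v $ i)"
    by (elim disjE) (simp_all only: fermat5_nth, (intro hp_diff *)+)
qed (simp add: dot3_3 fermat5_nth algebra_simps)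

text \<open>The line y = m x + k z is invariant if and only if
  \<open>(m x + k z)^5 = m x^5 + k z^5\<close>, which forces \<open>m k = 0\<close> and
  \<open>m\<close>, \<open>k\<close> fixed by the fifth power. This gives nine lines, besides the
  five lines x = c z and the line at infinity. All their normals have a zero coordinate, so the
  product of the coordinates serves as \<open>g\<close>.\<close>

lemma reduced_convex_fermat5: "reduced_convex 5 fermat5"
proof -
  interpret hom_form fermat5 6 by (rule hom_form_fermat5)
  define F where "F = {c :: complex. c ^ 5 = c}"
  have F: "finite F" by (simp add: F_def fifth_power_eq_self)
  define A where "A = {(m, k). m * k = 0 \<and> m \<in> F \<and> k \<in> F}"
  have iA: "A = {(0, 0), (1, 0), (-1, 0), (\<i>, 0), (-\<i>, 0), (0, 1), (0, -1), (0, \<i>), (0, -\<i>)}"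
    unfolding A_def F_def fifth_power_eq_self by auto
  show ?thesis
  proof (rule reduced_convex_by_lines[where ?l0.0 = "vector [1, 1, 1]", OF hom_form_fermat5 _ _ _ _ _ F])
    show "isolated_singularities fermat5"
      by (rule isolated_singularities_chart[OF F]) (simp_all add: vec3_eq_iff fermat5_nth F_def)
    show "invariant_line fermat5 (line_of (vector [m, -1, k])) \<longleftrightarrow> (m, k) \<in> A" for m k
    proof -
      have "invariant_line fermat5 (line_of (vector [m, -1, k])) \<longleftrightarrow> (\<forall>x z. (m * x + k * z) ^ 5 = m * x ^ 5 + k * z ^ 5)"
      proof -
        have 1: "fermat5 (vector [x, y, z]) $ 1 + m * fermat5 (vector [x, y, z]) $ 2 = z * (m * x ^ 5 + k * z ^ 5 - y ^ 5)"
          and 2: "k * fermat5 (vector [x, y, z]) $ 2 + fermat5 (vector [x, y, z]) $ 3 = - x * (m * x ^ 5 + k * z ^ 5 - y ^ 5)"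
          if "y = m * x + k * z" for x y z
          unfolding fermat5_nth vector_3 using that by - algebra+
        show ?thesis unfolding invariant_line_normal 1[OF refl] 2[OF refl]
        proof (intro iffI allI conjI)
          fix x z assume "\<forall>x z. z * (m * x ^ 5 + k * z ^ 5 - (m * x + k * z) ^ 5) = 0 \<and> - x * (m * x ^ 5 + k * z ^ 5 - (m * x + k * z) ^ 5) = 0"
          then have "z * (m * x ^ 5 + k * z ^ 5 - (m * x + k * z) ^ 5) = 0" "x * (m * x ^ 5 + k * z ^ 5 - (m * x + k * z) ^ 5) = 0" by auto
          then show "(m * x + k * z) ^ 5 = m * x ^ 5 + k * z ^ 5" by (cases "x = 0 \<and> z = 0") auto
        qed simp_all
      qed
      also have "\<dots> \<longleftrightarrow> (m, k) \<in> A"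
      proof
        assume *: "\<forall>x z. (m * x + k * z) ^ 5 = m * x ^ 5 + k * z ^ 5"
        have 1: "m ^ 5 = m" using *[rule_format, of 1 0] by simp
        have 2: "k ^ 5 = k" using *[rule_format, of 0 1] by simp
        have 3: "(m + k) ^ 5 = m + k" using *[rule_format, of 1 1] by simp
        have 4: "(k - m) ^ 5 = k - m" using *[rule_format, of "-1" 1] by simp
        \<comment> \<open>Sum and difference of the fifth powers of \<open>m + k\<close> and
          \<open>k - m\<close> isolate the mixed terms of the binomial expansion.\<close>
        have "10 * (m * (m * k) * (m ^ 2 + 2 * k ^ 2)) = 0" "10 * (k * (m * k) * (2 * m ^ 2 + k ^ 2)) = 0"
        proof -
          have "10 * (m * (m * k) * (m ^ 2 + 2 * k ^ 2)) = (m + k) ^ 5 + (k - m) ^ 5 - 2 * k ^ 5"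
            "10 * (k * (m * k) * (2 * m ^ 2 + k ^ 2)) = (m + k) ^ 5 - (k - m) ^ 5 - 2 * m ^ 5" by algebra+
          then show "10 * (m * (m * k) * (m ^ 2 + 2 * k ^ 2)) = 0" "10 * (k * (m * k) * (2 * m ^ 2 + k ^ 2)) = 0"
            unfolding 1 2 3 4 by simp_all
        qed
        then have "m * k = 0 \<or> m ^ 2 + 2 * k ^ 2 = 0" "m * k = 0 \<or> 2 * m ^ 2 + k ^ 2 = 0" by auto
        moreover have "k = 0" if "m ^ 2 + 2 * k ^ 2 = 0" "2 * m ^ 2 + k ^ 2 = 0"
        proof -
          have "3 * k ^ 2 = 0" using that by algebra
          then show ?thesis by simp
        qed
        ultimately have "m * k = 0" by auto
        then show "(m, k) \<in> A" using 1 2 by (simp add: A_def F_def)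
      next
        assume "(m, k) \<in> A"
        then show "\<forall>x z. (m * x + k * z) ^ 5 = m * x ^ 5 + k * z ^ 5"
          by (auto simp: A_def F_def power_mult_distrib)
      qed
      finally show ?thesis .
    qed
    show "invariant_line fermat5 (line_of (vector [1, 0, - c])) \<longleftrightarrow> c \<in> F" for c
    proof -
      have 1: "fermat5 (vector [c * z, y, z]) $ 2 = z ^ 6 * (c ^ 5 - c)"
        and 2: "c * fermat5 (vector [c * z, y, z]) $ 1 + fermat5 (vector [c * z, y, z]) $ 3 = - y * z ^ 5 * (c ^ 5 - c)" for y z
        unfolding fermat5_nth vector_3 by algebra+
      show ?thesis unfolding invariant_line_normal 1 2
      proof
        assume "\<forall>y z. z ^ 6 * (c ^ 5 - c) = 0 \<and> - y * z ^ 5 * (c ^ 5 - c) = 0"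
        then have "1 ^ 6 * (c ^ 5 - c) = 0" by blast
        then show "c \<in> F" by (simp add: F_def)
      qed (simp add: F_def)
    qed
    show "invariant_line fermat5 (line_of (vector [0, 0, 1]))" unfolding invariant_line_normal by (simp add: fermat5_nth)
    show "finite A" by (simp add: iA)
    show "card A + card F = 14" unfolding iA F_def fifth_power_eq_self by (simp add: complex_eq_iff)
    show "hp (1 + (1 + 1)) (\<lambda>l. l $ 1 * (l $ 2 * l $ 3))" using hp_mult[OF hp_nth hp_mult[OF hp_nth hp_nth]] by simp
  qed (auto simp: A_def)
qed

text \<open>Pairs \<open>(m, k)\<close> for the lines y = m x + k z: four horizontal lines, the
  diagonals y = x and y = - x, and the four sides of the parallelogram of
  \<open>six_points (sq5 - 2)\<close>.\<close>

definition hilbert_lines :: "(complex \<times> complex) set" where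
  "hilbert_lines = {(0, 1), (0, -1), (0, sq5 - 2), (0, 2 - sq5), (1, 0), (-1, 0),
     ((1 - sq5) / 2, (3 - sq5) / 2), ((1 - sq5) / 2, - ((3 - sq5) / 2)),
     ((- 1 - sq5) / 2, (sq5 - 1) / 2), ((- 1 - sq5) / 2, - ((sq5 - 1) / 2))}"

lemma sq5_neq: "r ^ 2 \<noteq> 5 \<Longrightarrow> sq5 \<noteq> r" using sq5_squared by auto

lemma sq5_distinct: "sq5 \<noteq> 0" "sq5 \<noteq> 1" "sq5 \<noteq> -1" "sq5 \<noteq> 2" "sq5 \<noteq> 3" "sq5 \<noteq> -3"
  by (rule sq5_neq, simp add: power2_eq_square)+

lemma card_hilbert_lines: "card hilbert_lines = 10" "finite hilbert_lines"
proof -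
  have c: "card {(0, 1), (0, -1), (0, t), (0, t'), (1, 0), (-1, 0), (m, k), (m, -k), (m', k'), (m', -k')} = 10"
    if "t \<noteq> 1" "t \<noteq> -1" "t' \<noteq> 1" "t' \<noteq> -1" "t \<noteq> t'" "m \<noteq> 0" "m' \<noteq> 0" "m \<noteq> 1" "m' \<noteq> 1" "m \<noteq> -1" "m' \<noteq> -1" "m \<noteq> m'" "k \<noteq> 0" "k' \<noteq> 0"
    for t t' m k m' k' :: complex using that by auto
  have h: "(a :: complex) / 2 = b \<longleftrightarrow> a = 2 * b" for a b by (auto simp: field_simps)
  have e: "a - sq5 = b \<longleftrightarrow> sq5 = a - b" "sq5 - a = b \<longleftrightarrow> sq5 = a + b" for a b by (auto simp: algebra_simps)
  show "card hilbert_lines = 10" unfolding hilbert_lines_def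
  proof (rule c)
    show "sq5 - 2 \<noteq> 2 - sq5"
    proof
      assume "sq5 - 2 = 2 - sq5"
      then have "2 * (sq5 - 2) = 0" by algebra
      then show False using sq5_distinct(4) by simp
    qed
    show "(1 - sq5) / 2 \<noteq> (- 1 - sq5) / 2" by simp
  qed (unfold h e, use sq5_distinct in simp_all)
  show "finite hilbert_lines" by (simp add: hilbert_lines_def)
qed

lemma hilbert_line_coefficients:
  fixes s m k :: complex
  defines "p \<equiv> (s - 2) ^ 2"
  defines "c5 \<equiv> m * (m ^ 2 - 1) * (m ^ 2 + s * m + 1)"
    and "c4 \<equiv> m * k * (5 * m ^ 3 + 4 * s * m ^ 2 - s)"
    and "c3 \<equiv> m * (k ^ 2 * m * (10 * m + 6 * s) - (1 + p) * (m ^ 2 - 1))"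
    and "c2 \<equiv> k * (k ^ 2 * (10 * m ^ 2 + 4 * s * m) - (1 + p) * (3 * m ^ 2 + s * m))"
    and "c1 \<equiv> 5 * m * k ^ 4 - 3 * (1 + p) * m * k ^ 2 + s * k ^ 4 - s * (1 + p) * k ^ 2 + s * p - s * p * m ^ 2"
    and "c0 \<equiv> k ^ 5 - (1 + p) * k ^ 3 + p * k - m * s * p * k"
  assumes y: "y = m * x + k * z"
  shows "(y ^ 2 - z ^ 2) * (y ^ 2 - p * z ^ 2) * (y + s * x) - m * ((x ^ 2 - z ^ 2) * (x ^ 2 - p * z ^ 2) * (x + s * y))
    = c5 * x ^ 5 + c4 * x ^ 4 * z + c3 * x ^ 3 * z ^ 2 + c2 * x ^ 2 * z ^ 3 + c1 * x * z ^ 4 + c0 * z ^ 5"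
  unfolding c5_def c4_def c3_def c2_def c1_def c0_def y by algebra

text \<open>The top coefficient \<open>c5\<close> leaves only the slopes 0, 1, -1 and the roots of
  \<open>m^2 + s m + 1\<close>. For these, \<open>k\<close> is then found from \<open>c1\<close>,
  from \<open>c4\<close> and from \<open>c3\<close>, respectively.\<close>

lemma hilbert_line_iff:
  fixes m k :: complex
  defines "s \<equiv> sq5" and "p \<equiv> (sq5 - 2) ^ 2"
  shows "(\<forall>x z. ((m * x + k * z) ^ 2 - z ^ 2) * ((m * x + k * z) ^ 2 - p * z ^ 2) * (m * x + k * z + s * x)
      - m * ((x ^ 2 - z ^ 2) * (x ^ 2 - p * z ^ 2) * (x + s * (m * x + k * z))) = 0) \<longleftrightarrow> (m, k) \<in> hilbert_lines"
proof -
  have s2: "s ^ 2 = 5" and s0: "s \<noteq> 0" using sq5_squared sq5_distinct by (simp_all add: s_def)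
  have p: "p = (s - 2) ^ 2" by (simp add: p_def s_def)
  define c5 where "c5 = m * (m ^ 2 - 1) * (m ^ 2 + s * m + 1)"
  define c4 where "c4 = m * k * (5 * m ^ 3 + 4 * s * m ^ 2 - s)"
  define c3 where "c3 = m * (k ^ 2 * m * (10 * m + 6 * s) - (1 + p) * (m ^ 2 - 1))"
  define c2 where "c2 = k * (k ^ 2 * (10 * m ^ 2 + 4 * s * m) - (1 + p) * (3 * m ^ 2 + s * m))"
  define c1 where "c1 = 5 * m * k ^ 4 - 3 * (1 + p) * m * k ^ 2 + s * k ^ 4 - s * (1 + p) * k ^ 2 + s * p - s * p * m ^ 2"
  define c0 where "c0 = k ^ 5 - (1 + p) * k ^ 3 + p * k - m * s * p * k"
  note defs = c5_def c4_def c3_def c2_def c1_def c0_def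
  have "(\<forall>x z. ((m * x + k * z) ^ 2 - z ^ 2) * ((m * x + k * z) ^ 2 - p * z ^ 2) * (m * x + k * z + s * x)
      - m * ((x ^ 2 - z ^ 2) * (x ^ 2 - p * z ^ 2) * (x + s * (m * x + k * z))) = 0) \<longleftrightarrow>
    (\<forall>x z. c5 * x ^ 5 + c4 * x ^ 4 * z + c3 * x ^ 3 * z ^ 2 + c2 * x ^ 2 * z ^ 3 + c1 * x * z ^ 4 + c0 * z ^ 5 = 0)" (is "?P \<longleftrightarrow> ?Q")
    unfolding p defs hilbert_line_coefficients[OF refl] ..
  also have "?Q \<longleftrightarrow> c5 = 0 \<and> c4 = 0 \<and> c3 = 0 \<and> c2 = 0 \<and> c1 = 0 \<and> c0 = 0"
  proof
    assume Q: ?Q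
    have "poly [:c0, c1, c2, c3, c4, c5:] x = 0" for x
      using Q[rule_format, of x 1] by (simp add: algebra_simps power_numeral_reduce)
    then have "[:c0, c1, c2, c3, c4, c5:] = 0" using poly_all_0_iff_0 by blast
    then show "c5 = 0 \<and> c4 = 0 \<and> c3 = 0 \<and> c2 = 0 \<and> c1 = 0 \<and> c0 = 0" by (simp add: pCons_eq_0_iff)
  qed simp
  also have "\<dots> \<longleftrightarrow> (m, k) \<in> hilbert_lines"
  proof
    assume c: "c5 = 0 \<and> c4 = 0 \<and> c3 = 0 \<and> c2 = 0 \<and> c1 = 0 \<and> c0 = 0"
    have eq: "a = b \<or> a = - b" if "a ^ 2 = b ^ 2" for a b :: complex using that by (simp add: power2_eq_iff)
    consider "m = 0" | "m ^ 2 = 1" | "m ^ 2 + s * m + 1 = 0" using c by (auto simp: c5_def)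
    then show "(m, k) \<in> hilbert_lines"
    proof cases
      case 1
      have "s * ((k ^ 2 - 1) * (k ^ 2 - (s - 2) ^ 2)) = 0" using c 1 unfolding c1_def p by algebra
      then have "k ^ 2 = 1 ^ 2 \<or> k ^ 2 = (s - 2) ^ 2" using s0 by simp
      then have "k = 1 \<or> k = -1 \<or> k = s - 2 \<or> k = - (s - 2)" using eq by blast
      then show ?thesis using 1 by (auto simp: hilbert_lines_def s_def)
    next
      case 2
      have "k * (m * (m * (m ^ 2 * m * 5 + 4 * s * m ^ 2 - s))) = 0" using c unfolding c4_def by algebra
      then have "k * (5 * m ^ 2 * m ^ 2 + 3 * s * m) = 0" using 2 by algebra
      then have "k * (5 + 3 * s * m) = 0" unfolding 2 by simp
      moreover have "5 + 3 * s * m \<noteq> 0"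
      proof
        assume "5 + 3 * s * m = 0"
        then have "(20 :: complex) = 0" using s2 2 by algebra
        then show False by simp
      qed
      ultimately have k: "k = 0" by simp
      have "m = 1 \<or> m = -1" using 2 by (simp add: power2_eq_1_iff)
      then show ?thesis using k by (auto simp: hilbert_lines_def)
    next
      case 3
      \<comment> \<open>The discriminant \<open>s^2 - 4\<close> of this quadratic is 1.\<close>
      have "(2 * m + s) ^ 2 = 1" using 3 s2 by algebra
      then have "(2 * m + s) ^ 2 = 1 ^ 2" by simp
      then consider "2 * m + s = 1" | "2 * m + s = -1" using eq by blast
      then show ?thesis
      proof cases
        case 1
        have "k ^ 2 = ((3 - s) / 2) ^ 2"
        proof -
          have "80 * (4 * k ^ 2 - (3 - s) ^ 2) = 0" using c 1 s2 unfolding c3_def p by algebra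
          then show ?thesis by (simp add: power_divide mult.commute)
        qed
        then have "k = (3 - s) / 2 \<or> k = - ((3 - s) / 2)" by (rule eq)
        moreover have "m = (1 - s) / 2" using 1 by (simp add: field_simps)
        ultimately show ?thesis by (auto simp: hilbert_lines_def s_def)
      next
        case 2
        have "k ^ 2 = ((s - 1) / 2) ^ 2"
        proof -
          have "80 * (4 * k ^ 2 - (s - 1) ^ 2) = 0" using c 2 s2 unfolding c3_def p by algebra
          then show ?thesis by (simp add: power_divide mult.commute)
        qed
        then have "k = (s - 1) / 2 \<or> k = - ((s - 1) / 2)" by (rule eq)
        moreover have "m = (- 1 - s) / 2" using 2 by (simp add: field_simps)
        ultimately show ?thesis by (auto simp: hilbert_lines_def s_def)
      qed
    qed
  next
    assume "(m, k) \<in> hilbert_lines"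
    then consider "m = 0" "k = 1 \<or> k = -1" | "m = 0" "k = s - 2 \<or> k = - (s - 2)" | "m = 1 \<or> m = -1" "k = 0"
      | "m = (1 - s) / 2" "k = (3 - s) / 2 \<or> k = - ((3 - s) / 2)" | "m = (- 1 - s) / 2" "k = (s - 1) / 2 \<or> k = - ((s - 1) / 2)"
      unfolding hilbert_lines_def s_def by auto
    moreover have h: "a = b / 2 \<Longrightarrow> 2 * a = b" "a = - (b / 2) \<Longrightarrow> 2 * a = - b" for a b :: complex by (simp_all add: mult.commute)
    ultimately show "c5 = 0 \<and> c4 = 0 \<and> c3 = 0 \<and> c2 = 0 \<and> c1 = 0 \<and> c0 = 0"
    proof cases
      case 1
      then have "k ^ 2 = 1" by auto
      then show ?thesis using 1(1) unfolding defs p by (intro conjI; algebra)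
    next
      case 2
      then have "k ^ 2 = (s - 2) ^ 2" by (auto simp: power2_commute)
      then show ?thesis using 2(1) unfolding defs p by (intro conjI; algebra)
    next
      case 3
      then have "m ^ 2 = 1" by auto
      then show ?thesis using 3(2) unfolding defs p by (intro conjI; algebra)
    next
      case 4
      have "2 * k = 3 - s \<or> 2 * k = - (3 - s)" using 4(2) h by blast
      then have "(2 * k) ^ 2 = (3 - s) ^ 2" by (elim disjE) (simp_all only: power2_minus)
      moreover have "2 * m = 1 - s" by (rule h(1)[OF 4(1)])
      ultimately show ?thesis using s2 unfolding defs p by (intro conjI; algebra)
    next
      case 5
      have "2 * k = s - 1 \<or> 2 * k = - (s - 1)" using 5(2) h by blast
      then have "(2 * k) ^ 2 = (s - 1) ^ 2" by (elim disjE) (simp_all only: power2_minus)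
      moreover have "2 * m = - 1 - s" by (rule h(1)[OF 5(1)])
      ultimately show ?thesis using s2 unfolding defs p by (intro conjI; algebra)
    qed
  qed
  finally show ?thesis .
qed

lemma reduced_convex_hilbert5: "reduced_convex 5 hilbert5"
proof -
  have hf: "hom_form hilbert5 6" by standard (rule hp_hilbert5, rule hilbert5_radial)
  interpret hom_form hilbert5 6 by (rule hf)
  define s where "s = sq5"
  have s2: "s ^ 2 = 5" and s0: "s \<noteq> 0" using sq5_squared sq5_distinct by (simp_all add: s_def)
  define T where "T = {1, -1, s - 2, - (s - 2)}"
  have T: "finite T" by (simp add: T_def)
  have eq: "a ^ 2 = b ^ 2 \<longleftrightarrow> a = b \<or> a = - b" for a b :: complex by (simp add: power2_eq_iff)
  have mem_T: "(c ^ 2 - 1) * (c ^ 2 - (s - 2) ^ 2) = 0 \<longleftrightarrow> c \<in> T" for c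
    using eq[of c 1] eq[of c "s - 2"] by (simp add: T_def)
  show ?thesis
  proof (rule reduced_convex_by_lines[where ?l0.0 = "vector [1, 1, 1]", OF hf _ _ _ _ card_hilbert_lines(2) T])
    show "isolated_singularities hilbert5"
    proof (rule isolated_singularities_chart)
      \<comment> \<open>All possible coordinates of singular points: \<open>T\<close> from the lines
        parallel to the axes, 0 from the common zero of the two linear factors, the third set from
        one such factor together with one line, and the last two values from the line at
        infinity.\<close>
      let ?K = "T \<union> {0} \<union> (\<lambda>c. - s * c) ` T \<union> {(1 - s) / 2, (- 1 - s) / 2}"
      show "finite ?K" using T by simp
      fix x y
      assume z: "hilbert5 (vector [x, y, 1]) = 0"
      have "hilbert5 (vector [x, y, 1]) $ 1 = 0" "hilbert5 (vector [x, y, 1]) $ 2 = 0" unfolding z by simp_all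
      then have "(y ^ 2 - 1) * (y ^ 2 - (s - 2) ^ 2) * (y + s * x) = 0" "(x ^ 2 - 1) * (x ^ 2 - (s - 2) ^ 2) * (x + s * y) = 0"
        unfolding hilbert5_nth s_def by simp_all
      then have "(y \<in> T \<or> y = - s * x) \<and> (x \<in> T \<or> x = - s * y)"
        unfolding mult_eq_0_iff[of "(_ - 1) * _"] mem_T by (simp add: eq_neg_iff_add_eq_0)
      moreover have "x = 0 \<and> y = 0" if "y = - s * x" "x = - s * y"
      proof -
        have "4 * x = 0" using that s2 by algebra
        then have "x = 0" by simp
        then show ?thesis using that(1) by simp
      qed
      ultimately show "x \<in> ?K \<and> y \<in> ?K" by blast
    next
      fix y
      assume z: "hilbert5 (vector [1, y, 0]) = 0"
      have "hilbert5 (vector [a, y, b]) $ 3 = - (y * (y ^ 2 - 1) * (y ^ 2 + s * y + 1))" if "a = 1" "b = 0" for a b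
        unfolding hilbert5_nth vector_3 s_def[symmetric] using that by algebra
      from this[OF refl refl] have "y * (y ^ 2 - 1) * (y ^ 2 + s * y + 1) = 0" unfolding z by simp
      then consider "y = 0" | "y ^ 2 = 1" | "y ^ 2 + s * y + 1 = 0" by auto
      then show "y \<in> T \<union> {0} \<union> (\<lambda>c. - s * c) ` T \<union> {(1 - s) / 2, (- 1 - s) / 2}"
      proof cases
        case 2
        then show ?thesis using eq[of y 1] by (auto simp: T_def)
      next
        case 3
        have "(2 * y + s) ^ 2 = 1" using 3 s2 by algebra
        then have "(2 * y + s) ^ 2 = 1 ^ 2" by simp
        then have "2 * y + s = 1 \<or> 2 * y + s = -1" unfolding eq .
        then have "y = (1 - s) / 2 \<or> y = (- 1 - s) / 2" by (auto simp: field_simps)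
        then show ?thesis by blast
      qed simp
    qed
    show "invariant_line hilbert5 (line_of (vector [m, -1, k])) \<longleftrightarrow> (m, k) \<in> hilbert_lines" for m k
    proof -
      define P where "P x z = ((m * x + k * z) ^ 2 - z ^ 2) * ((m * x + k * z) ^ 2 - (sq5 - 2) ^ 2 * z ^ 2) * (m * x + k * z + sq5 * x)
        - m * ((x ^ 2 - z ^ 2) * (x ^ 2 - (sq5 - 2) ^ 2 * z ^ 2) * (x + sq5 * (m * x + k * z)))" for x z
      have comb: "z * (A * B * C) + m * (z * - D) = z * (A * B * C - m * D)"
        "k * (z * - D) + - (x * (A * B * C) + (m * x + k * z) * - D) = - x * (A * B * C - m * D)" for A B C D x z :: complex
        by (simp_all add: algebra_simps)
      have "invariant_line hilbert5 (line_of (vector [m, -1, k])) \<longleftrightarrow> (\<forall>x z. P x z = 0)"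
        unfolding invariant_line_normal hilbert5_nth vector_3 comb P_def[symmetric]
      proof (intro iffI allI conjI)
        fix x z assume *: "\<forall>x z. z * P x z = 0 \<and> - x * P x z = 0"
        show "P x z = 0"
        proof (cases "x = 0 \<and> z = 0")
          case True then show ?thesis by (simp add: P_def)
        qed (use *[rule_format, of z x] in auto)
      qed simp_all
      then show ?thesis unfolding P_def hilbert_line_iff .
    qed
    show "invariant_line hilbert5 (line_of (vector [1, 0, - c])) \<longleftrightarrow> c \<in> T" for c
    proof -
      have 1: "hilbert5 (vector [c * z, y, z]) $ 2 = - (z ^ 5) * ((c ^ 2 - 1) * (c ^ 2 - (s - 2) ^ 2) * (c * z + s * y))"
        and 2: "c * hilbert5 (vector [c * z, y, z]) $ 1 + hilbert5 (vector [c * z, y, z]) $ 3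
          = y * z ^ 4 * ((c ^ 2 - 1) * (c ^ 2 - (s - 2) ^ 2) * (c * z + s * y))" for y z
        unfolding hilbert5_nth vector_3 s_def[symmetric] by algebra+
      show ?thesis unfolding invariant_line_normal 1 2
      proof
        assume *: "\<forall>y z. - (z ^ 5) * ((c ^ 2 - 1) * (c ^ 2 - (s - 2) ^ 2) * (c * z + s * y)) = 0 \<and>
          y * z ^ 4 * ((c ^ 2 - 1) * (c ^ 2 - (s - 2) ^ 2) * (c * z + s * y)) = 0"
        have "(c ^ 2 - 1) * (c ^ 2 - (s - 2) ^ 2) * (c + s * y) = 0" for y using *[rule_format, of 1 y] by simp
        from this[of 0] this[of 1] have "s * ((c ^ 2 - 1) * (c ^ 2 - (s - 2) ^ 2)) = 0" by algebra
        then have "(c ^ 2 - 1) * (c ^ 2 - (s - 2) ^ 2) = 0" using s0 by simp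
        then show "c \<in> T" unfolding mem_T .
      next
        assume "c \<in> T"
        then have "(c ^ 2 - 1) * (c ^ 2 - (s - 2) ^ 2) = 0" unfolding mem_T .
        then show "\<forall>y z. - (z ^ 5) * ((c ^ 2 - 1) * (c ^ 2 - (s - 2) ^ 2) * (c * z + s * y)) = 0 \<and>
          y * z ^ 4 * ((c ^ 2 - 1) * (c ^ 2 - (s - 2) ^ 2) * (c * z + s * y)) = 0" by (simp only: mult_zero_left mult_zero_right simp_thms)
      qed
    qed
    show "invariant_line hilbert5 (line_of (vector [0, 0, 1]))" unfolding invariant_line_normal by (simp add: hilbert5_nth)
    have "card T = 4"
    proof -
      have "2 * (s - 2) \<noteq> 0" using sq5_distinct(4) by (simp add: s_def)
      then have "s - 2 \<noteq> - (s - 2)" by (simp add: eq_neg_iff_add_eq_0)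
      moreover have "s - 2 \<noteq> 1" "s - 2 \<noteq> -1" using sq5_distinct unfolding s_def by (simp_all add: diff_eq_eq)
      moreover from this have "- (s - 2) \<noteq> -1" "- (s - 2) \<noteq> 1" by (simp_all only: neg_equal_iff_equal minus_equation_iff[of _ 1]) simp_all
      ultimately have "distinct [1, -1, s - 2, - (s - 2)]" by auto
      from distinct_card[OF this] show ?thesis by (simp add: T_def)
    qed
    then show "card hilbert_lines + card T = 14" using card_hilbert_lines by simp
    \<comment> \<open>The monomial vanishes at the normals with a zero coordinate. The quadratic
      factor is \<open>m^2 + s m + 1\<close> at \<open>(m, -1, k)\<close> and takes care of the four
      sides of the parallelogram.\<close>
    let ?g = "\<lambda>l :: complex^3. l $ 1 * (l $ 2 * l $ 3) * (l $ 1 ^ 2 - s * (l $ 1 * l $ 2) + l $ 2 ^ 2)"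
    have "hp (1 + 1) (\<lambda>l. l $ i * l $ j)" for i j :: 3 using hp_mult[OF hp_nth hp_nth] by simp
    then have q: "hp 2 (\<lambda>l. l $ i * l $ j)" for i j :: 3 by (simp add: numeral_2_eq_2)
    have "hp ((1 + 2) + 2) ?g"
      unfolding power2_eq_square using hp_nth q by (intro hp_mult hp_add hp_diff hp_cmult) simp_all
    moreover have "1 + 2 + 2 = (5 :: nat)" by simp
    ultimately show "hp 5 ?g" by (simp only:)
    show "?g (vector [1, 1, 1]) \<noteq> 0" using sq5_distinct by (simp add: s_def)
    fix m k assume "(m, k) \<in> hilbert_lines"
    then have "m * k = 0 \<or> m = (1 - s) / 2 \<or> m = (- 1 - s) / 2"
      unfolding hilbert_lines_def s_def by auto
    then have "m * k = 0 \<or> 2 * m + s = 1 \<or> 2 * m + s = -1" by (elim disjE) (simp_all add: mult.commute)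
    moreover have "m ^ 2 + s * m + 1 = 0" if "2 * m + s = 1 \<or> 2 * m + s = -1"
    proof -
      have "4 * (m ^ 2 + s * m + 1) = 0" using that
      proof
        assume "2 * m + s = 1" then show ?thesis using s2 by algebra
      next
        assume "2 * m + s = -1" then show ?thesis using s2 by algebra
      qed
      then show ?thesis unfolding mult_eq_0_iff by simp
    qed
    ultimately have "m * k = 0 \<or> m ^ 2 + s * m + 1 = 0" by blast
    then show "?g (vector [m, -1, k]) = 0" by auto
  qed simp_all
qed

theorem theoremG:
  shows "reduced_convex 5 fermat5 \<and> reduced_convex 5 hilbert5 \<and>
    (\<forall>\<omega>. reduced_convex 5 \<omega> \<longrightarrow> conjugate_foliations \<omega> fermat5 \<or> conjugate_foliations \<omega> hilbert5)"
  using reduced_convex_fermat5 reduced_convex_hilbert5 reduced_convex_form.classification[OF reduced_convex_formI] by blast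

end
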